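(* Suppose that $N\ge 2$, $N_d\ge 1$, $|M|_{\ell^1}\le 1$, $m_{ij}\neq 0$ for every $1\le i,j\le N$, and that there exist $1\le i_*,j_*\le N$ such that $L_{i_*}/L_{j_*}\notin\mathbb Q$. Then, for every $T\ge\mu>0$, there exist $C,\gamma>0$ such that, for every $p\in[1,+\infty]$, every initial condition $u_{i,0}\in L^p(0,L_i)$, $1\le i\le N$, and every choice of signals $\alpha_i\in\mathcal G(T,\mu)$, $1\le i\le N_d$, the corresponding solution $(u_1,\dots,u_N)$ of $$\begin{cases}\partial_t u_i(t,x)+\partial_x u_i(t,x)+\alpha_i(t)\chi_i(x)u_i(t,x)=0, & t\ge 0,\ x\in[0,L_i],\ 1\le i\le N_d,\\ \partial_t u_i(t,x)+\partial_x u_i(t,x)=0, & t\ge 0,\ x\in[0,L_i],\ N_d+1\le i\le N,\\ u_i(t,0)=\sum_{j=1}^N m_{ij}u_j(t,L_j), & t\ge0,\ 1\le i\le N,\\ u_i(0,x)=u_{i,0}(x), & x\in[0,L_i],\ 1\le i\le N,\end{cases}$$ satisfies $$\sum_{i=1}^N\|u_i(t)\|_{L^p(0,L_i)}\le C e^{-\gamma t}\sum_{i=1}^N\|u_{i,0}\|_{L^p(0,L_i)},\qquad\forall t\ge 0.$$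
   Context: Data: integers $N$ and $N_d$ with $N_d\le N$; lengths $L_1,\dots,L_N>0$; a real $N\times N$ matrix $M=(m_{ij})$; for $1\le i\le N_d$, an interval $[a_i,b_i]\subset[0,L_i]$ with $a_i<b_i$, whose characteristic function is $\chi_i$. $|M|_{\ell^1}=\max_j\sum_i|m_{ij}|$ is the matrix norm induced by the $\ell^1$ norm. For $T\ge\mu>0$, $\mathcal G(T,\mu)$ is the set of $\alpha\in L^\infty(\mathbb R,[0,1])$ such that $\int_t^{t+T}\alpha(s)\,ds\ge\mu$ for every $t\in\mathbb R$. Notion of solution: for $p\in[1,\infty)$ let $\mathsf X_p=\prod_{i=1}^N L^p(0,L_i)$ with norm $\|z\|_{\mathsf X_p}=(\sum_i\|u_i\|_{L^p}^p)^{1/p}$. Let $A$ be the operator $A(u_1,\dots,u_N)=(-u_1',\dots,-u_N')$ with domain $D(A)=\{(u_i)\in\prod_i W^{1,p}(0,L_i): u_i(0)=\sum_j m_{ij}u_j(L_j)\ \forall i\}$; it generates a strongly continuous semigroup $\{e^{tA}\}_{t\ge0}$ on $\mathsf X_p$. For $1\le i\le N_d$, $B_i\in\mathcal L(\mathsf X_p)$ maps $(u_1,\dots,u_N)$ to the vector whose $i$-th entry is $-\chi_iu_i$ and whose other entries are $0$. With $z_0=(u_{1,0},\dots,u_{N,0})\in\mathsf X_p$, the solution of the system is the unique (mild) solution $z=(u_1,\dots,u_N)\in\mathcal C^0([0,\infty),\mathsf X_p)$ of $z(t)=e^{tA}z_0+\int_0^t e^{(t-\tau)A}\sum_{i=1}^{N_d}\alpha_i(\tau)B_iz(\tau)\,d\tau$,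 $t\ge 0$. For $p=+\infty$, the solution with initial condition in $\prod_iL^\infty(0,L_i)$ is the solution obtained by viewing the initial condition as an element of $\mathsf X_q$ for finite $q$ (it does not depend on $q$ and takes values in $\prod_i L^\infty(0,L_i)$). *)

theory Defs
  imports
    "HOL-Analysis.Analysis"
    "HOL-Library.Function_Algebras"
    "HOL-Probability.Essential_Supremum"
begin

text \<open>Functions form a real vector space under the pointwise operations.\<close>

instantiation "fun" :: (type, real_vector) real_vector
begin

definition scaleR_fun :: "real \<Rightarrow> ('a \<Rightarrow> 'b) \<Rightarrow> 'a \<Rightarrow> 'b" where
  "scaleR_fun c f = (\<lambda>x. c *\<^sub>R f x)"

instance
  by standard (simp_all add: scaleR_fun_def fun_eq_iff scaleR_add_right scaleR_add_left)

end

section \<open>Functional analysis on a space given by representatives\<close>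

text \<open>
  A normed space of equivalence classes is represented by a linear subspace \<open>X\<close> of
  a vector space of representatives together with a seminorm \<open>nrm\<close> on \<open>X\<close>;
  two representatives \<open>u\<close>, \<open>v\<close> denote the same element iff \<open>nrm (u - v) = 0\<close>.
\<close>

text \<open>The Bochner integral, following the library predicate \<open>has_bochner_integral\<close>;
  \<open>f\<close> is strongly measurable (an a.e. limit of simple functions).\<close>

definition has_bochner_integral_in ::
  "'v::real_vector set \<Rightarrow> ('v \<Rightarrow> real) \<Rightarrow> 'a measure \<Rightarrow> ('a \<Rightarrow> 'v) \<Rightarrow> 'v \<Rightarrow> bool" where
  "has_bochner_integral_in X nrm M f w \<longleftrightarrow>
     w \<in> X \<and> (\<forall>x\<in>space M. f x \<in> X) \<and>
     (\<exists>s :: nat \<Rightarrow> 'a \<Rightarrow> 'v.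
        (\<forall>k. Bochner_Integration.simple_bochner_integrable M (s k) \<and> s k ` space M \<subseteq> X) \<and>
        (AE x in M. (\<lambda>k. nrm (f x - s k x)) \<longlonglongrightarrow> 0) \<and>
        (\<lambda>k. \<integral>\<^sup>+x. ennreal (nrm (f x - s k x)) \<partial>M) \<longlonglongrightarrow> 0 \<and>
        (\<lambda>k. nrm (Bochner_Integration.simple_bochner_integral M (s k) - w)) \<longlonglongrightarrow> 0)"

definition bounded_linear_in ::
  "'v::real_vector set \<Rightarrow> ('v \<Rightarrow> real) \<Rightarrow> ('v \<Rightarrow> 'v) \<Rightarrow> bool" where
  "bounded_linear_in X nrm B \<longleftrightarrow>
     (\<forall>u\<in>X. B u \<in> X) \<and>
     (\<forall>u\<in>X. \<forall>v\<in>X. nrm (B (u + v) - (B u + B v)) = 0) \<and>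
     (\<forall>c. \<forall>u\<in>X. nrm (B (c *\<^sub>R u) - c *\<^sub>R B u) = 0) \<and>
     (\<exists>K. \<forall>u\<in>X. nrm (B u) \<le> K * nrm u)"

definition strongly_continuous_semigroup ::
  "'v::real_vector set \<Rightarrow> ('v \<Rightarrow> real) \<Rightarrow> (real \<Rightarrow> 'v \<Rightarrow> 'v) \<Rightarrow> bool" where
  "strongly_continuous_semigroup X nrm S \<longleftrightarrow>
     (\<forall>t\<ge>0. bounded_linear_in X nrm (S t)) \<and>
     (\<forall>u\<in>X. nrm (S 0 u - u) = 0) \<and>
     (\<forall>s\<ge>0. \<forall>t\<ge>0. \<forall>u\<in>X. nrm (S (s + t) u - S s (S t u)) = 0) \<and>
     (\<forall>u\<in>X. ((\<lambda>t. nrm (S t u - u)) \<longlongrightarrow> 0) (at_right 0))"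

text \<open>\<open>S\<close> is a strongly continuous semigroup whose infinitesimal generator is exactly
  the operator \<open>A\<close> with domain \<open>D\<close>.\<close>

definition generates_semigroup ::
  "'v::real_vector set \<Rightarrow> ('v \<Rightarrow> real) \<Rightarrow> 'v set \<Rightarrow> ('v \<Rightarrow> 'v) \<Rightarrow> (real \<Rightarrow> 'v \<Rightarrow> 'v) \<Rightarrow> bool" where
  "generates_semigroup X nrm D A S \<longleftrightarrow>
     strongly_continuous_semigroup X nrm S \<and>
     (\<forall>u\<in>X. \<forall>v\<in>X.
        ((\<lambda>h. nrm ((1 / h) *\<^sub>R (S h u - u) - v)) \<longlongrightarrow> 0) (at_right 0) \<longleftrightarrow>
        u \<in> D \<and> nrm (v - A u) = 0)"

section \<open>Lebesgue and Sobolev spaces on an interval\<close>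

definition Lp_norm :: "ennreal \<Rightarrow> real \<Rightarrow> (real \<Rightarrow> real) \<Rightarrow> ennreal" where
  "Lp_norm p l f =
     (if p = \<infinity> then esssup (lebesgue_on {0<..<l}) (\<lambda>x. ennreal \<bar>f x\<bar>)
      else let I = (\<integral>\<^sup>+x. ennreal (\<bar>f x\<bar> powr enn2real p) \<partial>lebesgue_on {0<..<l})
           in if I = \<infinity> then \<infinity> else ennreal (enn2real I powr (1 / enn2real p)))"

definition Lp_space :: "ennreal \<Rightarrow> real \<Rightarrow> (real \<Rightarrow> real) set" where
  "Lp_space p l = {f \<in> borel_measurable (lebesgue_on {0<..<l}). Lp_norm p l f < \<infinity>}"

text \<open>Weak derivatives on \<open>(0, l)\<close>, with compactly supported \<open>C\<^sup>1\<close> test functions.\<close>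

definition has_weak_derivative :: "real \<Rightarrow> (real \<Rightarrow> real) \<Rightarrow> (real \<Rightarrow> real) \<Rightarrow> bool" where
  "has_weak_derivative l f g \<longleftrightarrow>
     (\<forall>\<phi> \<phi>'. (\<forall>x. (\<phi> has_real_derivative \<phi>' x) (at x)) \<longrightarrow> continuous_on UNIV \<phi>' \<longrightarrow>
        (\<exists>c d. 0 < c \<and> d < l \<and> (\<forall>x. x \<notin> {c..d} \<longrightarrow> \<phi> x = 0)) \<longrightarrow>
        (LINT x|lebesgue_on {0<..<l}. f x * \<phi>' x) = - (LINT x|lebesgue_on {0<..<l}. g x * \<phi> x))"

definition W1p_space :: "ennreal \<Rightarrow> real \<Rightarrow> (real \<Rightarrow> real) set" where
  "W1p_space p l = {f \<in> Lp_space p l. \<exists>g\<in>Lp_space p l. has_weak_derivative l f g}"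

definition weak_derivative :: "ennreal \<Rightarrow> real \<Rightarrow> (real \<Rightarrow> real) \<Rightarrow> real \<Rightarrow> real" where
  "weak_derivative p l f = (SOME g. g \<in> Lp_space p l \<and> has_weak_derivative l f g)"

text \<open>The representative of a \<open>W\<^sup>1\<^sup>,\<^sup>p\<close> function that is continuous on \<open>[0, l]\<close>; its
  end point values are the boundary values of the function.\<close>

definition cont_rep :: "real \<Rightarrow> (real \<Rightarrow> real) \<Rightarrow> real \<Rightarrow> real" where
  "cont_rep l f =
     (SOME w. continuous_on {0..l} w \<and> (AE x in lebesgue_on {0<..<l}. f x = w x))"

section \<open>The transport system\<close>

text \<open>A state \<open>u\<close> has the components \<open>u 1, \<dots>, u N\<close>; the other values of \<open>u\<close> and the values
  of \<open>u i\<close> outside \<open>(0, L i)\<close> are irrelevant (the seminorm does not see them).\<close>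

type_synonym state = "nat \<Rightarrow> real \<Rightarrow> real"

definition X_space :: "nat \<Rightarrow> (nat \<Rightarrow> real) \<Rightarrow> ennreal \<Rightarrow> state set" where
  "X_space N L p = {u. \<forall>i\<in>{1..N}. u i \<in> Lp_space p (L i)}"

text \<open>Only used for finite \<open>p\<close> and elements of \<open>X_space N L p\<close>.\<close>

definition X_norm :: "nat \<Rightarrow> (nat \<Rightarrow> real) \<Rightarrow> ennreal \<Rightarrow> state \<Rightarrow> real" where
  "X_norm N L p u =
     (\<Sum>i=1..N. enn2real (Lp_norm p (L i) (u i)) powr enn2real p) powr (1 / enn2real p)"

definition A_dom :: "nat \<Rightarrow> (nat \<Rightarrow> real) \<Rightarrow> (nat \<Rightarrow> nat \<Rightarrow> real) \<Rightarrow> ennreal \<Rightarrow> state set" where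
  "A_dom N L m p =
     {u. (\<forall>i\<in>{1..N}. u i \<in> W1p_space p (L i)) \<and>
         (\<forall>i\<in>{1..N}. cont_rep (L i) (u i) 0 = (\<Sum>j=1..N. m i j * cont_rep (L j) (u j) (L j)))}"

definition A_op :: "(nat \<Rightarrow> real) \<Rightarrow> ennreal \<Rightarrow> state \<Rightarrow> state" where
  "A_op L p u = (\<lambda>i x. - weak_derivative p (L i) (u i) x)"

definition B_op :: "(nat \<Rightarrow> real) \<Rightarrow> (nat \<Rightarrow> real) \<Rightarrow> nat \<Rightarrow> state \<Rightarrow> state" where
  "B_op a b i u = (\<lambda>j x. if j = i then - indicator {a i..b i} x * u i x else 0)"

text \<open>The semigroup generated by \<open>A\<close> is unique as a family of operators on equivalence classes,
  so the quantifier over \<open>S\<close> only ranges over the representations of \<open>e\<^sup>t\<^sup>A\<close>.\<close>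

definition mild_solution ::
  "nat \<Rightarrow> nat \<Rightarrow> (nat \<Rightarrow> real) \<Rightarrow> (nat \<Rightarrow> nat \<Rightarrow> real) \<Rightarrow> (nat \<Rightarrow> real) \<Rightarrow> (nat \<Rightarrow> real) \<Rightarrow>
   (nat \<Rightarrow> real \<Rightarrow> real) \<Rightarrow> ennreal \<Rightarrow> state \<Rightarrow> (real \<Rightarrow> state) \<Rightarrow> bool" where
  "mild_solution N Nd L m a b \<alpha> p z0 z \<longleftrightarrow>
     (\<forall>t\<ge>0. z t \<in> X_space N L p) \<and>
     (\<forall>t\<ge>0. ((\<lambda>s. X_norm N L p (z s - z t)) \<longlongrightarrow> 0) (at t within {0..})) \<and>
     (\<exists>S. generates_semigroup (X_space N L p) (X_norm N L p) (A_dom N L m p) (A_op L p) S \<and>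
          (\<forall>t\<ge>0. \<exists>w.
             has_bochner_integral_in (X_space N L p) (X_norm N L p) (lebesgue_on {0..t})
               (\<lambda>\<tau>. S (t - \<tau>) (\<Sum>i=1..Nd. \<alpha> i \<tau> *\<^sub>R B_op a b i (z \<tau>))) w \<and>
             X_norm N L p (z t - (S t z0 + w)) = 0))"

definition solution ::
  "nat \<Rightarrow> nat \<Rightarrow> (nat \<Rightarrow> real) \<Rightarrow> (nat \<Rightarrow> nat \<Rightarrow> real) \<Rightarrow> (nat \<Rightarrow> real) \<Rightarrow> (nat \<Rightarrow> real) \<Rightarrow>
   (nat \<Rightarrow> real \<Rightarrow> real) \<Rightarrow> ennreal \<Rightarrow> state \<Rightarrow> (real \<Rightarrow> state) \<Rightarrow> bool" where
  "solution N Nd L m a b \<alpha> p z0 z \<longleftrightarrow>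
     (if p = \<infinity> then \<exists>q. 1 \<le> q \<and> q < \<infinity> \<and> mild_solution N Nd L m a b \<alpha> q z0 z
      else mild_solution N Nd L m a b \<alpha> p z0 z)"

text \<open>The class \<open>\<G>(T, \<mu>)\<close> of persistently exciting signals.\<close>

definition PE_signals :: "real \<Rightarrow> real \<Rightarrow> (real \<Rightarrow> real) set" where
  "PE_signals T \<mu> =
     {\<alpha> \<in> borel_measurable lebesgue.
        (AE t in lebesgue. \<alpha> t \<in> {0..1}) \<and>
        (\<forall>t. (LINT s:{t..t + T}|lebesgue. \<alpha> s) \<ge> \<mu>)}"

definition l1_matrix_norm :: "nat \<Rightarrow> (nat \<Rightarrow> nat \<Rightarrow> real) \<Rightarrow> real" where
  "l1_matrix_norm N m = (MAX j\<in>{1..N}. \<Sum>i=1..N. \<bar>m i j\<bar>)"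

end

theory Submission
  imports Defs
begin

text \<open>
  By the method of characteristics a solution is determined by the values that enter the circles,
  and these are sums over the paths through the network that lead back to the initial data, each
  path being weighted by the product of its coefficients \<open>m i j\<close> and of the dampings it
  meets. The number of end points of such paths grows only polynomially in time, because
  the end point depends only on how often each circle has been crossed. So it suffices that
  the total weight \<open>\<theta> l s\<close> of the paths that end at a given point decays exponentially.
  As \<open>|M| \<le> 1\<close>, \<open>\<theta>\<close> obeys a maximum principle. Persistent excitation makes
  circle \<open>1\<close> strictly damping for some entry time in every bounded window. The irrationality
  of some \<open>L i / L j\<close> makes the nonnegative integer combinations of \<open>L i\<close> and \<open>L j\<close>
  eventually dense, and all coefficients are nonzero, so that such an entry time is met
  (up to a small error) by one of the paths and the maximum of \<open>\<theta>\<close> drops by a factor.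

  The mild solution agrees with this explicit one because both satisfy the same weak equation:
  on smooth test functions the dual of the semigroup is, for short times, an explicit shift, which
  follows from the description of the generator. A contraction argument for the \<open>L\<^sup>1\<close> norm of the
  difference then needs no representation of the semigroup itself.
\<close>

section \<open>Decay of path weights\<close>

text \<open>The obstacle is that persistent excitation says nothing about single moments: a signal
  may vanish whenever one given particle crosses the damped interval, and the bound on the matrix
  norm alone gives no decay. Hence no fixed path has to lose weight, and many paths are compared.
  Every window of length \<open>T\<close> contains a start of a window of length
  \<open>\<epsilon>\<close>, half the length of the damped interval, with excitation at least
  \<open>\<mu> / n0\<close>. Of the paths that cross circle \<open>i\<close> several times and then
  circle \<open>j\<close> several times, one enters circle \<open>1\<close> at a suitable moment.
  The number of its transits is bounded in advance, so it has a guaranteed share of the weight,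
  whence the factor \<open>1 - p ^ nm * \<eta>\<close> for all signals. Uniformity in the exponent
  comes from a pointwise bound: the solution is at most a decaying factor times a sum of translates
  of the initial data, and translation preserves every Lebesgue norm. The exponent thus enters only
  when norms are compared at the end.\<close>

lemma nat_combination_dense_aux:
  fixes x y \<epsilon> :: real and q p :: nat
  assumes x: "x > 0" and y: "y > 0" and pos: "real q * x - real p * y > 0"
    and small: "real q * x - real p * y < \<epsilon>"
  shows "\<exists>R\<ge>0. \<forall>r\<ge>R. \<exists>(n::nat) (k::nat). r \<le> n * x + k * y \<and> n * x + k * y \<le> r + \<epsilon>"
proof -
  define d where "d = real q * x - real p * y"
  have d: "d > 0" "d < \<epsilon>" using pos small by (auto simp: d_def)
  \<comment> \<open>Trading \<open>p\<close> copies of \<open>y\<close> for \<open>q\<close> copies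
    of \<open>x\<close> raises a combination by \<open>d\<close>. Together \<open>J\<close> trades
    raise it by at least \<open>y\<close>, and \<open>R = J * p * y\<close> holds enough copies of
    \<open>y\<close> for all of them. So the values \<open>R + j * d + k * y\<close> with
    \<open>j \<le> J\<close> come within \<open>d\<close> above every
    \<open>r \<ge> R\<close>.\<close>
  define J where "J = nat \<lceil>y / d\<rceil>"
  have J: "real J * d \<ge> y"
  proof -
    have "real J \<ge> y / d" unfolding J_def using y d by linarith
    then show ?thesis using d by (simp add: field_simps)
  qed
  define R where "R = real J * p * y"
  have R0: "R \<ge> 0" using y by (simp add: R_def)
  have "\<exists>(n::nat) (k::nat). r \<le> n * x + k * y \<and> n * x + k * y \<le> r + \<epsilon>" if r: "r \<ge> R" for r
  proof -
    define k where "k = nat \<lfloor>(r - R) / y\<rfloor>"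
    define w where "w = r - R - k * y"
    have "real k = of_int \<lfloor>(r - R) / y\<rfloor>" using r y by (simp add: k_def)
    then have k: "real k \<le> (r - R) / y" "(r - R) / y < real k + 1" by linarith+
    have w: "0 \<le> w" "w < y"
      using k y by (auto simp: w_def field_simps)
    define j where "j = nat \<lceil>w / d\<rceil>"
    have "real j = of_int \<lceil>w / d\<rceil>" using w d by (simp add: j_def)
    then have j: "real j \<ge> w / d" "real j < w / d + 1" by linarith+
    have j1: "w \<le> j * d" using j(1) d by (simp add: field_simps)
    have j2: "j * d < w + d" using j(2) d by (simp add: field_simps)
    have jJ: "j \<le> J" unfolding j_def J_def
      by (intro nat_mono ceiling_mono divide_right_mono) (use w d in auto)
    have "real (j * q) * x + real ((J - j) * p + k) * y = R + j * d + k * y"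
      proof -
      have "real ((J - j) * p + k) = (real J - real j) * p + k" using jJ by (simp add: of_nat_diff)
      then have "real ((J - j) * p + k) * y = (real J - real j) * p * y + k * y"
        by (simp only: distrib_right)
      then show ?thesis by (simp add: R_def d_def algebra_simps del: of_nat_add of_nat_diff)
    qed
    moreover have "r \<le> R + j * d + k * y" "R + j * d + k * y \<le> r + \<epsilon>"
      using j1 j2 d by (auto simp: w_def)
    ultimately show ?thesis by metis
  qed
  then show ?thesis using R0 by blast
qed

text \<open>Dirichlet approximation of \<open>x / y\<close> makes \<open>q * x - h * y\<close>
  smaller than \<open>\<epsilon>\<close> in absolute value, and irrationality makes it nonzero. Its
  sign is unknown; if it is negative, the auxiliary lemma applies with \<open>x\<close> and
  \<open>y\<close> exchanged.\<close>

lemma nat_combination_dense: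
  fixes x y \<epsilon> :: real
  assumes x: "x > 0" and y: "y > 0" and irr: "x / y \<notin> \<rat>" and e: "\<epsilon> > 0"
  shows "\<exists>R\<ge>0. \<forall>r\<ge>R. \<exists>(n::nat) (k::nat). r \<le> n * x + k * y \<and> n * x + k * y \<le> r + \<epsilon>"
proof -
  obtain K :: nat where K: "K > 0" "y / K < \<epsilon>"
    using reals_Archimedean2[of "y / \<epsilon>"] y e
    by (metis divide_less_eq less_divide_eq mult.commute of_nat_0_less_iff divide_pos_pos order.strict_trans)
  obtain h q where hq: "0 < q" "q \<le> int K" "\<bar>of_int q * (x / y) - of_int h\<bar> < 1 / K"
    using Dirichlet_approx[OF K(1), of "x / y"] by metis
  have ne: "of_int q * (x / y) - of_int h \<noteq> 0"
  proof
    assume "of_int q * (x / y) - of_int h = 0"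
    then have "x / y = of_int h / of_int q" using hq(1) by (simp add: field_simps)
    then show False using irr by auto
  qed
  have K1: "1 / real K \<le> 1" using K by simp
  have h0: "h \<ge> 0"
  proof (rule ccontr)
    assume "\<not> h \<ge> 0"
    then have "h \<le> -1" by simp
    then have "real_of_int h \<le> -1" by linarith
    moreover have "of_int q * (x / y) > 0" using hq x y by simp
    ultimately show False using hq(3) K1 by linarith
  qed
  define d where "d = real (nat q) * x - real (nat h) * y"
  have d: "d = (of_int q * (x / y) - of_int h) * y" using hq h0 y by (simp add: d_def field_simps)
  have "\<bar>d\<bar> < 1 / K * y" unfolding d abs_mult
    using mult_strict_right_mono[OF hq(3) y] y by simp
  then have dsm: "\<bar>d\<bar> < \<epsilon>" using K by simp
  have dne: "d \<noteq> 0" using ne y d by simp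
  consider "d > 0" | "d < 0" using dne by linarith
  then show ?thesis
  proof cases
    case 1
    then show ?thesis using nat_combination_dense_aux[OF x y, of "nat q" "nat h" \<epsilon>] dsm d_def by simp
  next
    case 2
    have "\<exists>R\<ge>0. \<forall>r\<ge>R. \<exists>(n::nat) (k::nat). r \<le> n * y + k * x \<and> n * y + k * x \<le> r + \<epsilon>"
      by (rule nat_combination_dense_aux[OF y x, of "nat h" "nat q"]) (use 2 dsm d_def in auto)
    then show ?thesis by (metis add.commute)
  qed
qed

text \<open>Pigeonhole principle: if every window of length \<open>\<epsilon>\<close> that starts in
  \<open>{w..w+T}\<close> carried less than \<open>\<mu> / n\<close>, the pieces that cover
  \<open>{w..w+T}\<close> would together carry less than \<open>\<mu>\<close>.\<close>

lemma short_window_integral: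
  fixes \<beta> :: "real \<Rightarrow> real"
  assumes e: "\<epsilon> > 0" and T: "T > 0"
    and int: "\<And>c d. set_integrable lborel {c..d} \<beta>"
    and n: "real n * \<epsilon> \<ge> T" and nn: "\<And>s. \<beta> s \<ge> 0"
    and mu: "(LINT s:{w..w+T}|lborel. \<beta> s) \<ge> \<mu>"
  shows "\<exists>s\<in>{w..w+T}. (LINT s:{s..s+\<epsilon>}|lborel. \<beta> s) \<ge> \<mu> / n"
proof (rule ccontr)
  assume neg: "\<not> ?thesis"
  have n0: "n > 0" using n T e by (cases n) auto
  \<comment> \<open>The pieces are counted by \<open>K\<close> rather than by \<open>n\<close>,
    because \<open>(K - 1) * \<epsilon> < T\<close> keeps all their starting points inside
    \<open>{w..w+T}\<close>; \<open>K \<le> n\<close> recovers the stated bound.\<close>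
  define K where "K = nat \<lceil>T / \<epsilon>\<rceil>"
  have rK: "real K = of_int \<lceil>T / \<epsilon>\<rceil>" using T e by (simp add: K_def)
  have K1: "real K * \<epsilon> \<ge> T"
  proof -
    have "T / \<epsilon> \<le> real K" unfolding rK by (rule le_of_int_ceiling)
    then show ?thesis using e by (simp add: divide_le_eq)
  qed
  have K2: "real K < T / \<epsilon> + 1" using rK by linarith
  then have K3: "(real K - 1) * \<epsilon> < T" using e by (simp add: field_simps)
  have Kn: "K \<le> n" unfolding K_def using n e by (simp add: nat_le_iff ceiling_le_iff field_simps)
  have K0: "K > 0" using K1 T e by (cases K) auto
  have sub: "(LINT s:{w..w+k*\<epsilon>}|lborel. \<beta> s) \<le> (\<Sum>j<k. (LINT s:{w+j*\<epsilon>..w+j*\<epsilon>+\<epsilon>}|lborel. \<beta> s))" for k :: nat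
  proof (induction k)
    case 0
    have "set_lebesgue_integral lborel {w} \<beta> = 0"
      unfolding set_lebesgue_integral_def
      by (rule integral_eq_zero_AE, rule eventually_mono[OF AE_lborel_singleton[of w]]) auto
    then show ?case by simp
  next
    case (Suc k)
    have "(LINT s:{w..w+Suc k*\<epsilon>}|lborel. \<beta> s) \<le> (LINT s:{w..w+k*\<epsilon>}|lborel. \<beta> s) + (LINT s:{w+k*\<epsilon>..w+k*\<epsilon>+\<epsilon>}|lborel. \<beta> s)"
      unfolding set_lebesgue_integral_def
      apply (subst Bochner_Integration.integral_add[symmetric])
      using int[unfolded set_integrable_def] apply blast
      using int[unfolded set_integrable_def] apply blast
      apply (rule integral_mono)
      using int[unfolded set_integrable_def] apply blast
       apply (intro Bochner_Integration.integrable_add)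
      using int[unfolded set_integrable_def] apply blast
      using int[unfolded set_integrable_def] apply blast
      using nn e by (auto simp: indicator_def algebra_simps)
    then show ?case using Suc by simp
  qed
  have "\<mu> \<le> (LINT s:{w..w+T}|lborel. \<beta> s)" by (rule mu)
  also have "\<dots> \<le> (LINT s:{w..w+K*\<epsilon>}|lborel. \<beta> s)"
    unfolding set_lebesgue_integral_def
    by (rule integral_mono) (use int[unfolded set_integrable_def] nn K1 in \<open>auto simp: indicator_def\<close>)
  also have "\<dots> \<le> (\<Sum>j<K. (LINT s:{w+j*\<epsilon>..w+j*\<epsilon>+\<epsilon>}|lborel. \<beta> s))" by (rule sub)
  also have "\<dots> < (\<Sum>j<K. \<mu> / n)"
  proof (rule sum_strict_mono)
    fix j assume "j \<in> {..<K}"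
    then have "real j \<le> real K - 1" by auto
    then have "real j * \<epsilon> \<le> (real K - 1) * \<epsilon>" using e by (simp add: mult_right_mono)
    then have "real j * \<epsilon> \<le> T" using K3 by linarith
    then have "w + j * \<epsilon> \<in> {w..w+T}" using e by auto
    then show "(LINT s:{w+j*\<epsilon>..w+j*\<epsilon>+\<epsilon>}|lborel. \<beta> s) < \<mu> / n" using neg not_le by blast
  qed (use K0 in auto)
  finally have less: "\<mu> < real K * (\<mu> / n)" by simp
  have int0: "0 \<le> (LINT s:{w..w+\<epsilon>}|lborel. \<beta> s)"
    unfolding set_lebesgue_integral_def by (rule integral_nonneg_AE) (use nn in auto)
  have "\<mu> / n > (LINT s:{w..w+\<epsilon>}|lborel. \<beta> s)" using neg T by force
  then have "\<mu> / n > 0" using int0 by linarith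
  then have "\<mu> > 0" using n0 by (simp add: zero_less_divide_iff)
  then have "real K * (\<mu> / n) \<le> \<mu>" using Kn n0 by (simp add: field_simps)
  then show False using less by simp
qed

text \<open>The function \<open>\<theta> l s\<close> stands for the total weight of the paths that enter circle \<open>l\<close> at
  time \<open>s\<close>. By the subharmonicity hypothesis its supremum decreases strictly over a time span
  in which some path with a uniformly bounded number of transits crosses circle \<open>1\<close> while the
  damping there is active.\<close>

locale transit =
  fixes N :: nat and L :: "nat \<Rightarrow> real" and m :: "nat \<Rightarrow> nat \<Rightarrow> real" and Lmin Lmax :: real
  assumes N1: "N \<ge> 1"
    and Lmin: "Lmin > 0"
    and Lge: "\<And>i. i \<in> {1..N} \<Longrightarrow> Lmin \<le> L i"
    and Lle: "\<And>i. i \<in> {1..N} \<Longrightarrow> L i \<le> Lmax"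
    and m1: "\<And>j. j \<in> {1..N} \<Longrightarrow> (\<Sum>i=1..N. \<bar>m i j\<bar>) \<le> 1"
begin

lemma Lpos: "i \<in> {1..N} \<Longrightarrow> L i > 0" using Lge Lmin by force

lemma Lmax0: "Lmax > 0" using Lpos[of 1] Lle[of 1] N1 by force

context
  fixes d :: "nat \<Rightarrow> real \<Rightarrow> real" and \<theta> :: "nat \<Rightarrow> real \<Rightarrow> real" and t :: real
  assumes d1: "\<And>l s. l \<in> {1..N} \<Longrightarrow> 0 \<le> d l s \<and> d l s \<le> 1"
    and \<theta>0: "\<And>l s. l \<in> {1..N} \<Longrightarrow> 0 \<le> \<theta> l s"
    and rec: "\<And>l s. l \<in> {1..N} \<Longrightarrow> s < t \<Longrightarrow> \<theta> l s \<le> d l s * (\<Sum>k=1..N. \<bar>m k l\<bar> * \<theta> k (s + L l))"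
begin

text \<open>Every transit lasts at least \<open>Lmin\<close>, so the times before
  \<open>\<sigma>\<close> are reached by induction in backward steps of length \<open>Lmin\<close>.
  Each new value is at most a combination of later values whose coefficients sum to at most
  \<open>1\<close>.\<close>

lemma weight_max_principle:
  assumes c: "c \<ge> 0" and \<sigma>: "\<sigma> \<le> t" and le: "\<And>l s. l \<in> {1..N} \<Longrightarrow> s \<ge> \<sigma> \<Longrightarrow> \<theta> l s \<le> c"
    and l: "l \<in> {1..N}"
  shows "\<theta> l s \<le> c"
proof -
  have "s \<ge> \<sigma> - n * Lmin \<Longrightarrow> l \<in> {1..N} \<Longrightarrow> \<theta> l s \<le> c" for n :: nat and l s
  proof (induction n arbitrary: l s)
    case 0 then show ?case using le by auto
  next
    case (Suc n)
    show ?case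
    proof (cases "s \<ge> \<sigma>")
      case True then show ?thesis using le Suc by auto
    next
      case False
      have sh: "s + L l \<ge> \<sigma> - n * Lmin" using Suc.prems Lge[of l] by (simp add: algebra_simps)
      have "\<theta> l s \<le> d l s * (\<Sum>k=1..N. \<bar>m k l\<bar> * \<theta> k (s + L l))"
        by (rule rec) (use Suc.prems False \<sigma> in auto)
      also have "\<dots> \<le> 1 * (\<Sum>k=1..N. \<bar>m k l\<bar> * c)"
        by (intro mult_mono sum_mono mult_left_mono Suc.IH sum_nonneg mult_nonneg_nonneg)
          (use d1 Suc.prems sh \<theta>0 in auto)
      also have "\<dots> \<le> c" using m1[OF Suc.prems(2)] c
        by (simp flip: sum_distrib_right) (metis mult_left_le_one_le mult.commute sum_nonneg abs_ge_zero)
      finally show ?thesis .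
    qed
  qed
  note this[of "nat \<lceil>(\<sigma> - s) / Lmin\<rceil>" s l]
  moreover have "(\<sigma> - s) / Lmin \<le> real (nat \<lceil>(\<sigma> - s) / Lmin\<rceil>)" by linarith
  then have "\<sigma> - s \<le> real (nat \<lceil>(\<sigma> - s) / Lmin\<rceil>) * Lmin" using Lmin by (simp add: field_simps)
  ultimately show ?thesis using l by simp
qed

text \<open>A deficit \<open>\<eta>\<close> in one of the averaged values survives the averaging up
  to the factor \<open>p\<close>, since that value enters the sum with a coefficient of at least
  \<open>p\<close>.\<close>

lemma weight_one_step:
  assumes c: "c \<ge> 0" and le: "\<And>l s. l \<in> {1..N} \<Longrightarrow> \<theta> l s \<le> c"
    and p: "\<And>i j. i \<in> {1..N} \<Longrightarrow> j \<in> {1..N} \<Longrightarrow> p \<le> \<bar>m i j\<bar>" and p0: "p \<ge> 0"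
    and l: "l \<in> {1..N}" and k: "k \<in> {1..N}" and st: "s < t"
    and h: "\<theta> k (s + L l) \<le> c * (1 - \<eta>)" and \<eta>: "0 \<le> \<eta>"
  shows "\<theta> l s \<le> c * (1 - p * \<eta>)"
proof -
  have "\<theta> l s \<le> d l s * (\<Sum>k=1..N. \<bar>m k l\<bar> * \<theta> k (s + L l))"
    by (rule rec) (use l st in auto)
  also have "\<dots> \<le> 1 * (\<Sum>k=1..N. \<bar>m k l\<bar> * \<theta> k (s + L l))"
    by (intro mult_right_mono sum_nonneg mult_nonneg_nonneg) (use d1 l \<theta>0 in auto)
  also have "\<dots> = \<bar>m k l\<bar> * \<theta> k (s + L l) + (\<Sum>k'\<in>{1..N}-{k}. \<bar>m k' l\<bar> * \<theta> k' (s + L l))"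
    using k by (simp add: sum.remove)
  also have "\<dots> \<le> \<bar>m k l\<bar> * (c * (1 - \<eta>)) + (\<Sum>k'\<in>{1..N}-{k}. \<bar>m k' l\<bar> * c)"
    by (intro add_mono sum_mono mult_left_mono) (use h le in auto)
  also have "\<dots> = (\<Sum>k'=1..N. \<bar>m k' l\<bar>) * c - \<bar>m k l\<bar> * (c * \<eta>)"
    using k by (simp add: sum.remove algebra_simps flip: sum_distrib_right sum_distrib_left)
  also have "\<dots> \<le> 1 * c - p * (c * \<eta>)"
    by (intro diff_mono mult_right_mono) (use m1[OF l] c p[OF k l] \<eta> in auto)
  finally show ?thesis by (simp add: algebra_simps)
qed

text \<open>The path leaves circle \<open>l\<close>, crosses circle \<open>i\<close>
  \<open>n\<close> times and then circle \<open>j\<close> \<open>n'\<close> times, and enters circle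
  \<open>k\<close> at time \<open>e\<close>. It uses \<open>n + n' + 1\<close> couplings, each of
  which costs a factor \<open>p\<close> of the deficit.\<close>

lemma weight_path:
  assumes c: "c \<ge> 0" and le: "\<And>l s. l \<in> {1..N} \<Longrightarrow> \<theta> l s \<le> c"
    and p: "\<And>i j. i \<in> {1..N} \<Longrightarrow> j \<in> {1..N} \<Longrightarrow> p \<le> \<bar>m i j\<bar>" and p0: "p \<ge> 0"
    and i: "i \<in> {1..N}" and j: "j \<in> {1..N}" and k: "k \<in> {1..N}"
    and h: "\<theta> k e \<le> c * (1 - \<eta>)" and \<eta>: "0 \<le> \<eta>" and et: "e < t"
  shows "l \<in> {1..N} \<Longrightarrow> \<theta> l (e - L l - (n * L i + n' * L j)) \<le> c * (1 - p ^ (n + n' + 1) * \<eta>)"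
proof (induction n arbitrary: l)
  case 0
  then show ?case
  proof (induction n' arbitrary: l)
    case 0
    show ?case using weight_one_step[OF c le p p0 0 k, of "e - L l" \<eta>] h \<eta> et Lpos[OF 0] by simp
  next
    case (Suc n')
    have *: "\<theta> j (e - L j - (n' * L j)) \<le> c * (1 - p ^ (n' + 1) * \<eta>)" using Suc.IH[OF j] by simp
    have "L l > 0" "n' * L j \<ge> 0" "L j > 0" using Lpos[OF Suc.prems] Lpos[OF j] by auto
    then have "e - L l - Suc n' * L j < t" using et Lpos[OF Suc.prems] by (simp only: distrib_right of_nat_Suc)
    moreover have **: "e - L l - Suc n' * L j + L l = e - L j - n' * L j" by (simp add: algebra_simps)
    ultimately have "\<theta> l (e - L l - Suc n' * L j) \<le> c * (1 - p * (p ^ (n' + 1) * \<eta>))"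
      using weight_one_step[OF c le p p0 Suc.prems j, of "e - L l - Suc n' * L j" "p ^ (n' + 1) * \<eta>", unfolded **] * \<eta> p0
      by simp
    then show ?case by (simp add: mult.assoc)
  qed
next
  case (Suc n)
  have *: "\<theta> i (e - L i - (n * L i + n' * L j)) \<le> c * (1 - p ^ (n + n' + 1) * \<eta>)" using Suc.IH[OF i] by simp
  have "L l > 0" "n * L i \<ge> 0" "n' * L j \<ge> 0" "L i > 0" using Lpos[OF Suc.prems] Lpos[OF j] Lpos[OF i] by auto
  then have "e - L l - (Suc n * L i + n' * L j) < t" using et by (simp only: distrib_right of_nat_Suc)
  moreover have **: "e - L l - (Suc n * L i + n' * L j) + L l = e - L i - (n * L i + n' * L j)" by (simp add: algebra_simps)
  ultimately have "\<theta> l (e - L l - (Suc n * L i + n' * L j)) \<le> c * (1 - p * (p ^ (n + n' + 1) * \<eta>))"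
    using weight_one_step[OF c le p p0 Suc.prems i, of "e - L l - (Suc n * L i + n' * L j)" "p ^ (n + n' + 1) * \<eta>", unfolded **] * \<eta> p0
    by simp
  then show ?case by (simp add: mult.assoc)
qed

end

lemma weight_decay:
  assumes p: "\<And>i j. i \<in> {1..N} \<Longrightarrow> j \<in> {1..N} \<Longrightarrow> p \<le> \<bar>m i j\<bar>" and p0: "p > 0"
    and i: "i \<in> {1..N}" and j: "j \<in> {1..N}" and irr: "L i / L j \<notin> \<rat>"
    and ab: "0 \<le> a" "a < b" "b \<le> L 1" and T: "T > 0" and mu: "\<mu> > 0"
  shows "\<exists>(\<kappa>::real) (T'::real). 0 < \<kappa> \<and> \<kappa> < 1 \<and> T' > 0 \<and> (\<forall>\<beta> d \<theta> (t::real).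
     (\<forall>s. \<beta> s \<ge> 0) \<longrightarrow> (\<forall>c d. set_integrable lborel {c..d} \<beta>) \<longrightarrow>
     (\<forall>w\<ge>0. (LINT s:{w..w+T}|lborel. \<beta> s) \<ge> \<mu>) \<longrightarrow>
     (\<forall>l\<in>{1..N}. \<forall>s. 0 \<le> d l s \<and> d l s \<le> 1) \<longrightarrow>
     (\<forall>s. d 1 s \<le> exp (- (LINT \<sigma>:{s+a..s+b}|lborel. \<beta> \<sigma>))) \<longrightarrow>
     (\<forall>l\<in>{1..N}. \<forall>s. 0 \<le> \<theta> l s) \<longrightarrow>
     (\<forall>l\<in>{1..N}. \<forall>s<t. \<theta> l s \<le> d l s * (\<Sum>k=1..N. \<bar>m k l\<bar> * \<theta> k (s + L l))) \<longrightarrow>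
     (\<forall>l\<in>{1..N}. \<forall>s\<ge>t. \<theta> l s \<le> 1) \<longrightarrow>
     (\<forall>l\<in>{1..N}. \<forall>s\<ge>-Lmax. \<forall>n::nat. s \<le> t - n * T' \<longrightarrow> \<theta> l s \<le> \<kappa> ^ n))"
proof -
  \<comment> \<open>The damped interval has length \<open>2 * \<epsilon>\<close>, so the passage
    through it contains a given window of length \<open>\<epsilon>\<close> for all entry times from
    an interval of length \<open>\<epsilon>\<close>. This interval is the tolerance asked of
    \<open>nat_combination_dense\<close>.\<close>
  define \<epsilon> where "\<epsilon> = (b - a) / 2"
  have e: "\<epsilon> > 0" using ab by (simp add: \<epsilon>_def)
  obtain R where R0: "R \<ge> 0" and R: "\<And>r. r \<ge> R \<Longrightarrow> \<exists>(n::nat) (k::nat). r \<le> n * L i + k * L j \<and> n * L i + k * L j \<le> r + \<epsilon>"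
    using nat_combination_dense[OF Lpos[OF i] Lpos[OF j] irr e] by blast
  define n0 where "n0 = nat \<lceil>T / \<epsilon>\<rceil>"
  have n0: "real n0 * \<epsilon> \<ge> T"
  proof -
    have "T / \<epsilon> \<le> real n0" unfolding n0_def by (rule real_nat_ceiling_ge)
    then show ?thesis using e by (simp add: divide_le_eq)
  qed
  have n00: "n0 > 0" using n0 T e by (cases n0) auto
  define \<eta> where "\<eta> = 1 - exp (- (\<mu> / n0))"
  have \<eta>: "\<eta> > 0" "\<eta> < 1" using mu n00 by (auto simp: \<eta>_def)
  \<comment> \<open>\<open>3 * Lmax + R\<close> is the delay after which an excited window is looked
    for, and \<open>T\<close> the time within which it starts. The rest lets the path end before the
    final time, and one \<open>Lmax\<close> is spent on the truncation of \<open>\<theta>\<close> in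
    the induction at the end.\<close>
  define T' where "T' = 5 * Lmax + R + T + \<epsilon>"
  have T': "T' > 0" using Lmax0 R0 T e by (simp add: T'_def)
  \<comment> \<open>The transits of \<open>i\<close> and \<open>j\<close> on the path take at most
    \<open>2 * T'\<close> in total and each takes at least \<open>Lmin\<close>; the additional
    \<open>1\<close> counts the coupling behind the starting circle.\<close>
  define nm where "nm = nat \<lceil>2 * T' / Lmin\<rceil> + 1"
  define \<kappa> where "\<kappa> = 1 - p ^ nm * \<eta>"
  have N1': "(1::nat) \<in> {1..N}" using N1 by auto
  have ple: "p \<le> 1"
  proof -
    have "p \<le> \<bar>m 1 1\<bar>" using p N1' by blast
    also have "\<dots> \<le> (\<Sum>i=1..N. \<bar>m i 1\<bar>)" by (rule member_le_sum) (use N1 in auto)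
    also have "\<dots> \<le> 1" using m1 N1' by blast
    finally show ?thesis .
  qed
  have pn: "0 < p ^ n" "p ^ n \<le> 1" for n using p0 ple by (auto simp: power_le_one)
  have \<kappa>: "0 < \<kappa>" "\<kappa> < 1"
    unfolding \<kappa>_def using \<eta> pn[of nm] by (auto simp: mult_le_one) (smt (verit) mult_left_le_one_le mult.commute)
  show ?thesis
  proof (rule exI[of _ \<kappa>], rule exI[of _ T'], intro conjI allI impI \<kappa> T', intro ballI allI impI)
    fix \<beta> :: "real \<Rightarrow> real" and d \<theta> :: "nat \<Rightarrow> real \<Rightarrow> real" and t :: real and l s and n :: nat
    assume \<beta>0: "\<forall>s. \<beta> s \<ge> 0" and \<beta>int: "\<forall>c d. set_integrable lborel {c..d} \<beta>"
      and PE: "\<forall>w\<ge>0. (LINT s:{w..w+T}|lborel. \<beta> s) \<ge> \<mu>"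
      and d1: "\<forall>l\<in>{1..N}. \<forall>s. 0 \<le> d l s \<and> d l s \<le> 1"
      and dd: "\<forall>s. d 1 s \<le> exp (- (LINT \<sigma>:{s+a..s+b}|lborel. \<beta> \<sigma>))"
      and \<theta>0: "\<forall>l\<in>{1..N}. \<forall>s. 0 \<le> \<theta> l s"
      and rec: "\<forall>l\<in>{1..N}. \<forall>s<t. \<theta> l s \<le> d l s * (\<Sum>k=1..N. \<bar>m k l\<bar> * \<theta> k (s + L l))"
      and end1: "\<forall>l\<in>{1..N}. \<forall>s\<ge>t. \<theta> l s \<le> 1"
      and l: "l \<in> {1..N}" and s: "-Lmax \<le> s" and st: "s \<le> t - n * T'"
    have d1': "\<And>l s. l \<in> {1..N} \<Longrightarrow> 0 \<le> d l s \<and> d l s \<le> 1" using d1 by blast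
    \<comment> \<open>A single drop of the maximum, starting from a bound \<open>c\<close> that
      holds everywhere. The restriction \<open>-Lmax \<le> s\<close> places the excited window at
      nonnegative times, where excitation is assumed.\<close>
    have key: "\<theta> l s \<le> c * \<kappa>" if c: "c \<ge> 0" and le: "\<And>l s. l \<in> {1..N} \<Longrightarrow> \<theta> l s \<le> c"
      and \<theta>0': "\<And>l s. l \<in> {1..N} \<Longrightarrow> 0 \<le> \<theta> l s"
      and rec': "\<And>l s. l \<in> {1..N} \<Longrightarrow> s < t \<Longrightarrow> \<theta> l s \<le> d l s * (\<Sum>k=1..N. \<bar>m k l\<bar> * \<theta> k (s + L l))"
      and l: "l \<in> {1..N}" and s: "-Lmax \<le> s" and st: "s \<le> t - (T' - Lmax)"
      for c l s t and \<theta> :: "nat \<Rightarrow> real \<Rightarrow> real"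
    proof -
      have Ll: "0 < L l" "L l \<le> Lmax" using Lpos[OF l] Lle[OF l] by auto
      have L1: "0 < L 1" "L 1 \<le> Lmax" using Lpos[OF N1'] Lle[OF N1'] by auto
      define w where "w = s + 3 * Lmax + R"
      have w0: "w \<ge> 0" using s Lmax0 R0 by (simp add: w_def)
      obtain s0 where s0: "s0 \<in> {w..w+T}" "(LINT s:{s0..s0+\<epsilon>}|lborel. \<beta> s) \<ge> \<mu> / n0"
        using short_window_integral[OF e T _ n0, of \<beta> \<mu> w] \<beta>0 \<beta>int PE w0 by blast
      \<comment> \<open>A path that spends the time \<open>r\<close> in the circles \<open>i\<close>
        and \<open>j\<close> enters circle \<open>1\<close> at the earliest moment \<open>e'\<close>
        for which \<open>{s0..s0+\<epsilon>}\<close> lies inside \<open>{e'+a..e'+b}\<close>. A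
        delay of at most \<open>\<epsilon>\<close> keeps it inside.\<close>
      define r where "r = s0 + \<epsilon> - b - s - L l"
      have "r \<ge> R" using s0(1) e ab L1 Ll by (auto simp: r_def w_def)
      then obtain n k :: nat where nk: "r \<le> n * L i + k * L j" "n * L i + k * L j \<le> r + \<epsilon>"
        using R by blast
      define e' where "e' = s + L l + (n * L i + k * L j)"
      have e1: "s0 + \<epsilon> - b \<le> e'" "e' \<le> s0 + 2 * \<epsilon> - b" using nk by (auto simp: e'_def r_def)
      have e2: "e' + a \<le> s0" "s0 + \<epsilon> \<le> e' + b" using e1 by (auto simp: \<epsilon>_def field_simps)
      have et: "e' < t" using e2 s0(1) st ab Lmax0 e by (auto simp: w_def T'_def)
      have "d 1 e' \<le> exp (- (LINT \<sigma>:{e'+a..e'+b}|lborel. \<beta> \<sigma>))" using dd by blast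
      also have "\<dots> \<le> exp (- (\<mu> / n0))"
      proof -
        have "(LINT s:{s0..s0+\<epsilon>}|lborel. \<beta> s) \<le> (LINT \<sigma>:{e'+a..e'+b}|lborel. \<beta> \<sigma>)"
          unfolding set_lebesgue_integral_def
          by (rule integral_mono) (use \<beta>int[unfolded set_integrable_def] \<beta>0 e2 in \<open>auto simp: indicator_def\<close>)
        then show ?thesis using s0(2) by simp
      qed
      finally have d': "d 1 e' \<le> 1 - \<eta>" by (simp add: \<eta>_def)
      have "\<theta> 1 e' \<le> d 1 e' * (\<Sum>k=1..N. \<bar>m k 1\<bar> * \<theta> k (e' + L 1))" using rec' N1' et by blast
      also have "\<dots> \<le> (1 - \<eta>) * (\<Sum>k=1..N. \<bar>m k 1\<bar> * c)"
        by (intro mult_mono sum_mono mult_left_mono sum_nonneg mult_nonneg_nonneg)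
          (use d' le \<theta>0' \<eta> in auto)
      also have "\<dots> \<le> (1 - \<eta>) * c"
        using m1[OF N1'] c \<eta> by (intro mult_left_mono)
          (auto simp flip: sum_distrib_right intro: mult_left_le_one_le sum_nonneg)
      finally have h: "\<theta> 1 e' \<le> c * (1 - \<eta>)" by (simp add: mult.commute)
      have "\<theta> l (e' - L l - (n * L i + k * L j)) \<le> c * (1 - p ^ (n + k + 1) * \<eta>)"
        by (rule weight_path[of d \<theta> t c p i j 1 e' \<eta> l n k])
          (use d1' \<theta>0' rec' c le p p0 i j N1' h \<eta> et l in auto)
      then have 1: "\<theta> l s \<le> c * (1 - p ^ (n + k + 1) * \<eta>)" by (simp add: e'_def)
      have "real (n + k) * Lmin \<le> n * L i + k * L j"
        using mult_left_mono[OF Lge[OF i], of n] mult_left_mono[OF Lge[OF j], of k] by (simp add: algebra_simps)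
      also have "\<dots> \<le> 2 * T'" using nk s0(1) ab e Ll s e1 Lmax0 R0 T
        by (auto simp: e'_def r_def w_def T'_def)
      finally have "real (n + k) \<le> 2 * T' / Lmin" using Lmin by (simp add: field_simps)
      then have "n + k \<le> nat \<lceil>2 * T' / Lmin\<rceil>" by linarith
      then have "n + k + 1 \<le> nm" by (simp add: nm_def)
      then have "p ^ nm \<le> p ^ (n + k + 1)" using p0 ple by (intro power_decreasing) auto
      then have "c * (1 - p ^ (n + k + 1) * \<eta>) \<le> c * \<kappa>"
        unfolding \<kappa>_def using c \<eta> by (intro mult_left_mono diff_mono mult_right_mono) auto
      then show ?thesis using 1 by simp
    qed
    have all: "\<theta> l s \<le> 1" if "l \<in> {1..N}" for l s
    proof (rule weight_max_principle[of d \<theta> t 1 t])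
      show "\<And>l s. l \<in> {1..N} \<Longrightarrow> s < t \<Longrightarrow> \<theta> l s \<le> d l s * (\<Sum>k=1..N. \<bar>m k l\<bar> * \<theta> k (s + L l))"
        using rec by blast
      show "\<And>l s. l \<in> {1..N} \<Longrightarrow> 0 \<le> \<theta> l s" using \<theta>0 by blast
      show "\<And>l s. l \<in> {1..N} \<Longrightarrow> t \<le> s \<Longrightarrow> \<theta> l s \<le> 1" using end1 by blast
    qed (use d1' that in simp_all)
    from l s st show "\<theta> l s \<le> \<kappa> ^ n"
    proof (induction n arbitrary: l s)
      case 0
      then show ?case using all by simp
    next
      case (Suc n)
      \<comment> \<open>The bound \<open>\<kappa> ^ n\<close> is known only on this range of times,
        but \<open>key\<close> asks for a bound everywhere. The truncation keeps the recursive
        inequality up to \<open>Lmax\<close> before the upper end: a transit from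
        \<open>s \<ge> -Lmax\<close> does not leave the range there, and for smaller
        \<open>s\<close> the left-hand side is \<open>0\<close>.\<close>
      define \<theta>' where "\<theta>' = (\<lambda>l s. if -Lmax \<le> s \<and> s \<le> t - n * T' then \<theta> l s else 0)"
      have rec'': "\<theta>' l s \<le> d l s * (\<Sum>k=1..N. \<bar>m k l\<bar> * \<theta>' k (s + L l))"
        if l: "l \<in> {1..N}" and s: "s < t - n * T' - Lmax" for l s
      proof -
        have nT: "n * T' \<ge> 0" using T' by simp
        show "\<theta>' l s \<le> d l s * (\<Sum>k=1..N. \<bar>m k l\<bar> * \<theta>' k (s + L l))"
        proof (cases "-Lmax \<le> s")
          case True
          then have "\<theta>' l s = \<theta> l s" "\<And>k. \<theta>' k (s + L l) = \<theta> k (s + L l)"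
            using s Lmax0 Lle[OF l] Lpos[OF l] by (auto simp: \<theta>'_def)
          then show ?thesis using rec l s nT Lmax0 by auto
        next
          case False
          then have "\<theta>' l s = 0" by (simp add: \<theta>'_def)
          moreover have "0 \<le> d l s * (\<Sum>k=1..N. \<bar>m k l\<bar> * \<theta>' k (s + L l))"
            using d1' l \<theta>0 by (auto simp: \<theta>'_def intro!: mult_nonneg_nonneg sum_nonneg)
          ultimately show ?thesis by simp
        qed
      qed
      have "\<theta>' l s \<le> \<kappa> ^ n * \<kappa>"
      proof (rule key[OF _ _ _ rec''])
        show "\<theta>' l s \<le> \<kappa> ^ n" if "l \<in> {1..N}" for l s
        proof -
          have "0 \<le> \<kappa> ^ n" using \<kappa> by simp
          then show ?thesis using Suc.IH[OF that, of s] by (simp add: \<theta>'_def)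
        qed
        show "s \<le> t - n * T' - Lmax - (T' - Lmax)" using Suc.prems by (simp add: algebra_simps)
        show "0 \<le> \<kappa> ^ n" using \<kappa> by simp
        show "0 \<le> \<theta>' l s" if "l \<in> {1..N}" for l s using that \<theta>0 by (simp add: \<theta>'_def)
      qed (use Suc.prems in auto)
      moreover have "s \<le> t - n * T'" using Suc.prems T' by (simp add: algebra_simps)
      ultimately show ?case using Suc.prems by (simp add: \<theta>'_def mult.commute)
    qed
  qed
qed

end

section \<open>Weak derivatives\<close>

definition C1_fun :: "(real \<Rightarrow> real) \<Rightarrow> (real \<Rightarrow> real) \<Rightarrow> bool" where
  "C1_fun \<phi> \<phi>' \<longleftrightarrow> (\<forall>x. (\<phi> has_real_derivative \<phi>' x) (at x)) \<and> continuous_on UNIV \<phi>'"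

lemma C1_fun_continuous: "C1_fun \<phi> \<phi>' \<Longrightarrow> continuous_on UNIV \<phi>"
  unfolding C1_fun_def by (meson DERIV_isCont continuous_at_imp_continuous_on)

lemma C1_fun_measurable:
  assumes "C1_fun \<phi> \<phi>'"
  shows "\<phi> \<in> borel_measurable borel" "\<phi>' \<in> borel_measurable borel"
  using assms C1_fun_continuous by (auto intro: borel_measurable_continuous_onI simp: C1_fun_def)

text \<open>Squaring removes the kink of the positive part; this provides the C1 cutoff function of
  the next lemma.\<close>

lemma pos_part_sq_has_derivative: "((\<lambda>y::real. (max 0 y)\<^sup>2) has_real_derivative 2 * max 0 y) (at y)"
proof -
  consider "y > 0" | "y < 0" | "y = 0" by linarith
  then show ?thesis
  proof cases
    case 1
    have "((\<lambda>y::real. y\<^sup>2) has_real_derivative 2 * max 0 y) (at y)"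
      using 1 by (auto intro!: derivative_eq_intros)
    then show ?thesis
      by (rule has_field_derivative_transform_within_open[where S="{0<..}"]) (use 1 in auto)
  next
    case 2
    have "((\<lambda>y::real. 0) has_real_derivative 2 * max 0 y) (at y)"
      using 2 by (auto intro!: derivative_eq_intros)
    then show ?thesis
      by (rule has_field_derivative_transform_within_open[where S="{..<0}"]) (use 2 in auto)
  next
    case 3
    have "((\<lambda>h::real. ((max 0 h)\<^sup>2 - 0) / h) \<longlongrightarrow> 0) (at 0)"
    proof (rule Lim_null_comparison[where g="\<lambda>h. \<bar>h\<bar>"])
      show "\<forall>\<^sub>F h::real in at 0. norm (((max 0 h)\<^sup>2 - 0) / h) \<le> \<bar>h\<bar>"
        by (rule always_eventually) (auto simp: max_def power2_eq_square)
    qed (auto intro!: tendsto_eq_intros)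
    then show ?thesis unfolding 3 DERIV_def by simp
  qed
qed

text \<open>The approximants are \<open>(q x)\<^sup>2 * P n x\<close> with \<open>q\<close> the
  positive part of \<open>(x - c) * (d - x)\<close> and a polynomial \<open>P n\<close>. The square
  makes them C1 across the end points. \<open>P n\<close> is close to a bounded continuous
  approximation of \<open>f\<close> divided by \<open>q\<^sup>2\<close>, so the cutoff cancels in
  the limit.\<close>

lemma C1_bump_approx:
  fixes f :: "real \<Rightarrow> real"
  assumes f: "f \<in> borel_measurable lebesgue" and K: "\<And>x. \<bar>f x\<bar> \<le> K"
  shows "\<exists>w w'. (\<forall>n. C1_fun (w n) (w' n)) \<and> (\<forall>n x. x \<notin> {c<..<d} \<longrightarrow> w n x = 0) \<and>
     (\<forall>n x. \<bar>w n x\<bar> \<le> K + 1 / (Suc n)) \<and>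
     (AE x in lebesgue. (\<lambda>n. w n x) \<longlonglongrightarrow> indicator {c<..<d} x * f x)"
proof -
  have K0: "K \<ge> 0" using K[of 0] by linarith
  have "f measurable_on UNIV"
    using f by (simp add: measurable_on_iff_borel_measurable lebesgue_on_UNIV_eq)
  then obtain Z g where Z: "negligible Z" and g: "\<And>n. continuous_on UNIV (g n)"
    and lim: "\<And>x. x \<notin> Z \<Longrightarrow> (\<lambda>n. g n x) \<longlonglongrightarrow> f x"
    unfolding measurable_on_def by auto
  define q where "q = (\<lambda>x. max 0 ((x - c) * (d - x)) :: real)"
  have q0: "q x \<ge> 0" for x by (simp add: q_def)
  have qout: "q x = 0" if "x \<notin> {c<..<d}" "c \<le> d" for x
  proof -
    have "x \<le> c \<or> d \<le> x" using that by auto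
    then have "(x - c) * (d - x) \<le> 0"
      using that(2) by (auto intro: mult_nonpos_nonneg mult_nonneg_nonpos)
    then show ?thesis by (simp add: q_def)
  qed
  have cq: "continuous_on UNIV q" unfolding q_def by (intro continuous_intros)
  show ?thesis
  proof (cases "c < d")
    case False
    then show ?thesis by (intro exI[of _ "\<lambda>n x. 0"]) (use K0 in \<open>auto simp: C1_fun_def\<close>)
  next
    case True
    define B where "B = (d - c) ^ 2 + 1"
    have qB: "q x \<le> B" for x
    proof (cases "x \<in> {c<..<d}")
      case True
      then have "(x - c) * (d - x) \<le> (d - c) * (d - c)" by (intro mult_mono) auto
      then show ?thesis using True by (auto simp: q_def B_def power2_eq_square)
    next
      case False then show ?thesis using qout True by (simp add: B_def)
    qed
    have B: "B > 0" by (simp add: B_def add_nonneg_pos)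
    define h where "h = (\<lambda>n x. max (-K) (min K (g n x)))"
    \<comment> \<open>The divisor is kept away from \<open>0\<close> so that \<open>k n\<close> is
      continuous on \<open>{c..d}\<close>, as the Stone-Weierstrass theorem requires. At each inner
      point it equals \<open>(q x)\<^sup>2\<close> for all large \<open>n\<close>.\<close>
    define k where "k = (\<lambda>n x. h n x / max ((q x)\<^sup>2) (1 / Suc n))"
    have h: "\<bar>h n x\<bar> \<le> K" for n x using K0 by (auto simp: h_def)
    \<comment> \<open>\<open>B\<^sup>2\<close> bounds \<open>(q x)\<^sup>2\<close>, so this error
      becomes at most \<open>1 / Suc n\<close> after multiplication by the cutoff.\<close>
    have "\<exists>P. real_polynomial_function P \<and> (\<forall>x\<in>{c..d}. \<bar>k n x - P x\<bar> < 1 / (Suc n * B\<^sup>2))" for n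
    proof -
      have "continuous_on {c..d} (k n)" unfolding k_def h_def
        by (intro continuous_intros continuous_on_subset[OF g] continuous_on_subset[OF cq])
          (auto simp: max_def)
      then show ?thesis
        using Stone_Weierstrass_real_polynomial_function[OF compact_Icc, of c d "k n" "1 / (Suc n * B\<^sup>2)"] B
        by (metis divide_pos_pos mult_pos_pos of_nat_0_less_iff zero_less_Suc zero_less_one zero_less_power)
    qed
    then obtain P where P: "\<And>n. real_polynomial_function (P n)"
      and kP: "\<And>n x. x \<in> {c..d} \<Longrightarrow> \<bar>k n x - P n x\<bar> < 1 / (Suc n * B\<^sup>2)" by metis
    define w where "w = (\<lambda>n x. (q x)\<^sup>2 * P n x)"
    have C1: "\<exists>w'. C1_fun (w n) w'" for n
    proof -
      obtain P' where P': "polynomial_function P'" "\<And>x. (P n has_vector_derivative P' x) (at x)"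
        using has_vector_derivative_polynomial_function[of "P n"] P[of n] real_polynomial_function_eq by metis
      have dP: "(P n has_real_derivative P' x) (at x)" for x
        using P'(2) by (simp add: has_real_derivative_iff_has_vector_derivative)
      have dq: "((\<lambda>x. (q x)\<^sup>2) has_real_derivative 2 * q x * (d + c - 2 * x)) (at x)" for x
      proof -
        have "((\<lambda>x. (x - c) * (d - x)) has_real_derivative (d + c - 2 * x)) (at x)"
          by (auto intro!: derivative_eq_intros)
        from DERIV_chain2[OF pos_part_sq_has_derivative this] show ?thesis unfolding q_def by simp
      qed
      have "continuous_on UNIV (P n)" "continuous_on UNIV P'"
        using continuous_on_polymonial_function P'(1) P[of n] real_polynomial_function_eq by blast+
      then have "continuous_on UNIV (\<lambda>x. 2 * q x * (d + c - 2 * x) * P n x + P' x * (q x)\<^sup>2)"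
        by (intro continuous_intros cq)
      then have "C1_fun (w n) (\<lambda>x. 2 * q x * (d + c - 2 * x) * P n x + P' x * (q x)\<^sup>2)"
        unfolding C1_fun_def w_def using DERIV_mult[OF dq dP] by blast
      then show ?thesis by blast
    qed
    have close: "\<bar>w n x - (q x)\<^sup>2 * k n x\<bar> \<le> 1 / Suc n" for n x
    proof (cases "x \<in> {c<..<d}")
      case False then show ?thesis using qout True by (simp add: w_def)
    next
      case x: True
      have "\<bar>w n x - (q x)\<^sup>2 * k n x\<bar> = (q x)\<^sup>2 * \<bar>k n x - P n x\<bar>"
        unfolding w_def by (simp add: abs_mult right_diff_distrib[symmetric] abs_minus_commute)
      also have "\<dots> \<le> B\<^sup>2 * (1 / (Suc n * B\<^sup>2))"
        using kP[of x n] x qB[of x] q0[of x] by (intro mult_mono power_mono) auto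
      also have "\<dots> = 1 / Suc n" using B by simp
      finally show ?thesis .
    qed
    have qk: "\<bar>(q x)\<^sup>2 * k n x\<bar> \<le> K" for n x
    proof -
      have mx: "max ((q x)\<^sup>2) (1 / Suc n) > 0" by (rule max.strict_coboundedI2) simp
      have "\<bar>(q x)\<^sup>2 * k n x\<bar> = ((q x)\<^sup>2 / max ((q x)\<^sup>2) (1 / Suc n)) * \<bar>h n x\<bar>"
        using mx by (simp add: k_def abs_mult)
      also have "\<dots> \<le> 1 * K" using mx h by (intro mult_mono) auto
      finally show ?thesis by simp
    qed
    have bd: "\<bar>w n x\<bar> \<le> K + 1 / Suc n" for n x using close[of n x] qk[of x n] by linarith
    have conv: "(\<lambda>n. w n x) \<longlonglongrightarrow> indicator {c<..<d} x * f x" if xZ: "x \<notin> Z" for x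
    proof (cases "x \<in> {c<..<d}")
      case False then show ?thesis using qout True by (simp add: w_def)
    next
      case x: True
      have qx: "q x > 0" using x by (simp add: q_def)
      have "(\<lambda>n. h n x) \<longlonglongrightarrow> max (-K) (min K (f x))" unfolding h_def
        by (intro tendsto_intros lim xZ)
      moreover have "max (-K) (min K (f x)) = f x" using K[of x] by (simp add: abs_le_iff)
      ultimately have h1: "(\<lambda>n. h n x) \<longlonglongrightarrow> f x" by simp
      have "eventually (\<lambda>n. 1 / Suc n < (q x)\<^sup>2) sequentially"
        using order_tendstoD(2)[OF LIMSEQ_inverse_real_of_nat, of "(q x)\<^sup>2"] qx
        by (simp add: inverse_eq_divide)
      then have "eventually (\<lambda>n. (q x)\<^sup>2 * k n x = h n x) sequentially"
      proof eventually_elim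
        case (elim n)
        then show ?case using qx by (simp add: k_def max_def)
      qed
      then have h2: "(\<lambda>n. (q x)\<^sup>2 * k n x) \<longlonglongrightarrow> f x" using h1 by (simp add: tendsto_cong)
      have "(\<lambda>n. w n x - (q x)\<^sup>2 * k n x) \<longlonglongrightarrow> 0"
        by (rule Lim_null_comparison[OF _ LIMSEQ_inverse_real_of_nat])
          (use close in \<open>auto simp: inverse_eq_divide\<close>)
      from tendsto_add[OF this h2] show ?thesis using x by simp
    qed
    obtain w' where w': "\<And>n. C1_fun (w n) (w' n)" using C1 by metis
    have "AE x in lebesgue. x \<notin> Z"
      using Z by (simp add: AE_not_in negligible_iff_null_sets)
    then have "AE x in lebesgue. (\<lambda>n. w n x) \<longlonglongrightarrow> indicator {c<..<d} x * f x"
      by eventually_elim (rule conv)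
    moreover have "w n x = 0" if "x \<notin> {c<..<d}" for n x using that qout True by (simp add: w_def)
    ultimately show ?thesis using w' bd by blast
  qed
qed

lemma borel_measurable_lebesgue_onI:
  fixes f :: "real \<Rightarrow> real"
  shows "f \<in> borel_measurable borel \<Longrightarrow> f \<in> borel_measurable (lebesgue_on S)"
  by (intro measurable_restrict_space1 measurable_completion) simp

lemma AE_lebesgue_onI:
  fixes S :: "real set"
  assumes "AE x in lebesgue. P x" "S \<in> sets borel"
  shows "AE x in lebesgue_on S. P x"
  using assms by (subst AE_restrict_space_iff) (auto elim: eventually_mono)

lemma C1_fun_bounded_on:
  assumes "C1_fun \<phi> \<phi>'"
  shows "\<exists>K. \<forall>x\<in>{a..b}. \<bar>\<phi> x\<bar> \<le> K \<and> \<bar>\<phi>' x\<bar> \<le> K"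
proof -
  have c: "continuous_on {a..b} \<phi>" "continuous_on {a..b} \<phi>'"
    using C1_fun_continuous[OF assms] assms continuous_on_subset unfolding C1_fun_def by blast+
  obtain K1 where K1: "\<And>x. x \<in> {a..b} \<Longrightarrow> norm (\<phi> x) \<le> K1"
    using compact_imp_bounded[OF compact_continuous_image[OF c(1) compact_Icc]] unfolding bounded_iff by blast
  obtain K2 where K2: "\<And>x. x \<in> {a..b} \<Longrightarrow> norm (\<phi>' x) \<le> K2"
    using compact_imp_bounded[OF compact_continuous_image[OF c(2) compact_Icc]] unfolding bounded_iff by blast
  show ?thesis by (rule exI[of _ "max K1 K2"]) (use K1 K2 in force)
qed

lemma integrable_mult_bounded_AE:
  fixes e \<phi> :: "'a \<Rightarrow> real"
  assumes e: "integrable M e" and m: "\<phi> \<in> borel_measurable M" and b: "AE x in M. \<bar>\<phi> x\<bar> \<le> K"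
  shows "integrable M (\<lambda>x. e x * \<phi> x)"
proof (rule Bochner_Integration.integrable_bound[of M "\<lambda>x. K * e x"])
  show "AE x in M. norm (e x * \<phi> x) \<le> norm (K * e x)"
    using b by eventually_elim (auto simp: abs_mult mult.commute[of K] intro!: mult_mono)
qed (use e m in auto)

section \<open>Test functions and the du Bois-Reymond lemma\<close>

definition test_fun :: "real \<Rightarrow> (real \<Rightarrow> real) \<Rightarrow> (real \<Rightarrow> real) \<Rightarrow> bool" where
  "test_fun l \<phi> \<phi>' \<longleftrightarrow> C1_fun \<phi> \<phi>' \<and> (\<exists>c d. 0 < c \<and> d < l \<and> (\<forall>x. x \<notin> {c..d} \<longrightarrow> \<phi> x = 0))"

text \<open>Testing with C1 approximations of the sign of \<open>e\<close> shows that
  \<open>\<bar>e\<bar>\<close> has integral \<open>0\<close> over \<open>{c<..<d}\<close>. The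
  detour through smaller intervals is due to the supports of the test functions, which have to stay
  away from \<open>0\<close> and \<open>l\<close>.\<close>

lemma du_Bois_Reymond_zero:
  fixes e :: "real \<Rightarrow> real"
  assumes e: "integrable (lebesgue_on {0<..<l}) e"
    and z: "\<And>\<phi> \<phi>'. test_fun l \<phi> \<phi>' \<Longrightarrow> (LINT x|lebesgue_on {0<..<l}. e x * \<phi> x) = 0"
  shows "AE x in lebesgue_on {0<..<l}. e x = 0"
proof -
  let ?M = "lebesgue_on {0<..<l}"
  define s where "s = (\<lambda>x. if x \<in> {0<..<l} then sgn (e x) else 0)"
  have em: "e \<in> borel_measurable ?M" using e by auto
  have s: "s \<in> borel_measurable lebesgue" unfolding s_def
    by (rule borel_measurable_if_I) (use em in auto)
  have *: "AE x in ?M. indicator {c<..<d} x * \<bar>e x\<bar> = 0" if cd: "0 < c" "d < l" for c d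
  proof -
    obtain w w' where w: "\<And>n. C1_fun (w n) (w' n)" and w0: "\<And>n x. x \<notin> {c<..<d} \<Longrightarrow> w n x = 0"
      and wb: "\<And>n x. \<bar>w n x\<bar> \<le> 1 + 1 / (Suc n)"
      and wl: "AE x in lebesgue. (\<lambda>n. w n x) \<longlonglongrightarrow> indicator {c<..<d} x * s x"
    proof -
      have "\<bar>s x\<bar> \<le> 1" for x by (simp add: s_def sgn_if)
      from C1_bump_approx[OF s this, of c d] show ?thesis using that by blast
    qed
    have wb2: "\<bar>w n x\<bar> \<le> 2" for n x 
    proof -
      have "1 / real (Suc n) \<le> 1" by simp
      then show ?thesis using wb[of n x] by linarith
    qed
    have "(\<lambda>n. LINT x|?M. e x * w n x) \<longlonglongrightarrow> (LINT x|?M. e x * (indicator {c<..<d} x * s x))"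
    proof (rule integral_dominated_convergence[where w="\<lambda>x. 2 * \<bar>e x\<bar>"])
      show "AE x in ?M. (\<lambda>n. e x * w n x) \<longlonglongrightarrow> e x * (indicator {c<..<d} x * s x)"
      proof -
        have "AE x in ?M. (\<lambda>n. w n x) \<longlonglongrightarrow> indicator {c<..<d} x * s x"
          using wl by (rule AE_lebesgue_onI) simp
        then show ?thesis by eventually_elim (intro tendsto_intros)
      qed
      show "(\<lambda>x. e x * (indicator {c<..<d} x * s x)) \<in> borel_measurable ?M"
        by (intro borel_measurable_times em measurable_restrict_space1[OF s] borel_measurable_lebesgue_onI borel_measurable_indicator) simp
      show "\<And>n. (\<lambda>x. e x * w n x) \<in> borel_measurable ?M"
        by (intro borel_measurable_times em borel_measurable_lebesgue_onI C1_fun_measurable(1)[OF w])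
      show "\<And>n. AE x in ?M. norm (e x * w n x) \<le> 2 * \<bar>e x\<bar>"
      proof (rule AE_I2)
        fix n x
        show "norm (e x * w n x) \<le> 2 * \<bar>e x\<bar>"
          using mult_left_mono[OF wb2[of n x], of "\<bar>e x\<bar>"] by (simp add: abs_mult)
      qed
    qed (use e in auto)
    moreover have "(LINT x|?M. e x * w n x) = 0" for n
    proof (rule z[of _ "w' n"])
      have "\<forall>x. x \<notin> {c..d} \<longrightarrow> w n x = 0" using w0 by auto
      then show "test_fun l (w n) (w' n)" unfolding test_fun_def using w cd by blast
    qed
    ultimately have "(LINT x|?M. e x * (indicator {c<..<d} x * s x)) = 0"
      by (simp add: LIMSEQ_const_iff)
    moreover have "(LINT x|?M. e x * (indicator {c<..<d} x * s x)) = (LINT x|?M. indicator {c<..<d} x * \<bar>e x\<bar>)"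
      by (rule Bochner_Integration.integral_cong) (auto simp: s_def abs_sgn mult.commute)
    ultimately have 0: "(LINT x|?M. indicator {c<..<d} x * \<bar>e x\<bar>) = 0" by simp
    have int: "integrable ?M (\<lambda>x. \<bar>e x\<bar> * indicator {c<..<d} x)"
      by (rule integrable_mult_bounded_AE[where K=1])
        (use e in \<open>auto intro!: borel_measurable_lebesgue_onI simp: indicator_def\<close>)
    then show ?thesis
      using integral_nonneg_eq_0_iff_AE[of ?M "\<lambda>x. indicator {c<..<d} x * \<bar>e x\<bar>"] 0
      by (simp add: mult.commute)
  qed
  have "AE x in ?M. \<forall>n. indicator {inverse (Suc n)<..<l - inverse (Suc n)} x * \<bar>e x\<bar> = 0"
    by (subst AE_all_countable) (intro allI *, auto)
  then have "AE x in ?M. x \<in> {0<..<l} \<longrightarrow> e x = 0"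
  proof eventually_elim
    case (elim x)
    show ?case
    proof
      assume x: "x \<in> {0<..<l}"
      have "eventually (\<lambda>n. inverse (real (Suc n)) < min x (l - x)) sequentially"
        by (rule order_tendstoD(2)[OF LIMSEQ_inverse_real_of_nat]) (use x in auto)
      then obtain n where "inverse (real (Suc n)) < min x (l - x)" by (auto simp: eventually_sequentially)
      then show "e x = 0" using elim[rule_format, of n] by auto
    qed
  qed
  then show ?thesis using AE_space[of ?M] by (auto elim: eventually_mono)
qed

lemma continuous_AE_eq:
  fixes u v :: "real \<Rightarrow> real"
  assumes u: "continuous_on {0..l} u" and v: "continuous_on {0..l} v" and l: "l > 0"
    and ae: "AE x in lebesgue_on {0<..<l}. u x = v x" and x: "x \<in> {0..l}"
  shows "u x = v x"
proof -
  define h where "h = (\<lambda>x. u x - v x)"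
  have h: "continuous_on {0..l} h" unfolding h_def by (intro continuous_intros u v)
  have "continuous_on {0<..<l} h" by (rule continuous_on_subset[OF h]) auto
  then have op: "open ({0<..<l} \<inter> h -` (-{0}))"
    by (rule continuous_open_preimage) auto
  have "AE x in lebesgue. x \<in> {0<..<l} \<longrightarrow> u x = v x"
    using ae by (subst (asm) AE_restrict_space_iff) auto
  then have "AE x in lebesgue. x \<notin> {0<..<l} \<inter> h -` (-{0})" by eventually_elim (auto simp: h_def)
  then have "negligible ({0<..<l} \<inter> h -` (-{0}))"
    using op by (simp add: negligible_iff_null_sets AE_iff_null_sets borel_open)
  then have "{0<..<l} \<inter> h -` (-{0}) = {}" using open_not_negligible[OF op] by blast
  then have "\<And>x. x \<in> {0<..<l} \<Longrightarrow> h x = 0" by auto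
  then have "h x = 0"
    using continuous_constant_on_closure[of "{0<..<l}" h 0 x] h x l by simp
  then show ?thesis by (simp add: h_def)
qed

text \<open>The generator of a semigroup yields right derivatives only, so a continuation argument
  stands in for the mean value theorem: the largest \<open>\<sigma>\<close> with
  \<open>\<bar>F \<sigma> - F 0\<bar> \<le> \<epsilon> * \<sigma>\<close> could be moved to the
  right if it were smaller than \<open>t\<close>.\<close>

lemma right_derivative_zero_imp_const:
  fixes F :: "real \<Rightarrow> real"
  assumes c: "continuous_on {0..t} F" and t: "t \<ge> 0"
    and d: "\<And>s. s \<in> {0..<t} \<Longrightarrow> ((\<lambda>h. (F (s + h) - F s) / h) \<longlongrightarrow> 0) (at_right 0)"
  shows "F t = F 0"
proof -
  have le: "\<bar>F t - F 0\<bar> \<le> \<epsilon> * t" if e: "\<epsilon> > 0" for \<epsilon>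
  proof -
    define A where "A = {s \<in> {0..t}. \<bar>F s - F 0\<bar> \<le> \<epsilon> * s}"
    have A0: "0 \<in> A" using t by (simp add: A_def)
    have clA: "closed A"
    proof -
      have "A = {0..t} \<inter> (\<lambda>s. \<bar>F s - F 0\<bar> - \<epsilon> * s) -` {..0}" by (auto simp: A_def)
      moreover have "closed \<dots>"
        by (rule continuous_closed_preimage) (intro continuous_intros c, auto)
      ultimately show ?thesis by simp
    qed
    define \<sigma> where "\<sigma> = Sup A"
    have bA: "bdd_above A" by (rule bdd_aboveI[of _ t]) (auto simp: A_def)
    have \<sigma>A: "\<sigma> \<in> A" unfolding \<sigma>_def by (rule closed_contains_Sup) (use A0 bA clA in auto)
    have "\<sigma> = t"
    proof (rule ccontr)
      assume "\<sigma> \<noteq> t"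
      then have s: "\<sigma> \<in> {0..<t}" using \<sigma>A by (auto simp: A_def)
      have "eventually (\<lambda>h. dist ((F (\<sigma> + h) - F \<sigma>) / h) 0 < \<epsilon>) (at_right 0)"
        by (rule tendstoD[OF d[OF s] e])
      moreover have "eventually (\<lambda>h. h \<in> {0<..<t - \<sigma>}) (at_right 0)"
        by (rule eventually_at_right_real) (use s in auto)
      ultimately have "eventually (\<lambda>h. h \<in> {0<..<t - \<sigma>} \<and> dist ((F (\<sigma> + h) - F \<sigma>) / h) 0 < \<epsilon>) (at_right 0)"
        by eventually_elim auto
      from eventually_happens'[OF trivial_limit_at_right_real this]
      obtain h where h0: "h \<in> {0<..<t - \<sigma>}" "dist ((F (\<sigma> + h) - F \<sigma>) / h) 0 < \<epsilon>" by blast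
      then have h: "h \<in> {0<..<t - \<sigma>}" "\<bar>F (\<sigma> + h) - F \<sigma>\<bar> / h < \<epsilon>" by (auto simp: dist_real_def)
      then have "\<bar>F (\<sigma> + h) - F \<sigma>\<bar> \<le> \<epsilon> * h" by (auto simp: field_simps)
      then have "\<sigma> + h \<in> A" using \<sigma>A h by (auto simp: A_def algebra_simps)
      then have "\<sigma> + h \<le> \<sigma>" unfolding \<sigma>_def by (rule cSup_upper[OF _ bA])
      then show False using h by auto
    qed
    then show ?thesis using \<sigma>A by (simp add: A_def)
  qed
  have "\<bar>F t - F 0\<bar> \<le> 0"
  proof (cases "t = 0")
    case False
    show ?thesis
    proof (rule field_le_epsilon)
      fix e :: real assume "e > 0"
      then show "\<bar>F t - F 0\<bar> \<le> 0 + e" using le[of "e / t"] t False by simp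
    qed
  qed simp
  then show ?thesis by simp
qed

section \<open>Borel versions, and integrals over an interval as integrals over
  \<open>lborel\<close>\<close>

lemma borel_version_on:
  fixes f :: "real \<Rightarrow> real"
  assumes f: "f \<in> borel_measurable (lebesgue_on S)" and S: "S \<in> sets borel"
  shows "\<exists>f'\<in>borel_measurable borel. (AE x in lebesgue_on S. f x = f' x) \<and> (\<forall>x. x \<notin> S \<longrightarrow> f' x = 0)"
proof -
  have "(\<lambda>x. if x \<in> S then f x else 0) \<in> borel_measurable lebesgue"
    by (rule borel_measurable_if_I) (use f S in auto)
  from completion_ex_borel_measurable_real[OF this] obtain g
    where g: "g \<in> borel_measurable borel" and ae: "AE x in lborel. (if x \<in> S then f x else 0) = g x" by auto
  have "AE x in lebesgue. (if x \<in> S then f x else 0) = g x" using ae by (rule AE_completion)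
  then have ae: "AE x in lebesgue_on S. (if x \<in> S then f x else 0) = g x" by (rule AE_lebesgue_onI[OF _ S])
  have "AE x in lebesgue_on S. x \<in> S" using AE_space[of "lebesgue_on S"] by (auto elim: eventually_mono)
  with ae have "AE x in lebesgue_on S. f x = indicator S x * g x" by eventually_elim auto
  moreover have "(\<lambda>x. indicator S x * g x) \<in> borel_measurable borel"
    using g S by (intro borel_measurable_times borel_measurable_indicator) auto
  ultimately show ?thesis by (intro bexI[of _ "\<lambda>x. indicator S x * g x"]) auto
qed

lemma integrable_lebesgue_on_borel:
  fixes f :: "real \<Rightarrow> real"
  assumes "f \<in> borel_measurable borel" "S \<in> sets borel"
  shows "integrable (lebesgue_on S) f \<longleftrightarrow> integrable lborel (\<lambda>x. indicator S x * f x)"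
proof -
  have "integrable (lebesgue_on S) f \<longleftrightarrow> integrable lebesgue (\<lambda>x. indicator S x * f x)"
    using assms by (subst integrable_restrict_space) auto
  also have "\<dots> \<longleftrightarrow> integrable lborel (\<lambda>x. indicator S x * f x)"
    by (rule integrable_completion) (use assms in auto)
  finally show ?thesis .
qed

lemma integral_lebesgue_on_borel:
  fixes f :: "real \<Rightarrow> real"
  assumes "f \<in> borel_measurable borel" "S \<in> sets borel"
  shows "integral\<^sup>L (lebesgue_on S) f = (LINT x|lborel. indicator S x * f x)"
proof -
  have "integral\<^sup>L (lebesgue_on S) f = (LINT x|lebesgue. indicator S x * f x)"
    using assms by (subst integral_restrict_space) auto
  also have "\<dots> = (LINT x|lborel. indicator S x * f x)"
    by (rule integral_completion) (use assms in auto)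
  finally show ?thesis .
qed

lemma integrable_one_Ioo: "integrable (lebesgue_on {a<..<b::real}) (\<lambda>x. 1::real)"
proof -
  have "integrable lborel (\<lambda>x. indicator {a<..<b} x * 1 :: real)"
    by (cases "a \<le> b") (auto intro!: integrable_real_indicator)
  then show ?thesis by (subst integrable_lebesgue_on_borel) auto
qed

section \<open>Primitives of integrable functions, boundary values and integration by parts\<close>

lemma integrable_prod_lborel:
  fixes f g :: "real \<Rightarrow> real"
  assumes f: "integrable lborel f" and g: "integrable lborel g"
  shows "integrable (lborel \<Otimes>\<^sub>M lborel) (\<lambda>(x, y). f x * g y)"
proof (rule lborel_pair.Fubini_integrable)
  show "(\<lambda>(x, y). f x * g y) \<in> borel_measurable (lborel \<Otimes>\<^sub>M lborel)"
    using f g by measurable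
qed (use f g in \<open>auto simp: abs_mult\<close>)

text \<open>\<open>g\<close> is merely integrable, so no pointwise product rule holds for
  \<open>G * \<phi>\<close>. Fubini's theorem on the triangle \<open>y < x < l\<close> gives the
  formula instead: integrating \<open>\<phi>'\<close> over \<open>x\<close> from \<open>y\<close> to
  \<open>l\<close> leaves \<open>\<phi> l - \<phi> y\<close>.\<close>

lemma primitive_by_parts:
  fixes g :: "real \<Rightarrow> real"
  assumes g: "integrable lborel g" and g0: "\<And>x. x \<notin> {0<..<l} \<Longrightarrow> g x = 0"
    and C: "C1_fun \<phi> \<phi>'" and l: "l > 0"
  defines "G \<equiv> (\<lambda>x. LINT y|lborel. g y * indicator {..<x} y)"
  shows "(LINT x|lborel. indicator {0<..<l} x * (G x * \<phi>' x)) = G l * \<phi> l - (LINT y|lborel. g y * \<phi> y)"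
proof -
  obtain K where K: "\<And>x. x \<in> {0..l} \<Longrightarrow> \<bar>\<phi> x\<bar> \<le> K \<and> \<bar>\<phi>' x\<bar> \<le> K"
    using C1_fun_bounded_on[OF C] by blast
  have K0: "K \<ge> 0" using K[of 0] l by force
  note Cm[measurable] = C1_fun_measurable[OF C]
  note gm[measurable] = borel_measurable_integrable[OF g]
  define F where "F = (\<lambda>x y. indicator {0<..<l} x * \<phi>' x * (g y * indicator {..<x} y))"
  have Fint: "integrable (lborel \<Otimes>\<^sub>M lborel) (case_prod F)"
  proof (rule Bochner_Integration.integrable_bound)
    show "integrable (lborel \<Otimes>\<^sub>M lborel) (\<lambda>(x, y). (K * indicator {0<..<l} x) * g y)"
      by (rule integrable_prod_lborel[OF _ g]) (intro integrable_mult_right integrable_real_indicator, use l in auto)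
    have [measurable]: "(\<lambda>p::real\<times>real. indicator {..<fst p} (snd p) :: real) \<in> borel_measurable (lborel \<Otimes>\<^sub>M lborel)"
    proof -
      have "(\<lambda>p::real\<times>real. indicator {..<fst p} (snd p) :: real) = indicator {p. snd p < fst p}"
        by (auto simp: indicator_def)
      then show ?thesis by simp
    qed
    show "case_prod F \<in> borel_measurable (lborel \<Otimes>\<^sub>M lborel)"
      unfolding F_def split_beta by measurable
    show "AE x in lborel \<Otimes>\<^sub>M lborel. norm (case x of (x, y) \<Rightarrow> F x y)
            \<le> norm (case x of (x, y) \<Rightarrow> K * indicator {0<..<l} x * g y)"
    proof (rule AE_I2, clarify)
      fix x y :: real
      have "\<bar>indicator {0<..<l} x * \<phi>' x\<bar> \<le> \<bar>K * indicator {0<..<l} x\<bar>"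
        using K[of x] by (auto simp: indicator_def)
      moreover have "\<bar>g y * indicator {..<x} y\<bar> \<le> \<bar>g y\<bar>" by (auto simp: indicator_def)
      ultimately have "\<bar>indicator {0<..<l} x * \<phi>' x\<bar> * \<bar>g y * indicator {..<x} y\<bar> \<le> \<bar>K * indicator {0<..<l} x\<bar> * \<bar>g y\<bar>"
        by (intro mult_mono) auto
      then show "norm (F x y) \<le> norm (K * indicator {0<..<l} x * g y)"
        unfolding F_def by (simp add: abs_mult)
    qed
  qed
  have "(LINT x|lborel. indicator {0<..<l} x * (G x * \<phi>' x)) = (LINT x|lborel. LINT y|lborel. F x y)"
  proof (rule Bochner_Integration.integral_cong)
    fix x
    have "(LINT y|lborel. F x y) = indicator {0<..<l} x * \<phi>' x * G x"
      unfolding F_def G_def by (rule integral_mult_right_zero)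
    then show "indicator {0<..<l} x * (G x * \<phi>' x) = (LINT y|lborel. F x y)" by simp
  qed simp
  also have "\<dots> = (LINT y|lborel. LINT x|lborel. F x y)"
    by (rule lborel_pair.Fubini_integral[OF Fint, symmetric])
  also have "\<dots> = (LINT y|lborel. (g y * indicator {..<l} y) * \<phi> l - g y * \<phi> y)"
  proof (rule Bochner_Integration.integral_cong)
    fix y
    show "(LINT x|lborel. F x y) = (g y * indicator {..<l} y) * \<phi> l - g y * \<phi> y"
    proof (cases "y \<in> {0<..<l}")
      case False then show ?thesis unfolding F_def using g0 by simp
    next
      case True
      have "(LINT x|lborel. F x y) = (LINT x|lborel. g y * (\<phi>' x * indicator {y..l} x))"
      proof (rule integral_cong_AE)
        show "AE x in lborel. F x y = g y * (\<phi>' x * indicator {y..l} x)"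
          using AE_lborel_singleton[of y] AE_lborel_singleton[of l]
          by eventually_elim (use True in \<open>auto simp: F_def indicator_def\<close>)
        have "(\<lambda>x. F x y) = (\<lambda>x. indicator {0<..<l} x * \<phi>' x * (g y * indicator {y<..} x))"
          by (auto simp: F_def indicator_def fun_eq_iff)
        then show "(\<lambda>x. F x y) \<in> borel_measurable lborel" by simp
      qed simp
      also have "\<dots> = g y * (\<phi> l - \<phi> y)"
      proof -
        have "(LINT x|lborel. \<phi>' x * indicator {y..l} x) = \<phi> l - \<phi> y"
          by (rule integral_FTC_Icc_real)
            (use True C in \<open>auto simp: C1_fun_def continuous_on_eq_continuous_at\<close>)
        then show ?thesis by simp
      qed
      finally show ?thesis using True by (simp add: algebra_simps)
    qed
  qed auto
  also have "\<dots> = (LINT y|lborel. (g y * indicator {..<l} y) * \<phi> l) - (LINT y|lborel. g y * \<phi> y)"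
  proof (rule Bochner_Integration.integral_diff)
    show "integrable lborel (\<lambda>y. g y * indicator {..<l} y * \<phi> l)"
      by (rule integrable_mult_left, rule integrable_mult_bounded_AE[OF g, where K=1]) (auto simp: indicator_def)
    have "integrable lborel (\<lambda>y. g y * (indicator {0..l} y * \<phi> y))"
      by (rule integrable_mult_bounded_AE[OF g, where K=K]) (use K K0 in \<open>auto simp: indicator_def\<close>)
    moreover have "(\<lambda>y. g y * (indicator {0..l} y * \<phi> y)) = (\<lambda>y. g y * \<phi> y)"
    proof
      fix y
      show "g y * (indicator {0..l} y * \<phi> y) = g y * \<phi> y"
        using g0[of y] by (cases "y \<in> {0<..<l}") auto
    qed
    ultimately show "integrable lborel (\<lambda>y. g y * \<phi> y)" by simp
  qed
  also have "\<dots> = G l * \<phi> l - (LINT y|lborel. g y * \<phi> y)" by (simp add: G_def)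
  finally show ?thesis .
qed

lemma primitive_continuous:
  fixes g :: "real \<Rightarrow> real"
  assumes g: "integrable lborel g"
  shows "continuous_on UNIV (\<lambda>x. LINT y|lborel. g y * indicator {..<x} y)"
proof -
  have "(\<lambda>n. LINT y|lborel. g y * indicator {..<u n} y) \<longlonglongrightarrow> (LINT y|lborel. g y * indicator {..<x} y)"
    if u: "u \<longlonglongrightarrow> x" for u :: "nat \<Rightarrow> real" and x
  proof (rule integral_dominated_convergence[where w="\<lambda>y. \<bar>g y\<bar>"])
    show "AE y in lborel. (\<lambda>n. g y * indicator {..<u n} y) \<longlonglongrightarrow> g y * indicator {..<x} y"
      using AE_lborel_singleton[of x]
    proof eventually_elim
      case (elim y)
      have "eventually (\<lambda>n. indicator {..<u n} y = (indicator {..<x} y :: real)) sequentially"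
      proof (cases "y < x")
        case True
        then show ?thesis using order_tendstoD(1)[OF u, of y] by (auto elim: eventually_mono)
      next
        case False
        then show ?thesis using order_tendstoD(2)[OF u, of y] elim by (auto elim: eventually_mono)
      qed
      then show ?case by (intro tendsto_intros tendsto_eventually)
    qed
  qed (use g in \<open>auto simp: indicator_def\<close>)
  then show ?thesis by (auto simp: continuous_on_sequentially o_def)
qed

text \<open>An antiderivative is constant on either side of the support of \<open>\<psi>\<close>.
  Mean zero makes the two constants equal, so subtracting this constant leaves a compactly supported
  function.\<close>

lemma mean_zero_antiderivative:
  assumes t: "test_fun l \<psi> \<psi>'" and z: "(LINT x|lborel. indicator {0<..<l} x * \<psi> x) = 0" and l: "l > 0"
  shows "\<exists>\<phi>. test_fun l \<phi> \<psi>"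
proof -
  obtain c d where cd: "0 < c" "d < l" "\<And>x. x \<notin> {c..d} \<Longrightarrow> \<psi> x = 0" and C: "C1_fun \<psi> \<psi>'"
    using t unfolding test_fun_def by blast
  have cont: "continuous_on UNIV \<psi>" by (rule C1_fun_continuous[OF C])
  then have ic: "isCont \<psi> x" for x by (simp add: continuous_on_eq_continuous_at)
  obtain F where F: "\<And>x. (F has_real_derivative \<psi> x) (at x)"
    using einterval_antiderivative[of "-\<infinity>" "\<infinity>" \<psi>] ic
    by (auto simp: has_real_derivative_iff_has_vector_derivative)
  have "(LINT x|lborel. \<psi> x * indicator {0..l} x) = F l - F 0"
    by (rule integral_FTC_Icc_real) (use F ic l in auto)
  moreover have "(\<lambda>x. \<psi> x * indicator {0..l} x) = (\<lambda>x. indicator {0<..<l} x * \<psi> x)"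
    using cd by (force simp: indicator_def fun_eq_iff)
  ultimately have Fl: "F l = F 0" using z by simp
  have 1: "F x = F 0" if "x < c" for x
  proof -
    have "\<exists>k. \<forall>y\<in>{..<c}. F y = k"
    proof (rule has_field_derivative_zero_constant)
      show "(F has_real_derivative 0) (at y within {..<c})" if "y \<in> {..<c}" for y
        using has_field_derivative_at_within[OF F[of y], of "{..<c}"] cd(3)[of y] that by auto
    qed simp
    then obtain k where k: "\<And>y. y < c \<Longrightarrow> F y = k" by auto
    show ?thesis using k[OF that] k[OF cd(1)] by simp
  qed
  have 2: "F x = F 0" if "x > d" for x
  proof -
    have "\<exists>k. \<forall>y\<in>{d<..}. F y = k"
    proof (rule has_field_derivative_zero_constant)
      show "(F has_real_derivative 0) (at y within {d<..})" if "y \<in> {d<..}" for y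
        using has_field_derivative_at_within[OF F[of y], of "{d<..}"] cd(3)[of y] that by auto
    qed simp
    then obtain k where k: "\<And>y. d < y \<Longrightarrow> F y = k" by auto
    show ?thesis using k[OF that] k[OF cd(2)] Fl by simp
  qed
  have "C1_fun (\<lambda>x. F x - F 0) \<psi>" unfolding C1_fun_def using F cont by (auto intro!: derivative_eq_intros)
  moreover have "\<forall>x. x \<notin> {c..d} \<longrightarrow> F x - F 0 = 0" using 1 2 by force
  ultimately show ?thesis unfolding test_fun_def using cd by blast
qed

text \<open>The difference \<open>e\<close> of \<open>f\<close> and the primitive \<open>G\<close>
  of \<open>g\<close> annihilates all derivatives of test functions, hence is constant. Testing with
  functions that need not vanish at the end points then brings in the boundary values, to which the
  coupling condition in \<open>A_dom\<close> refers.\<close>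

lemma weak_derivative_primitive:
  fixes f g :: "real \<Rightarrow> real"
  assumes f: "integrable (lebesgue_on {0<..<l}) f" and g: "integrable (lebesgue_on {0<..<l}) g"
    and wd: "has_weak_derivative l f g" and l: "l > 0"
  shows "\<exists>w. continuous_on {0..l} w \<and> (AE x in lebesgue_on {0<..<l}. f x = w x) \<and>
    (\<forall>\<phi> \<phi>'. C1_fun \<phi> \<phi>' \<longrightarrow>
      (LINT x|lebesgue_on {0<..<l}. g x * \<phi> x) = w l * \<phi> l - w 0 * \<phi> 0 - (LINT x|lebesgue_on {0<..<l}. f x * \<phi>' x))"
proof -
  let ?S = "{0<..<l}"
  let ?M = "lebesgue_on ?S"
  obtain g' where g'm: "g' \<in> borel_measurable borel" and gg': "AE x in ?M. g x = g' x"
    and g'0: "\<And>x. x \<notin> ?S \<Longrightarrow> g' x = 0"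
    using borel_version_on[OF borel_measurable_integrable[OF g]] by (metis borel_open open_greaterThanLessThan)
  have g'M: "integrable ?M g'" using integrable_cong_AE_imp[OF g _ gg'] g'm borel_measurable_lebesgue_onI by blast
  have g'int: "integrable lborel g'"
  proof -
    have "(\<lambda>x. indicator ?S x * g' x) = g'" using g'0 by (auto simp: indicator_def fun_eq_iff)
    then show ?thesis using g'M integrable_lebesgue_on_borel[OF g'm, of ?S] by simp
  qed
  define G where "G = (\<lambda>x. LINT y|lborel. g' y * indicator {..<x} y)"
  have Gc: "continuous_on UNIV G" unfolding G_def by (rule primitive_continuous[OF g'int])
  have Gm: "G \<in> borel_measurable borel" by (rule borel_measurable_continuous_onI[OF Gc])
  have G0: "G 0 = 0" unfolding G_def
  proof (rule integral_eq_zero_AE, rule AE_I2)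
    show "g' y * indicator {..<0} y = 0" for y using g'0[of y] by (auto simp: indicator_def)
  qed
  obtain KG where KG: "\<And>x. x \<in> {0..l} \<Longrightarrow> \<bar>G x\<bar> \<le> KG"
    using compact_imp_bounded[OF compact_continuous_image[OF continuous_on_subset[OF Gc subset_UNIV] compact_Icc[of 0 l]]]
    unfolding bounded_iff real_norm_def by blast
  have one: "integrable ?M (\<lambda>x. 1::real)" by (rule integrable_one_Ioo)
  have bnd: "integrable ?M h" if "h \<in> borel_measurable borel" "\<And>x. x \<in> ?S \<Longrightarrow> \<bar>h x\<bar> \<le> K" for h and K :: real
  proof -
    have "AE x in ?M. \<bar>h x\<bar> \<le> K" using that(2) by (auto intro: AE_I2)
    from integrable_mult_bounded_AE[OF one borel_measurable_lebesgue_onI[OF that(1)] this] show ?thesis by simp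
  qed
  have GM: "integrable ?M G" by (rule bnd[OF Gm, of KG]) (use KG in auto)
  have C1int: "integrable ?M (\<lambda>x. h x * \<phi> x)" "integrable ?M (\<lambda>x. h x * \<phi>' x)" if C: "C1_fun \<phi> \<phi>'" and h: "integrable ?M h" for h \<phi> \<phi>'
  proof -
    obtain K where K: "\<And>x. x \<in> {0..l} \<Longrightarrow> \<bar>\<phi> x\<bar> \<le> K \<and> \<bar>\<phi>' x\<bar> \<le> K"
      using C1_fun_bounded_on[OF C] by blast
    show "integrable ?M (\<lambda>x. h x * \<phi> x)" "integrable ?M (\<lambda>x. h x * \<phi>' x)"
      by (rule integrable_mult_bounded_AE[OF h, where K=K];
          use K in \<open>auto intro!: AE_I2 borel_measurable_lebesgue_onI C1_fun_measurable[OF C]\<close>)+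
  qed
  have gcong: "(LINT x|?M. g x * \<phi> x) = (LINT y|lborel. g' y * \<phi> y)" if "C1_fun \<phi> \<phi>'" for \<phi> \<phi>'
  proof -
    have "(LINT x|?M. g x * \<phi> x) = (LINT x|?M. g' x * \<phi> x)"
    proof (rule integral_cong_AE)
      show "AE x in ?M. g x * \<phi> x = g' x * \<phi> x" using gg' by eventually_elim simp
    qed (use C1int(1)[OF that] g g'M in auto)
    also have "\<dots> = (LINT y|lborel. indicator ?S y * (g' y * \<phi> y))"
      by (rule integral_lebesgue_on_borel) (use g'm C1_fun_measurable[OF that] in auto)
    also have "\<dots> = (LINT y|lborel. g' y * \<phi> y)"
      by (rule Bochner_Integration.integral_cong) (use g'0 in \<open>auto simp: indicator_def\<close>)
    finally show ?thesis .
  qed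
  have Gibp: "(LINT x|?M. G x * \<phi>' x) = G l * \<phi> l - (LINT x|?M. g x * \<phi> x)" if C: "C1_fun \<phi> \<phi>'" for \<phi> \<phi>'
  proof -
    have "(LINT x|?M. G x * \<phi>' x) = (LINT x|lborel. indicator ?S x * (G x * \<phi>' x))"
      by (rule integral_lebesgue_on_borel) (use Gm C1_fun_measurable[OF C] in auto)
    also have "\<dots> = G l * \<phi> l - (LINT y|lborel. g' y * \<phi> y)"
      unfolding G_def by (rule primitive_by_parts[OF g'int g'0 C l])
    finally show ?thesis using gcong[OF C] by simp
  qed
  define e where "e = (\<lambda>x. f x - G x)"
  have e: "integrable ?M e" unfolding e_def using f GM by auto
  have e0: "(LINT x|?M. e x * \<phi>' x) = 0" if t: "test_fun l \<phi> \<phi>'" for \<phi> \<phi>'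
  proof -
    have C: "C1_fun \<phi> \<phi>'" and \<phi>l: "\<phi> l = 0" using t unfolding test_fun_def by auto
    have "(LINT x|?M. f x * \<phi>' x) = - (LINT x|?M. g x * \<phi> x)"
      using wd t unfolding has_weak_derivative_def test_fun_def C1_fun_def by blast
    moreover have "(LINT x|?M. e x * \<phi>' x) = (LINT x|?M. f x * \<phi>' x) - (LINT x|?M. G x * \<phi>' x)"
      unfolding e_def left_diff_distrib by (rule Bochner_Integration.integral_diff) (use C1int(2)[OF C] f GM in auto)
    ultimately show ?thesis using Gibp[OF C] \<phi>l by simp
  qed
  \<comment> \<open>If all test functions had mean zero, the du Bois-Reymond lemma would make the
    constant \<open>1\<close> vanish almost everywhere.\<close>
  obtain \<psi>0 \<psi>0' where t0: "test_fun l \<psi>0 \<psi>0'" and nz: "(LINT x|?M. \<psi>0 x) \<noteq> 0"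
  proof (rule ccontr)
    assume "\<not> thesis"
    then have "\<And>\<psi> \<psi>'. test_fun l \<psi> \<psi>' \<Longrightarrow> (LINT x|?M. 1 * \<psi> x) = 0" using that by auto
    from du_Bois_Reymond_zero[OF one this] have "AE x in ?M. False" by auto
    then have "emeasure ?M (space ?M) = 0" by (simp only: eventually_False ae_filter_eq_bot_iff)
    then show False using l by (simp add: emeasure_restrict_space)
  qed
  have C0: "C1_fun \<psi>0 \<psi>0'" using t0 by (simp add: test_fun_def)
  define c0 where "c0 = (LINT x|?M. e x * \<psi>0 x) / (LINT x|?M. \<psi>0 x)"
  have "AE x in ?M. e x - c0 = 0"
  proof (rule du_Bois_Reymond_zero)
    show "integrable ?M (\<lambda>x. e x - c0)"
      using Bochner_Integration.integrable_diff[OF e integrable_mult_right[OF one, of c0]] by simp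
    fix \<psi> \<psi>' assume t: "test_fun l \<psi> \<psi>'"
    then have C: "C1_fun \<psi> \<psi>'" by (simp add: test_fun_def)
    define k where "k = (LINT x|?M. \<psi> x) / (LINT x|?M. \<psi>0 x)"
    \<comment> \<open>Subtracting the multiple of \<open>\<psi>0\<close> with the same mean leaves a
      test function of mean zero, which is the derivative of a test function and is therefore
      annihilated by \<open>e\<close>.\<close>
    define \<eta> where "\<eta> = (\<lambda>x. \<psi> x - k * \<psi>0 x)"
    have i1: "integrable ?M \<psi>" "integrable ?M \<psi>0" using C1int(1)[OF C one] C1int(1)[OF C0 one] by auto
    have t\<eta>: "test_fun l \<eta> (\<lambda>x. \<psi>' x - k * \<psi>0' x)"
    proof -
      obtain c d where cd: "0 < c" "d < l" "\<And>x. x \<notin> {c..d} \<Longrightarrow> \<psi> x = 0" using t unfolding test_fun_def by blast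
      obtain c' d' where cd': "0 < c'" "d' < l" "\<And>x. x \<notin> {c'..d'} \<Longrightarrow> \<psi>0 x = 0" using t0 unfolding test_fun_def by blast
      have "C1_fun \<eta> (\<lambda>x. \<psi>' x - k * \<psi>0' x)"
        using C C0 unfolding C1_fun_def \<eta>_def by (auto intro!: derivative_eq_intros continuous_intros)
      moreover have "\<forall>x. x \<notin> {min c c'..max d d'} \<longrightarrow> \<eta> x = 0"
      proof (intro allI impI)
        fix x assume "x \<notin> {min c c'..max d d'}"
        then have "x \<notin> {c..d}" "x \<notin> {c'..d'}" by auto
        then show "\<eta> x = 0" unfolding \<eta>_def using cd(3)[of x] cd'(3)[of x] by simp
      qed
      ultimately show ?thesis unfolding test_fun_def using cd cd'
        by (intro conjI exI[of _ "min c c'"] exI[of _ "max d d'"]) auto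
    qed
    have \<eta>z: "(LINT x|?M. \<eta> x) = 0" unfolding \<eta>_def using i1 nz by (simp add: k_def)
    have \<eta>m: "\<eta> \<in> borel_measurable borel" using t\<eta> C1_fun_measurable unfolding test_fun_def by blast
    have "(LINT x|lborel. indicator ?S x * \<eta> x) = 0"
      using \<eta>z integral_lebesgue_on_borel[OF \<eta>m, of ?S] by simp
    from mean_zero_antiderivative[OF t\<eta> this l] obtain \<phi> where "test_fun l \<phi> \<eta>" by blast
    from e0[OF this] have "(LINT x|?M. e x * \<eta> x) = 0" .
    moreover have "(LINT x|?M. e x * \<eta> x) = (LINT x|?M. e x * \<psi> x) - k * (LINT x|?M. e x * \<psi>0 x)"
    proof -
      have "(LINT x|?M. e x * \<eta> x) = (LINT x|?M. e x * \<psi> x - k * (e x * \<psi>0 x))"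
        unfolding \<eta>_def by (simp add: algebra_simps)
      then show ?thesis using C1int(1)[OF C e] C1int(1)[OF C0 e] by simp
    qed
    moreover have "k * (LINT x|?M. e x * \<psi>0 x) = c0 * (LINT x|?M. \<psi> x)" by (simp add: k_def c0_def)
    moreover have "(LINT x|?M. (e x - c0) * \<psi> x) = (LINT x|?M. e x * \<psi> x) - c0 * (LINT x|?M. \<psi> x)"
      unfolding left_diff_distrib using C1int(1)[OF C e] i1 by simp
    ultimately show "(LINT x|?M. (e x - c0) * \<psi> x) = 0" by simp
  qed
  then have fw: "AE x in ?M. f x = c0 + G x" by eventually_elim (simp add: e_def)
  show ?thesis
  proof (intro exI[of _ "\<lambda>x. c0 + G x"] conjI fw allI impI)
    show "continuous_on {0..l} (\<lambda>x. c0 + G x)" by (intro continuous_intros continuous_on_subset[OF Gc]) auto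
    fix \<phi> \<phi>' assume C: "C1_fun \<phi> \<phi>'"
    have "(LINT x|?M. f x * \<phi>' x) = (LINT x|?M. c0 * \<phi>' x + G x * \<phi>' x)"
    proof (rule integral_cong_AE)
      show "AE x in ?M. f x * \<phi>' x = c0 * \<phi>' x + G x * \<phi>' x" using fw by eventually_elim (simp add: algebra_simps)
    qed (use C1int(2)[OF C f] C1int(2)[OF C GM] C1int(2)[OF C one] in auto)
    also have "\<dots> = c0 * (LINT x|?M. \<phi>' x) + (LINT x|?M. G x * \<phi>' x)"
      using C1int(2)[OF C GM] C1int(2)[OF C one] by simp
    also have "(LINT x|?M. \<phi>' x) = \<phi> l - \<phi> 0"
    proof -
      have "(LINT x|lborel. \<phi>' x * indicator {0..l} x) = \<phi> l - \<phi> 0"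
        by (rule integral_FTC_Icc_real) (use C l in \<open>auto simp: C1_fun_def continuous_on_eq_continuous_at\<close>)
      moreover have "(LINT x|lborel. \<phi>' x * indicator {0..l} x) = (LINT x|lborel. indicator ?S x * \<phi>' x)"
      proof (rule integral_cong_AE)
        show "AE x in lborel. \<phi>' x * indicator {0..l} x = indicator ?S x * \<phi>' x"
          using AE_lborel_singleton[of 0] AE_lborel_singleton[of l]
          by eventually_elim (auto simp: indicator_def)
      qed (use C1_fun_measurable[OF C] in auto)
      ultimately show ?thesis
        using integral_lebesgue_on_borel[OF C1_fun_measurable(2)[OF C], of ?S] by simp
    qed
    finally show "(LINT x|?M. g x * \<phi> x) = (c0 + G l) * \<phi> l - (c0 + G 0) * \<phi> 0 - (LINT x|?M. f x * \<phi>' x)"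
      using Gibp[OF C] G0 by (simp add: algebra_simps)
  qed
qed

text \<open>\<open>cont_rep\<close> is an arbitrary choice, but two continuous representatives agree
  on the closed interval, so the boundary terms do not depend on the choice.\<close>

lemma cont_rep_by_parts:
  fixes f g :: "real \<Rightarrow> real"
  assumes f: "integrable (lebesgue_on {0<..<l}) f" and g: "integrable (lebesgue_on {0<..<l}) g"
    and wd: "has_weak_derivative l f g" and l: "l > 0" and C: "C1_fun \<phi> \<phi>'"
  shows "(LINT x|lebesgue_on {0<..<l}. g x * \<phi> x) =
    cont_rep l f l * \<phi> l - cont_rep l f 0 * \<phi> 0 - (LINT x|lebesgue_on {0<..<l}. f x * \<phi>' x)"
proof -
  obtain w where w: "continuous_on {0..l} w" "AE x in lebesgue_on {0<..<l}. f x = w x"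
    and ibp: "(LINT x|lebesgue_on {0<..<l}. g x * \<phi> x) = w l * \<phi> l - w 0 * \<phi> 0 - (LINT x|lebesgue_on {0<..<l}. f x * \<phi>' x)"
    using weak_derivative_primitive[OF f g wd l] C by blast
  have r: "continuous_on {0..l} (cont_rep l f) \<and> (AE x in lebesgue_on {0<..<l}. f x = cont_rep l f x)"
    unfolding cont_rep_def by (rule someI[of _ w]) (use w in blast)
  then have ae: "AE x in lebesgue_on {0<..<l}. cont_rep l f x = w x" using w(2)
    by (auto elim: eventually_elim2)
  have "cont_rep l f x = w x" if "x \<in> {0..l}" for x
    by (rule continuous_AE_eq[OF _ w(1) l ae that]) (use r in auto)
  then show ?thesis using ibp l by simp
qed

lemma cont_rep_continuous:
  assumes w: "continuous_on {0..l} w" and l: "l > 0" and x: "x \<in> {0..l}"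
  shows "cont_rep l w x = w x"
proof -
  have r: "continuous_on {0..l} (cont_rep l w) \<and> (AE x in lebesgue_on {0<..<l}. w x = cont_rep l w x)"
    unfolding cont_rep_def by (rule someI[of _ w]) (use w in auto)
  then have ae: "AE x in lebesgue_on {0<..<l}. cont_rep l w x = w x" by (auto elim: eventually_mono)
  show ?thesis by (rule continuous_AE_eq[OF _ w l ae x]) (use r in auto)
qed

lemma C1_fun_has_weak_derivative:
  assumes C: "C1_fun w w'" and l: "l > 0"
  shows "has_weak_derivative l w w'"
  unfolding has_weak_derivative_def
proof (intro allI impI)
  fix \<phi> \<phi>' :: "real \<Rightarrow> real"
  assume d: "\<forall>x. (\<phi> has_real_derivative \<phi>' x) (at x)" and c: "continuous_on UNIV \<phi>'"
    and s: "\<exists>c d. 0 < c \<and> d < l \<and> (\<forall>x. x \<notin> {c..d} \<longrightarrow> \<phi> x = 0)"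
  have C': "C1_fun \<phi> \<phi>'" using d c by (simp add: C1_fun_def)
  let ?p = "\<lambda>x. w x * \<phi>' x + w' x * \<phi> x"
  note m = C1_fun_measurable[OF C] C1_fun_measurable[OF C']
  have z: "\<phi> 0 = 0" "\<phi> l = 0" using s by force+
  have cts: "continuous_on UNIV (\<lambda>x. w x * \<phi>' x)" "continuous_on UNIV (\<lambda>x. w' x * \<phi> x)"
    using C1_fun_continuous[OF C] C1_fun_continuous[OF C'] C c
    by (auto intro!: continuous_intros simp: C1_fun_def)
  have int: "integrable (lebesgue_on {0<..<l}) h" if h: "continuous_on UNIV h" for h :: "real \<Rightarrow> real"
  proof -
    obtain K where K: "\<And>x. x \<in> {0..l} \<Longrightarrow> norm (h x) \<le> K"
      using compact_imp_bounded[OF compact_continuous_image[OF continuous_on_subset[OF h subset_UNIV] compact_Icc[of 0 l]]]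
      unfolding bounded_iff by blast
    have "integrable (lebesgue_on {0<..<l}) (\<lambda>x. 1 * h x)"
      by (rule integrable_mult_bounded_AE[where K=K])
        (use K in \<open>auto intro!: AE_I2 integrable_one_Ioo borel_measurable_lebesgue_onI borel_measurable_continuous_onI h\<close>)
    then show ?thesis by simp
  qed
  have "(LINT x|lebesgue_on {0<..<l}. w x * \<phi>' x) + (LINT x|lebesgue_on {0<..<l}. w' x * \<phi> x) = (LINT x|lebesgue_on {0<..<l}. ?p x)"
    by (rule Bochner_Integration.integral_add[symmetric]) (intro int cts)+
  also have "\<dots> = (LINT x|lborel. indicator {0<..<l} x * ?p x)"
    by (rule integral_lebesgue_on_borel) (use m in auto)
  also have "\<dots> = (LINT x|lborel. ?p x * indicator {0..l} x)"
  proof (rule integral_cong_AE)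
    show "AE x in lborel. indicator {0<..<l} x * ?p x = ?p x * indicator {0..l} x"
      using AE_lborel_singleton[of 0] AE_lborel_singleton[of l]
      by eventually_elim (auto simp: indicator_def)
  qed (use m in auto)
  also have "\<dots> = w l * \<phi> l - w 0 * \<phi> 0"
  proof (rule integral_FTC_Icc_real)
    show "((\<lambda>x. w x * \<phi> x) has_real_derivative ?p x) (at x)" for x
      using C C' unfolding C1_fun_def by (auto intro!: derivative_eq_intros)
    show "isCont ?p x" for x
      using continuous_on_add[OF cts] by (simp add: continuous_on_eq_continuous_at)
  qed (use l in auto)
  finally show "(LINT x|lebesgue_on {0<..<l}. w x * \<phi>' x) = - (LINT x|lebesgue_on {0<..<l}. w' x * \<phi> x)"
    using z by simp
qed

section \<open>Semigroups on quasi-normed spaces\<close>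

text \<open>A vector space of representatives with a quasi-seminorm; the quasi-triangle inequality is
  all that is needed, which spares Minkowski's inequality for \<open>X_norm\<close>.\<close>

locale quasi_normed =
  fixes X :: "'v::real_vector set" and nrm :: "'v \<Rightarrow> real" and Q :: real
  assumes Xadd: "u \<in> X \<Longrightarrow> v \<in> X \<Longrightarrow> u + v \<in> X"
    and Xscale: "u \<in> X \<Longrightarrow> c *\<^sub>R u \<in> X"
    and Xzero: "0 \<in> X"
    and Q: "Q \<ge> 1"
    and nrm_nonneg: "nrm u \<ge> 0"
    and nrm_add: "u \<in> X \<Longrightarrow> v \<in> X \<Longrightarrow> nrm (u + v) \<le> Q * (nrm u + nrm v)"
    and nrm_scale: "u \<in> X \<Longrightarrow> nrm (c *\<^sub>R u) = \<bar>c\<bar> * nrm u"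
begin

lemma Xminus: "u \<in> X \<Longrightarrow> - u \<in> X" using Xscale[of u "-1"] by simp

lemma Xdiff: "u \<in> X \<Longrightarrow> v \<in> X \<Longrightarrow> u - v \<in> X"
  using Xadd[of u "-v"] Xminus by simp

lemma nrm_minus: "u \<in> X \<Longrightarrow> nrm (- u) = nrm u" using nrm_scale[of u "-1"] by simp

lemma nrm_zero: "nrm 0 = 0" using nrm_scale[OF Xzero, of 0] by simp

lemma nrm_diff_commute: "u \<in> X \<Longrightarrow> v \<in> X \<Longrightarrow> nrm (u - v) = nrm (v - u)"
  using nrm_minus[of "v - u"] Xdiff by simp

lemma nrm_diff_triangle:
  assumes "u \<in> X" "v \<in> X" "w \<in> X"
  shows "nrm (u - w) \<le> Q * (nrm (u - v) + nrm (v - w))"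
  using nrm_add[of "u - v" "v - w"] assms Xdiff by simp

lemma nrm_diff_null:
  assumes "u \<in> X" "v \<in> X" "w \<in> X" "nrm (u - v) = 0"
  shows "nrm (u - w) \<le> Q * nrm (v - w)" 
  using nrm_diff_triangle[OF assms(1-3)] assms(4) by simp

lemma Xsum: "finite I \<Longrightarrow> (\<And>i. i \<in> I \<Longrightarrow> f i \<in> X) \<Longrightarrow> sum f I \<in> X"
  by (induction I rule: finite_induct) (auto intro: Xzero Xadd)

end

section \<open>Strongly continuous semigroups whose laws hold up to null elements\<close>

definition linear_functional_in :: "'v::real_vector set \<Rightarrow> ('v \<Rightarrow> real) \<Rightarrow> ('v \<Rightarrow> real) \<Rightarrow> bool" where
  "linear_functional_in X nrm \<Lambda> \<longleftrightarrow>
     (\<forall>u\<in>X. \<forall>v\<in>X. \<Lambda> (u + v) = \<Lambda> u + \<Lambda> v) \<and> (\<forall>c. \<forall>u\<in>X. \<Lambda> (c *\<^sub>R u) = c * \<Lambda> u) \<and>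
     (\<exists>K. \<forall>u\<in>X. \<bar>\<Lambda> u\<bar> \<le> K * nrm u)"

locale semigroup_in = quasi_normed X nrm Q
  for X :: "'v::real_vector set" and nrm :: "'v \<Rightarrow> real" and Q :: real +
  fixes S :: "real \<Rightarrow> 'v \<Rightarrow> 'v"
  assumes semigroup: "strongly_continuous_semigroup X nrm S"
begin

text \<open>Equality of the represented elements. Linearity and the semigroup law hold only in this
  sense, so computations are chains of \<open>eqv\<close> rather than of equalities.\<close>

definition eqv :: "'v \<Rightarrow> 'v \<Rightarrow> bool" where "eqv u v \<longleftrightarrow> u \<in> X \<and> v \<in> X \<and> nrm (u - v) = 0"

lemma eqvI: "u \<in> X \<Longrightarrow> v \<in> X \<Longrightarrow> nrm (u - v) \<le> 0 \<Longrightarrow> eqv u v"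
  using nrm_nonneg[of "u - v"] by (simp add: eqv_def)

lemma eqv_sym: "eqv u v \<Longrightarrow> eqv v u"
  by (auto simp: eqv_def nrm_diff_commute)

lemma eqv_trans: "eqv u v \<Longrightarrow> eqv v w \<Longrightarrow> eqv u w"
  using nrm_diff_triangle[of u v w] by (intro eqvI) (auto simp: eqv_def)

lemma eqv_diff: assumes "eqv u v" "eqv u' v'" shows "eqv (u - u') (v - v')"
proof (rule eqvI)
  have e: "(u - u') - (v - v') = (u - v) + - (u' - v')" by simp
  show "nrm (u - u' - (v - v')) \<le> 0"
    unfolding e using nrm_add[of "u - v" "- (u' - v')"] assms nrm_minus[of "u' - v'"] Xdiff Xminus
    by (auto simp: eqv_def)
qed (use assms Xdiff in \<open>auto simp: eqv_def\<close>)

lemma eqv_scale: assumes "eqv u v" shows "eqv (c *\<^sub>R u) (c *\<^sub>R v)"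
  using assms nrm_scale[of "u - v" c] Xscale Xdiff by (auto simp: eqv_def scaleR_diff_right)

lemma eqv_bound: assumes "eqv u v" "w \<in> X" shows "nrm (u - w) \<le> Q * nrm (v - w)"
  using nrm_diff_null[of u v w] assms by (auto simp: eqv_def)

lemma S_bl: "t \<ge> 0 \<Longrightarrow> bounded_linear_in X nrm (S t)"
  using semigroup unfolding strongly_continuous_semigroup_def by blast

lemma S_in: "t \<ge> 0 \<Longrightarrow> u \<in> X \<Longrightarrow> S t u \<in> X"
  using S_bl unfolding bounded_linear_in_def by blast

lemma S_diff_eqv:
  assumes t: "t \<ge> 0" and u: "u \<in> X" and v: "v \<in> X"
  shows "eqv (S t u - S t v) (S t (u - v))"
proof -
  have "nrm (S t ((u - v) + v) - (S t (u - v) + S t v)) = 0"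
    using S_bl[OF t] v Xdiff[OF u v] unfolding bounded_linear_in_def by blast
  then have "nrm (S t u - (S t (u - v) + S t v)) = 0" by (simp only: diff_add_cancel)
  moreover have "S t u - (S t (u - v) + S t v) = (S t u - S t v) - S t (u - v)" by simp
  ultimately show ?thesis unfolding eqv_def using S_in[OF t] u v Xdiff by metis
qed

lemma S_scale_eqv:
  assumes t: "t \<ge> 0" and u: "u \<in> X"
  shows "eqv (S t (c *\<^sub>R u)) (c *\<^sub>R S t u)"
  using S_bl[OF t] u S_in[OF t] Xscale unfolding bounded_linear_in_def eqv_def by blast

lemma S_semi_eqv:
  assumes "s \<ge> 0" "t \<ge> 0" "u \<in> X"
  shows "eqv (S (s + t) u) (S s (S t u))"
proof -
  have "nrm (S (s + t) u - S s (S t u)) = 0"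
    using semigroup assms unfolding strongly_continuous_semigroup_def by blast
  then show ?thesis using S_in assms by (simp add: eqv_def)
qed

lemma S_zero_eqv: "u \<in> X \<Longrightarrow> eqv (S 0 u) u"
proof -
  assume u: "u \<in> X"
  have "nrm (S 0 u - u) = 0" using semigroup u unfolding strongly_continuous_semigroup_def by blast
  then show ?thesis using S_in u by (simp add: eqv_def)
qed

lemma S_lipschitz:
  assumes t: "t \<ge> 0"
  shows "\<exists>K\<ge>0. \<forall>u\<in>X. \<forall>v\<in>X. nrm (S t u - S t v) \<le> K * nrm (u - v)"
proof -
  obtain K where K: "\<And>u. u \<in> X \<Longrightarrow> nrm (S t u) \<le> K * nrm u"
    using S_bl[OF t] unfolding bounded_linear_in_def by blast
  have "nrm (S t u - S t v) \<le> (Q * \<bar>K\<bar>) * nrm (u - v)" if u: "u \<in> X" and v: "v \<in> X" for u v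
  proof -
    have "nrm (S t u - S t v) \<le> Q * nrm (S t (u - v))"
      using eqv_bound[OF S_diff_eqv[OF t u v] Xzero] by simp
    also have "nrm (S t (u - v)) \<le> K * nrm (u - v)" by (rule K[OF Xdiff[OF u v]])
    also have "\<dots> \<le> \<bar>K\<bar> * nrm (u - v)" by (rule mult_right_mono) (use nrm_nonneg in auto)
    finally show ?thesis using Q by (simp add: mult.assoc)
  qed
  then show ?thesis using Q by (intro exI[of _ "Q * \<bar>K\<bar>"]) auto
qed

lemma S_right_continuous:
  assumes s: "s \<ge> 0" and u: "u \<in> X"
  shows "((\<lambda>h. nrm (S (s + h) u - S s u)) \<longlongrightarrow> 0) (at_right 0)"
proof -
  obtain K where K: "K \<ge> 0" "\<And>u v. u \<in> X \<Longrightarrow> v \<in> X \<Longrightarrow> nrm (S s u - S s v) \<le> K * nrm (u - v)"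
    using S_lipschitz[OF s] by blast
  have 0: "((\<lambda>h. nrm (S h u - u)) \<longlongrightarrow> 0) (at_right 0)"
    using semigroup u unfolding strongly_continuous_semigroup_def by blast
  have lim: "((\<lambda>h. Q * (K * nrm (S h u - u))) \<longlongrightarrow> 0) (at_right 0)"
    using tendsto_mult_left[OF tendsto_mult_left[OF 0, of K], of Q] by simp
  show ?thesis
  proof (rule Lim_null_comparison[OF _ lim])
    have "eventually (\<lambda>h::real. h > 0) (at_right 0)" by (simp add: eventually_at_right_less)
    then show "\<forall>\<^sub>F h in at_right 0. norm (nrm (S (s + h) u - S s u)) \<le> Q * (K * nrm (S h u - u))"
    proof eventually_elim
      case (elim h)
      have "nrm (S (s + h) u - S s u) \<le> Q * nrm (S s (S h u) - S s u)"
        by (rule eqv_bound[OF S_semi_eqv]) (use s u elim S_in in auto)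
      also have "\<dots> \<le> Q * (K * nrm (S h u - u))"
        by (rule mult_left_mono[OF K(2)]) (use S_in u elim Q in auto)
      finally show ?case using nrm_nonneg by simp
    qed
  qed
qed

text \<open>Right continuity leaves only countably many left discontinuities, and by the semigroup
  law left continuity at \<open>s0\<close> propagates to all \<open>s \<ge> s0\<close>; no uniform boundedness principle is needed.\<close>

lemma S_left_continuous:
  assumes s: "s > 0" and u: "u \<in> X"
  shows "((\<lambda>h. nrm (S (s - h) u - S s u)) \<longlongrightarrow> 0) (at_right 0)"
proof -
  \<comment> \<open>The times at which the left oscillation of the orbit does not fall below
    \<open>\<epsilon>\<close>.\<close>
  define Bad where "Bad = (\<lambda>\<epsilon>. {\<sigma>. \<sigma> > 0 \<and> \<not> (\<exists>\<delta>>0. \<forall>h\<in>{0<..<\<delta>}. nrm (S (\<sigma> - h) u - S \<sigma> u) < \<epsilon>)})"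
  have cB: "countable (Bad \<epsilon>)" if e: "\<epsilon> > 0" for \<epsilon>
  proof -
    have "\<exists>\<delta>>0. \<forall>h\<in>{0<..<\<delta>}. nrm (S (\<sigma> + h) u - S \<sigma> u) < \<epsilon> / (2 * Q)" if "\<sigma> \<in> Bad \<epsilon>" for \<sigma>
    proof -
      have "\<sigma> \<ge> 0" using that by (simp add: Bad_def)
      from order_tendstoD(2)[OF S_right_continuous[OF this u], of "\<epsilon> / (2 * Q)"]
      have "eventually (\<lambda>h. nrm (S (\<sigma> + h) u - S \<sigma> u) < \<epsilon> / (2 * Q)) (at_right 0)" using e Q by simp
      then show ?thesis unfolding eventually_at_right_field by auto
    qed
    then obtain \<delta> where \<delta>0: "\<And>\<sigma>. \<sigma> \<in> Bad \<epsilon> \<Longrightarrow> \<delta> \<sigma> > 0"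
      and \<delta>: "\<And>\<sigma> h. \<sigma> \<in> Bad \<epsilon> \<Longrightarrow> h \<in> {0<..<\<delta> \<sigma>} \<Longrightarrow> nrm (S (\<sigma> + h) u - S \<sigma> u) < \<epsilon> / (2 * Q)" by metis
    \<comment> \<open>For a while after a bad time \<open>\<sigma>\<close> the orbit stays within
      \<open>\<epsilon> / (2 * Q)\<close> of its value at \<open>\<sigma>\<close>, which excludes
      further bad times there. So the intervals of length \<open>\<delta> \<sigma>\<close> to the
      right of the bad times are disjoint, and each contains a rational number.\<close>
    have iso: "\<sigma>' \<notin> Bad \<epsilon>" if \<sigma>: "\<sigma> \<in> Bad \<epsilon>" and \<sigma>': "\<sigma> < \<sigma>'" "\<sigma>' < \<sigma> + \<delta> \<sigma>" for \<sigma> \<sigma>'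
    proof -
      have s0: "\<sigma> > 0" using \<sigma> by (simp add: Bad_def)
      have "nrm (S (\<sigma>' - h) u - S \<sigma>' u) < \<epsilon>" if h: "h \<in> {0<..<\<sigma>' - \<sigma>}" for h
      proof -
        have a: "nrm (S (\<sigma>' - h) u - S \<sigma> u) < \<epsilon> / (2 * Q)"
          using \<delta>[OF \<sigma>, of "\<sigma>' - h - \<sigma>"] h \<sigma>' by simp
        have b: "nrm (S \<sigma> u - S \<sigma>' u) < \<epsilon> / (2 * Q)"
          using \<delta>[OF \<sigma>, of "\<sigma>' - \<sigma>"] \<sigma>' s0 nrm_diff_commute[of "S \<sigma> u" "S \<sigma>' u"] S_in u by simp
        have "nrm (S (\<sigma>' - h) u - S \<sigma>' u) \<le> Q * (nrm (S (\<sigma>' - h) u - S \<sigma> u) + nrm (S \<sigma> u - S \<sigma>' u))"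
          by (rule nrm_diff_triangle) (use S_in u h \<sigma>' s0 in auto)
        also have "\<dots> < Q * (\<epsilon> / (2 * Q) + \<epsilon> / (2 * Q))"
          using a b Q by (intro mult_strict_left_mono) auto
        also have "\<dots> = \<epsilon>" using Q by (simp add: field_simps)
        finally show ?thesis .
      qed
      then show ?thesis using \<sigma>' unfolding Bad_def by (auto intro!: exI[of _ "\<sigma>' - \<sigma>"])
    qed
    have "\<exists>q\<in>\<rat>. \<sigma> < q \<and> q < \<sigma> + \<delta> \<sigma>" if "\<sigma> \<in> Bad \<epsilon>" for \<sigma>
      using Rats_dense_in_real[of \<sigma> "\<sigma> + \<delta> \<sigma>"] \<delta>0[OF that] by auto
    then obtain q where q: "\<And>\<sigma>. \<sigma> \<in> Bad \<epsilon> \<Longrightarrow> q \<sigma> \<in> \<rat> \<and> \<sigma> < q \<sigma> \<and> q \<sigma> < \<sigma> + \<delta> \<sigma>" by metis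
    have lt: False if "\<sigma> \<in> Bad \<epsilon>" "\<sigma>' \<in> Bad \<epsilon>" "q \<sigma> = q \<sigma>'" "\<sigma> < \<sigma>'" for \<sigma> \<sigma>'
      using iso[OF that(1,4)] q[OF that(1)] q[OF that(2)] that by auto
    have "inj_on q (Bad \<epsilon>)"
      by (rule inj_onI) (metis lt linorder_neqE_linordered_idom)
    moreover have "countable (q ` Bad \<epsilon>)"
      by (rule countable_subset[OF _ countable_rat]) (use q in auto)
    ultimately show ?thesis by (rule countable_image_inj_on[rotated])
  qed
  have "countable (\<Union>n. Bad (inverse (real (Suc n))))" by (intro countable_UN cB) auto
  then have "\<not> {0<..<s} \<subseteq> (\<Union>n. Bad (inverse (real (Suc n))))"
    using uncountable_open_interval[of 0 s] s countable_subset by blast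
  \<comment> \<open>A time before \<open>s\<close> that is bad for no \<open>inverse (Suc n)\<close>
    is a point of left continuity, and the Lipschitz operator \<open>S (s - s0)\<close> carries left
    continuity from \<open>s0\<close> to \<open>s\<close>.\<close>
  then obtain s0 where s0: "0 < s0" "s0 < s" and nb: "\<And>n. s0 \<notin> Bad (inverse (real (Suc n)))"
    unfolding subset_iff UN_iff greaterThanLessThan_iff by blast
  have left0: "((\<lambda>h. nrm (S (s0 - h) u - S s0 u)) \<longlongrightarrow> 0) (at_right 0)"
  proof (rule tendstoI)
    fix e :: real assume "e > 0"
    then obtain n where n: "inverse (real (Suc n)) < e" using reals_Archimedean by blast
    obtain \<delta> where "\<delta> > 0" "\<forall>h\<in>{0<..<\<delta>}. nrm (S (s0 - h) u - S s0 u) < inverse (real (Suc n))"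
      using nb[of n] s0 by (auto simp: Bad_def)
    then show "\<forall>\<^sub>F h in at_right 0. dist (nrm (S (s0 - h) u - S s0 u)) 0 < e"
      unfolding eventually_at_right_field using n nrm_nonneg
      by (intro exI[of _ \<delta>]) (auto simp: dist_real_def intro: less_trans)
  qed
  have ss: "s - s0 \<ge> 0" using s0 by simp
  obtain K where K: "K \<ge> 0" "\<And>u v. u \<in> X \<Longrightarrow> v \<in> X \<Longrightarrow> nrm (S (s - s0) u - S (s - s0) v) \<le> K * nrm (u - v)"
    using S_lipschitz[OF ss] by blast
  have lim: "((\<lambda>h. Q * (Q * (K * nrm (S (s0 - h) u - S s0 u)))) \<longlongrightarrow> 0) (at_right 0)"
    using tendsto_mult_left[OF tendsto_mult_left[OF tendsto_mult_left[OF left0, of K], of Q], of Q] by simp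
  show ?thesis
  proof (rule Lim_null_comparison[OF _ lim])
    have "eventually (\<lambda>h::real. h \<in> {0<..<s0}) (at_right 0)" by (rule eventually_at_right_real[OF s0(1)])
    then show "\<forall>\<^sub>F h in at_right 0. norm (nrm (S (s - h) u - S s u)) \<le> Q * (Q * (K * nrm (S (s0 - h) u - S s0 u)))"
    proof eventually_elim
      case (elim h)
      have x: "S (s0 - h) u \<in> X" "S s0 u \<in> X" "S s u \<in> X" using S_in u s0 elim by auto
      have e1: "eqv (S (s - h) u) (S (s - s0) (S (s0 - h) u))"
        using S_semi_eqv[OF ss, of "s0 - h" u] elim u by simp
      have e2: "eqv (S s u) (S (s - s0) (S s0 u))"
        using S_semi_eqv[OF ss, of "s0" u] s0 u by simp
      have "nrm (S (s - h) u - S s u) \<le> Q * nrm (S (s - s0) (S (s0 - h) u) - S s u)"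
        by (rule eqv_bound[OF e1 x(3)])
      also have "nrm (S (s - s0) (S (s0 - h) u) - S s u) = nrm (S s u - S (s - s0) (S (s0 - h) u))"
        by (rule nrm_diff_commute) (use x S_in ss in auto)
      also have "\<dots> \<le> Q * nrm (S (s - s0) (S s0 u) - S (s - s0) (S (s0 - h) u))"
        by (rule eqv_bound[OF e2]) (use x S_in ss in auto)
      also have "\<dots> \<le> Q * (K * nrm (S s0 u - S (s0 - h) u))"
        by (rule mult_left_mono[OF K(2)]) (use x Q in auto)
      also have "nrm (S s0 u - S (s0 - h) u) = nrm (S (s0 - h) u - S s0 u)" by (rule nrm_diff_commute) (use x in auto)
      finally show ?case using nrm_nonneg Q by simp
    qed
  qed
qed

lemma S_continuous:
  assumes s: "s \<ge> 0" and u: "u \<in> X"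
  shows "((\<lambda>s'. nrm (S s' u - S s u)) \<longlongrightarrow> 0) (at s within {0..})"
proof -
  have r: "((\<lambda>s'. nrm (S s' u - S s u)) \<longlongrightarrow> 0) (at_right s)"
    using S_right_continuous[OF s u] by (subst filterlim_at_right_to_0) (simp add: add.commute)
  show ?thesis
  proof (cases "s = 0")
    case True
    then show ?thesis using r by (simp add: at_within_Ici_at_right)
  next
    case False
    then have s': "s > 0" using s by simp
    have "((\<lambda>x. nrm (S (- x) u - S s u)) \<longlongrightarrow> 0) (at_right (- s))"
      using S_left_continuous[OF s' u] by (subst filterlim_at_right_to_0) simp
    then have "((\<lambda>s'. nrm (S s' u - S s u)) \<longlongrightarrow> 0) (at_left s)"
      by (subst filterlim_at_left_to_right) simp
    then have "((\<lambda>s'. nrm (S s' u - S s u)) \<longlongrightarrow> 0) (at s)"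
      using r by (simp add: filterlim_at_split)
    then show ?thesis by (rule tendsto_within_subset) simp
  qed
qed

text \<open>\<open>S s\<close> maps the difference quotients of \<open>u\<close> at \<open>0\<close>
  to elements that converge to \<open>S s (A u)\<close>. Up to null elements these are the right
  difference quotients of the orbit at \<open>s\<close> and also the quotients that define the
  generator at \<open>S s u\<close>; this gives all three claims at once.\<close>

lemma generator_invariant:
  assumes g: "generates_semigroup X nrm D A S" and u: "u \<in> X" "u \<in> D" and Au: "A u \<in> X" and s: "s \<ge> 0"
  shows "S s u \<in> D" "nrm (S s (A u) - A (S s u)) = 0"
    "((\<lambda>h. nrm ((1 / h) *\<^sub>R (S (s + h) u - S s u) - S s (A u))) \<longlongrightarrow> 0) (at_right 0)"
proof -
  have gen: "\<And>u v. u \<in> X \<Longrightarrow> v \<in> X \<Longrightarrow>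
        ((\<lambda>h. nrm ((1 / h) *\<^sub>R (S h u - u) - v)) \<longlongrightarrow> 0) (at_right 0) \<longleftrightarrow> u \<in> D \<and> nrm (v - A u) = 0"
    using g unfolding generates_semigroup_def by blast
  have lim0: "((\<lambda>h. nrm ((1 / h) *\<^sub>R (S h u - u) - A u)) \<longlongrightarrow> 0) (at_right 0)"
    using gen[OF u(1) Au] u(2) nrm_zero by simp
  obtain K where K: "K \<ge> 0" "\<And>u v. u \<in> X \<Longrightarrow> v \<in> X \<Longrightarrow> nrm (S s u - S s v) \<le> K * nrm (u - v)"
    using S_lipschitz[OF s] by blast
  have lim: "((\<lambda>h. Q * (K * nrm ((1 / h) *\<^sub>R (S h u - u) - A u))) \<longlongrightarrow> 0) (at_right 0)"
    using tendsto_mult_left[OF tendsto_mult_left[OF lim0, of K], of Q] by simp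
  have su: "S s u \<in> X" "S s (A u) \<in> X" using S_in s u Au by auto
  have main: "((\<lambda>h. nrm (y h - S s (A u))) \<longlongrightarrow> 0) (at_right 0)"
    if y: "\<And>h. h > 0 \<Longrightarrow> eqv (y h) (S s ((1 / h) *\<^sub>R (S h u - u)))" for y
  proof (rule Lim_null_comparison[OF _ lim])
    have "eventually (\<lambda>h::real. h > 0) (at_right 0)" by (simp add: eventually_at_right_less)
    then show "\<forall>\<^sub>F h in at_right 0. norm (nrm (y h - S s (A u))) \<le> Q * (K * nrm ((1 / h) *\<^sub>R (S h u - u) - A u))"
    proof eventually_elim
      case (elim h)
      have x: "(1 / h) *\<^sub>R (S h u - u) \<in> X" using S_in elim u by (intro Xscale Xdiff) auto
      have "nrm (y h - S s (A u)) \<le> Q * nrm (S s ((1 / h) *\<^sub>R (S h u - u)) - S s (A u))"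
        by (rule eqv_bound[OF y[OF elim] su(2)])
      also have "\<dots> \<le> Q * (K * nrm ((1 / h) *\<^sub>R (S h u - u) - A u))"
        by (rule mult_left_mono[OF K(2)[OF x Au]]) (use Q in auto)
      finally show ?case using nrm_nonneg by simp
    qed
  qed
  have quot: "eqv ((1 / h) *\<^sub>R (S s (S h u) - S s u)) (S s ((1 / h) *\<^sub>R (S h u - u)))" if h: "h > 0" for h
  proof -
    have hu: "S h u \<in> X" using S_in h u by auto
    have "eqv (S s (S h u) - S s u) (S s (S h u - u))" by (rule S_diff_eqv[OF s hu u(1)])
    then have "eqv ((1 / h) *\<^sub>R (S s (S h u) - S s u)) ((1 / h) *\<^sub>R S s (S h u - u))" by (rule eqv_scale)
    also note eqv_sym[OF S_scale_eqv[OF s Xdiff[OF hu u(1)], of "1 / h"]]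
    finally (eqv_trans) show ?thesis .
  qed
  have id: "eqv (S s u) (S s u)" using su nrm_zero by (simp add: eqv_def)
  have sh: "eqv (S (s + h) u) (S s (S h u))" if "h > 0" for h
    using S_semi_eqv[OF s, of h u] that u by simp
  have hs: "eqv (S h (S s u)) (S s (S h u))" if "h > 0" for h
    using eqv_trans[OF eqv_sym[OF S_semi_eqv[of h s u]], of "S s (S h u)"] sh[OF that] that s u by (simp add: add.commute)
  show "((\<lambda>h. nrm ((1 / h) *\<^sub>R (S (s + h) u - S s u) - S s (A u))) \<longlongrightarrow> 0) (at_right 0)"
    by (rule main) (rule eqv_trans[OF eqv_scale[OF eqv_diff[OF sh id]] quot])
  have "((\<lambda>h. nrm ((1 / h) *\<^sub>R (S h (S s u) - S s u) - S s (A u))) \<longlongrightarrow> 0) (at_right 0)"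
    by (rule main) (rule eqv_trans[OF eqv_scale[OF eqv_diff[OF hs id]] quot])
  then show "S s u \<in> D" "nrm (S s (A u) - A (S s u)) = 0" using gen[OF su] by auto
qed

end

section \<open>Duality for the transport semigroup\<close>

lemma powr_add_le:
  fixes a b r :: real
  assumes "r \<ge> 1"
  shows "\<bar>a + b\<bar> powr r \<le> 2 powr r * (\<bar>a\<bar> powr r + \<bar>b\<bar> powr r)"
proof -
  have "\<bar>a + b\<bar> powr r \<le> (2 * max \<bar>a\<bar> \<bar>b\<bar>) powr r"
    by (rule powr_mono2) (use assms in auto)
  also have "\<dots> = 2 powr r * (max \<bar>a\<bar> \<bar>b\<bar>) powr r" by (simp add: powr_mult)
  also have "(max \<bar>a\<bar> \<bar>b\<bar>) powr r \<le> \<bar>a\<bar> powr r + \<bar>b\<bar> powr r" by (simp add: max_def)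
  finally show ?thesis by simp
qed

text \<open>Together with \<open>powr_add_le\<close> this gives the constant \<open>4\<close> of the
  quasi-triangle inequality: one factor \<open>2\<close> is the root of \<open>2 powr r\<close>, the
  other comes from \<open>A + B \<le> 2 powr r * max A B\<close>.\<close>

lemma root_add_le:
  fixes A B r :: real
  assumes r: "r \<ge> 1" and A: "A \<ge> 0" and B: "B \<ge> 0"
  shows "(2 powr r * (A + B)) powr (1 / r) \<le> 4 * (A powr (1 / r) + B powr (1 / r))"
proof -
  have "(2 powr r * (A + B)) powr (1 / r) \<le> (2 powr r * (2 powr r * max A B)) powr (1 / r)"
  proof (rule powr_mono2)
    have "(2::real) \<le> 2 powr r" using powr_mono[OF r, of 2] by simp
    then have "2 * max A B \<le> 2 powr r * max A B" using A by (intro mult_right_mono) auto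
    then have "A + B \<le> 2 powr r * max A B" by linarith
    then show "2 powr r * (A + B) \<le> 2 powr r * (2 powr r * max A B)" by simp
  qed (use r A B in auto)
  also have "\<dots> = 4 * (max A B) powr (1 / r)"
    using r A by (simp add: powr_mult powr_powr)
  also have "(max A B) powr (1 / r) \<le> A powr (1 / r) + B powr (1 / r)" by (simp add: max_def)
  finally show ?thesis by simp
qed

lemma Lp_space_iff:
  assumes p: "1 \<le> p" "p < \<infinity>"
  shows "f \<in> Lp_space p l \<longleftrightarrow> f \<in> borel_measurable (lebesgue_on {0<..<l}) \<and>
     integrable (lebesgue_on {0<..<l}) (\<lambda>x. \<bar>f x\<bar> powr enn2real p)"
proof -
  let ?M = "lebesgue_on {0<..<l}"
  have "(\<integral>\<^sup>+x. ennreal (\<bar>f x\<bar> powr enn2real p) \<partial>?M) < \<infinity> \<longleftrightarrow> integrable ?M (\<lambda>x. \<bar>f x\<bar> powr enn2real p)"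
    if "f \<in> borel_measurable ?M"
    using that by (auto simp: integrable_iff_bounded)
  then show ?thesis using p unfolding Lp_space_def Lp_norm_def Let_def
    by (auto simp: top.not_eq_extremum)
qed

lemma Lp_norm_eq:
  assumes p: "1 \<le> p" "p < \<infinity>" and f: "f \<in> Lp_space p l"
  shows "Lp_norm p l f = ennreal ((LINT x|lebesgue_on {0<..<l}. \<bar>f x\<bar> powr enn2real p) powr (1 / enn2real p))"
proof -
  let ?M = "lebesgue_on {0<..<l}"
  have "integrable ?M (\<lambda>x. \<bar>f x\<bar> powr enn2real p)" using f Lp_space_iff[OF p] by blast
  then have "(\<integral>\<^sup>+x. ennreal (\<bar>f x\<bar> powr enn2real p) \<partial>?M) = ennreal (LINT x|?M. \<bar>f x\<bar> powr enn2real p)"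
    by (rule nn_integral_eq_integral) auto
  then show ?thesis using p unfolding Lp_norm_def Let_def by simp
qed

locale Lp_network =
  fixes N :: nat and L :: "nat \<Rightarrow> real" and p :: ennreal
  assumes Lp: "\<And>i. i \<in> {1..N} \<Longrightarrow> L i > 0" and p: "1 \<le> p" "p < \<infinity>"
begin

abbreviation "X \<equiv> X_space N L p"
abbreviation "nrm \<equiv> X_norm N L p"
abbreviation "r \<equiv> enn2real p"
abbreviation "M i \<equiv> lebesgue_on {0<..<L i}"

lemma r1: "r \<ge> 1"
  using p by (cases p) (auto simp: ennreal_ge_1)

definition J :: "state \<Rightarrow> real" where
  "J u = (\<Sum>i=1..N. LINT x|M i. \<bar>u i x\<bar> powr r)"

lemma J_nonneg: "J u \<ge> 0" unfolding J_def by (intro sum_nonneg integral_nonneg_AE) auto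

lemma XD:
  assumes "u \<in> X" "i \<in> {1..N}"
  shows "u i \<in> borel_measurable (M i)" "integrable (M i) (\<lambda>x. \<bar>u i x\<bar> powr r)"
  using assms Lp_space_iff[OF p] unfolding X_space_def by auto

lemma XI:
  assumes "\<And>i. i \<in> {1..N} \<Longrightarrow> u i \<in> borel_measurable (M i)"
    "\<And>i. i \<in> {1..N} \<Longrightarrow> integrable (M i) (\<lambda>x. \<bar>u i x\<bar> powr r)"
  shows "u \<in> X"
  using assms Lp_space_iff[OF p] unfolding X_space_def by auto

lemma nrm_eq:
  assumes "u \<in> X"
  shows "nrm u = J u powr (1 / r)"
proof -
  have "enn2real (Lp_norm p (L i) (u i)) powr r = (LINT x|M i. \<bar>u i x\<bar> powr r)" if "i \<in> {1..N}" for i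
  proof -
    have "u i \<in> Lp_space p (L i)" using assms that by (auto simp: X_space_def)
    moreover have "0 \<le> (LINT x|M i. \<bar>u i x\<bar> powr r)" by (rule integral_nonneg_AE) auto
    ultimately show ?thesis using r1 by (simp add: Lp_norm_eq[OF p] powr_powr)
  qed
  then show ?thesis unfolding X_norm_def J_def by simp
qed

lemma X_add: assumes u: "u \<in> X" and v: "v \<in> X" shows "u + v \<in> X" "J (u + v) \<le> 2 powr r * (J u + J v)"
proof -
  have m: "(\<lambda>x. u i x + v i x) \<in> borel_measurable (M i)" if "i \<in> {1..N}" for i
    using XD[OF u that] XD[OF v that] by simp
  have b: "\<bar>u i x + v i x\<bar> powr r \<le> 2 powr r * (\<bar>u i x\<bar> powr r + \<bar>v i x\<bar> powr r)" for i x
    by (rule powr_add_le[OF r1])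
  have i: "integrable (M i) (\<lambda>x. \<bar>u i x + v i x\<bar> powr r)" if "i \<in> {1..N}" for i
  proof (rule Bochner_Integration.integrable_bound)
    show "integrable (M i) (\<lambda>x. 2 powr r * (\<bar>u i x\<bar> powr r + \<bar>v i x\<bar> powr r))"
      using XD[OF u that] XD[OF v that] by auto
  qed (use m[OF that] b in auto)
  have pl: "(u + v) i = (\<lambda>x. u i x + v i x)" for i by (simp add: fun_eq_iff)
  show "u + v \<in> X"
  proof (rule XI)
    fix j assume j: "j \<in> {1..N}"
    show "(u + v) j \<in> borel_measurable (M j)" unfolding pl by (rule m[OF j])
    show "integrable (M j) (\<lambda>x. \<bar>(u + v) j x\<bar> powr r)" using i[OF j] by simp
  qed
  have "J (u + v) \<le> (\<Sum>i=1..N. 2 powr r * ((LINT x|M i. \<bar>u i x\<bar> powr r) + (LINT x|M i. \<bar>v i x\<bar> powr r)))"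
    unfolding J_def
  proof (rule sum_mono)
    fix i assume i': "i \<in> {1..N}"
    have "(LINT x|M i. \<bar>(u + v) i x\<bar> powr r) \<le> (LINT x|M i. 2 powr r * (\<bar>u i x\<bar> powr r + \<bar>v i x\<bar> powr r))"
      by (rule integral_mono) (use i[OF i'] b XD[OF u i'] XD[OF v i'] in auto)
    also have "\<dots> = 2 powr r * ((LINT x|M i. \<bar>u i x\<bar> powr r) + (LINT x|M i. \<bar>v i x\<bar> powr r))"
      using XD[OF u i'] XD[OF v i'] by simp
    finally show "(LINT x|M i. \<bar>(u + v) i x\<bar> powr r) \<le> 2 powr r * ((LINT x|M i. \<bar>u i x\<bar> powr r) + (LINT x|M i. \<bar>v i x\<bar> powr r))" .
  qed
  also have "\<dots> = 2 powr r * (J u + J v)"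
    unfolding J_def by (simp only: sum_distrib_left[symmetric] sum.distrib)
  finally show "J (u + v) \<le> 2 powr r * (J u + J v)" .
qed

lemma X_scale: assumes u: "u \<in> X" shows "c *\<^sub>R u \<in> X" "J (c *\<^sub>R u) = \<bar>c\<bar> powr r * J u"
proof -
  have e: "\<bar>(c *\<^sub>R u) i x\<bar> powr r = \<bar>c\<bar> powr r * \<bar>u i x\<bar> powr r" for i x
    by (simp add: scaleR_fun_def abs_mult powr_mult)
  show "c *\<^sub>R u \<in> X"
  proof (rule XI)
    fix i assume i: "i \<in> {1..N}"
    have "(c *\<^sub>R u) i = (\<lambda>x. c * u i x)" by (simp add: scaleR_fun_def)
    then show "(c *\<^sub>R u) i \<in> borel_measurable (M i)" using XD[OF u i] by simp
    show "integrable (M i) (\<lambda>x. \<bar>(c *\<^sub>R u) i x\<bar> powr r)" unfolding e using XD[OF u i] by simp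
  qed
  show "J (c *\<^sub>R u) = \<bar>c\<bar> powr r * J u" unfolding J_def e by (simp add: sum_distrib_left)
qed

sublocale qn: quasi_normed X nrm 4
proof
  fix u v :: state and c :: real
  show "nrm u \<ge> 0" unfolding X_norm_def by simp
  show "(0::state) \<in> X" by (rule XI) (auto simp: zero_fun_def)
  { assume u: "u \<in> X" and v: "v \<in> X"
    show "u + v \<in> X" by (rule X_add[OF u v])
    have "nrm (u + v) = J (u + v) powr (1 / r)" using nrm_eq X_add[OF u v] by blast
    also have "\<dots> \<le> (2 powr r * (J u + J v)) powr (1 / r)"
      by (rule powr_mono2) (use X_add[OF u v] J_nonneg r1 in auto)
    also have "\<dots> \<le> 4 * (J u powr (1 / r) + J v powr (1 / r))" by (rule root_add_le[OF r1 J_nonneg J_nonneg])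
    finally show "nrm (u + v) \<le> 4 * (nrm u + nrm v)" by (simp add: nrm_eq u v) }
  { assume u: "u \<in> X"
    show "c *\<^sub>R u \<in> X" by (rule X_scale[OF u])
    show "nrm (c *\<^sub>R u) = \<bar>c\<bar> * nrm u"
      using nrm_eq[OF u] nrm_eq[OF X_scale(1)[OF u]] X_scale(2)[OF u] r1
      by (simp add: powr_mult powr_powr J_nonneg) }
qed simp

lemma X_integrable:
  assumes u: "u \<in> X" and i: "i \<in> {1..N}"
  shows "integrable (M i) (u i)"
proof (rule Bochner_Integration.integrable_bound)
  show "integrable (M i) (\<lambda>x. 1 + \<bar>u i x\<bar> powr r)"
    using XD[OF u i] integrable_one_Ioo by auto
  show "AE x in M i. norm (u i x) \<le> norm (1 + \<bar>u i x\<bar> powr r)"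
  proof (rule AE_I2)
    fix x
    show "norm (u i x) \<le> norm (1 + \<bar>u i x\<bar> powr r)"
    proof (cases "\<bar>u i x\<bar> \<le> 1")
      case False
      then have "\<bar>u i x\<bar> powr 1 \<le> \<bar>u i x\<bar> powr r" using r1 by (intro powr_mono) auto
      then show ?thesis by simp
    qed (simp add: add_increasing2)
  qed
qed (use XD[OF u i] in auto)

text \<open>Pairings with bounded functions are estimated in this norm of L^1 type; the exponent
  \<open>p\<close> enters such estimates only through \<open>N1_le\<close>.\<close>

definition N1 :: "state \<Rightarrow> real" where
  "N1 u = (\<Sum>i=1..N. LINT x|M i. \<bar>u i x\<bar>)"

lemma N1_nonneg: "N1 u \<ge> 0" unfolding N1_def by (intro sum_nonneg integral_nonneg_AE) auto

text \<open>Scaling \<open>|u| \<le> 1 + |u| powr r\<close> by the norm replaces Hoelder's inequality.\<close>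

lemma N1_le:
  assumes u: "u \<in> X"
  shows "N1 u \<le> ((\<Sum>i=1..N. L i) + 1) * nrm u"
proof -
  have le: "N1 v \<le> (\<Sum>i=1..N. L i) + J v" if v: "v \<in> X" for v
  proof -
    have "(LINT x|M i. \<bar>v i x\<bar>) \<le> L i + (LINT x|M i. \<bar>v i x\<bar> powr r)" if i: "i \<in> {1..N}" for i
    proof -
      have "(LINT x|M i. \<bar>v i x\<bar>) \<le> (LINT x|M i. 1 + \<bar>v i x\<bar> powr r)"
      proof (rule integral_mono)
        fix x
        show "\<bar>v i x\<bar> \<le> 1 + \<bar>v i x\<bar> powr r"
        proof (cases "\<bar>v i x\<bar> \<le> 1")
          case False
          then have "\<bar>v i x\<bar> powr 1 \<le> \<bar>v i x\<bar> powr r" using r1 by (intro powr_mono) auto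
          then show ?thesis by simp
        qed (simp add: add_increasing2)
      qed (use X_integrable[OF v i] XD[OF v i] integrable_one_Ioo in auto)
      also have "\<dots> = (LINT x|M i. 1) + (LINT x|M i. \<bar>v i x\<bar> powr r)"
        by (rule Bochner_Integration.integral_add) (use XD[OF v i] integrable_one_Ioo in auto)
      also have "(LINT x|M i. (1::real)) = L i" using Lp[OF i] by (simp add: measure_restrict_space)
      finally show ?thesis .
    qed
    then show ?thesis unfolding N1_def J_def sum.distrib[symmetric] by (rule sum_mono)
  qed
  have sc: "N1 (c *\<^sub>R u) = \<bar>c\<bar> * N1 u" for c
    unfolding N1_def by (simp add: scaleR_fun_def abs_mult sum_distrib_left)
  show ?thesis
  proof (cases "nrm u = 0")
    case True
    have "\<bar>c\<bar> * N1 u \<le> (\<Sum>i=1..N. L i)" for c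
    proof -
      have "J u = 0" using True nrm_eq[OF u] by simp
      then show ?thesis using le[OF X_scale(1)[OF u], of c] X_scale(2)[OF u, of c] sc[of c] by simp
    qed
    \<comment> \<open>All multiples of a null element obey the same bound. This multiple would have
      the value \<open>(\<Sum>i=1..N. L i) + 1\<close> if \<open>N1 u\<close> were positive, which
      is too large.\<close>
    from this[of "((\<Sum>i=1..N. L i) + 1) / N1 u"] have "N1 u = 0"
      using N1_nonneg[of u] Lp
      by (cases "N1 u = 0") (auto simp: abs_mult sum_nonneg less_imp_le)
    then show ?thesis using True by simp
  next
    case False
    then have n: "nrm u > 0" using qn.nrm_nonneg[of u] by linarith
    have "J ((1 / nrm u) *\<^sub>R u) = 1"
    proof -
      have "J u = nrm u powr r" using nrm_eq[OF u] r1 J_nonneg[of u] by (simp add: powr_powr)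
      then have "J ((1 / nrm u) *\<^sub>R u) = (1 / nrm u) powr r * nrm u powr r" using X_scale(2)[OF u] n by simp
      also have "\<dots> = 1" using n by (simp add: powr_divide)
      finally show ?thesis .
    qed
    then have "(1 / nrm u) * N1 u \<le> (\<Sum>i=1..N. L i) + 1"
      using le[OF X_scale(1)[OF u], of "1 / nrm u"] sc[of "1 / nrm u"] n by simp
    then show ?thesis using n by (simp add: field_simps)
  qed
qed

definition pair :: "state \<Rightarrow> state \<Rightarrow> real" where
  "pair \<phi> u = (\<Sum>i=1..N. LINT x|M i. u i x * \<phi> i x)"

definition bdd_test :: "real \<Rightarrow> state \<Rightarrow> bool" where
  "bdd_test K \<phi> \<longleftrightarrow> (\<forall>i\<in>{1..N}. \<phi> i \<in> borel_measurable borel \<and> (\<forall>x. \<bar>\<phi> i x\<bar> \<le> K))"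

lemma pair_integrable:
  assumes "bdd_test K \<phi>" "u \<in> X" "i \<in> {1..N}"
  shows "integrable (M i) (\<lambda>x. u i x * \<phi> i x)"
  by (rule integrable_mult_bounded_AE[OF X_integrable, where K=K])
    (use assms in \<open>auto simp: bdd_test_def intro: borel_measurable_lebesgue_onI\<close>)

lemma pair_bound:
  assumes b: "bdd_test K \<phi>" and u: "u \<in> X"
  shows "\<bar>pair \<phi> u\<bar> \<le> K * N1 u"
proof -
  have "\<bar>pair \<phi> u\<bar> \<le> (\<Sum>i=1..N. K * (LINT x|M i. \<bar>u i x\<bar>))"
    unfolding pair_def
  proof (rule order_trans[OF sum_abs], rule sum_mono)
    fix i assume i: "i \<in> {1..N}"
    have "\<bar>LINT x|M i. u i x * \<phi> i x\<bar> \<le> (LINT x|M i. \<bar>u i x * \<phi> i x\<bar>)" by (rule integral_abs_bound)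
    also have "\<dots> \<le> (LINT x|M i. K * \<bar>u i x\<bar>)"
    proof (rule integral_mono)
      fix x show "\<bar>u i x * \<phi> i x\<bar> \<le> K * \<bar>u i x\<bar>"
        using b i by (auto simp: bdd_test_def abs_mult mult.commute[of K] intro: mult_left_mono)
    qed (use pair_integrable[OF b u i] X_integrable[OF u i] in auto)
    finally show "\<bar>LINT x|M i. u i x * \<phi> i x\<bar> \<le> K * (LINT x|M i. \<bar>u i x\<bar>)" by simp
  qed
  then show ?thesis unfolding N1_def by (simp add: sum_distrib_left)
qed

lemma pair_add:
  assumes b: "bdd_test K \<phi>" and u: "u \<in> X" and v: "v \<in> X"
  shows "pair \<phi> (u + v) = pair \<phi> u + pair \<phi> v"
  unfolding pair_def sum.distrib[symmetric]
proof (rule sum.cong)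
  fix i assume i: "i \<in> {1..N}"
  have "(LINT x|M i. (u + v) i x * \<phi> i x) = (LINT x|M i. u i x * \<phi> i x + v i x * \<phi> i x)"
    by (simp add: algebra_simps)
  then show "(LINT x|M i. (u + v) i x * \<phi> i x) = (LINT x|M i. u i x * \<phi> i x) + (LINT x|M i. v i x * \<phi> i x)"
    using pair_integrable[OF b u i] pair_integrable[OF b v i] by simp
qed simp

lemma pair_scale: "pair \<phi> (c *\<^sub>R u) = c * pair \<phi> u"
  unfolding pair_def by (simp add: scaleR_fun_def mult.assoc sum_distrib_left)

lemma pair_diff:
  assumes b: "bdd_test K \<phi>" and u: "u \<in> X" and v: "v \<in> X"
  shows "pair \<phi> (u - v) = pair \<phi> u - pair \<phi> v"
  using pair_add[OF b u qn.Xminus[OF v]] pair_scale[of \<phi> "-1" v] by simp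

lemma pair_diff_test:
  assumes b: "bdd_test K \<phi>" and b': "bdd_test K' \<psi>" and u: "u \<in> X"
  shows "pair (\<lambda>i x. \<phi> i x - \<psi> i x) u = pair \<phi> u - pair \<psi> u"
  unfolding pair_def sum_subtractf[symmetric]
proof (rule sum.cong)
  fix i assume i: "i \<in> {1..N}"
  show "(LINT x|M i. u i x * (\<phi> i x - \<psi> i x)) = (LINT x|M i. u i x * \<phi> i x) - (LINT x|M i. u i x * \<psi> i x)"
    using pair_integrable[OF b u i] pair_integrable[OF b' u i] by (simp add: right_diff_distrib)
qed simp

lemma pair_functional:
  assumes b: "bdd_test K \<phi>"
  shows "linear_functional_in X nrm (pair \<phi>)"
proof -
  have "\<bar>pair \<phi> u\<bar> \<le> (\<bar>K\<bar> * ((\<Sum>i=1..N. L i) + 1)) * nrm u" if u: "u \<in> X" for u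
  proof -
    have "\<bar>pair \<phi> u\<bar> \<le> K * N1 u" by (rule pair_bound[OF b u])
    also have "\<dots> \<le> \<bar>K\<bar> * N1 u" by (rule mult_right_mono) (use N1_nonneg in auto)
    also have "\<dots> \<le> \<bar>K\<bar> * (((\<Sum>i=1..N. L i) + 1) * nrm u)"
      by (rule mult_left_mono[OF N1_le[OF u]]) auto
    finally show ?thesis by (simp add: mult.assoc)
  qed
  then show ?thesis unfolding linear_functional_in_def
    using pair_add[OF b] pair_scale by blast
qed

lemma pair_null:
  assumes b: "bdd_test K \<phi>" and u: "u \<in> X" and v: "v \<in> X" and z: "nrm (u - v) = 0"
  shows "pair \<phi> u = pair \<phi> v"
proof -
  have "N1 (u - v) \<le> 0" using N1_le[OF qn.Xdiff[OF u v]] z by simp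
  then have "N1 (u - v) = 0" using N1_nonneg[of "u - v"] by simp
  then have "\<bar>pair \<phi> (u - v)\<bar> \<le> 0" using pair_bound[OF b qn.Xdiff[OF u v]] by simp
  then show ?thesis using pair_diff[OF b u v] by simp
qed

lemma N1_add: assumes u: "u \<in> X" and v: "v \<in> X" shows "N1 (u + v) \<le> N1 u + N1 v"
  unfolding N1_def sum.distrib[symmetric]
proof (rule sum_mono)
  fix i assume i: "i \<in> {1..N}"
  have "(LINT x|M i. \<bar>(u + v) i x\<bar>) \<le> (LINT x|M i. \<bar>u i x\<bar> + \<bar>v i x\<bar>)"
  proof (rule integral_mono)
    show "integrable (M i) (\<lambda>x. \<bar>(u + v) i x\<bar>)"
      by (rule Bochner_Integration.integrable_abs[OF X_integrable[OF X_add(1)[OF u v] i]])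
  qed (use X_integrable[OF u i] X_integrable[OF v i] in auto)
  then show "(LINT x|M i. \<bar>(u + v) i x\<bar>) \<le> (LINT x|M i. \<bar>u i x\<bar>) + (LINT x|M i. \<bar>v i x\<bar>)"
    using X_integrable[OF u i] X_integrable[OF v i] by simp
qed

end

lemma C1_fun_global_bound:
  assumes C: "C1_fun \<phi> \<phi>'" and z: "\<And>x. x \<notin> {0<..<l} \<Longrightarrow> \<phi> x = 0"
  shows "\<exists>K\<ge>0. \<forall>x. \<bar>\<phi> x\<bar> \<le> K \<and> \<bar>\<phi>' x\<bar> \<le> K"
proof -
  obtain K where K: "\<And>x. x \<in> {0..l} \<Longrightarrow> \<bar>\<phi> x\<bar> \<le> K \<and> \<bar>\<phi>' x\<bar> \<le> K"
    using C1_fun_bounded_on[OF C] by blast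
  have z': "\<phi>' x = 0" if x: "x \<notin> {0..l}" for x
  proof -
    have d: "(\<phi> has_real_derivative \<phi>' x) (at x)" using C by (simp add: C1_fun_def)
    have "((\<lambda>_. 0) has_real_derivative \<phi>' x) (at x)"
      by (rule has_field_derivative_transform_within_open[OF d, of "- {0..l}"]) (use x z in \<open>auto simp: open_Compl\<close>)
    then show ?thesis using DERIV_unique DERIV_const by blast
  qed
  have "\<bar>\<phi> x\<bar> \<le> max K 0 \<and> \<bar>\<phi>' x\<bar> \<le> max K 0" for x
    using K[of x] z[of x] z'[of x] by (cases "x \<in> {0..l}") (auto simp: max_def split: if_splits)
  then show ?thesis by (intro exI[of _ "max K 0"]) auto
qed

lemma AE_lebesgue_translate:
  fixes c :: real
  assumes "AE x in lebesgue. P x"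
  shows "AE x in lebesgue. P (x + c)"
proof -
  obtain Z where Z: "{x. \<not> P x} \<subseteq> Z" "Z \<in> null_sets lebesgue"
    using assms unfolding eventually_ae_filter by auto
  have "negligible ((+) (- c) ` Z)" using Z(2) by (intro negligible_translation) (simp add: negligible_iff_null_sets)
  moreover have "{x. \<not> P (x + c)} \<subseteq> (+) (- c) ` Z"
  proof
    fix x assume "x \<in> {x. \<not> P (x + c)}"
    then have "x + c \<in> Z" using Z(1) by blast
    then show "x \<in> (+) (- c) ` Z" by (intro image_eqI[of _ _ "x + c"]) auto
  qed
  ultimately show ?thesis unfolding negligible_iff_null_sets by (intro AE_I') auto
qed

context Lp_network
begin

definition test :: "real \<Rightarrow> state \<Rightarrow> bool" where
  "test K \<phi> \<longleftrightarrow> bdd_test K \<phi> \<and> (\<forall>i\<in>{1..N}. \<forall>x. x \<notin> {0<..<L i} \<longrightarrow> \<phi> i x = 0)"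

definition smooth :: "state \<Rightarrow> state \<Rightarrow> bool" where
  "smooth \<phi> \<phi>' \<longleftrightarrow> (\<forall>i\<in>{1..N}. C1_fun (\<phi> i) (\<phi>' i) \<and> (\<forall>x. x \<notin> {0<..<L i} \<longrightarrow> \<phi> i x = 0))"

lemma bdd_test_measurable: "bdd_test K \<phi> \<Longrightarrow> i \<in> {1..N} \<Longrightarrow> \<phi> i \<in> borel_measurable borel"
  by (simp add: bdd_test_def)

lemma pair_limit:
  assumes u: "u \<in> X" and b: "\<And>n. bdd_test K (\<psi> n)"
    and m: "\<And>i. i \<in> {1..N} \<Longrightarrow> \<phi> i \<in> borel_measurable borel"
    and lim: "\<And>i. i \<in> {1..N} \<Longrightarrow> AE x in M i. (\<lambda>n. \<psi> n i x) \<longlonglongrightarrow> \<phi> i x"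
  shows "(\<lambda>n. pair (\<psi> n) u) \<longlonglongrightarrow> pair \<phi> u"
  unfolding pair_def
proof (rule tendsto_sum)
  fix i assume i: "i \<in> {1..N}"
  show "(\<lambda>n. LINT x|M i. u i x * \<psi> n i x) \<longlonglongrightarrow> (LINT x|M i. u i x * \<phi> i x)"
  proof (rule integral_dominated_convergence[where w="\<lambda>x. K * \<bar>u i x\<bar>"])
    show "AE x in M i. (\<lambda>n. u i x * \<psi> n i x) \<longlonglongrightarrow> u i x * \<phi> i x"
      using lim[OF i] by eventually_elim (intro tendsto_intros)
    show "\<And>n. (\<lambda>x. u i x * \<psi> n i x) \<in> borel_measurable (M i)"
      using pair_integrable[OF b u i] by auto
    show "(\<lambda>x. u i x * \<phi> i x) \<in> borel_measurable (M i)"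
      by (rule borel_measurable_times[OF XD(1)[OF u i] borel_measurable_lebesgue_onI[OF m[OF i]]])
    show "AE x in M i. norm (u i x * \<psi> n i x) \<le> K * \<bar>u i x\<bar>" for n
      using b[of n] i by (intro AE_I2) (auto simp: bdd_test_def abs_mult mult.commute[of K] intro: mult_left_mono)
  qed (use X_integrable[OF u i] in auto)
qed

lemma pair_cong:
  assumes "\<And>i x. i \<in> {1..N} \<Longrightarrow> x \<in> {0<..<L i} \<Longrightarrow> \<phi> i x = \<psi> i x"
  shows "pair \<phi> u = pair \<psi> u"
  unfolding pair_def by (intro sum.cong Bochner_Integration.integral_cong) (use assms in auto)

end

section \<open>The dual semigroup on smooth test functions for times up to
  \<open>Lmin\<close>\<close>

locale transport_semigroup = Lp_network N L p for N L p +
  fixes m :: "nat \<Rightarrow> nat \<Rightarrow> real" and S :: "real \<Rightarrow> state \<Rightarrow> state" and Lmin :: real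
  assumes gen: "generates_semigroup (X_space N L p) (X_norm N L p) (A_dom N L m p) (A_op L p) S"
    and Lmin: "Lmin > 0" and Lge: "\<And>i. i \<in> {1..N} \<Longrightarrow> Lmin \<le> L i"
    and m1: "\<And>j. j \<in> {1..N} \<Longrightarrow> (\<Sum>i=1..N. \<bar>m i j\<bar>) \<le> 1"
begin

sublocale sg: semigroup_in X nrm 4 S
  by unfold_locales (use gen in \<open>simp add: generates_semigroup_def\<close>)

text \<open>\<open>shift \<rho> \<phi>\<close> is the dual semigroup at time \<open>\<rho> \<le> Lmin\<close> applied to \<open>\<phi>\<close>.\<close>

definition ext :: "state \<Rightarrow> state" where
  "ext \<phi> j y = \<phi> j y + (\<Sum>i=1..N. m i j * \<phi> i (y - L j))"

definition shift :: "real \<Rightarrow> state \<Rightarrow> state" where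
  "shift \<rho> \<phi> j x = ext \<phi> j (x + \<rho>)"

lemma ext_measurable:
  assumes "bdd_test K \<phi>" "j \<in> {1..N}"
  shows "ext \<phi> j \<in> borel_measurable borel"
proof -
  have m: "\<And>i. i \<in> {1..N} \<Longrightarrow> \<phi> i \<in> borel_measurable borel" using assms by (simp add: bdd_test_def)
  have "(\<lambda>y. \<phi> j y + (\<Sum>i=1..N. m i j * \<phi> i (y - L j))) \<in> borel_measurable borel"
    by (intro borel_measurable_add borel_measurable_sum borel_measurable_times measurable_compose[OF _ m] m assms) auto
  then show ?thesis unfolding ext_def[abs_def] .
qed

lemma test_nonneg: "test K \<phi> \<Longrightarrow> j \<in> {1..N} \<Longrightarrow> K \<ge> 0"
  unfolding test_def bdd_test_def by (metis abs_ge_zero order_trans)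

text \<open>The two summands of \<open>ext\<close> never overlap: \<open>\<phi> j\<close> vanishes
  from \<open>L j\<close> on, and the functions \<open>\<phi> i (y - L j)\<close> vanish before
  that. The bound on the columns of \<open>m\<close> then makes the dual semigroup a contraction for
  the supremum norm.\<close>

lemma ext_bound:
  assumes t: "test K \<phi>" and j: "j \<in> {1..N}"
  shows "\<bar>ext \<phi> j y\<bar> \<le> K"
proof (cases "y < L j")
  case True
  then have "\<And>i. i \<in> {1..N} \<Longrightarrow> \<phi> i (y - L j) = 0" using t by (auto simp: test_def)
  then have "ext \<phi> j y = \<phi> j y" by (simp add: ext_def)
  then show ?thesis using t j by (simp add: test_def bdd_test_def)
next
  case False
  then have "ext \<phi> j y = (\<Sum>i=1..N. m i j * \<phi> i (y - L j))" using t j by (simp add: ext_def test_def)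
  also have "\<bar>\<dots>\<bar> \<le> (\<Sum>i=1..N. \<bar>m i j\<bar> * K)"
    by (rule order_trans[OF sum_abs], rule sum_mono)
      (use t in \<open>auto simp: abs_mult test_def bdd_test_def intro!: mult_left_mono\<close>)
  also have "\<dots> \<le> K" using m1[OF j] test_nonneg[OF t j]
    by (simp add: sum_distrib_right[symmetric] mult_left_le_one_le sum_nonneg)
  finally show ?thesis .
qed

lemma shift_bdd: assumes t: "test K \<phi>" shows "bdd_test K (shift \<rho> \<phi>)"
proof -
  have b: "bdd_test K \<phi>" using t by (simp add: test_def)
  have "shift \<rho> \<phi> j \<in> borel_measurable borel" if "j \<in> {1..N}" for j
    unfolding shift_def[abs_def] by (intro measurable_compose[OF _ ext_measurable[OF b that]]) auto
  then show ?thesis unfolding bdd_test_def using ext_bound[OF t] by (simp add: shift_def)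
qed

lemma smooth_test:
  assumes s: "smooth \<phi> \<phi>'"
  shows "\<exists>K\<ge>0. test K \<phi> \<and> (\<forall>i\<in>{1..N}. \<forall>x. \<bar>\<phi>' i x\<bar> \<le> K)"
proof -
  have "\<exists>K\<ge>0. \<forall>x. \<bar>\<phi> i x\<bar> \<le> K \<and> \<bar>\<phi>' i x\<bar> \<le> K" if "i \<in> {1..N}" for i
    using s that by (intro C1_fun_global_bound[of _ _ "L i"]) (auto simp: smooth_def)
  then obtain K where K: "\<And>i. i \<in> {1..N} \<Longrightarrow> K i \<ge> 0 \<and> (\<forall>x. \<bar>\<phi> i x\<bar> \<le> K i \<and> \<bar>\<phi>' i x\<bar> \<le> K i)" by metis
  define B where "B = (\<Sum>i=1..N. K i)"
  have KB: "K i \<le> B" if "i \<in> {1..N}" for i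
    unfolding B_def by (rule member_le_sum) (use K that in auto)
  have B: "B \<ge> 0" unfolding B_def by (rule sum_nonneg) (use K in auto)
  have "test B \<phi>" unfolding test_def bdd_test_def
    using s K KB C1_fun_measurable by (fastforce simp: smooth_def intro: order_trans)
  moreover have "\<forall>i\<in>{1..N}. \<forall>x. \<bar>\<phi>' i x\<bar> \<le> B" using K KB by (meson order_trans)
  ultimately show ?thesis using B by blast
qed

lemma ext_C1:
  assumes s: "smooth \<phi> \<phi>'" and j: "j \<in> {1..N}"
  shows "C1_fun (ext \<phi> j) (ext \<phi>' j)"
proof -
  have d: "\<And>i x. i \<in> {1..N} \<Longrightarrow> (\<phi> i has_real_derivative \<phi>' i x) (at x)"
    and c: "\<And>i. i \<in> {1..N} \<Longrightarrow> continuous_on UNIV (\<phi>' i)"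
    using s by (auto simp: smooth_def C1_fun_def)
  have d': "((\<lambda>y. \<phi> i (y - L j)) has_real_derivative \<phi>' i (y - L j)) (at y)" if "i \<in> {1..N}" for i y
    using DERIV_shift[of "\<phi> i" "\<phi>' i (y - L j)" y "- L j"] d[OF that, of "y - L j"] by simp
  have c': "continuous_on UNIV (\<lambda>y. \<phi>' i (y - L j))" if "i \<in> {1..N}" for i
    by (rule continuous_on_compose2[OF c[OF that]]) (auto intro!: continuous_intros)
  show ?thesis unfolding C1_fun_def ext_def[abs_def]
  proof (intro conjI allI)
    show "((\<lambda>y. \<phi> j y + (\<Sum>i=1..N. m i j * \<phi> i (y - L j))) has_real_derivative
        \<phi>' j x + (\<Sum>i=1..N. m i j * \<phi>' i (x - L j))) (at x)" for x
      by (intro DERIV_add DERIV_sum DERIV_cmult d d' j)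
    show "continuous_on UNIV (\<lambda>y. \<phi>' j y + (\<Sum>i=1..N. m i j * \<phi>' i (y - L j)))"
      by (intro continuous_intros c c' j)
  qed
qed

text \<open>The boundary terms of the integration by parts cancel because of the coupling condition in
  the domain of the generator.\<close>

lemma pair_generator:
  assumes s: "smooth \<phi> \<phi>'" and w: "w \<in> A_dom N L m p" and \<rho>: "0 \<le> \<rho>" "\<rho> \<le> Lmin"
  shows "pair (shift \<rho> \<phi>) (A_op L p w) = pair (shift \<rho> \<phi>') w" and "w \<in> X" and "A_op L p w \<in> X"
proof -
  let ?g = "\<lambda>i. weak_derivative p (L i) (w i)"
  have W: "w i \<in> Lp_space p (L i)" "?g i \<in> Lp_space p (L i)" "has_weak_derivative (L i) (w i) (?g i)" if i: "i \<in> {1..N}" for i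
  proof -
    have "w i \<in> W1p_space p (L i)" using w i by (simp add: A_dom_def)
    then have ex: "\<exists>g. g \<in> Lp_space p (L i) \<and> has_weak_derivative (L i) (w i) g" and "w i \<in> Lp_space p (L i)"
      by (auto simp: W1p_space_def)
    then show "w i \<in> Lp_space p (L i)" by simp
    show "?g i \<in> Lp_space p (L i)" "has_weak_derivative (L i) (w i) (?g i)"
      using someI_ex[OF ex] unfolding weak_derivative_def by auto
  qed
  show wX: "w \<in> X" using W by (simp add: X_space_def)
  have gX: "?g \<in> X" using W by (simp add: X_space_def)
  have Ag: "A_op L p w = - ?g" by (auto simp: A_op_def fun_eq_iff)
  show AX: "A_op L p w \<in> X" unfolding Ag by (rule qn.Xminus[OF gX])
  define c where "c = (\<lambda>i. cont_rep (L i) (w i) 0)"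
  define e where "e = (\<lambda>i. cont_rep (L i) (w i) (L i))"
  have ce: "c i = (\<Sum>j=1..N. m i j * e j)" if "i \<in> {1..N}" for i
    using w that by (simp add: A_dom_def c_def e_def)
  have C1: "C1_fun (shift \<rho> \<phi> i) (shift \<rho> \<phi>' i)" if i: "i \<in> {1..N}" for i
  proof -
    have C: "C1_fun (ext \<phi> i) (ext \<phi>' i)" by (rule ext_C1[OF s i])
    have "((\<lambda>x. ext \<phi> i (x + \<rho>)) has_real_derivative ext \<phi>' i (x + \<rho>)) (at x)" for x
      using C by (simp add: C1_fun_def flip: DERIV_shift)
    moreover have "continuous_on UNIV (\<lambda>x. ext \<phi>' i (x + \<rho>))"
      by (rule continuous_on_compose2[of UNIV "ext \<phi>' i"]) (use C in \<open>auto simp: C1_fun_def intro!: continuous_intros\<close>)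
    ultimately show ?thesis unfolding C1_fun_def shift_def[abs_def] by blast
  qed
  have z: "\<phi> i x = 0" if "i \<in> {1..N}" "x \<notin> {0<..<L i}" for i x using s that by (simp add: smooth_def)
  \<comment> \<open>Here \<open>\<rho> \<le> Lmin\<close> is essential: a translate by
    \<open>\<rho>\<close> never passes a whole circle. So the coupling terms vanish at position
    \<open>0\<close>, and at \<open>L i\<close> only the coupling terms are left; both boundary
    values involve the numbers \<open>\<phi> k \<rho>\<close> alone.\<close>
  have at0: "shift \<rho> \<phi> i 0 = \<phi> i \<rho>" if i: "i \<in> {1..N}" for i
    using z Lge[OF i] \<rho> by (simp add: shift_def ext_def)
  have atL: "shift \<rho> \<phi> i (L i) = (\<Sum>k=1..N. m k i * \<phi> k \<rho>)" if i: "i \<in> {1..N}" for i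
    using z[OF i, of "L i + \<rho>"] \<rho> by (simp add: shift_def ext_def)
  have ibp: "(LINT x|M i. ?g i x * shift \<rho> \<phi> i x) =
      e i * (\<Sum>k=1..N. m k i * \<phi> k \<rho>) - c i * \<phi> i \<rho> - (LINT x|M i. w i x * shift \<rho> \<phi>' i x)" if i: "i \<in> {1..N}" for i
    using cont_rep_by_parts[OF X_integrable[OF wX i] X_integrable[OF gX i] W(3)[OF i] Lp[OF i] C1[OF i]]
    by (simp add: at0[OF i] atL[OF i] c_def e_def)
  have "pair (shift \<rho> \<phi>) ?g = (\<Sum>i=1..N. e i * (\<Sum>k=1..N. m k i * \<phi> k \<rho>)) - (\<Sum>i=1..N. c i * \<phi> i \<rho>) - pair (shift \<rho> \<phi>') w"
    unfolding pair_def using ibp by (simp add: sum_subtractf)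
  also have "(\<Sum>i=1..N. c i * \<phi> i \<rho>) = (\<Sum>i=1..N. \<Sum>j=1..N. m i j * e j * \<phi> i \<rho>)"
    by (simp add: ce sum_distrib_right)
  also have "\<dots> = (\<Sum>j=1..N. \<Sum>i=1..N. m i j * e j * \<phi> i \<rho>)" by (rule sum.swap)
  also have "\<dots> = (\<Sum>i=1..N. e i * (\<Sum>k=1..N. m k i * \<phi> k \<rho>))"
    by (simp add: sum_distrib_left mult.assoc mult.left_commute)
  finally have "pair (shift \<rho> \<phi>) ?g = - pair (shift \<rho> \<phi>') w" by simp
  then show "pair (shift \<rho> \<phi>) (A_op L p w) = pair (shift \<rho> \<phi>') w"
    unfolding Ag using pair_scale[of "shift \<rho> \<phi>" "-1" ?g] by simp
qed

text \<open>The function \<open>F s = pair (shift (t - s) \<phi>) (S s u)\<close> joins the two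
  sides. Its right derivative is the sum of a contribution of the orbit and one of the test
  function, and these cancel by \<open>pair_generator\<close>.\<close>

lemma pair_semigroup_smooth:
  assumes s: "smooth \<phi> \<phi>'" and u: "u \<in> A_dom N L m p" and t: "0 \<le> t" "t \<le> Lmin"
  shows "pair \<phi> (S t u) = pair (shift t \<phi>) u"
proof -
  obtain K where K0: "K \<ge> 0" and T: "test K \<phi>" and K': "\<And>i x. i \<in> {1..N} \<Longrightarrow> \<bar>\<phi>' i x\<bar> \<le> K"
    using smooth_test[OF s] by blast
  have uX: "u \<in> X" and AuX: "A_op L p u \<in> X" using pair_generator[OF s u t] by auto
  \<comment> \<open>This bounds \<open>ext \<phi>' j\<close> for all \<open>j\<close> at once, and
    so is a Lipschitz constant for the dependence of \<open>shift \<rho> \<phi>\<close> on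
    \<open>\<rho>\<close>.\<close>
  define K2 where "K2 = K + (\<Sum>i=1..N. \<Sum>j=1..N. \<bar>m i j\<bar> * K)"
  have K20: "K2 \<ge> 0" unfolding K2_def using K0 by (auto intro!: add_nonneg_nonneg sum_nonneg)
  have eb: "\<bar>ext \<phi>' j y\<bar> \<le> K2" if j: "j \<in> {1..N}" for j y
  proof -
    have "\<bar>ext \<phi>' j y\<bar> \<le> \<bar>\<phi>' j y\<bar> + \<bar>\<Sum>i=1..N. m i j * \<phi>' i (y - L j)\<bar>" unfolding ext_def by (rule abs_triangle_ineq)
    also have "\<dots> \<le> K + (\<Sum>i=1..N. \<bar>m i j\<bar> * K)"
      by (intro add_mono K' j order_trans[OF sum_abs] sum_mono) (auto simp: abs_mult intro!: mult_left_mono K')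
    also have "\<dots> \<le> K2" unfolding K2_def
      by (intro add_left_mono sum_mono member_le_sum) (use j K0 in auto)
    finally show ?thesis .
  qed
  have lip: "\<bar>ext \<phi> j y - ext \<phi> j y'\<bar> \<le> K2 * \<bar>y - y'\<bar>" if j: "j \<in> {1..N}" for j y y'
  proof -
    have "norm (ext \<phi> j y - ext \<phi> j y') \<le> K2 * norm (y - y')"
      by (rule field_differentiable_bound[of UNIV _ "ext \<phi>' j"])
        (use ext_C1[OF s j] eb[OF j] in \<open>auto simp: C1_fun_def intro: has_field_derivative_at_within\<close>)
    then show ?thesis by simp
  qed
  define \<psi> where "\<psi> = (\<lambda>s. shift (t - s) \<phi>)"
  have bp: "bdd_test K (\<psi> s)" for s unfolding \<psi>_def by (rule shift_bdd[OF T])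
  have dp: "\<bar>pair (\<psi> s) v - pair (\<psi> s') v\<bar> \<le> K2 * \<bar>s - s'\<bar> * N1 v" if v: "v \<in> X" for s s' v
  proof -
    have "pair (\<psi> s) v - pair (\<psi> s') v = pair (\<lambda>i x. \<psi> s i x - \<psi> s' i x) v"
      by (rule pair_diff_test[OF bp bp v, symmetric])
    also have "\<bar>\<dots>\<bar> \<le> (K2 * \<bar>s - s'\<bar>) * N1 v"
    proof (rule pair_bound[OF _ v])
      show "bdd_test (K2 * \<bar>s - s'\<bar>) (\<lambda>i x. \<psi> s i x - \<psi> s' i x)"
        unfolding bdd_test_def
      proof (intro ballI conjI allI)
        fix i x assume i: "i \<in> {1..N}"
        show "(\<lambda>x. \<psi> s i x - \<psi> s' i x) \<in> borel_measurable borel"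
          by (rule borel_measurable_diff[OF bdd_test_measurable[OF bp i] bdd_test_measurable[OF bp i]])
        show "\<bar>\<psi> s i x - \<psi> s' i x\<bar> \<le> K2 * \<bar>s - s'\<bar>"
          using lip[OF i, of "x + (t - s)" "x + (t - s')"] by (simp add: \<psi>_def shift_def abs_minus_commute)
      qed
    qed
    finally show ?thesis .
  qed
  define C where "C = (\<Sum>i=1..N. L i) + 1"
  have C0: "C \<ge> 0" unfolding C_def using Lp by (intro add_nonneg_nonneg sum_nonneg) (auto intro: less_imp_le)
  have pn: "\<bar>pair (\<psi> s) v\<bar> \<le> K * C * nrm v" if v: "v \<in> X" for s v
  proof -
    have "\<bar>pair (\<psi> s) v\<bar> \<le> K * N1 v" by (rule pair_bound[OF bp v])
    also have "\<dots> \<le> K * (C * nrm v)" unfolding C_def by (rule mult_left_mono[OF N1_le[OF v] K0])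
    finally show ?thesis by (simp add: mult.assoc)
  qed
  define F where "F = (\<lambda>s. pair (\<psi> s) (S s u))"
  have SX: "S s u \<in> X" if "s \<ge> 0" for s using sg.S_in[OF that uX] .
  have Fc: "continuous_on {0..t} F" unfolding continuous_on_def
  proof
    fix s assume "s \<in> {0..t}"
    then have s0: "s \<ge> 0" by simp
    have l1: "((\<lambda>s'. K * C * nrm (S s' u - S s u) + K2 * \<bar>s' - s\<bar> * N1 (S s u)) \<longlongrightarrow> K * C * 0 + K2 * \<bar>s - s\<bar> * N1 (S s u)) (at s within {0..t})"
      by (intro tendsto_intros tendsto_within_subset[OF sg.S_continuous[OF s0 uX]]) auto
    show "(F \<longlongrightarrow> F s) (at s within {0..t})"
    proof (rule Lim_transform[OF tendsto_const], rule Lim_null_comparison)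
      show "((\<lambda>s'. K * C * nrm (S s' u - S s u) + K2 * \<bar>s' - s\<bar> * N1 (S s u)) \<longlongrightarrow> 0) (at s within {0..t})"
        using l1 by simp
      have "\<forall>\<^sub>F s' in at s within {0..t}. s' \<in> {0..t}" by (simp add: eventually_at_filter)
      then show "\<forall>\<^sub>F s' in at s within {0..t}. norm (F s' - F s) \<le> K * C * nrm (S s' u - S s u) + K2 * \<bar>s' - s\<bar> * N1 (S s u)"
      proof eventually_elim
        case (elim s')
        have "F s' - F s = pair (\<psi> s') (S s' u - S s u) + (pair (\<psi> s') (S s u) - pair (\<psi> s) (S s u))"
          unfolding F_def using pair_diff[OF bp SX[of s'] SX[OF s0]] elim by simp
        moreover have "\<bar>pair (\<psi> s') (S s' u - S s u)\<bar> \<le> K * C * nrm (S s' u - S s u)"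
          using pn qn.Xdiff SX elim s0 by simp
        moreover have "\<bar>pair (\<psi> s') (S s u) - pair (\<psi> s) (S s u)\<bar> \<le> K2 * \<bar>s' - s\<bar> * N1 (S s u)"
          by (rule dp[OF SX[OF s0]])
        ultimately show ?case by simp
      qed
    qed
  qed
  have Fd: "((\<lambda>h. (F (s' + h) - F s') / h) \<longlongrightarrow> 0) (at_right 0)" if s': "s' \<in> {0..<t}" for s'
  proof -
    have s0: "s' \<ge> 0" using s' by simp
    define w where "w = S s' u"
    define v where "v = S s' (A_op L p u)"
    have wX: "w \<in> X" unfolding w_def by (rule SX[OF s0])
    have vX: "v \<in> X" using sg.S_in[OF s0 AuX] unfolding v_def .
    have gi: "w \<in> A_dom N L m p" "nrm (v - A_op L p w) = 0"
        "((\<lambda>h. nrm ((1 / h) *\<^sub>R (S (s' + h) u - w) - v)) \<longlongrightarrow> 0) (at_right 0)"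
      unfolding w_def v_def
      using sg.generator_invariant(1)[OF gen, OF uX u AuX s0] sg.generator_invariant(2)[OF gen, OF uX u AuX s0]
        sg.generator_invariant(3)[OF gen, OF uX u AuX s0] by - assumption+
    define q where "q = (\<lambda>h. (1 / h) *\<^sub>R (S (s' + h) u - w))"
    have qX: "q h \<in> X" if "h > 0" for h unfolding q_def using SX[of "s' + h"] that s0 wX by (intro qn.Xscale qn.Xdiff) auto
    have l1: "((\<lambda>h. K * C * nrm (q h - v) + K2 * h * N1 v) \<longlongrightarrow> K * C * 0 + K2 * 0 * N1 v) (at_right 0)"
      unfolding q_def by (intro tendsto_intros gi(3))
    have 1: "((\<lambda>h. pair (\<psi> (s' + h)) (q h)) \<longlongrightarrow> pair (\<psi> s') v) (at_right 0)"
    proof (rule Lim_transform[OF tendsto_const], rule Lim_null_comparison)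
      show "((\<lambda>h. K * C * nrm (q h - v) + K2 * h * N1 v) \<longlongrightarrow> 0) (at_right 0)" using l1 by simp
      have "eventually (\<lambda>h::real. h > 0) (at_right 0)" by (simp add: eventually_at_right_less)
      then show "\<forall>\<^sub>F h in at_right 0. norm (pair (\<psi> (s' + h)) (q h) - pair (\<psi> s') v) \<le> K * C * nrm (q h - v) + K2 * h * N1 v"
      proof eventually_elim
        case (elim h)
        have "pair (\<psi> (s' + h)) (q h) - pair (\<psi> s') v = pair (\<psi> (s' + h)) (q h - v) + (pair (\<psi> (s' + h)) v - pair (\<psi> s') v)"
          using pair_diff[OF bp qX[OF elim] vX] by simp
        moreover have "\<bar>pair (\<psi> (s' + h)) (q h - v)\<bar> \<le> K * C * nrm (q h - v)"
          using pn qn.Xdiff qX[OF elim] vX by simp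
        moreover have "\<bar>pair (\<psi> (s' + h)) v - pair (\<psi> s') v\<bar> \<le> K2 * h * N1 v"
          using dp[OF vX, of "s' + h" s'] elim by simp
        ultimately show ?case by simp
      qed
    qed
    \<comment> \<open>Difference quotients of the test function in time. They are bounded by
      \<open>K2\<close> and converge pointwise, so dominated convergence identifies the limit of
      their pairings with \<open>w\<close>.\<close>
    define d where "d = (\<lambda>h i x. (1 / h) * (\<psi> (s' + h) i x - \<psi> s' i x))"
    have db: "bdd_test K2 (d h)" if h: "h > 0" for h unfolding bdd_test_def
    proof (intro ballI conjI allI)
      fix i x assume i: "i \<in> {1..N}"
      show "d h i \<in> borel_measurable borel"
        unfolding d_def using bdd_test_measurable[OF bp[of "s' + h"] i] bdd_test_measurable[OF bp[of s'] i] by simp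
      have "\<bar>\<psi> (s' + h) i x - \<psi> s' i x\<bar> \<le> K2 * h"
        using lip[OF i, of "x + (t - (s' + h))" "x + (t - s')"] h by (simp add: \<psi>_def shift_def)
      then show "\<bar>d h i x\<bar> \<le> K2" using h by (simp add: d_def abs_mult field_simps)
    qed
    have 2: "((\<lambda>h. pair (d h) w) \<longlongrightarrow> pair (\<lambda>i x. - shift (t - s') \<phi>' i x) w) (at_right 0)"
    proof (rule tendsto_at_right_sequentially[of 0 1])
      fix h :: "nat \<Rightarrow> real" assume h0: "\<And>n. 0 < h n" and hl: "h \<longlonglongrightarrow> 0"
      show "(\<lambda>n. pair (d (h n)) w) \<longlonglongrightarrow> pair (\<lambda>i x. - shift (t - s') \<phi>' i x) w"
      proof (rule pair_limit[OF wX db[OF h0]])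
        fix i assume i: "i \<in> {1..N}"
        have C: "C1_fun (ext \<phi> i) (ext \<phi>' i)" by (rule ext_C1[OF s i])
        show "(\<lambda>x. - shift (t - s') \<phi>' i x) \<in> borel_measurable borel"
          unfolding shift_def by (intro borel_measurable_uminus measurable_compose[OF _ C1_fun_measurable(2)[OF C]]) auto
        have "(\<lambda>n. d (h n) i x) \<longlonglongrightarrow> - shift (t - s') \<phi>' i x" for x
        proof -
          let ?y = "x + (t - s')"
          have "(ext \<phi> i has_real_derivative ext \<phi>' i ?y) (at ?y)" using C by (simp add: C1_fun_def)
          then have "((\<lambda>k. (ext \<phi> i (?y + k) - ext \<phi> i ?y) / k) \<longlongrightarrow> ext \<phi>' i ?y) (at 0)" by (simp add: DERIV_def)
          moreover have "filterlim (\<lambda>n. - h n) (at 0) sequentially"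
          proof -
            have "h n \<noteq> 0" for n using h0[of n] by simp
            then show ?thesis unfolding filterlim_at using tendsto_minus[OF hl] by simp
          qed
          ultimately have "(\<lambda>n. (ext \<phi> i (?y + - h n) - ext \<phi> i ?y) / - h n) \<longlonglongrightarrow> ext \<phi>' i ?y"
            by (rule filterlim_compose)
          from tendsto_minus[OF this] show ?thesis
            by (simp add: d_def \<psi>_def shift_def algebra_simps diff_divide_distrib)
        qed
        then show "AE x in M i. (\<lambda>n. d (h n) i x) \<longlonglongrightarrow> - shift (t - s') \<phi>' i x" by simp
      qed
    qed simp
    have 3: "pair (\<lambda>i x. - shift (t - s') \<phi>' i x) w = - pair (shift (t - s') \<phi>') w"
      unfolding pair_def by (simp add: sum_negf)
    have "pair (\<psi> s') v = pair (\<psi> s') (A_op L p w)"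
      by (rule pair_null[OF bp vX]) (use pair_generator[OF s gi(1)] t s' gi(2) in auto)
    also have "\<dots> = pair (shift (t - s') \<phi>') w"
      unfolding \<psi>_def by (rule pair_generator(1)[OF s gi(1)]) (use t s' in auto)
    finally have 4: "pair (\<psi> s') v = pair (shift (t - s') \<phi>') w" .
    have lim: "((\<lambda>h. pair (\<psi> (s' + h)) (q h) + pair (d h) w) \<longlongrightarrow> 0) (at_right 0)"
      using tendsto_add[OF 1 2] 3 4 by simp
    show ?thesis
    proof (rule Lim_transform_eventually[OF lim])
      have "eventually (\<lambda>h::real. h > 0) (at_right 0)" by (simp add: eventually_at_right_less)
      then show "\<forall>\<^sub>F h in at_right 0. pair (\<psi> (s' + h)) (q h) + pair (d h) w = (F (s' + h) - F s') / h"
      proof eventually_elim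
        case (elim h)
        have "pair (\<psi> (s' + h)) (q h) = (1 / h) * (pair (\<psi> (s' + h)) (S (s' + h) u) - pair (\<psi> (s' + h)) w)"
          unfolding q_def pair_scale using pair_diff[OF bp SX[of "s' + h"] wX] elim s0 by simp
        moreover have "pair (d h) w = (1 / h) * (pair (\<psi> (s' + h)) w - pair (\<psi> s') w)"
        proof -
          have "pair (d h) w = (1 / h) * pair (\<lambda>i x. \<psi> (s' + h) i x - \<psi> s' i x) w"
            unfolding pair_def d_def by (simp add: sum_distrib_left mult.left_commute)
          then show ?thesis using pair_diff_test[OF bp bp wX] by simp
        qed
        ultimately show ?case unfolding F_def w_def
          by (simp only: distrib_left[symmetric]) simp
      qed
    qed
  qed
  have "F t = F 0" by (rule right_derivative_zero_imp_const[OF Fc t(1) Fd])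
  moreover have "F 0 = pair (shift t \<phi>) u"
    unfolding F_def \<psi>_def using pair_null[OF shift_bdd[OF T], of "S 0 u" u t] sg.S_zero_eqv[OF uX]
    by (simp add: sg.eqv_def)
  moreover have "F t = pair \<phi> (S t u)"
    unfolding F_def \<psi>_def
    by (rule pair_cong) (use T in \<open>auto simp: shift_def ext_def test_def\<close>)
  ultimately show ?thesis by simp
qed

end

section \<open>Density of C1 functions, and Bochner integrals tested with functionals\<close>

context Lp_network
begin

text \<open>Truncation at a level \<open>k\<close> reduces the claim to bounded functions, which
  \<open>C1_bump_approx\<close> treats. Both errors tend to \<open>0\<close> by dominated
  convergence.\<close>

lemma C1_Lp_approx:
  assumes u: "u \<in> X" and i: "i \<in> {1..N}" and \<eta>: "\<eta> > 0"
  shows "\<exists>w w'. C1_fun w w' \<and> (\<forall>x. x \<notin> {0<..<L i} \<longrightarrow> w x = 0) \<and>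
     integrable (M i) (\<lambda>x. \<bar>w x - u i x\<bar> powr r) \<and> (LINT x|M i. \<bar>w x - u i x\<bar> powr r) < \<eta>"
proof -
  let ?S = "{0<..<L i}"
  define f where "f = (\<lambda>x. if x \<in> ?S then u i x else 0)"
  have fm: "f \<in> borel_measurable lebesgue" unfolding f_def
    by (rule borel_measurable_if_I) (use XD[OF u i] in auto)
  define c where "c = (\<lambda>k x. max (- real k) (min (real k) (f x)))"
  have cm: "c k \<in> borel_measurable lebesgue" for k
    unfolding c_def by (intro borel_measurable_max borel_measurable_min fm) auto
  have cM: "c k \<in> borel_measurable (M i)" for k by (rule measurable_restrict_space1[OF cm])
  have uM: "u i \<in> borel_measurable (M i)" and uI: "integrable (M i) (\<lambda>x. \<bar>u i x\<bar> powr r)" using XD[OF u i] by auto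
  \<comment> \<open>Two errors below \<open>\<epsilon>\<close>, enlarged by the factor
    \<open>2 powr r\<close> of \<open>powr_add_le\<close>, add up to less than two thirds of
    \<open>\<eta>\<close>.\<close>
  define \<epsilon> where "\<epsilon> = \<eta> / (3 * 2 powr r)"
  have e: "\<epsilon> > 0" using \<eta> by (simp add: \<epsilon>_def)
  have pow0: "(\<lambda>n. \<bar>h n\<bar> powr r) \<longlonglongrightarrow> 0" if "h \<longlonglongrightarrow> 0" for h :: "nat \<Rightarrow> real"
  proof -
    have "(\<lambda>n. \<bar>h n\<bar> powr r) \<longlonglongrightarrow> \<bar>0\<bar> powr r"
      by (rule tendsto_powr'[OF tendsto_rabs[OF that] tendsto_const]) (use r1 in auto)
    then show ?thesis by simp
  qed
  have "(\<lambda>k. LINT x|M i. \<bar>c k x - u i x\<bar> powr r) \<longlonglongrightarrow> (LINT x|M i. 0)"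
  proof (rule integral_dominated_convergence[where w="\<lambda>x. \<bar>u i x\<bar> powr r"])
    show "AE x in M i. (\<lambda>k. \<bar>c k x - u i x\<bar> powr r) \<longlonglongrightarrow> 0"
    proof (rule AE_I2)
      fix x assume "x \<in> space (M i)"
      then have fx: "f x = u i x" by (simp add: f_def)
      obtain k0 :: nat where "\<bar>u i x\<bar> \<le> k0" using real_arch_simple by blast
      then have "c k x - u i x = 0" if "k \<ge> k0" for k using that by (auto simp: c_def fx max_def min_def)
      then have "\<forall>\<^sub>F k in sequentially. c k x - u i x = 0" by (rule eventually_sequentiallyI)
      then show "(\<lambda>k. \<bar>c k x - u i x\<bar> powr r) \<longlonglongrightarrow> 0" by (intro pow0 tendsto_eventually)
    qed
    show "AE x in M i. norm (\<bar>c k x - u i x\<bar> powr r) \<le> \<bar>u i x\<bar> powr r" for k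
    proof (rule AE_I2)
      fix x assume "x \<in> space (M i)"
      then have fx: "f x = u i x" by (simp add: f_def)
      have "\<bar>c k x - u i x\<bar> \<le> \<bar>u i x\<bar>" by (auto simp: c_def fx max_def min_def)
      then show "norm (\<bar>c k x - u i x\<bar> powr r) \<le> \<bar>u i x\<bar> powr r" using r1 by (simp add: powr_mono2)
    qed
  qed (use uI uM cM in auto)
  then have "(\<lambda>k. LINT x|M i. \<bar>c k x - u i x\<bar> powr r) \<longlonglongrightarrow> 0" by simp
  from order_tendstoD(2)[OF this e] obtain k where k: "(LINT x|M i. \<bar>c k x - u i x\<bar> powr r) < \<epsilon>"
    by (auto simp: eventually_sequentially)
  have cui: "integrable (M i) (\<lambda>x. \<bar>c k x - u i x\<bar> powr r)"
  proof (rule Bochner_Integration.integrable_bound[OF uI])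
    show "AE x in M i. norm (\<bar>c k x - u i x\<bar> powr r) \<le> norm (\<bar>u i x\<bar> powr r)"
    proof (rule AE_I2)
      fix x assume "x \<in> space (M i)"
      then have fx: "f x = u i x" by (simp add: f_def)
      have "\<bar>c k x - u i x\<bar> \<le> \<bar>u i x\<bar>" by (auto simp: c_def fx max_def min_def)
      then show "norm (\<bar>c k x - u i x\<bar> powr r) \<le> norm (\<bar>u i x\<bar> powr r)" using r1 by (simp add: powr_mono2)
    qed
  qed (use uM cM in auto)
  have ck: "\<bar>c k x\<bar> \<le> real k" for x by (auto simp: c_def)
  obtain w w' where w: "\<And>n. C1_fun (w n) (w' n)" and w0: "\<And>n x. x \<notin> ?S \<Longrightarrow> w n x = 0"
    and wb: "\<And>n x. \<bar>w n x\<bar> \<le> real k + 1 / Suc n"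
    and wl: "AE x in lebesgue. (\<lambda>n. w n x) \<longlonglongrightarrow> indicator ?S x * c k x"
    using C1_bump_approx[OF cm ck, of 0 "L i"] by blast
  have wM: "w n \<in> borel_measurable (M i)" for n by (rule borel_measurable_lebesgue_onI[OF C1_fun_measurable(1)[OF w]])
  have dom: "\<bar>w n x - c k x\<bar> \<le> 2 * real k + 1" for n x
  proof -
    have "1 / real (Suc n) \<le> 1" by simp
    then show ?thesis using wb[of n x] ck[of x] by linarith
  qed
  have domi: "integrable (M i) (\<lambda>x. (2 * real k + 1) powr r)"
    using integrable_mult_right[OF integrable_one_Ioo[of 0 "L i"], of "(2 * real k + 1) powr r"] by simp
  have "(\<lambda>n. LINT x|M i. \<bar>w n x - c k x\<bar> powr r) \<longlonglongrightarrow> (LINT x|M i. 0)"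
  proof (rule integral_dominated_convergence[where w="\<lambda>x. (2 * real k + 1) powr r"])
    have "AE x in M i. x \<in> ?S" using AE_space[of "M i"] by (auto elim: eventually_mono)
    moreover have "AE x in M i. (\<lambda>n. w n x) \<longlonglongrightarrow> indicator ?S x * c k x"
      by (rule AE_lebesgue_onI[OF wl]) simp
    ultimately show "AE x in M i. (\<lambda>n. \<bar>w n x - c k x\<bar> powr r) \<longlonglongrightarrow> 0"
    proof eventually_elim
      case (elim x)
      then have "(\<lambda>n. w n x - c k x) \<longlonglongrightarrow> 0" by (simp add: LIM_zero)
      then show ?case by (rule pow0)
    qed
    show "AE x in M i. norm (\<bar>w n x - c k x\<bar> powr r) \<le> (2 * real k + 1) powr r" for n
      using dom r1 by (intro AE_I2) (auto intro: powr_mono2)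
  qed (use domi wM cM in auto)
  then have "(\<lambda>n. LINT x|M i. \<bar>w n x - c k x\<bar> powr r) \<longlonglongrightarrow> 0" by simp
  from order_tendstoD(2)[OF this e] obtain n where n: "(LINT x|M i. \<bar>w n x - c k x\<bar> powr r) < \<epsilon>"
    by (auto simp: eventually_sequentially)
  have wci: "integrable (M i) (\<lambda>x. \<bar>w n x - c k x\<bar> powr r)"
  proof (rule Bochner_Integration.integrable_bound[OF domi])
    show "AE x in M i. norm (\<bar>w n x - c k x\<bar> powr r) \<le> norm ((2 * real k + 1) powr r)"
      using dom r1 by (intro AE_I2) (auto intro: powr_mono2)
  qed (use wM cM in auto)
  have b: "\<bar>w n x - u i x\<bar> powr r \<le> 2 powr r * (\<bar>w n x - c k x\<bar> powr r + \<bar>c k x - u i x\<bar> powr r)" for x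
    using powr_add_le[OF r1, of "w n x - c k x" "c k x - u i x"] by simp
  have bi: "integrable (M i) (\<lambda>x. 2 powr r * (\<bar>w n x - c k x\<bar> powr r + \<bar>c k x - u i x\<bar> powr r))"
    using wci cui by auto
  have int: "integrable (M i) (\<lambda>x. \<bar>w n x - u i x\<bar> powr r)"
    by (rule Bochner_Integration.integrable_bound[OF bi]) (use wM uM b in auto)
  have "(LINT x|M i. \<bar>w n x - u i x\<bar> powr r) \<le> (LINT x|M i. 2 powr r * (\<bar>w n x - c k x\<bar> powr r + \<bar>c k x - u i x\<bar> powr r))"
    by (rule integral_mono[OF int bi b])
  also have "\<dots> = 2 powr r * ((LINT x|M i. \<bar>w n x - c k x\<bar> powr r) + (LINT x|M i. \<bar>c k x - u i x\<bar> powr r))"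
    using wci cui by simp
  also have "\<dots> < 2 powr r * (\<epsilon> + \<epsilon>)" using n k by (intro mult_strict_left_mono add_strict_mono) auto
  also have "\<dots> < \<eta>" using \<eta> by (simp add: \<epsilon>_def field_simps)
  finally show ?thesis using w w0 int by blast
qed

end

text \<open>No measurability of \<open>g\<close> is assumed: a simple function below
  \<open>c * g\<close> is divided by \<open>c\<close>. The lemma is applied to
  \<open>nrm (f x - s k x)\<close>, whose measurability in \<open>x\<close> is not part of the
  definition of the integral.\<close>

lemma nn_integral_cmult_le:
  assumes c: "c > 0"
  shows "(\<integral>\<^sup>+x. ennreal c * g x \<partial>M) \<le> ennreal c * (\<integral>\<^sup>+x. g x \<partial>M)"
  unfolding nn_integral_def[of M "\<lambda>x. ennreal c * g x"]
proof (rule SUP_least)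
  fix s assume "s \<in> {s. simple_function M s \<and> s \<le> (\<lambda>x. ennreal c * g x)}"
  then have s: "simple_function M s" and le: "\<And>x. s x \<le> ennreal c * g x" by (auto simp: le_fun_def)
  define s' where "s' = (\<lambda>x. ennreal (1 / c) * s x)"
  have cc: "ennreal c * ennreal (1 / c) = 1" "ennreal (1 / c) * ennreal c = 1"
    using c by (simp_all add: ennreal_mult[symmetric])
  have s': "simple_function M s'" unfolding s'_def by (rule simple_function_mult[OF simple_function_const s])
  have "s' x \<le> g x" for x
  proof -
    have "s' x \<le> ennreal (1 / c) * (ennreal c * g x)" unfolding s'_def by (rule mult_left_mono[OF le]) simp
    also have "\<dots> = g x" using cc by (simp add: mult.assoc[symmetric])
    finally show ?thesis .
  qed
  then have "integral\<^sup>S M s' \<le> (\<integral>\<^sup>+x. g x \<partial>M)"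
    unfolding nn_integral_def by (intro SUP_upper) (use s' in \<open>auto simp: le_fun_def\<close>)
  then have "ennreal c * integral\<^sup>S M s' \<le> ennreal c * (\<integral>\<^sup>+x. g x \<partial>M)" by (rule mult_left_mono) simp
  moreover have "ennreal c * integral\<^sup>S M s' = integral\<^sup>S M s"
  proof -
    have "ennreal c * integral\<^sup>S M s' = integral\<^sup>S M (\<lambda>x. ennreal c * s' x)" by (rule simple_integral_mult[OF s', symmetric])
    also have "(\<lambda>x. ennreal c * s' x) = s" using cc by (simp add: s'_def mult.assoc[symmetric])
    finally show ?thesis .
  qed
  ultimately show "integral\<^sup>S M s \<le> ennreal c * (\<integral>\<^sup>+x. g x \<partial>M)" by simp
qed

text \<open>This turns the vector-valued Duhamel formula into scalar integrals. A bounded functional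
  maps the approximating simple functions to scalar ones and commutes with their integrals, and its
  bound transfers the convergence.\<close>

lemma (in quasi_normed) bochner_functional:
  assumes b: "has_bochner_integral_in X nrm (lebesgue_on {c..d::real}) f w"
    and l: "linear_functional_in X nrm \<Lambda>"
  shows "has_bochner_integral (lebesgue_on {c..d}) (\<lambda>x. \<Lambda> (f x)) (\<Lambda> w)"
proof -
  let ?M = "lebesgue_on {c..d}"
  obtain s where s: "\<And>k. Bochner_Integration.simple_bochner_integrable ?M (s k)"
    and sX: "\<And>k. s k ` space ?M \<subseteq> X"
    and ae: "AE x in ?M. (\<lambda>k. nrm (f x - s k x)) \<longlonglongrightarrow> 0"
    and l1: "(\<lambda>k. \<integral>\<^sup>+x. ennreal (nrm (f x - s k x)) \<partial>?M) \<longlonglongrightarrow> 0"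
    and lw: "(\<lambda>k. nrm (Bochner_Integration.simple_bochner_integral ?M (s k) - w)) \<longlonglongrightarrow> 0"
    and wX: "w \<in> X" and fX: "\<And>x. x \<in> space ?M \<Longrightarrow> f x \<in> X"
    using b unfolding has_bochner_integral_in_def by blast
  obtain K0 where K0: "\<And>u. u \<in> X \<Longrightarrow> \<bar>\<Lambda> u\<bar> \<le> K0 * nrm u" using l unfolding linear_functional_in_def by blast
  define K where "K = \<bar>K0\<bar>"
  have Kp: "K \<ge> 0" by (simp add: K_def)
  have K: "\<bar>\<Lambda> u\<bar> \<le> K * nrm u" if "u \<in> X" for u
    using order_trans[OF K0[OF that] mult_right_mono[OF abs_ge_self nrm_nonneg]] by (simp add: K_def)
  have add: "\<And>u v. u \<in> X \<Longrightarrow> v \<in> X \<Longrightarrow> \<Lambda> (u + v) = \<Lambda> u + \<Lambda> v"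
    and sc: "\<And>c u. u \<in> X \<Longrightarrow> \<Lambda> (c *\<^sub>R u) = c * \<Lambda> u" using l unfolding linear_functional_in_def by blast+
  have z: "\<Lambda> 0 = 0" using sc[OF Xzero, of 0] by simp
  have dif: "\<Lambda> (u - v) = \<Lambda> u - \<Lambda> v" if "u \<in> X" "v \<in> X" for u v
    using add[OF that(1) Xminus[OF that(2)]] sc[OF that(2), of "-1"] by simp
  have lsum: "\<Lambda> (\<Sum>y\<in>I. g y *\<^sub>R y) = (\<Sum>y\<in>I. g y * \<Lambda> y)" if "finite I" "I \<subseteq> X" for I g
    using that
  proof (induction I rule: finite_induct)
    case (insert x F)
    have "\<Lambda> (g x *\<^sub>R x + (\<Sum>y\<in>F. g y *\<^sub>R y)) = \<Lambda> (g x *\<^sub>R x) + \<Lambda> (\<Sum>y\<in>F. g y *\<^sub>R y)"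
      by (rule add) (use insert in \<open>auto intro!: Xscale Xsum\<close>)
    then show ?case using insert sc by simp
  qed (simp add: z)
  have si: "Bochner_Integration.simple_bochner_integrable ?M (\<lambda>x. \<Lambda> (s k x))" for k
    using simple_bochner_integrable_compose2[of "\<lambda>x y. \<Lambda> x" ?M "s k" "s k"] z s by simp
  have fin: "finite (s k ` space ?M)" for k
    using s[of k] by (auto elim!: simple_bochner_integrable.cases simp: simple_function_def)
  have sI: "Bochner_Integration.simple_bochner_integral ?M (s k) \<in> X" for k
    unfolding simple_bochner_integral_def using sX fin by (intro Xsum Xscale) auto
  have sint: "Bochner_Integration.simple_bochner_integral ?M (\<lambda>x. \<Lambda> (s k x)) = \<Lambda> (Bochner_Integration.simple_bochner_integral ?M (s k))" for k
  proof -
    have "Bochner_Integration.simple_bochner_integral ?M (\<lambda>x. \<Lambda> (s k x)) =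
      (\<Sum>y\<in>s k ` space ?M. measure ?M {x \<in> space ?M. s k x = y} *\<^sub>R \<Lambda> y)"
      by (rule simple_bochner_integral_partition) (use si s in \<open>auto elim: simple_bochner_integrable.cases\<close>)
    also have "\<dots> = \<Lambda> (Bochner_Integration.simple_bochner_integral ?M (s k))"
      unfolding simple_bochner_integral_def using lsum[OF fin sX] by simp
    finally show ?thesis .
  qed
  have sm: "(\<lambda>x. \<Lambda> (s k x)) \<in> borel_measurable ?M" for k
    using si[of k] by (auto elim!: simple_bochner_integrable.cases intro: borel_measurable_simple_function)
  have ptw: "\<bar>\<Lambda> (f x) - \<Lambda> (s k x)\<bar> \<le> K * nrm (f x - s k x)" if "x \<in> space ?M" for x k
  proof -
    have "f x \<in> X" "s k x \<in> X" using fX[OF that] sX[of k] that by blast+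
    then show ?thesis using K[OF Xdiff] dif by metis
  qed
  have conv: "AE x in ?M. (\<lambda>k. \<Lambda> (s k x)) \<longlonglongrightarrow> \<Lambda> (f x)"
    using ae AE_space
  proof eventually_elim
    case (elim x)
    have "(\<lambda>k. \<Lambda> (f x) - \<Lambda> (s k x)) \<longlonglongrightarrow> 0"
      by (rule Lim_null_comparison[of _ "\<lambda>k. K * nrm (f x - s k x)"])
        (use ptw[OF elim(2)] tendsto_mult_left[OF elim(1), of K] in auto)
    from tendsto_diff[OF tendsto_const[of "\<Lambda> (f x)"] this] show ?case by simp
  qed
  have meas: "(\<lambda>x. \<Lambda> (f x)) \<in> borel_measurable ?M"
  proof -
    \<comment> \<open>The composition is a limit of measurable functions only almost everywhere; the
      completeness of Lebesgue measure makes it measurable nevertheless.\<close>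
    define g where "g = (\<lambda>x. lim (\<lambda>k. \<Lambda> (s k x)))"
    have gm: "g \<in> borel_measurable ?M" unfolding g_def by (rule borel_measurable_lim_metric[OF sm])
    have gm': "(\<lambda>x. if x \<in> {c..d} then g x else 0) \<in> borel_measurable lebesgue"
      by (rule borel_measurable_if_I) (use gm in auto)
    have "AE x in ?M. g x = \<Lambda> (f x)" using conv by eventually_elim (simp add: g_def limI)
    then have "AE x in lebesgue. x \<in> {c..d} \<longrightarrow> g x = \<Lambda> (f x)" by (subst (asm) AE_restrict_space_iff) auto
    then have "AE x in lebesgue. (if x \<in> {c..d} then g x else 0) = (if x \<in> {c..d} then \<Lambda> (f x) else 0)"
      by eventually_elim auto
    from borel_measurable_AE[OF gm' this]
    have "(\<lambda>x. if x \<in> {c..d} then \<Lambda> (f x) else 0) \<in> borel_measurable lebesgue" .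
    then show ?thesis by (rule borel_measurable_if_D)
  qed
  show ?thesis
  proof (rule has_bochner_integral.intros[OF meas si])
    show "(\<lambda>k. \<integral>\<^sup>+x. ennreal (norm (\<Lambda> (f x) - \<Lambda> (s k x))) \<partial>?M) \<longlonglongrightarrow> 0"
    proof (rule tendsto_sandwich[OF always_eventually always_eventually tendsto_const])
      show "\<forall>k. (\<integral>\<^sup>+x. ennreal (norm (\<Lambda> (f x) - \<Lambda> (s k x))) \<partial>?M) \<le> ennreal (K + 1) * (\<integral>\<^sup>+x. ennreal (nrm (f x - s k x)) \<partial>?M)"
      proof
        fix k
        have "ennreal (norm (\<Lambda> (f x) - \<Lambda> (s k x))) \<le> ennreal (K + 1) * ennreal (nrm (f x - s k x))" if "x \<in> space ?M" for x
        proof -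
          have "\<bar>\<Lambda> (f x) - \<Lambda> (s k x)\<bar> \<le> (K + 1) * nrm (f x - s k x)"
            using ptw[OF that, of k] nrm_nonneg[of "f x - s k x"] by (simp add: algebra_simps)
          then have "ennreal \<bar>\<Lambda> (f x) - \<Lambda> (s k x)\<bar> \<le> ennreal ((K + 1) * nrm (f x - s k x))" by (rule ennreal_leI)
          also have "\<dots> = ennreal (K + 1) * ennreal (nrm (f x - s k x))"
            by (rule ennreal_mult) (use Kp nrm_nonneg in auto)
          finally show ?thesis by simp
        qed
        then have "(\<integral>\<^sup>+x. ennreal (norm (\<Lambda> (f x) - \<Lambda> (s k x))) \<partial>?M) \<le> (\<integral>\<^sup>+x. ennreal (K + 1) * ennreal (nrm (f x - s k x)) \<partial>?M)"
          by (rule nn_integral_mono)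
        also have "\<dots> \<le> ennreal (K + 1) * (\<integral>\<^sup>+x. ennreal (nrm (f x - s k x)) \<partial>?M)"
          by (rule nn_integral_cmult_le) (use Kp in simp)
        finally show "(\<integral>\<^sup>+x. ennreal (norm (\<Lambda> (f x) - \<Lambda> (s k x))) \<partial>?M) \<le> ennreal (K + 1) * (\<integral>\<^sup>+x. ennreal (nrm (f x - s k x)) \<partial>?M)" .
      qed
      show "(\<lambda>k. ennreal (K + 1) * (\<integral>\<^sup>+x. ennreal (nrm (f x - s k x)) \<partial>?M)) \<longlonglongrightarrow> 0"
        using ennreal_tendsto_cmult[OF _ l1, of "ennreal (K + 1)"] by simp
    qed auto
    show "(\<lambda>k. Bochner_Integration.simple_bochner_integral ?M (\<lambda>x. \<Lambda> (s k x))) \<longlonglongrightarrow> \<Lambda> w"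
    proof (rule Lim_transform[OF tendsto_const], rule Lim_null_comparison)
      show "(\<lambda>k. K * nrm (Bochner_Integration.simple_bochner_integral ?M (s k) - w)) \<longlonglongrightarrow> 0"
        using tendsto_mult_left[OF lw, of K] by simp
      have nd: "norm (\<Lambda> v - \<Lambda> w) \<le> K * nrm (v - w)" if "v \<in> X" for v
        using K[OF Xdiff[OF that wX]] unfolding dif[OF that wX] real_norm_def .
      show "\<forall>\<^sub>F k in sequentially. norm (Bochner_Integration.simple_bochner_integral ?M (\<lambda>x. \<Lambda> (s k x)) - \<Lambda> w)
          \<le> K * nrm (Bochner_Integration.simple_bochner_integral ?M (s k) - w)"
        unfolding sint by (rule always_eventually) (rule allI, rule nd[OF sI])
    qed
  qed
qed

section \<open>Extension of the duality to all states and to bounded Borel test functions\<close>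

context transport_semigroup
begin

text \<open>C1 functions that vanish at both ends of their circles have boundary values
  \<open>0\<close> and hence satisfy the coupling condition for every \<open>m\<close>. These states
  are already dense.\<close>

lemma domain_dense:
  assumes u: "u \<in> X" and \<epsilon>: "\<epsilon> > 0"
  shows "\<exists>d\<in>A_dom N L m p. nrm (d - u) < \<epsilon>"
proof -
  \<comment> \<open>\<open>N\<close> components contribute at most \<open>\<eta>\<close> each; the
    divisor \<open>N + 1\<close> keeps their sum strictly below
    \<open>\<epsilon> powr r\<close>.\<close>
  define \<eta> where "\<eta> = \<epsilon> powr r / (N + 1)"
  have \<eta>: "\<eta> > 0" using \<epsilon> by (simp add: \<eta>_def)
  define Pr where "Pr = (\<lambda>i w w'. C1_fun w w' \<and> (\<forall>x. x \<notin> {0<..<L i} \<longrightarrow> w x = 0) \<and>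
     integrable (M i) (\<lambda>x. \<bar>w x - u i x\<bar> powr r) \<and> (LINT x|M i. \<bar>w x - u i x\<bar> powr r) < \<eta>)"
  have "\<exists>w w'. Pr i w w'" if "i \<in> {1..N}" for i
    unfolding Pr_def by (rule C1_Lp_approx[OF u that \<eta>])
  then obtain w w' where Pr: "\<And>i. i \<in> {1..N} \<Longrightarrow> Pr i (w i) (w' i)" by metis
  have C: "\<And>i. i \<in> {1..N} \<Longrightarrow> C1_fun (w i) (w' i)"
    and w0: "\<And>i x. i \<in> {1..N} \<Longrightarrow> x \<notin> {0<..<L i} \<Longrightarrow> w i x = 0"
    and wi: "\<And>i. i \<in> {1..N} \<Longrightarrow> integrable (M i) (\<lambda>x. \<bar>w i x - u i x\<bar> powr r)"
    and wl: "\<And>i. i \<in> {1..N} \<Longrightarrow> (LINT x|M i. \<bar>w i x - u i x\<bar> powr r) < \<eta>"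
    using Pr unfolding Pr_def by blast+
  have Lpb: "h \<in> Lp_space p (L i)" if hm: "h \<in> borel_measurable borel" and hb: "\<And>x. \<bar>h x\<bar> \<le> K" for h K i
  proof -
    have K: "K \<ge> 0" using hb[of 0] by linarith
    have "integrable (M i) (\<lambda>x. 1 * \<bar>h x\<bar> powr r)"
      by (rule integrable_mult_bounded_AE[OF integrable_one_Ioo, where K="K powr r"])
        (use hm hb r1 in \<open>auto intro!: AE_I2 borel_measurable_lebesgue_onI powr_mono2\<close>)
    then show ?thesis using Lp_space_iff[OF p] borel_measurable_lebesgue_onI[OF hm] by simp
  qed
  have wLp: "w i \<in> Lp_space p (L i) \<and> w' i \<in> Lp_space p (L i)" if i: "i \<in> {1..N}" for i
  proof -
    obtain K where "\<forall>x. \<bar>w i x\<bar> \<le> K \<and> \<bar>w' i x\<bar> \<le> K" using C1_fun_global_bound[OF C[OF i] w0[OF i]] by blast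
    then show ?thesis using Lpb C1_fun_measurable[OF C[OF i]] by blast
  qed
  have wX: "w \<in> X" using wLp by (simp add: X_space_def)
  have "w \<in> A_dom N L m p"
  proof -
    have "w i \<in> W1p_space p (L i)" if i: "i \<in> {1..N}" for i
      using wLp[OF i] C1_fun_has_weak_derivative[OF C[OF i] Lp[OF i]] by (auto simp: W1p_space_def)
    moreover have "cont_rep (L i) (w i) x = 0" if i: "i \<in> {1..N}" and x: "x = 0 \<or> x = L i" for i x
    proof -
      have "cont_rep (L i) (w i) x = w i x"
        by (rule cont_rep_continuous) (use continuous_on_subset[OF C1_fun_continuous[OF C[OF i]]] Lp[OF i] x in auto)
      then show ?thesis using w0[OF i, of x] x by auto
    qed
    ultimately show ?thesis unfolding A_dom_def by simp
  qed
  moreover have "nrm (w - u) < \<epsilon>"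
  proof -
    have "J (w - u) = (\<Sum>i=1..N. LINT x|M i. \<bar>w i x - u i x\<bar> powr r)" by (simp add: J_def)
    also have "\<dots> \<le> (\<Sum>i=1..N. \<eta>)" by (rule sum_mono) (use wl in \<open>simp add: less_imp_le\<close>)
    also have "\<dots> < \<epsilon> powr r" using \<epsilon> by (simp add: \<eta>_def field_simps)
    finally have "J (w - u) powr (1 / r) < (\<epsilon> powr r) powr (1 / r)"
      using r1 J_nonneg by (intro powr_less_mono2) auto
    then show ?thesis using nrm_eq[OF qn.Xdiff[OF wX u]] r1 \<epsilon> by (simp add: powr_powr)
  qed
  ultimately show ?thesis by blast
qed

lemma test_pair_lipschitz:
  assumes b: "bdd_test K \<phi>" and u: "u \<in> X" and v: "v \<in> X"
  shows "\<bar>pair \<phi> u - pair \<phi> v\<bar> \<le> \<bar>K\<bar> * ((\<Sum>i=1..N. L i) + 1) * nrm (u - v)"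
proof -
  have "\<bar>pair \<phi> u - pair \<phi> v\<bar> = \<bar>pair \<phi> (u - v)\<bar>" using pair_diff[OF b u v] by simp
  also have "\<dots> \<le> K * N1 (u - v)" by (rule pair_bound[OF b qn.Xdiff[OF u v]])
  also have "\<dots> \<le> \<bar>K\<bar> * N1 (u - v)" by (rule mult_right_mono) (use N1_nonneg in auto)
  also have "\<dots> \<le> \<bar>K\<bar> * (((\<Sum>i=1..N. L i) + 1) * nrm (u - v))" by (rule mult_left_mono[OF N1_le[OF qn.Xdiff[OF u v]]]) simp
  finally show ?thesis by (simp add: mult.assoc)
qed

text \<open>Both sides are Lipschitz in \<open>u\<close> for the quasi-norm, so the identity extends
  from the dense domain of the generator.\<close>

lemma pair_semigroup_smooth_all:
  assumes s: "smooth \<phi> \<phi>'" and u: "u \<in> X" and t: "0 \<le> t" "t \<le> Lmin"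
  shows "pair \<phi> (S t u) = pair (shift t \<phi>) u"
proof -
  obtain K where T: "test K \<phi>" using smooth_test[OF s] by blast
  have b: "bdd_test K \<phi>" using T by (simp add: test_def)
  have b': "bdd_test K (shift t \<phi>)" by (rule shift_bdd[OF T])
  define C where "C = \<bar>K\<bar> * ((\<Sum>i=1..N. L i) + 1)"
  have C: "C \<ge> 0" unfolding C_def using Lp by (intro mult_nonneg_nonneg add_nonneg_nonneg sum_nonneg) (auto intro: less_imp_le)
  obtain K' where K': "K' \<ge> 0" "\<And>u v. u \<in> X \<Longrightarrow> v \<in> X \<Longrightarrow> nrm (S t u - S t v) \<le> K' * nrm (u - v)"
    using sg.S_lipschitz[OF t(1)] by blast
  have "\<bar>pair \<phi> (S t u) - pair (shift t \<phi>) u\<bar> \<le> 0"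
  proof (rule field_le_epsilon)
    fix e :: real assume e: "e > 0"
    define \<delta> where "\<delta> = e / (C * K' + C + 1)"
    have D: "C * K' + C + 1 > 0" using C K'(1) by (simp add: add_nonneg_pos)
    have \<delta>: "\<delta> > 0" using e D by (simp add: \<delta>_def)
    obtain d where d: "d \<in> A_dom N L m p" "nrm (d - u) < \<delta>" using domain_dense[OF u \<delta>] by blast
    have dX: "d \<in> X" using pair_generator(2)[OF s d(1) t] .
    have SX: "S t u \<in> X" "S t d \<in> X" using sg.S_in t u dX by auto
    have eq: "pair \<phi> (S t d) = pair (shift t \<phi>) d" by (rule pair_semigroup_smooth[OF s d(1) t])
    have "\<bar>pair \<phi> (S t d) - pair \<phi> (S t u)\<bar> \<le> C * nrm (S t d - S t u)"
      unfolding C_def by (rule test_pair_lipschitz[OF b SX(2,1)])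
    also have "\<dots> \<le> C * (K' * nrm (d - u))" by (rule mult_left_mono[OF K'(2)[OF dX u] C])
    finally have 1: "\<bar>pair \<phi> (S t d) - pair \<phi> (S t u)\<bar> \<le> C * K' * nrm (d - u)" by (simp add: mult.assoc)
    have 2: "\<bar>pair (shift t \<phi>) d - pair (shift t \<phi>) u\<bar> \<le> C * nrm (d - u)"
      unfolding C_def by (rule test_pair_lipschitz[OF b' dX u])
    have "\<bar>pair \<phi> (S t u) - pair (shift t \<phi>) u\<bar> \<le> (C * K' + C) * nrm (d - u)"
      using 1 2 eq by (simp add: algebra_simps)
    also have "\<dots> \<le> (C * K' + C + 1) * \<delta>" using d(2) C K'(1) qn.nrm_nonneg by (intro mult_mono) auto
    also have "\<dots> = e" using D by (simp add: \<delta>_def)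
    finally show "\<bar>pair \<phi> (S t u) - pair (shift t \<phi>) u\<bar> \<le> 0 + e" by simp
  qed
  then show ?thesis by simp
qed

lemma test_approx:
  assumes T: "test K \<phi>"
  shows "\<exists>w w'. (\<forall>n. smooth (w n) (w' n) \<and> test (K + 1 / Suc n) (w n)) \<and>
    (\<forall>i\<in>{1..N}. AE x in lebesgue. (\<lambda>n. w n i x) \<longlonglongrightarrow> \<phi> i x)"
proof -
  define Pr where "Pr = (\<lambda>i v v'. (\<forall>n. C1_fun (v n) (v' n)) \<and> (\<forall>n x. x \<notin> {0<..<L i} \<longrightarrow> v n x = 0) \<and>
     (\<forall>n x. \<bar>v n x\<bar> \<le> K + 1 / (Suc n)) \<and>
     (AE x in lebesgue. (\<lambda>n. v n x) \<longlonglongrightarrow> \<phi> i x))"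
  have "\<exists>v v'. Pr i v v'" if i: "i \<in> {1..N}" for i
  proof -
    have m: "\<phi> i \<in> borel_measurable lebesgue" using T i by (simp add: test_def bdd_test_def measurable_completion)
    have b: "\<bar>\<phi> i x\<bar> \<le> K" for x using T i by (simp add: test_def bdd_test_def)
    have e: "indicator {0<..<L i} x * \<phi> i x = \<phi> i x" for x using T i by (auto simp: test_def indicator_def)
    show ?thesis using C1_bump_approx[OF m b, of 0 "L i"] unfolding e Pr_def by simp
  qed
  then obtain v v' where Pr: "\<And>i. i \<in> {1..N} \<Longrightarrow> Pr i (v i) (v' i)" by metis
  have v: "\<And>i n. i \<in> {1..N} \<Longrightarrow> C1_fun (v i n) (v' i n)"
    "\<And>i n x. i \<in> {1..N} \<Longrightarrow> x \<notin> {0<..<L i} \<Longrightarrow> v i n x = 0"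
    "\<And>i n x. i \<in> {1..N} \<Longrightarrow> \<bar>v i n x\<bar> \<le> K + 1 / (Suc n)"
    "\<And>i. i \<in> {1..N} \<Longrightarrow> AE x in lebesgue. (\<lambda>n. v i n x) \<longlonglongrightarrow> \<phi> i x"
    using Pr unfolding Pr_def by blast+
  show ?thesis
    by (rule exI[of _ "\<lambda>n i. v i n"], rule exI[of _ "\<lambda>n i. v' i n"])
      (use v C1_fun_measurable(1)[OF v(1)] in \<open>simp add: smooth_def test_def bdd_test_def\<close>)
qed

lemma bdd_test_mono: "bdd_test K \<phi> \<Longrightarrow> K \<le> K' \<Longrightarrow> bdd_test K' \<phi>"
  unfolding bdd_test_def by (meson order_trans)

text \<open>The uniqueness proof tests with signs of integrable functions, so merely bounded Borel
  test functions are needed. They are bounded limits of smooth ones almost everywhere, and the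
  shifted functions converge as well because translations preserve null sets.\<close>

lemma pair_semigroup:
  assumes T: "test K \<phi>" and u: "u \<in> X" and t: "0 \<le> t" "t \<le> Lmin"
  shows "pair \<phi> (S t u) = pair (shift t \<phi>) u"
proof -
  obtain w w' where w: "\<And>n. smooth (w n) (w' n)" "\<And>n. test (K + 1 / Suc n) (w n)"
    and wl: "\<And>i. i \<in> {1..N} \<Longrightarrow> AE x in lebesgue. (\<lambda>n. w n i x) \<longlonglongrightarrow> \<phi> i x"
    using test_approx[OF T] by blast
  have le: "K + 1 / real (Suc n) \<le> K + 1" for n by simp
  have m: "\<And>i. i \<in> {1..N} \<Longrightarrow> \<phi> i \<in> borel_measurable borel" using T by (simp add: test_def bdd_test_def)
  have b1: "bdd_test (K + 1) (w n)" for n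
    by (rule bdd_test_mono[OF _ le[of n]]) (use w(2)[of n] in \<open>simp add: test_def\<close>)
  have b2: "bdd_test (K + 1) (shift t (w n))" for n
    by (rule bdd_test_mono[OF shift_bdd[OF w(2)] le[of n]])
  have 1: "(\<lambda>n. pair (w n) (S t u)) \<longlonglongrightarrow> pair \<phi> (S t u)"
  proof (rule pair_limit[OF sg.S_in[OF t(1) u] b1 m])
    show "AE x in M i. (\<lambda>n. w n i x) \<longlonglongrightarrow> \<phi> i x" if "i \<in> {1..N}" for i
      by (rule AE_lebesgue_onI[OF wl[OF that]]) simp
  qed
  have 2: "(\<lambda>n. pair (shift t (w n)) u) \<longlonglongrightarrow> pair (shift t \<phi>) u"
  proof (rule pair_limit[OF u b2])
    fix i assume i: "i \<in> {1..N}"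
    show "shift t \<phi> i \<in> borel_measurable borel" by (rule bdd_test_measurable[OF shift_bdd[OF T] i])
    have "AE x in lebesgue. \<forall>k\<in>{1..N}. (\<lambda>n. w n k (x + (t - L i))) \<longlonglongrightarrow> \<phi> k (x + (t - L i))"
    proof (rule AE_finite_allI)
      show "AE x in lebesgue. (\<lambda>n. w n k (x + (t - L i))) \<longlonglongrightarrow> \<phi> k (x + (t - L i))" if "k \<in> {1..N}" for k
        by (rule AE_lebesgue_translate[OF wl[OF that]])
    qed simp
    moreover have "AE x in lebesgue. (\<lambda>n. w n i (x + t)) \<longlonglongrightarrow> \<phi> i (x + t)"
      by (rule AE_lebesgue_translate[OF wl[OF i]])
    ultimately have "AE x in lebesgue. (\<lambda>n. shift t (w n) i x) \<longlonglongrightarrow> shift t \<phi> i x"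
    proof eventually_elim
      case (elim x)
      then show ?case unfolding shift_def ext_def
        by (intro tendsto_intros) (auto simp: algebra_simps)
    qed
    then show "AE x in M i. (\<lambda>n. shift t (w n) i x) \<longlonglongrightarrow> shift t \<phi> i x" by (rule AE_lebesgue_onI) simp
  qed
  show ?thesis
    by (rule LIMSEQ_unique[OF 1]) (use 2 pair_semigroup_smooth_all[OF w(1) u t] in simp)
qed

end

section \<open>Mild solutions\<close>

locale mild = transport_semigroup N L p m S Lmin
  for N L p m S Lmin +
  fixes Nd :: nat and a b :: "nat \<Rightarrow> real" and \<alpha> :: "nat \<Rightarrow> real \<Rightarrow> real" and z0 :: state and z :: "real \<Rightarrow> state"
  assumes Nd: "Nd \<le> N" and z0: "z0 \<in> X_space N L p"
    and zX: "\<And>t. t \<ge> 0 \<Longrightarrow> z t \<in> X_space N L p"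
    and zc: "\<And>t. t \<ge> 0 \<Longrightarrow> ((\<lambda>s. X_norm N L p (z s - z t)) \<longlongrightarrow> 0) (at t within {0..})"
    and duhamel: "\<And>t. t \<ge> 0 \<Longrightarrow> \<exists>w.
             has_bochner_integral_in (X_space N L p) (X_norm N L p) (lebesgue_on {0..t})
               (\<lambda>\<tau>. S (t - \<tau>) (\<Sum>i=1..Nd. \<alpha> i \<tau> *\<^sub>R B_op a b i (z \<tau>))) w \<and>
             X_norm N L p (z t - (S t z0 + w)) = 0"
begin

definition source :: "real \<Rightarrow> state" where
  "source \<tau> = (\<Sum>i=1..Nd. \<alpha> i \<tau> *\<^sub>R B_op a b i (z \<tau>))"

lemma B_op_X:
  assumes u: "u \<in> X"
  shows "B_op a b i u \<in> X"
proof (rule XI)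
  fix j assume j: "j \<in> {1..N}"
  have e: "B_op a b i u j = (if j = i then (\<lambda>x. - indicator {a i..b i} x * u j x) else (\<lambda>x. 0))"
    by (auto simp: B_op_def)
  have im: "(indicator {a i..b i} :: real \<Rightarrow> real) \<in> borel_measurable (M j)"
    by (rule borel_measurable_lebesgue_onI) simp
  show m: "B_op a b i u j \<in> borel_measurable (M j)"
    unfolding e using XD(1)[OF u j] im by (auto intro!: borel_measurable_times)
  show "integrable (M j) (\<lambda>x. \<bar>B_op a b i u j x\<bar> powr r)"
  proof (rule Bochner_Integration.integrable_bound[OF XD(2)[OF u j]])
    show "AE x in M j. norm (\<bar>B_op a b i u j x\<bar> powr r) \<le> norm (\<bar>u j x\<bar> powr r)"
      unfolding e by (rule AE_I2) (auto simp: indicator_def)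
  qed (use m in auto)
qed

lemma source_X: "\<tau> \<ge> 0 \<Longrightarrow> source \<tau> \<in> X"
  unfolding source_def by (intro qn.Xsum qn.Xscale B_op_X zX) auto

definition coef :: "nat \<Rightarrow> real \<Rightarrow> real" where
  "coef j \<tau> = (if j \<in> {1..Nd} then \<alpha> j \<tau> else 0)"

lemma pair_sum:
  assumes b: "bdd_test K \<phi>" and I: "finite I" and u: "\<And>i. i \<in> I \<Longrightarrow> u i \<in> X"
  shows "pair \<phi> (sum u I) = (\<Sum>i\<in>I. pair \<phi> (u i))"
  using I u
proof (induction I rule: finite_induct)
  case empty
  then show ?case by (simp add: pair_def)
next
  case (insert i I)
  have X: "u i \<in> X" "sum u I \<in> X" using insert qn.Xsum[of I u] by blast+
  have "pair \<phi> (sum u (insert i I)) = pair \<phi> (u i) + pair \<phi> (sum u I)"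
    unfolding sum.insert[OF insert(1,2)] by (rule pair_add[OF b X])
  also have "pair \<phi> (sum u I) = (\<Sum>i\<in>I. pair \<phi> (u i))" using insert by blast
  finally show ?case unfolding sum.insert[OF insert(1,2)] .
qed

lemma pair_source:
  assumes bt: "bdd_test K \<psi>" and \<tau>: "\<tau> \<ge> 0"
  shows "pair \<psi> (source \<tau>) = - (\<Sum>j=1..N. coef j \<tau> * (LINT x|M j. indicator {a j..b j} x * z \<tau> j x * \<psi> j x))"
proof -
  have "pair \<psi> (B_op a b i (z \<tau>)) = - (LINT x|M i. indicator {a i..b i} x * z \<tau> i x * \<psi> i x)" if i: "i \<in> {1..Nd}" for i
  proof -
    have iN: "i \<in> {1..N}" using i Nd by auto
    have "pair \<psi> (B_op a b i (z \<tau>)) = (\<Sum>j=1..N. if j = i then - (LINT x|M i. indicator {a i..b i} x * z \<tau> i x * \<psi> i x) else 0)"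
      unfolding pair_def by (rule sum.cong) (auto simp: B_op_def)
    then show ?thesis using iN by simp
  qed
  note B = this
  have "pair \<psi> (source \<tau>) = (\<Sum>i=1..Nd. pair \<psi> (\<alpha> i \<tau> *\<^sub>R B_op a b i (z \<tau>)))"
    unfolding source_def by (rule pair_sum[OF bt]) (auto intro: qn.Xscale B_op_X zX[OF \<tau>])
  also have "\<dots> = (\<Sum>i=1..Nd. - (\<alpha> i \<tau> * (LINT x|M i. indicator {a i..b i} x * z \<tau> i x * \<psi> i x)))"
    by (rule sum.cong) (simp_all add: pair_scale B)
  also have "\<dots> = - (\<Sum>i\<in>{1..Nd}. coef i \<tau> * (LINT x|M i. indicator {a i..b i} x * z \<tau> i x * \<psi> i x))"
    by (simp add: sum_negf coef_def)
  also have "(\<Sum>i\<in>{1..Nd}. coef i \<tau> * (LINT x|M i. indicator {a i..b i} x * z \<tau> i x * \<psi> i x)) =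
      (\<Sum>i\<in>{1..N}. coef i \<tau> * (LINT x|M i. indicator {a i..b i} x * z \<tau> i x * \<psi> i x))"
    by (rule sum.mono_neutral_left) (use Nd in \<open>auto simp: coef_def\<close>)
  finally show ?thesis .
qed

lemma pair_duhamel:
  assumes bt: "bdd_test K \<phi>" and t: "t \<ge> 0"
  shows "has_bochner_integral (lebesgue_on {0..t}) (\<lambda>\<tau>. pair \<phi> (S (t - \<tau>) (source \<tau>))) (pair \<phi> (z t) - pair \<phi> (S t z0))"
proof -
  obtain w where w: "has_bochner_integral_in X nrm (lebesgue_on {0..t}) (\<lambda>\<tau>. S (t - \<tau>) (source \<tau>)) w"
    and zw: "nrm (z t - (S t z0 + w)) = 0" using duhamel[OF t] unfolding source_def by blast
  have wX: "w \<in> X" using w by (simp add: has_bochner_integral_in_def)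
  have Sz: "S t z0 \<in> X" by (rule sg.S_in[OF t z0])
  have "pair \<phi> (z t) = pair \<phi> (S t z0 + w)" by (rule pair_null[OF bt zX[OF t] qn.Xadd[OF Sz wX] zw])
  also have "\<dots> = pair \<phi> (S t z0) + pair \<phi> w" by (rule pair_add[OF bt Sz wX])
  finally show ?thesis using qn.bochner_functional[OF w pair_functional[OF bt]] by simp
qed

lemma pair_initial:
  assumes bt: "bdd_test K \<phi>"
  shows "pair \<phi> (z 0) = pair \<phi> z0"
proof -
  have "has_bochner_integral (lebesgue_on {0..0}) (\<lambda>\<tau>. pair \<phi> (S (0 - \<tau>) (source \<tau>))) (pair \<phi> (z 0) - pair \<phi> (S 0 z0))"
    by (rule pair_duhamel[OF bt]) simp
  then have "pair \<phi> (z 0) - pair \<phi> (S 0 z0) = (LINT \<tau>|lebesgue_on {0..0}. pair \<phi> (S (0 - \<tau>) (source \<tau>)))"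
    by (simp add: has_bochner_integral_integral_eq)
  also have "\<dots> = 0"
  proof (rule integral_eq_zero_AE)
    have "AE x in lebesgue. x \<noteq> (0::real)" by (rule AE_completion[OF AE_lborel_singleton])
    then have "AE x in lebesgue_on {0..0}. x \<noteq> (0::real)" by (rule AE_lebesgue_onI) simp
    then show "AE x in lebesgue_on {0..0}. pair \<phi> (S (0 - x) (source x)) = 0"
      using AE_space by eventually_elim auto
  qed
  finally show ?thesis using pair_null[OF bt _ z0, of "S 0 z0"] sg.S_zero_eqv[OF z0] by (simp add: sg.eqv_def)
qed

text \<open>The Duhamel formula at time \<open>s\<close>, tested with
  \<open>shift \<rho> \<phi>\<close>, is subtracted from the one at time \<open>s + \<rho>\<close>,
  tested with \<open>\<phi>\<close>. By the semigroup law and the duality the initial datum and the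
  source before \<open>s\<close> cancel. The remaining times are at most \<open>Lmin\<close>, so the
  semigroup disappears from the formula.\<close>

lemma pair_restart:
  assumes T: "test K \<phi>" and s: "s \<ge> 0" and \<rho>: "0 \<le> \<rho>" "\<rho> \<le> Lmin"
  shows "has_bochner_integral lebesgue (\<lambda>\<tau>. indicator {s<..s+\<rho>} \<tau> * pair (shift (s + \<rho> - \<tau>) \<phi>) (source \<tau>))
    (pair \<phi> (z (s + \<rho>)) - pair (shift \<rho> \<phi>) (z s))"
proof -
  have b: "bdd_test K \<phi>" using T by (simp add: test_def)
  let ?g = "\<lambda>\<tau>. pair \<phi> (S (s + \<rho> - \<tau>) (source \<tau>))"
  have 1: "has_bochner_integral lebesgue (\<lambda>\<tau>. indicator {0..s+\<rho>} \<tau> *\<^sub>R ?g \<tau>) (pair \<phi> (z (s + \<rho>)) - pair \<phi> (S (s + \<rho>) z0))"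
  proof -
    have "0 \<le> s + \<rho>" using s \<rho> by simp
    from pair_duhamel[OF b this] show ?thesis by (subst (asm) has_bochner_integral_restrict_space) auto
  qed
  have 2: "has_bochner_integral lebesgue (\<lambda>\<tau>. indicator {0..s} \<tau> *\<^sub>R pair (shift \<rho> \<phi>) (S (s - \<tau>) (source \<tau>)))
      (pair (shift \<rho> \<phi>) (z s) - pair (shift \<rho> \<phi>) (S s z0))"
    using pair_duhamel[OF shift_bdd[OF T] s] by (subst (asm) has_bochner_integral_restrict_space) auto
  have sp: "pair \<phi> (S (s' + \<rho>) v) = pair (shift \<rho> \<phi>) (S s' v)" if s': "s' \<ge> 0" and v: "v \<in> X" for s' v
  proof -
    have "pair \<phi> (S (\<rho> + s') v) = pair \<phi> (S \<rho> (S s' v))"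
      by (rule pair_null[OF b]) (use sg.S_semi_eqv[OF \<rho>(1) s' v] in \<open>auto simp: sg.eqv_def\<close>)
    also have "\<dots> = pair (shift \<rho> \<phi>) (S s' v)" by (rule pair_semigroup[OF T sg.S_in[OF s' v] \<rho>])
    finally show ?thesis by (simp add: add.commute)
  qed
  have e: "indicator {0..s+\<rho>} \<tau> *\<^sub>R ?g \<tau> - indicator {0..s} \<tau> *\<^sub>R pair (shift \<rho> \<phi>) (S (s - \<tau>) (source \<tau>)) =
      indicator {s<..s+\<rho>} \<tau> * pair (shift (s + \<rho> - \<tau>) \<phi>) (source \<tau>)" for \<tau>
  proof (cases "\<tau> \<in> {0..s}")
    case True
    then have "?g \<tau> = pair (shift \<rho> \<phi>) (S (s - \<tau>) (source \<tau>))"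
      using sp[of "s - \<tau>" "source \<tau>"] source_X[of \<tau>] by (simp add: algebra_simps)
    then show ?thesis using True \<rho> by simp
  next
    case False
    show ?thesis
    proof (cases "\<tau> \<in> {s<..s+\<rho>}")
      case True
      then have "?g \<tau> = pair (shift (s + \<rho> - \<tau>) \<phi>) (source \<tau>)"
        by (intro pair_semigroup[OF T source_X]) (use s \<rho> in auto)
      then show ?thesis using True s by simp
    next
      case F: False
      then have "\<tau> \<notin> {0..s+\<rho>}" using False by auto
      then show ?thesis using F False by simp
    qed
  qed
  have "pair \<phi> (S (s + \<rho>) z0) = pair (shift \<rho> \<phi>) (S s z0)" by (rule sp[OF s z0])
  then show ?thesis using has_bochner_integral_diff[OF 1 2] unfolding e by simp
qed

end

section \<open>The explicit solution\<close>

text \<open>\<open>q\<close> is merely measurable, so \<open>exp (- A y)\<close> cannot be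
  differentiated pointwise. Instead \<open>F\<close>, the exponential plus the integral up to the
  same point, changes by at most the square of the step and is therefore constant.\<close>

lemma exp_primitive:
  fixes q :: "real \<Rightarrow> real"
  assumes qm[measurable]: "q \<in> borel_measurable borel" and q: "\<And>z. 0 \<le> q z \<and> q z \<le> 1"
    and y: "0 \<le> y1" "y1 \<le> y2"
  defines "A \<equiv> (\<lambda>y. LINT z|lborel. (if 0 \<le> z \<and> z \<le> y then q z else 0))"
  shows "(LINT z|lborel. (if y1 < z \<and> z < y2 then q z * exp (- A z) else 0)) = exp (- A y1) - exp (- A y2)"
proof -
  have int: "integrable lborel (\<lambda>z. if c < z \<and> z \<le> d then h z else 0)"
    if hm[measurable]: "h \<in> borel_measurable borel" and h: "\<And>z. 0 \<le> h z \<and> h z \<le> 1" for h :: "real \<Rightarrow> real" and c d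
  proof (rule Bochner_Integration.integrable_bound)
    show "integrable lborel (indicator {c..d} :: real \<Rightarrow> real)" by (cases "c \<le> d") (auto intro!: integrable_real_indicator)
    show "AE z in lborel. norm (if c < z \<and> z \<le> d then h z else 0) \<le> norm (indicator {c..d} z :: real)"
      using h by (intro AE_I2) auto
  qed simp
  have int': "integrable lborel (\<lambda>z. if 0 \<le> z \<and> z \<le> d then q z else 0)" for d
  proof (rule Bochner_Integration.integrable_bound)
    show "integrable lborel (indicator {0..d} :: real \<Rightarrow> real)" by (cases "0 \<le> d") (auto intro!: integrable_real_indicator)
    show "AE z in lborel. norm (if 0 \<le> z \<and> z \<le> d then q z else 0) \<le> norm (indicator {0..d} z :: real)"
      using q by (intro AE_I2) auto
  qed simp
  have Am[measurable]: "A \<in> borel_measurable borel"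
  proof -
    have "(\<lambda>(y, z). if 0 \<le> z \<and> z \<le> y then q z else 0) \<in> borel_measurable (borel \<Otimes>\<^sub>M lborel)" by measurable
    then show ?thesis unfolding A_def by (intro lborel.borel_measurable_lebesgue_integral) auto
  qed
  have A0: "A y \<ge> 0" for y unfolding A_def by (rule integral_nonneg_AE) (use q in auto)
  define \<Delta> where "\<Delta> = (\<lambda>y y'. LINT z|lborel. (if y < z \<and> z \<le> y' then q z else 0))"
  have Adiff: "A y' = A y + \<Delta> y y'" if "0 \<le> y" "y \<le> y'" for y y'
  proof -
    have "A y' = (LINT z|lborel. (if 0 \<le> z \<and> z \<le> y then q z else 0) + (if y < z \<and> z \<le> y' then q z else 0))"
      unfolding A_def by (rule Bochner_Integration.integral_cong) (use that in auto)
    also have "\<dots> = A y + \<Delta> y y'"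
      unfolding A_def \<Delta>_def by (rule Bochner_Integration.integral_add[OF int' int[OF qm q]])
    finally show ?thesis .
  qed
  have \<Delta>b: "0 \<le> \<Delta> y y'" "\<Delta> y y' \<le> y' - y" if "y \<le> y'" for y y'
  proof -
    show "0 \<le> \<Delta> y y'" unfolding \<Delta>_def by (rule integral_nonneg_AE) (use q in auto)
    have "\<Delta> y y' \<le> (LINT z|lborel. indicator {y..y'} z)" unfolding \<Delta>_def
    proof (rule integral_mono[OF int[OF qm q]])
      show "integrable lborel (indicator {y..y'} :: real \<Rightarrow> real)" using that by (intro integrable_real_indicator) auto
    qed (use q in \<open>auto simp: indicator_def\<close>)
    then show "\<Delta> y y' \<le> y' - y" using that by simp
  qed
  have Amono: "A y \<le> A y'" if "0 \<le> y" "y \<le> y'" for y y' using Adiff[OF that] \<Delta>b(1)[OF that(2)] by simp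
  define e where "e = (\<lambda>z. q z * exp (- A z))"
  have em[measurable]: "e \<in> borel_measurable borel" unfolding e_def by measurable
  have e01: "0 \<le> e z \<and> e z \<le> 1" for z
    using q[of z] A0[of z] unfolding e_def by (auto intro: mult_le_one)
  define B where "B = (\<lambda>y y'. LINT z|lborel. (if y < z \<and> z \<le> y' then e z else 0))"
  have Badd: "B y1 y3 = B y1 y2 + B y2 y3" if "y1 \<le> y2" "y2 \<le> y3" for y1 y2 y3
  proof -
    have "B y1 y3 = (LINT z|lborel. (if y1 < z \<and> z \<le> y2 then e z else 0) + (if y2 < z \<and> z \<le> y3 then e z else 0))"
      unfolding B_def by (rule Bochner_Integration.integral_cong) (use that in auto)
    also have "\<dots> = B y1 y2 + B y2 y3"
      unfolding B_def by (rule Bochner_Integration.integral_add[OF int[OF em e01] int[OF em e01]])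
    finally show ?thesis .
  qed
  define F where "F = (\<lambda>y. exp (- A (y1 + y)) + B y1 (y1 + y))"
  have sq: "\<bar>F y' - F y\<bar> \<le> (y' - y)\<^sup>2" if yy: "0 \<le> y" "y \<le> y'" for y y'
  proof -
    define x where "x = exp (- A (y1 + y))"
    define d where "d = \<Delta> (y1 + y) (y1 + y')"
    define \<theta> where "\<theta> = B (y1 + y) (y1 + y')"
    have d: "0 \<le> d" "d \<le> y' - y" using \<Delta>b[of "y1 + y" "y1 + y'"] yy by (auto simp: d_def)
    have x: "0 < x" "x \<le> 1" using A0 by (auto simp: x_def)
    have A': "exp (- A (y1 + y')) = x * exp (- d)"
      using Adiff[of "y1 + y" "y1 + y'"] yy y by (simp add: x_def d_def exp_add[symmetric])
    have qi: "integrable lborel (\<lambda>z. if y1 + y < z \<and> z \<le> y1 + y' then q z else 0)" by (rule int[OF qm q])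
    \<comment> \<open>During the step the exponential stays between \<open>x * exp (- d)\<close> and
      \<open>x\<close>, so the increment \<open>\<theta>\<close> of the integral lies between
      \<open>x * exp (- d) * d\<close> and \<open>x * d\<close>. This compensates the change of the
      exponential up to \<open>d\<^sup>2\<close>.\<close>
    have up: "\<theta> \<le> x * d"
    proof -
      have "\<theta> \<le> (LINT z|lborel. x * (if y1 + y < z \<and> z \<le> y1 + y' then q z else 0))" unfolding \<theta>_def B_def
      proof (rule integral_mono[OF int[OF em e01]])
        fix z show "(if y1 + y < z \<and> z \<le> y1 + y' then e z else 0) \<le> x * (if y1 + y < z \<and> z \<le> y1 + y' then q z else 0)"
          using Amono[of "y1 + y" z] yy y q[of z] by (auto simp: e_def x_def mult.commute intro: mult_left_mono)
      qed (use qi in auto)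
      also have "\<dots> = x * d" by (simp add: d_def \<Delta>_def)
      finally show ?thesis .
    qed
    have lo: "x * exp (- d) * d \<le> \<theta>"
    proof -
      have "x * exp (- d) * d = (LINT z|lborel. (x * exp (- d)) * (if y1 + y < z \<and> z \<le> y1 + y' then q z else 0))"
        by (simp add: d_def \<Delta>_def)
      also have "\<dots> \<le> \<theta>" unfolding \<theta>_def B_def
      proof (rule integral_mono[OF _ int[OF em e01]])
        fix z show "(x * exp (- d)) * (if y1 + y < z \<and> z \<le> y1 + y' then q z else 0) \<le> (if y1 + y < z \<and> z \<le> y1 + y' then e z else 0)"
          using Amono[of z "y1 + y'"] yy y q[of z] by (auto simp: e_def A'[symmetric] mult.commute intro: mult_left_mono)
      qed (use qi in auto)
      finally show ?thesis .
    qed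
    have F: "F y' - F y = x * exp (- d) - x + \<theta>"
      using Badd[of y1 "y1 + y" "y1 + y'"] yy by (simp add: F_def A' x_def \<theta>_def)
    have e1: "exp (- d) \<ge> 1 - d" using exp_ge_add_one_self[of "- d"] by simp
    have e2: "exp (- d) * (1 + d) \<le> 1"
    proof -
      have "exp (- d) * (1 + d) \<le> exp (- d) * exp d" by (rule mult_left_mono[OF exp_ge_add_one_self]) simp
      then show ?thesis by (simp add: exp_minus_inverse mult.commute)
    qed
    have u: "exp (- d) - 1 + d \<le> d\<^sup>2"
    proof -
      have "exp (- d) \<le> 1 - exp (- d) * d" using e2 by (simp add: algebra_simps)
      also have "\<dots> \<le> 1 - (1 - d) * d" using mult_right_mono[OF e1 d(1)] by simp
      finally show ?thesis by (simp add: algebra_simps power2_eq_square)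
    qed
    have l: "- d\<^sup>2 \<le> exp (- d) * (1 + d) - 1"
    proof -
      have "(1 - d) * (1 + d) \<le> exp (- d) * (1 + d)" by (rule mult_right_mono[OF e1]) (use d in simp)
      then show ?thesis by (simp add: algebra_simps power2_eq_square)
    qed
    have "F y' - F y \<le> x * (exp (- d) - 1 + d)" using F up by (simp add: algebra_simps)
    also have "\<dots> \<le> x * d\<^sup>2" by (rule mult_left_mono[OF u]) (use x in simp)
    also have "\<dots> \<le> 1 * d\<^sup>2" by (rule mult_right_mono[OF x(2)]) simp
    finally have 1: "F y' - F y \<le> d\<^sup>2" by simp
    have "x * (- d\<^sup>2) \<le> x * (exp (- d) * (1 + d) - 1)" by (rule mult_left_mono[OF l]) (use x in simp)
    also have "\<dots> \<le> F y' - F y" using F lo by (simp add: algebra_simps)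
    finally have "- (x * d\<^sup>2) \<le> F y' - F y" by simp
    moreover have "x * d\<^sup>2 \<le> 1 * d\<^sup>2" by (rule mult_right_mono[OF x(2)]) simp
    ultimately have 2: "- d\<^sup>2 \<le> F y' - F y" by linarith
    have "\<bar>F y' - F y\<bar> \<le> d\<^sup>2" using 1 2 by (simp add: abs_le_iff)
    also have "\<dots> \<le> (y' - y)\<^sup>2" by (rule power_mono[OF d(2,1)])
    finally show ?thesis .
  qed
  have sq': "\<bar>F y' - F y\<bar> \<le> (y' - y)\<^sup>2" if "0 \<le> y" "0 \<le> y'" for y y'
    using sq[of y y'] sq[of y' y] that by (cases "y \<le> y'") (auto simp: power2_commute abs_minus_commute)
  have cF: "continuous_on {0..y2 - y1} F" unfolding continuous_on_def
  proof
    fix y assume y: "y \<in> {0..y2 - y1}"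
    show "(F \<longlongrightarrow> F y) (at y within {0..y2 - y1})"
    proof (rule Lim_transform[OF tendsto_const], rule Lim_null_comparison)
      have "((\<lambda>y'. (y' - y)\<^sup>2) \<longlongrightarrow> (y - y)\<^sup>2) (at y within {0..y2 - y1})" by (intro tendsto_intros)
      then show "((\<lambda>y'. (y' - y)\<^sup>2) \<longlongrightarrow> 0) (at y within {0..y2 - y1})" by simp
      show "\<forall>\<^sub>F y' in at y within {0..y2 - y1}. norm (F y' - F y) \<le> (y' - y)\<^sup>2"
        using sq' y by (auto simp: eventually_at_filter)
    qed
  qed
  have "F (y2 - y1) = F 0"
  proof (rule right_derivative_zero_imp_const[OF cF])
    fix s assume s: "s \<in> {0..<y2 - y1}"
    show "((\<lambda>h. (F (s + h) - F s) / h) \<longlongrightarrow> 0) (at_right 0)"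
    proof (rule Lim_null_comparison)
      show "((\<lambda>h::real. h) \<longlongrightarrow> 0) (at_right 0)" by (rule tendsto_ident_at)
      have "eventually (\<lambda>h::real. h > 0) (at_right 0)" by (simp add: eventually_at_right_less)
      then show "\<forall>\<^sub>F h in at_right 0. norm ((F (s + h) - F s) / h) \<le> h"
      proof eventually_elim
        case (elim h)
        have "\<bar>F (s + h) - F s\<bar> \<le> h * h" using sq'[of s "s + h"] s elim by (simp add: power2_eq_square)
        then show ?case using elim by (simp add: divide_le_eq)
      qed
    qed
  qed (use y in simp)
  moreover have "B y1 y1 = 0" unfolding B_def by (rule integral_eq_zero_AE) auto
  ultimately have "B y1 y2 = exp (- A y1) - exp (- A y2)" by (simp add: F_def)
  moreover have "B y1 y2 = (LINT z|lborel. (if y1 < z \<and> z < y2 then q z * exp (- A z) else 0))"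
    unfolding B_def
  proof (rule integral_cong_AE)
    show "AE z in lborel. (if y1 < z \<and> z \<le> y2 then e z else 0) = (if y1 < z \<and> z < y2 then q z * exp (- A z) else 0)"
      using AE_lborel_singleton[of y2] by eventually_elim (auto simp: e_def)
  qed measurable
  ultimately show ?thesis by simp
qed

section \<open>Values carried along the characteristics\<close>

locale damped_network =
  fixes N :: nat and L :: "nat \<Rightarrow> real" and m :: "nat \<Rightarrow> nat \<Rightarrow> real" and Lmin :: real
    and a b :: "nat \<Rightarrow> real" and \<beta> u0 :: "nat \<Rightarrow> real \<Rightarrow> real"
  assumes Lmin: "Lmin > 0" and Lge: "\<And>i. i \<in> {1..N} \<Longrightarrow> Lmin \<le> L i"
    and \<beta>m: "\<And>i. \<beta> i \<in> borel_measurable borel"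
    and \<beta>01: "\<And>i t. 0 \<le> \<beta> i t \<and> \<beta> i t \<le> 1"
    and \<beta>neg: "\<And>i t. t < 0 \<Longrightarrow> \<beta> i t = 0"
    and u0m: "\<And>i. u0 i \<in> borel_measurable borel"
    and u0i: "\<And>i. i \<in> {1..N} \<Longrightarrow> integrable lborel (\<lambda>x. indicator {0<..<L i} x * u0 i x)"
begin

lemma Lp: "i \<in> {1..N} \<Longrightarrow> L i > 0" using Lge[of i] Lmin by simp

text \<open>A particle that enters circle \<open>j\<close> at time \<open>c\<close> is at position \<open>y\<close> at time \<open>c + y\<close>;
  \<open>damping j c y\<close> is the factor by which it has been damped until then. The value \<open>g j c\<close> carried
  by the particles that enter at a negative time \<open>c\<close> is the initial datum at \<open>- c\<close>.\<close>

definition q :: "nat \<Rightarrow> real \<Rightarrow> real \<Rightarrow> real" where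
  "q j c y = \<beta> j (c + y) * indicator {a j..b j} y"

definition damping :: "nat \<Rightarrow> real \<Rightarrow> real \<Rightarrow> real" where
  "damping j c y = exp (- (LINT z|lborel. (if 0 \<le> z \<and> z \<le> y then q j c z else 0)))"

text \<open>Entering values refer to entering values that are earlier by at least
  \<open>Lmin\<close>. The number \<open>n\<close> limits how many transits are traced back and
  makes the recursion well-founded; for \<open>t < n * Lmin\<close> the default value
  \<open>0\<close> is never reached, and \<open>g\<close> takes \<open>n\<close> beyond
  \<open>t / Lmin\<close>.\<close>

fun gf :: "nat \<Rightarrow> nat \<Rightarrow> real \<Rightarrow> real" where
  "gf 0 i t = (if t < 0 then u0 i (- t) else 0)"
| "gf (Suc n) i t = (if t < 0 then u0 i (- t)
     else (\<Sum>j=1..N. m i j * damping j (t - L j) (L j) * gf n j (t - L j)))"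

definition g :: "nat \<Rightarrow> real \<Rightarrow> real" where
  "g i t = gf (nat \<lceil>t / Lmin\<rceil> + 1) i t"

definition v :: "real \<Rightarrow> nat \<Rightarrow> real \<Rightarrow> real" where
  "v t i x = damping i (t - x) x * g i (t - x)"

lemma q_measurable[measurable]: "q j c \<in> borel_measurable borel"
proof -
  note [measurable] = \<beta>m
  have "(\<lambda>y. \<beta> j (c + y) * indicator {a j..b j} y) \<in> borel_measurable borel" by measurable
  then show ?thesis unfolding q_def[abs_def] .
qed

lemma q01: "0 \<le> q j c y \<and> q j c y \<le> 1"
  using \<beta>01[of j "c + y"] by (auto simp: q_def indicator_def)

text \<open>Measurability jointly in entry time and position, as required by Fubini's theorem in the
  variables time and label.\<close>

lemma damping_measurable: "(\<lambda>p. damping j (fst p) (snd p)) \<in> borel_measurable (borel \<Otimes>\<^sub>M borel)"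
proof -
  note [measurable] = \<beta>m
  have "(\<lambda>(p, z). if 0 \<le> z \<and> z \<le> snd p then \<beta> j (fst p + z) * indicator {a j..b j} z else 0)
      \<in> borel_measurable ((borel \<Otimes>\<^sub>M borel) \<Otimes>\<^sub>M (lborel :: real measure))" by measurable
  then have "(\<lambda>p. LINT z|lborel. (if 0 \<le> z \<and> z \<le> snd p then \<beta> j (fst p + z) * indicator {a j..b j} z else 0))
      \<in> borel_measurable (borel \<Otimes>\<^sub>M borel)"
    by (intro lborel.borel_measurable_lebesgue_integral) auto
  then show ?thesis unfolding damping_def q_def by measurable
qed

lemma damping_measurable_comp:
  assumes "f \<in> borel_measurable M" "h \<in> borel_measurable M"
  shows "(\<lambda>x. damping j (f x) (h x)) \<in> borel_measurable M"
proof -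
  have "(\<lambda>x. (f x, h x)) \<in> measurable M (borel \<Otimes>\<^sub>M borel)" using assms by measurable
  from measurable_compose[OF this damping_measurable[of j]] show ?thesis by simp
qed

lemma damping01: "0 < damping j c y" "damping j c y \<le> 1"
proof -
  have "0 \<le> (LINT z|lborel. (if 0 \<le> z \<and> z \<le> y then q j c z else 0))"
    by (rule integral_nonneg_AE) (use q01 in auto)
  then show "0 < damping j c y" "damping j c y \<le> 1" by (auto simp: damping_def)
qed

lemma damping_zero: "y \<le> 0 \<Longrightarrow> damping j c y = 1"
proof -
  assume y: "y \<le> 0"
  have "(LINT z|lborel. (if 0 \<le> z \<and> z \<le> y then q j c z else 0)) = 0"
    by (rule integral_eq_zero_AE, rule eventually_mono[OF AE_lborel_singleton[of 0]]) (use y in auto)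
  then show ?thesis by (simp add: damping_def)
qed

text \<open>This is the purpose of letting \<open>\<beta>\<close> vanish at negative times: the
  initial data are continued backward along the characteristics without damping, so that
  \<open>v\<close> starts from \<open>u0\<close>.\<close>

lemma damping_early: "c + y \<le> 0 \<Longrightarrow> damping j c y = 1"
proof -
  assume y: "c + y \<le> 0"
  have "(LINT z|lborel. (if 0 \<le> z \<and> z \<le> y then q j c z else 0)) = 0"
    by (rule integral_eq_zero_AE, rule eventually_mono[OF AE_lborel_singleton[of y]])
      (use y \<beta>neg in \<open>auto simp: q_def\<close>)
  then show ?thesis by (simp add: damping_def)
qed

lemma damping_primitive:
  assumes "0 \<le> y1" "y1 \<le> y2"
  shows "(LINT z|lborel. (if y1 < z \<and> z < y2 then q j c z * damping j c z else 0)) = damping j c y1 - damping j c y2"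
  using exp_primitive[OF q_measurable q01 assms, of j c] unfolding damping_def .

lemma gf_stable:
  "i \<in> {1..N} \<Longrightarrow> t < n * Lmin \<Longrightarrow> gf (Suc n) i t = gf n i t"
proof (induction n arbitrary: i t)
  case 0
  then show ?case by simp
next
  case (Suc n)
  show ?case
  proof (cases "t < 0")
    case False
    have "gf (Suc n) j (t - L j) = gf n j (t - L j)" if j: "j \<in> {1..N}" for j
    proof (rule Suc.IH[OF j])
      show "t - L j < n * Lmin" using Suc.prems Lge[OF j] by (simp add: algebra_simps)
    qed
    then have "(\<Sum>j=1..N. m i j * damping j (t - L j) (L j) * gf (Suc n) j (t - L j)) =
      (\<Sum>j=1..N. m i j * damping j (t - L j) (L j) * gf n j (t - L j))" by (intro sum.cong) auto
    then show ?thesis using False by (simp only: gf.simps if_False)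
  qed simp
qed

lemma gf_stable_add:
  assumes i: "i \<in> {1..N}" and t: "t < n * Lmin"
  shows "gf (n + k) i t = gf n i t"
proof (induction k)
  case (Suc k)
  have "t < (n + k) * Lmin" using t Lmin by (simp add: algebra_simps add_pos_nonneg less_le_trans)
  from gf_stable[OF i this] Suc show ?case by simp
qed simp

lemma g_eq:
  assumes i: "i \<in> {1..N}" and t: "t < n * Lmin"
  shows "g i t = gf n i t"
proof -
  define n0 where "n0 = nat \<lceil>t / Lmin\<rceil> + 1"
  have "t / Lmin < real n0" unfolding n0_def by linarith
  then have t0: "t < n0 * Lmin" using Lmin by (simp add: field_simps)
  have "gf n0 i t = gf n i t"
  proof (cases "n \<le> n0")
    case True
    then show ?thesis using gf_stable_add[OF i t, of "n0 - n"] by simp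
  next
    case False
    then show ?thesis using gf_stable_add[OF i t0, of "n - n0"] by simp
  qed
  then show ?thesis by (simp add: g_def n0_def)
qed

lemma g_neg: "t < 0 \<Longrightarrow> g i t = u0 i (- t)"
  by (simp add: g_def)

lemma g_rec:
  assumes i: "i \<in> {1..N}" and t: "t \<ge> 0"
  shows "g i t = (\<Sum>j=1..N. m i j * damping j (t - L j) (L j) * g j (t - L j))"
proof -
  obtain n :: nat where "t / Lmin < n" using reals_Archimedean2 by blast
  then have n: "t < n * Lmin" using Lmin by (simp add: field_simps)
  then have n': "t < (Suc n) * Lmin" using Lmin by (simp add: algebra_simps)
  have "gf n j (t - L j) = g j (t - L j)" if "j \<in> {1..N}" for j
    by (rule g_eq[symmetric, OF that]) (use n Lp[OF that] in simp)
  then show ?thesis using g_eq[OF i n'] t by simp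
qed

lemma gf_measurable: "gf n i \<in> borel_measurable borel"
proof (induction n arbitrary: i)
  case 0
  have "(\<lambda>t. u0 i (- t)) \<in> borel_measurable borel"
    using measurable_compose[OF borel_measurable_uminus[OF measurable_ident] u0m[of i]] by simp
  then have "(\<lambda>t. if t < 0 then u0 i (- t) else 0) \<in> borel_measurable borel" by measurable
  then show ?case by simp
next
  case (Suc n)
  have 1: "(\<lambda>t. u0 i (- t)) \<in> borel_measurable borel"
    using measurable_compose[OF borel_measurable_uminus[OF measurable_ident] u0m[of i]] by simp
  have 2: "(\<lambda>t. \<Sum>j=1..N. m i j * damping j (t - L j) (L j) * gf n j (t - L j)) \<in> borel_measurable borel"
    by (intro borel_measurable_sum borel_measurable_times damping_measurable_comp measurable_compose[OF _ Suc.IH]) auto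
  have "(\<lambda>t. if t < 0 then u0 i (- t) else (\<Sum>j=1..N. m i j * damping j (t - L j) (L j) * gf n j (t - L j))) \<in> borel_measurable borel"
    using 1 2 by measurable
  then show ?case by simp
qed

lemma g_measurable:
  assumes i: "i \<in> {1..N}"
  shows "g i \<in> borel_measurable borel"
proof (rule borel_measurable_LIMSEQ_real)
  fix t
  obtain n0 :: nat where "t / Lmin < n0" using reals_Archimedean2 by blast
  then have n0: "t < n0 * Lmin" using Lmin by (simp add: field_simps)
  have "g i t = gf n i t" if "n \<ge> n0" for n
  proof (rule g_eq[OF i])
    have "real n0 * Lmin \<le> n * Lmin" using that Lmin by simp
    then show "t < n * Lmin" using n0 by linarith
  qed
  then have "\<forall>\<^sub>F n in sequentially. gf n i t = g i t" by (intro eventually_sequentiallyI[of n0]) simp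
  then show "(\<lambda>n. gf n i t) \<longlonglongrightarrow> g i t" by (rule tendsto_eventually)
qed (rule gf_measurable)

lemma v_measurable:
  assumes i: "i \<in> {1..N}"
  shows "v t i \<in> borel_measurable borel"
  unfolding v_def[abs_def]
  by (intro borel_measurable_times damping_measurable_comp measurable_compose[OF _ g_measurable[OF i]]) auto

text \<open>Integrability is extended by \<open>Lmin\<close> at a time: on the next piece,
  \<open>g i\<close> is a combination with bounded coefficients of translates of the
  \<open>g j\<close> from the range already treated.\<close>

lemma g_integrable:
  assumes i: "i \<in> {1..N}"
  shows "integrable lborel (\<lambda>t. indicator {- L i<..<T} t * g i t)"
proof -
  have *: "integrable lborel (\<lambda>t. indicator {- L i<..<n * Lmin} t * g i t)" if i: "i \<in> {1..N}" for n :: nat and i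
    using i
  proof (induction n arbitrary: i)
    case 0
    have "integrable lborel (\<lambda>x. indicator {0<..<L i} (0 + (-1) * x) * u0 i (0 + (-1) * x))"
      using lborel_integrable_real_affine[OF u0i[OF 0], of "-1" 0] by simp
    moreover have "(\<lambda>x. indicator {0<..<L i} (0 + (-1) * x) * u0 i (0 + (-1) * x)) = (\<lambda>t. indicator {- L i<..<0} t * g i t)"
      by (auto simp: indicator_def g_neg fun_eq_iff)
    ultimately show ?case by simp
  next
    case (Suc n)
    let ?h = "\<lambda>j t. (m i j * damping j (t - L j) (L j)) * (indicator {- L j<..<n * Lmin} (t - L j) * g j (t - L j))"
    have h: "integrable lborel (?h j)" if j: "j \<in> {1..N}" for j
    proof (rule Bochner_Integration.integrable_bound)
      have "integrable lborel (\<lambda>t. indicator {- L j<..<n * Lmin} (- L j + 1 * t) * g j (- L j + 1 * t))"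
        using lborel_integrable_real_affine[OF Suc.IH[OF j], of 1 "- L j"] by simp
      then show "integrable lborel (\<lambda>t. m i j * (indicator {- L j<..<n * Lmin} (t - L j) * g j (t - L j)))"
        by simp
      show "?h j \<in> borel_measurable lborel"
        using measurable_compose[OF _ g_measurable[OF j], of "\<lambda>t. t - L j" borel]
          damping_measurable_comp[of "\<lambda>t. t - L j" borel "\<lambda>t. L j" j] by simp
      show "AE t in lborel. norm (?h j t) \<le> norm (m i j * (indicator {- L j<..<n * Lmin} (t - L j) * g j (t - L j)))"
      proof (rule AE_I2)
        fix t
        have "\<bar>m i j * damping j (t - L j) (L j)\<bar> \<le> \<bar>m i j\<bar>"
          using damping01[of j "t - L j" "L j"] by (simp add: abs_mult mult_left_le)
        then show "norm (?h j t) \<le> norm (m i j * (indicator {- L j<..<n * Lmin} (t - L j) * g j (t - L j)))"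
          by (simp only: real_norm_def abs_mult[of _ "indicator _ _ * _"] mult_right_mono abs_ge_zero)
      qed
    qed
    have "integrable lborel (\<lambda>t. indicator {- L i<..<n * Lmin} t * g i t + indicator {0..} t * indicator {n * Lmin..<Suc n * Lmin} t * (\<Sum>j=1..N. ?h j t))"
    proof (intro Bochner_Integration.integrable_add Suc.IH Suc.prems)
      have "integrable lborel (\<lambda>t. (\<Sum>j=1..N. ?h j t) * (indicator {0..} t * indicator {n * Lmin..<Suc n * Lmin} t))"
        by (rule integrable_mult_bounded_AE[where K=1]) (use h in \<open>auto simp: indicator_def\<close>)
      then show "integrable lborel (\<lambda>t. indicator {0..} t * indicator {n * Lmin..<Suc n * Lmin} t * (\<Sum>j=1..N. ?h j t))"
        by (simp add: mult.commute)
    qed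
    moreover have "AE t in lborel. indicator {- L i<..<n * Lmin} t * g i t + indicator {0..} t * indicator {n * Lmin..<Suc n * Lmin} t * (\<Sum>j=1..N. ?h j t)
        = indicator {- L i<..<Suc n * Lmin} t * g i t"
    proof -
      \<comment> \<open>At \<open>t = 0\<close> the argument \<open>t - L j\<close> is the left end
        point of the open interval \<open>{- L j<..<n * Lmin}\<close>, where the indicator vanishes;
        finitely many points are discarded.\<close>
      have "AE t in lborel. \<forall>j\<in>{1..N}. t \<noteq> n * Lmin + L j \<and> t \<noteq> 0"
        by (rule AE_finite_allI) (use AE_conjI[OF AE_lborel_singleton AE_lborel_singleton] in auto)
      then show ?thesis
      proof eventually_elim
        case (elim t)
        have nL: "0 \<le> n * Lmin" using Lmin by simp
        have le: "n * Lmin \<le> Suc n * Lmin" using Lmin by simp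
        consider "t < n * Lmin" | "t \<ge> Suc n * Lmin" | "n * Lmin \<le> t" "t < Suc n * Lmin" by linarith
        then show ?case
        proof cases
          case 1
          then show ?thesis using le by (auto simp: indicator_def)
        next
          case 2
          then show ?thesis using le by (auto simp: indicator_def)
        next
          case 3
          have t0: "t \<ge> 0" using 3 nL by linarith
          have hj: "?h j t = m i j * damping j (t - L j) (L j) * g j (t - L j)" if j: "j \<in> {1..N}" for j
          proof -
            have "t - L j < n * Lmin" using 3 Lge[OF j] by (simp add: algebra_simps)
            moreover have "t \<noteq> 0" using elim j by blast
            ultimately show ?thesis using t0 by (simp add: indicator_def)
          qed
          have "(\<Sum>j=1..N. ?h j t) = g i t"
            unfolding g_rec[OF Suc.prems t0] by (rule sum.cong[OF refl hj])
          moreover have "- L i < t" using t0 Lp[OF Suc.prems] by linarith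
          ultimately show ?thesis using 3 t0 by (simp add: indicator_def)
        qed
      qed
    qed
    moreover have "(\<lambda>t. indicator {- L i<..<Suc n * Lmin} t * g i t) \<in> borel_measurable lborel"
      using g_measurable[OF Suc.prems] by simp
    ultimately show ?case using integrable_cong_AE_imp by blast
  qed
  obtain n :: nat where "T / Lmin < n" using reals_Archimedean2 by blast
  then have n: "T < n * Lmin" using Lmin by (simp add: field_simps)
  have "integrable lborel (\<lambda>t. (indicator {- L i<..<n * Lmin} t * g i t) * indicator {..<T} t)"
    by (rule integrable_mult_bounded_AE[OF *[OF i], where K=1]) (auto simp: indicator_def)
  moreover have "(\<lambda>t. (indicator {- L i<..<n * Lmin} t * g i t) * indicator {..<T} t) = (\<lambda>t. indicator {- L i<..<T} t * g i t)"
    using n by (auto simp: indicator_def fun_eq_iff)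
  ultimately show ?thesis by simp
qed

text \<open>For a fixed label \<open>c\<close>, the absorption during the part of the transit inside
  \<open>{s<..<s+\<rho>}\<close> is the drop of the damping factor between the first and the last
  position occupied in that time. This is the inner integral in the application of Fubini's
  theorem.\<close>

lemma inner_transit:
  assumes "L j > 0" "0 \<le> \<rho>"
  shows "(LINT \<tau>|lborel. indicator {s<..<s+\<rho>} \<tau> * indicator {0<..<L j} (\<tau> - c) * (q j c (\<tau> - c) * damping j c (\<tau> - c))) =
    (if s - L j < c \<and> c < s + \<rho> then damping j c (max 0 (s - c)) - damping j c (min (L j) (s + \<rho> - c)) else 0)"
proof -
  let ?f = "\<lambda>\<tau>. indicator {s<..<s+\<rho>} \<tau> * indicator {0<..<L j} (\<tau> - c) * (q j c (\<tau> - c) * damping j c (\<tau> - c)) :: real"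
  have "(LINT \<tau>|lborel. ?f \<tau>) = (LINT y|lborel. ?f (c + 1 * y))"
    using lborel_integral_real_affine[of 1 ?f c] by simp
  also have "\<dots> = (if s - L j < c \<and> c < s + \<rho> then damping j c (max 0 (s - c)) - damping j c (min (L j) (s + \<rho> - c)) else 0)"
  proof (cases "s - L j < c \<and> c < s + \<rho>")
    case True
    have "(LINT y|lborel. ?f (c + 1 * y)) =
      (LINT y|lborel. (if max 0 (s - c) < y \<and> y < min (L j) (s + \<rho> - c) then q j c y * damping j c y else 0))"
      by (rule Bochner_Integration.integral_cong) (auto simp: indicator_def)
    also have "\<dots> = damping j c (max 0 (s - c)) - damping j c (min (L j) (s + \<rho> - c))"
      by (rule damping_primitive) (use True assms in auto)
    finally show ?thesis using True by simp
  next
    case False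
    have "?f (c + 1 * y) = 0" for y
    proof (cases "s < c + y \<and> c + y < s + \<rho> \<and> 0 < y \<and> y < L j")
      case True
      then have "s - L j < c" "c < s + \<rho>" by auto
      then show ?thesis using False by blast
    qed (auto simp: indicator_def)
    then show ?thesis unfolding if_not_P[OF False] by (simp only: Bochner_Integration.integral_zero)
  qed
  finally show ?thesis .
qed

lemma affine_integral_cong:
  fixes f h :: "real \<Rightarrow> real"
  assumes "\<And>c. f (s + (-1) * c) = h c"
  shows "(LINT x|lborel. f x) = (LINT c|lborel. h c)"
  using lborel_integral_real_affine[of "-1" f s] by (simp add: assms[simplified])

text \<open>By Fubini's theorem in the variables (time, label), where the label of a particle is its
  time of entry.\<close>

lemma transport_weak:
  assumes j: "j \<in> {1..N}" and s: "s \<ge> 0" and \<rho>: "0 \<le> \<rho>" "\<rho> \<le> Lmin"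
    and Em[measurable]: "E \<in> borel_measurable borel" and EK: "\<And>x. \<bar>E x\<bar> \<le> K"
  defines "w \<equiv> (\<lambda>\<tau>. \<beta> j \<tau> * (LINT x|lborel. indicator {0<..<L j} x * (indicator {a j..b j} x * v \<tau> j x * E (x + (s + \<rho> - \<tau>)))))"
  shows "integrable lborel (\<lambda>\<tau>. indicator {s<..<s+\<rho>} \<tau> * w \<tau>)"
    and "(LINT x|lborel. indicator {0<..<L j} x * (v s j x * E (x + \<rho>))) - (LINT \<tau>|lborel. indicator {s<..<s+\<rho>} \<tau> * w \<tau>) =
      (LINT x|lborel. indicator {0<..<L j} x * (v (s + \<rho>) j x * E x))
      - (LINT c|lborel. indicator {s<..<s+\<rho>} c * (g j c * E (s + \<rho> - c)))
      + (LINT c|lborel. indicator {s<..<s+\<rho>} c * (damping j (c - L j) (L j) * g j (c - L j) * E (s + \<rho> - c + L j)))"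
proof -
  have Lj: "L j > 0" "\<rho> \<le> L j" using Lp[OF j] Lge[OF j] \<rho> by auto
  note [measurable] = g_measurable[OF j] \<beta>m
  have Dmc[measurable]: "\<And>f h M. f \<in> borel_measurable M \<Longrightarrow> h \<in> borel_measurable M \<Longrightarrow> (\<lambda>x. damping j (f x) (h x)) \<in> borel_measurable M"
    by (rule damping_measurable_comp)
  \<comment> \<open>The common density of all five terms once they are written as integrals over the
    label \<open>c\<close>; other labels do not meet the circle between \<open>s\<close> and
    \<open>s + \<rho>\<close>. What remains is an identity for each single label.\<close>
  define H where "H = (\<lambda>c. indicator {s - L j<..<s+\<rho>} c * (g j c * E (s + \<rho> - c)))"
  have Hm[measurable]: "H \<in> borel_measurable borel" unfolding H_def by measurable
  have Hi: "integrable lborel H"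
  proof -
    have "integrable lborel (\<lambda>c. (indicator {- L j<..<s+\<rho>} c * g j c) * (indicator {s - L j<..} c * E (s + \<rho> - c)))"
    proof (rule integrable_mult_bounded_AE[OF g_integrable[OF j], where K=K])
      show "AE x in lborel. \<bar>indicator {s - L j<..} x * E (s + \<rho> - x)\<bar> \<le> K"
        using EK order_trans[OF abs_ge_zero EK[of 0]] by (intro AE_I2) (auto simp: indicator_def)
    qed measurable
    moreover have "(\<lambda>c. (indicator {- L j<..<s+\<rho>} c * g j c) * (indicator {s - L j<..} c * E (s + \<rho> - c))) = H"
      using s by (auto simp: H_def indicator_def fun_eq_iff)
    ultimately show ?thesis by simp
  qed
  have Hb: "integrable lborel (\<lambda>c. H c * k c)" if "k \<in> borel_measurable borel" "\<And>c. \<bar>k c\<bar> \<le> 1" for k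
    by (rule integrable_mult_bounded_AE[OF Hi, where K=1]) (use that in auto)
  define F where "F = (\<lambda>\<tau> c. indicator {s<..<s+\<rho>} \<tau> * indicator {0<..<L j} (\<tau> - c) * (q j c (\<tau> - c) * damping j c (\<tau> - c)) * H c)"
  have qq: "q j c (\<tau> - c) = \<beta> j \<tau> * indicator {a j..b j} (\<tau> - c)" for c \<tau> by (simp add: q_def)
  have Fm: "case_prod F \<in> borel_measurable (lborel \<Otimes>\<^sub>M lborel)"
    unfolding F_def qq split_beta by measurable
  have Fi: "integrable (lborel \<Otimes>\<^sub>M lborel) (case_prod F)"
  proof (rule Bochner_Integration.integrable_bound[OF _ Fm])
    show "integrable (lborel \<Otimes>\<^sub>M lborel) (\<lambda>(\<tau>, c). indicator {s<..<s+\<rho>} \<tau> * H c)"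
      by (rule integrable_prod_lborel[OF _ Hi]) (intro integrable_real_indicator, use \<rho> in auto)
    show "AE x in lborel \<Otimes>\<^sub>M lborel. norm (case x of (\<tau>, c) \<Rightarrow> F \<tau> c) \<le> norm (case x of (\<tau>, c) \<Rightarrow> indicator {s<..<s+\<rho>} \<tau> * H c)"
    proof (rule AE_I2, clarify)
      fix \<tau> c
      have "\<bar>indicator {0<..<L j} (\<tau> - c) * (q j c (\<tau> - c) * damping j c (\<tau> - c))\<bar> \<le> 1"
        using q01[of j c "\<tau> - c"] damping01[of j c "\<tau> - c"] by (auto simp: abs_mult indicator_def intro!: mult_le_one)
      then have "\<bar>indicator {0<..<L j} (\<tau> - c) * (q j c (\<tau> - c) * damping j c (\<tau> - c))\<bar> * \<bar>indicator {s<..<s+\<rho>} \<tau> * H c\<bar> \<le> 1 * \<bar>indicator {s<..<s+\<rho>} \<tau> * H c\<bar>"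
        by (rule mult_right_mono) simp
      then show "norm (F \<tau> c) \<le> norm (indicator {s<..<s+\<rho>} \<tau> * H c)"
        unfolding F_def by (simp add: abs_mult mult_ac)
    qed
  qed
  have w: "indicator {s<..<s+\<rho>} \<tau> * w \<tau> = (LINT c|lborel. F \<tau> c)" for \<tau>
  proof (cases "\<tau> \<in> {s<..<s+\<rho>}")
    case True
    have "(LINT x|lborel. indicator {0<..<L j} x * (indicator {a j..b j} x * v \<tau> j x * E (x + (s + \<rho> - \<tau>)))) =
      (LINT c|lborel. indicator {0<..<L j} (\<tau> - c) * (indicator {a j..b j} (\<tau> - c) * (damping j c (\<tau> - c) * g j c) * E (s + \<rho> - c)))"
      by (rule affine_integral_cong[where s=\<tau>]) (simp add: v_def)
    then have "w \<tau> = (LINT c|lborel. \<beta> j \<tau> * (indicator {0<..<L j} (\<tau> - c) * (indicator {a j..b j} (\<tau> - c) * (damping j c (\<tau> - c) * g j c) * E (s + \<rho> - c))))"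
      by (simp add: w_def)
    also have "\<dots> = (LINT c|lborel. F \<tau> c)"
    proof (rule Bochner_Integration.integral_cong)
      fix c
      show "\<beta> j \<tau> * (indicator {0<..<L j} (\<tau> - c) * (indicator {a j..b j} (\<tau> - c) * (damping j c (\<tau> - c) * g j c) * E (s + \<rho> - c))) = F \<tau> c"
        using True by (auto simp: F_def qq H_def indicator_def)
    qed simp
    finally show ?thesis using True by simp
  next
    case False
    then show ?thesis by (simp add: F_def)
  qed
  show "integrable lborel (\<lambda>\<tau>. indicator {s<..<s+\<rho>} \<tau> * w \<tau>)"
    unfolding w by (rule lborel_pair.integrable_fst[OF Fi])
  define I where "I = (\<lambda>c. if s - L j < c \<and> c < s + \<rho> then damping j c (max 0 (s - c)) - damping j c (min (L j) (s + \<rho> - c)) else 0)"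
  have Im[measurable]: "I \<in> borel_measurable borel" unfolding I_def by measurable
  have T2: "(LINT \<tau>|lborel. indicator {s<..<s+\<rho>} \<tau> * w \<tau>) = (LINT c|lborel. H c * I c)"
  proof -
    have "(LINT \<tau>|lborel. indicator {s<..<s+\<rho>} \<tau> * w \<tau>) = (LINT \<tau>|lborel. LINT c|lborel. F \<tau> c)"
      unfolding w ..
    also have "\<dots> = (LINT c|lborel. LINT \<tau>|lborel. F \<tau> c)"
      by (rule lborel_pair.Fubini_integral[OF Fi, symmetric])
    also have "\<dots> = (LINT c|lborel. H c * I c)"
    proof (rule Bochner_Integration.integral_cong)
      fix c
      have "(LINT \<tau>|lborel. F \<tau> c) = I c * H c"
        unfolding F_def I_def inner_transit[OF Lj(1) \<rho>(1), symmetric] by (rule integral_mult_left_zero)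
      then show "(LINT \<tau>|lborel. F \<tau> c) = H c * I c" by simp
    qed simp
    finally show ?thesis .
  qed
  have T1: "(LINT x|lborel. indicator {0<..<L j} x * (v s j x * E (x + \<rho>))) =
      (LINT c|lborel. H c * (indicator {s - L j<..<s} c * damping j c (s - c)))"
  proof (rule affine_integral_cong[where s=s])
    fix c
    show "indicator {0<..<L j} (s + - 1 * c) * (v s j (s + - 1 * c) * E (s + - 1 * c + \<rho>)) = H c * (indicator {s - L j<..<s} c * damping j c (s - c))"
      using \<rho> by (auto simp: H_def v_def indicator_def algebra_simps)
  qed
  have T3: "(LINT x|lborel. indicator {0<..<L j} x * (v (s + \<rho>) j x * E x)) =
      (LINT c|lborel. H c * (indicator {s + \<rho> - L j<..<s+\<rho>} c * damping j c (s + \<rho> - c)))"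
  proof (rule affine_integral_cong[where s="s + \<rho>"])
    fix c
    show "indicator {0<..<L j} (s + \<rho> + - 1 * c) * (v (s + \<rho>) j (s + \<rho> + - 1 * c) * E (s + \<rho> + - 1 * c)) = H c * (indicator {s + \<rho> - L j<..<s+\<rho>} c * damping j c (s + \<rho> - c))"
      using \<rho> by (auto simp: H_def v_def indicator_def algebra_simps)
  qed
  have T4: "(LINT c|lborel. indicator {s<..<s+\<rho>} c * (g j c * E (s + \<rho> - c))) = (LINT c|lborel. H c * indicator {s<..<s+\<rho>} c)"
    by (rule Bochner_Integration.integral_cong) (use Lj in \<open>auto simp: H_def indicator_def\<close>)
  have T5: "(LINT c|lborel. indicator {s<..<s+\<rho>} c * (damping j (c - L j) (L j) * g j (c - L j) * E (s + \<rho> - c + L j))) =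
      (LINT c|lborel. H c * (indicator {s - L j<..<s+\<rho> - L j} c * damping j c (L j)))"
  proof -
    let ?h = "\<lambda>c. indicator {s<..<s+\<rho>} c * (damping j (c - L j) (L j) * g j (c - L j) * E (s + \<rho> - c + L j)) :: real"
    have "(LINT c|lborel. ?h c) = (LINT c|lborel. ?h (L j + 1 * c))"
      using lborel_integral_real_affine[of 1 ?h "L j"] by simp
    also have "\<dots> = (LINT c|lborel. H c * (indicator {s - L j<..<s+\<rho> - L j} c * damping j c (L j)))"
      by (rule Bochner_Integration.integral_cong) (use Lj in \<open>auto simp: H_def indicator_def algebra_simps\<close>)
    finally show ?thesis .
  qed
  have D1: "\<bar>damping j c y\<bar> \<le> 1" for c y using damping01[of j c y] by simp
  have i1: "integrable lborel (\<lambda>c. H c * (indicator {s - L j<..<s} c * damping j c (s - c)))"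
    by (rule Hb) (use D1 in \<open>auto simp: indicator_def\<close>)
  have i2: "integrable lborel (\<lambda>c. H c * I c)"
  proof (rule Hb)
    fix c show "\<bar>I c\<bar> \<le> 1"
      using damping01[of j c "max 0 (s - c)"] damping01[of j c "min (L j) (s + \<rho> - c)"] by (auto simp: I_def)
  qed measurable
  have i3: "integrable lborel (\<lambda>c. H c * (indicator {s + \<rho> - L j<..<s+\<rho>} c * damping j c (s + \<rho> - c)))"
    by (rule Hb) (use D1 in \<open>auto simp: indicator_def\<close>)
  have i4: "integrable lborel (\<lambda>c. H c * indicator {s<..<s+\<rho>} c)"
    by (rule Hb) (auto simp: indicator_def)
  have i5: "integrable lborel (\<lambda>c. H c * (indicator {s - L j<..<s+\<rho> - L j} c * damping j c (L j)))"
    by (rule Hb) (use D1 in \<open>auto simp: indicator_def\<close>)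
  have "(LINT c|lborel. H c * (indicator {s - L j<..<s} c * damping j c (s - c)) - H c * I c) =
    (LINT c|lborel. H c * (indicator {s + \<rho> - L j<..<s+\<rho>} c * damping j c (s + \<rho> - c)) - H c * indicator {s<..<s+\<rho>} c
       + H c * (indicator {s - L j<..<s+\<rho> - L j} c * damping j c (L j)))"
  proof (rule integral_cong_AE)
    show "AE c in lborel. H c * (indicator {s - L j<..<s} c * damping j c (s - c)) - H c * I c =
      H c * (indicator {s + \<rho> - L j<..<s+\<rho>} c * damping j c (s + \<rho> - c)) - H c * indicator {s<..<s+\<rho>} c
       + H c * (indicator {s - L j<..<s+\<rho> - L j} c * damping j c (L j))"
      using AE_lborel_singleton[of s] AE_lborel_singleton[of "s + \<rho> - L j"]
    proof eventually_elim
      case (elim c)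
      \<comment> \<open>The label is on the circle at time \<open>s\<close> or enters later, and it
        has left by time \<open>s + \<rho>\<close> or is still there. In each case the damping
        factors at the first and last position cancel those of the boundary terms.\<close>
      have "indicator {s - L j<..<s} c * damping j c (s - c) - I c =
        indicator {s + \<rho> - L j<..<s+\<rho>} c * damping j c (s + \<rho> - c) - indicator {s<..<s+\<rho>} c + indicator {s - L j<..<s+\<rho> - L j} c * damping j c (L j)"
        if c: "s - L j < c" "c < s + \<rho>"
      proof (cases "c < s")
        case True
        then show ?thesis using c Lj elim by (cases "c < s + \<rho> - L j") (auto simp: I_def indicator_def)
      next
        case False
        then have "damping j c (max 0 (s - c)) = 1" using damping_zero[of 0] by simp
        then show ?thesis using c Lj elim False by (cases "c < s + \<rho> - L j") (auto simp: I_def indicator_def)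
      qed
      moreover have "H c = 0" if "\<not> (s - L j < c \<and> c < s + \<rho>)" using that by (auto simp: H_def)
      ultimately show ?case by (metis (no_types, opaque_lifting) right_diff_distrib distrib_left mult_zero_left diff_self add_0)
    qed
  qed measurable
  then show "(LINT x|lborel. indicator {0<..<L j} x * (v s j x * E (x + \<rho>))) - (LINT \<tau>|lborel. indicator {s<..<s+\<rho>} \<tau> * w \<tau>) =
      (LINT x|lborel. indicator {0<..<L j} x * (v (s + \<rho>) j x * E x))
      - (LINT c|lborel. indicator {s<..<s+\<rho>} c * (g j c * E (s + \<rho> - c)))
      + (LINT c|lborel. indicator {s<..<s+\<rho>} c * (damping j (c - L j) (L j) * g j (c - L j) * E (s + \<rho> - c + L j)))"
    unfolding T1 T2 T3 T4 T5 using i1 i2 i3 i4 i5 by simp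
qed

text \<open>This is the counterpart of \<open>pair_restart\<close> for the explicit solution. In the
  sum over all circles the outflow terms \<open>?R\<close> cancel the inflow terms \<open>?G\<close>
  by the recursion \<open>g_rec\<close>, for the same reason as in
  \<open>pair_generator\<close>.\<close>

lemma v_weak:
  assumes s: "s \<ge> 0" and \<rho>: "0 \<le> \<rho>" "\<rho> \<le> Lmin"
    and \<phi>m: "\<And>i. i \<in> {1..N} \<Longrightarrow> \<phi> i \<in> borel_measurable borel"
    and \<phi>0: "\<And>i x. i \<in> {1..N} \<Longrightarrow> x \<notin> {0<..<L i} \<Longrightarrow> \<phi> i x = 0"
    and E: "\<And>j y. j \<in> {1..N} \<Longrightarrow> E j y = \<phi> j y + (\<Sum>i=1..N. m i j * \<phi> i (y - L j))"
    and Em: "\<And>j. j \<in> {1..N} \<Longrightarrow> E j \<in> borel_measurable borel"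
    and EK: "\<And>j x. j \<in> {1..N} \<Longrightarrow> \<bar>E j x\<bar> \<le> K"
  defines "w \<equiv> (\<lambda>j \<tau>. \<beta> j \<tau> * (LINT x|lborel. indicator {0<..<L j} x * (indicator {a j..b j} x * v \<tau> j x * E j (x + (s + \<rho> - \<tau>)))))"
  shows "\<And>j. j \<in> {1..N} \<Longrightarrow> integrable lborel (\<lambda>\<tau>. indicator {s<..<s+\<rho>} \<tau> * w j \<tau>)"
    and "(\<Sum>j=1..N. LINT x|lborel. indicator {0<..<L j} x * (v s j x * E j (x + \<rho>)))
       - (\<Sum>j=1..N. LINT \<tau>|lborel. indicator {s<..<s+\<rho>} \<tau> * w j \<tau>)
     = (\<Sum>j=1..N. LINT x|lborel. indicator {0<..<L j} x * (v (s + \<rho>) j x * \<phi> j x))"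
proof -
  show "\<And>j. j \<in> {1..N} \<Longrightarrow> integrable lborel (\<lambda>\<tau>. indicator {s<..<s+\<rho>} \<tau> * w j \<tau>)"
    unfolding w_def by (rule transport_weak(1)[OF _ s \<rho> Em EK])
  let ?G = "\<lambda>j c. indicator {s<..<s+\<rho>} c * (g j c * \<phi> j (s + \<rho> - c)) :: real"
  let ?R = "\<lambda>i j c. indicator {s<..<s+\<rho>} c * (m i j * damping j (c - L j) (L j) * g j (c - L j) * \<phi> i (s + \<rho> - c)) :: real"
  have \<phi>K: "\<bar>\<phi> i x\<bar> \<le> K" if i: "i \<in> {1..N}" for i x
  proof (cases "x \<in> {0<..<L i}")
    case True
    then have "E i x = \<phi> i x" using E[OF i] \<phi>0 by simp
    then show ?thesis using EK[OF i, of x] by simp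
  next
    case False
    then show ?thesis using \<phi>0[OF i] order_trans[OF abs_ge_zero EK[OF i]] by simp
  qed
  have Ri: "integrable lborel (?R i j)" if i: "i \<in> {1..N}" and j: "j \<in> {1..N}" for i j
  proof -
    have eq: "- L j + 1 * c = c - L j" for c by simp
    have 1: "integrable lborel (\<lambda>c. indicator {- L j<..<s+\<rho>} (c - L j) * g j (c - L j))"
      using lborel_integrable_real_affine[OF g_integrable[OF j, of "s + \<rho>"], of 1 "- L j"] unfolding eq by simp
    have "integrable lborel (\<lambda>c. (indicator {- L j<..<s+\<rho>} (c - L j) * g j (c - L j)) *
        (indicator {s<..<s+\<rho>} c * (m i j * damping j (c - L j) (L j) * \<phi> i (s + \<rho> - c))))"
    proof (rule integrable_mult_bounded_AE[OF 1, where K="\<bar>m i j\<bar> * K"])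
      note [measurable] = \<phi>m[OF i] damping_measurable_comp
      show "(\<lambda>c. indicator {s<..<s+\<rho>} c * (m i j * damping j (c - L j) (L j) * \<phi> i (s + \<rho> - c))) \<in> borel_measurable lborel"
        by measurable
      show "AE c in lborel. \<bar>indicator {s<..<s+\<rho>} c * (m i j * damping j (c - L j) (L j) * \<phi> i (s + \<rho> - c))\<bar> \<le> \<bar>m i j\<bar> * K"
      proof (rule AE_I2)
        fix c
        have "damping j (c - L j) (L j) * \<bar>\<phi> i (s + \<rho> - c)\<bar> \<le> 1 * K"
          by (rule mult_mono) (use damping01[of j "c - L j" "L j"] \<phi>K[OF i] in auto)
        then have "\<bar>m i j\<bar> * (damping j (c - L j) (L j) * \<bar>\<phi> i (s + \<rho> - c)\<bar>) \<le> \<bar>m i j\<bar> * K"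
          by (intro mult_left_mono) auto
        moreover have "0 \<le> \<bar>m i j\<bar> * K" using \<phi>K[OF i] by (intro mult_nonneg_nonneg) (auto intro: order_trans[OF abs_ge_zero])
        ultimately show "\<bar>indicator {s<..<s+\<rho>} c * (m i j * damping j (c - L j) (L j) * \<phi> i (s + \<rho> - c))\<bar> \<le> \<bar>m i j\<bar> * K"
          using damping01[of j "c - L j" "L j"] by (auto simp: abs_mult indicator_def mult.assoc)
      qed
    qed
    moreover have "(\<lambda>c. (indicator {- L j<..<s+\<rho>} (c - L j) * g j (c - L j)) *
        (indicator {s<..<s+\<rho>} c * (m i j * damping j (c - L j) (L j) * \<phi> i (s + \<rho> - c)))) = ?R i j"
      using s Lp[OF j] by (auto simp: indicator_def fun_eq_iff)
    ultimately show ?thesis by simp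
  qed
  have A: "(LINT x|lborel. indicator {0<..<L j} x * (v (s + \<rho>) j x * E j x)) =
      (LINT x|lborel. indicator {0<..<L j} x * (v (s + \<rho>) j x * \<phi> j x))" if j: "j \<in> {1..N}" for j
    by (rule Bochner_Integration.integral_cong) (use \<phi>0 in \<open>auto simp: E[OF j] indicator_def\<close>)
  have B: "(LINT c|lborel. indicator {s<..<s+\<rho>} c * (g j c * E j (s + \<rho> - c))) = (LINT c|lborel. ?G j c)" if j: "j \<in> {1..N}" for j
  proof (rule Bochner_Integration.integral_cong)
    fix c
    have "E j (s + \<rho> - c) = \<phi> j (s + \<rho> - c)" if "c \<in> {s<..<s+\<rho>}"
      using \<phi>0 that \<rho> Lge[OF j] by (simp add: E[OF j])
    then show "indicator {s<..<s+\<rho>} c * (g j c * E j (s + \<rho> - c)) = ?G j c" by (auto simp: indicator_def)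
  qed simp
  have C: "(LINT c|lborel. indicator {s<..<s+\<rho>} c * (damping j (c - L j) (L j) * g j (c - L j) * E j (s + \<rho> - c + L j))) =
      (\<Sum>i=1..N. LINT c|lborel. ?R i j c)" if j: "j \<in> {1..N}" for j
  proof -
    have "(LINT c|lborel. indicator {s<..<s+\<rho>} c * (damping j (c - L j) (L j) * g j (c - L j) * E j (s + \<rho> - c + L j))) =
      (LINT c|lborel. (\<Sum>i=1..N. ?R i j c))"
    proof (rule Bochner_Integration.integral_cong)
      fix c
      have "E j (s + \<rho> - c + L j) = (\<Sum>i=1..N. m i j * \<phi> i (s + \<rho> - c))" if "c \<in> {s<..<s+\<rho>}"
        using \<phi>0[OF j, of "s + \<rho> - c + L j"] that by (simp add: E[OF j])
      then show "indicator {s<..<s+\<rho>} c * (damping j (c - L j) (L j) * g j (c - L j) * E j (s + \<rho> - c + L j)) = (\<Sum>i=1..N. ?R i j c)"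
        by (cases "c \<in> {s<..<s+\<rho>}") (simp_all add: sum_distrib_left mult_ac)
    qed simp
    also have "\<dots> = (\<Sum>i=1..N. LINT c|lborel. ?R i j c)" by (rule Bochner_Integration.integral_sum) (use Ri j in auto)
    finally show ?thesis .
  qed
  have D: "(LINT c|lborel. ?G i c) = (\<Sum>j=1..N. LINT c|lborel. ?R i j c)" if i: "i \<in> {1..N}" for i
  proof -
    have "(LINT c|lborel. ?G i c) = (LINT c|lborel. (\<Sum>j=1..N. ?R i j c))"
    proof (rule Bochner_Integration.integral_cong)
      fix c
      have "g i c = (\<Sum>j=1..N. m i j * damping j (c - L j) (L j) * g j (c - L j))" if "c \<in> {s<..<s+\<rho>}"
        by (rule g_rec[OF i]) (use that s in auto)
      then show "?G i c = (\<Sum>j=1..N. ?R i j c)"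
        by (cases "c \<in> {s<..<s+\<rho>}") (simp_all add: sum_distrib_left sum_distrib_right mult_ac)
    qed simp
    also have "\<dots> = (\<Sum>j=1..N. LINT c|lborel. ?R i j c)" by (rule Bochner_Integration.integral_sum) (use Ri i in auto)
    finally show ?thesis .
  qed
  have "(\<Sum>j=1..N. LINT x|lborel. indicator {0<..<L j} x * (v s j x * E j (x + \<rho>)))
       - (\<Sum>j=1..N. LINT \<tau>|lborel. indicator {s<..<s+\<rho>} \<tau> * w j \<tau>)
     = (\<Sum>j=1..N. (LINT x|lborel. indicator {0<..<L j} x * (v (s + \<rho>) j x * \<phi> j x)) - (LINT c|lborel. ?G j c)
        + (\<Sum>i=1..N. LINT c|lborel. ?R i j c))"
    unfolding sum_subtractf[symmetric]
  proof (rule sum.cong[OF refl])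
    fix j assume j: "j \<in> {1..N}"
    have "(LINT x|lborel. indicator {0<..<L j} x * (v s j x * E j (x + \<rho>))) - (LINT \<tau>|lborel. indicator {s<..<s+\<rho>} \<tau> * w j \<tau>) =
      (LINT x|lborel. indicator {0<..<L j} x * (v (s + \<rho>) j x * E j x))
      - (LINT c|lborel. indicator {s<..<s+\<rho>} c * (g j c * E j (s + \<rho> - c)))
      + (LINT c|lborel. indicator {s<..<s+\<rho>} c * (damping j (c - L j) (L j) * g j (c - L j) * E j (s + \<rho> - c + L j)))"
      unfolding w_def by (rule transport_weak(2)[OF j s \<rho> Em[OF j] EK[OF j]])
    then show "(LINT x|lborel. indicator {0<..<L j} x * (v s j x * E j (x + \<rho>))) - (LINT \<tau>|lborel. indicator {s<..<s+\<rho>} \<tau> * w j \<tau>) =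
      (LINT x|lborel. indicator {0<..<L j} x * (v (s + \<rho>) j x * \<phi> j x)) - (LINT c|lborel. ?G j c)
        + (\<Sum>i=1..N. LINT c|lborel. ?R i j c)"
      unfolding A[OF j] B[OF j] C[OF j] .
  qed
  also have "\<dots> = (\<Sum>j=1..N. LINT x|lborel. indicator {0<..<L j} x * (v (s + \<rho>) j x * \<phi> j x))
      - (\<Sum>j=1..N. LINT c|lborel. ?G j c) + (\<Sum>j=1..N. \<Sum>i=1..N. LINT c|lborel. ?R i j c)"
    by (simp only: sum.distrib sum_subtractf)
  also have "(\<Sum>j=1..N. LINT c|lborel. ?G j c) = (\<Sum>i=1..N. \<Sum>j=1..N. LINT c|lborel. ?R i j c)"
    by (rule sum.cong[OF refl D])
  also have "(\<Sum>i=1..N. \<Sum>j=1..N. LINT c|lborel. ?R i j c) = (\<Sum>j=1..N. \<Sum>i=1..N. LINT c|lborel. ?R i j c)"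
    by (rule sum.swap)
  finally show "(\<Sum>j=1..N. LINT x|lborel. indicator {0<..<L j} x * (v s j x * E j (x + \<rho>)))
       - (\<Sum>j=1..N. LINT \<tau>|lborel. indicator {s<..<s+\<rho>} \<tau> * w j \<tau>)
     = (\<Sum>j=1..N. LINT x|lborel. indicator {0<..<L j} x * (v (s + \<rho>) j x * \<phi> j x))" by simp
qed

lemma v_zero: "x > 0 \<Longrightarrow> v 0 i x = u0 i x"
  by (simp add: v_def g_neg damping_early)

lemma v_integrable:
  assumes i: "i \<in> {1..N}" and t: "0 \<le> t" "t \<le> T"
  shows "integrable lborel (\<lambda>x. indicator {0<..<L i} x * v t i x)"
    and "(LINT x|lborel. \<bar>indicator {0<..<L i} x * v t i x\<bar>) \<le> (LINT c|lborel. \<bar>indicator {- L i<..<T} c * g i c\<bar>)"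
proof -
  let ?h = "\<lambda>c. indicator {- L i<..<T} c * g i c :: real"
  let ?f = "\<lambda>x. ?h (t + (-1) * x) :: real"
  have hi: "integrable lborel ?h" by (rule g_integrable[OF i])
  have fi: "integrable lborel ?f" by (rule lborel_integrable_real_affine[OF hi]) simp
  have le: "\<bar>indicator {0<..<L i} x * v t i x\<bar> \<le> \<bar>?f x\<bar>" for x
  proof (cases "x \<in> {0<..<L i}")
    case True
    have "damping i (t - x) x * \<bar>g i (t - x)\<bar> \<le> 1 * \<bar>g i (t - x)\<bar>" by (rule mult_right_mono) (use damping01 in auto)
    then show ?thesis using True t damping01[of i "t - x" x] by (simp add: v_def abs_mult indicator_def)
  qed simp
  show vi: "integrable lborel (\<lambda>x. indicator {0<..<L i} x * v t i x)"
    by (rule Bochner_Integration.integrable_bound[OF fi]) (use le v_measurable[OF i] in auto)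
  have "(LINT x|lborel. \<bar>indicator {0<..<L i} x * v t i x\<bar>) \<le> (LINT x|lborel. \<bar>?f x\<bar>)"
    by (rule integral_mono) (use vi fi le in auto)
  also have "\<dots> = (LINT c|lborel. \<bar>?h c\<bar>)"
    using lborel_integral_real_affine[of "-1" "\<lambda>c. \<bar>?h c\<bar>" t] by simp
  finally show "(LINT x|lborel. \<bar>indicator {0<..<L i} x * v t i x\<bar>) \<le> (LINT c|lborel. \<bar>?h c\<bar>)" .
qed

end

section \<open>Uniqueness\<close>

locale mild_damped = mild N L p m S Lmin Nd a b \<alpha> z0 z + damped_network N L m Lmin a b \<beta> u0
  for N L p m S Lmin Nd a b \<alpha> z0 z \<beta> u0 +
  assumes coef_\<beta>: "\<And>j. j \<in> {1..N} \<Longrightarrow> AE \<tau> in lebesgue. 0 \<le> \<tau> \<longrightarrow> coef j \<tau> = \<beta> j \<tau>"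
    and z0_u0: "\<And>i. i \<in> {1..N} \<Longrightarrow> AE x in M i. z0 i x = u0 i x"
begin

definition err :: "real \<Rightarrow> real" where
  "err t = (\<Sum>i=1..N. LINT x|M i. \<bar>z t i x - v t i x\<bar>)"

lemma err_nonneg: "err t \<ge> 0" unfolding err_def by (intro sum_nonneg integral_nonneg_AE) auto

lemma v_M:
  assumes "i \<in> {1..N}" "t \<ge> 0"
  shows "integrable (M i) (v t i)"
  using v_integrable(1)[OF assms(1), of t t] assms integrable_lebesgue_on_borel[OF v_measurable[OF assms(1)], of "{0<..<L i}"] by simp

lemma zv_M:
  assumes "i \<in> {1..N}" "t \<ge> 0"
  shows "integrable (M i) (\<lambda>x. z t i x - v t i x)"
  using v_M[OF assms] X_integrable[OF zX[OF assms(2)] assms(1)] by auto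

text \<open>Test functions must be Borel and bounded everywhere, so a Borel version of the sign is
  clamped to \<open>{-1..1}\<close>. Its values almost everywhere suffice to turn the pairing into
  the L^1 norm.\<close>

lemma sgn_test:
  assumes d: "\<And>i. i \<in> {1..N} \<Longrightarrow> integrable (M i) (d i)"
  shows "\<exists>\<phi>. test 1 \<phi> \<and> (\<forall>i\<in>{1..N}. (LINT x|M i. d i x * \<phi> i x) = (LINT x|M i. \<bar>d i x\<bar>))"
proof -
  define Pr where "Pr = (\<lambda>i f. f \<in> borel_measurable borel \<and> (AE x in M i. sgn (d i x) = f x) \<and> (\<forall>x. x \<notin> {0<..<L i} \<longrightarrow> f x = (0::real)))"
  have "\<exists>f. Pr i f" if i: "i \<in> {1..N}" for i
  proof -
    have "(\<lambda>x. sgn (d i x)) \<in> borel_measurable (M i)"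
      using borel_measurable_integrable[OF d[OF i]] by simp
    from borel_version_on[OF this] show ?thesis unfolding Pr_def by auto
  qed
  then obtain f where f: "\<And>i. i \<in> {1..N} \<Longrightarrow> Pr i (f i)" by metis
  define \<phi> where "\<phi> = (\<lambda>i x. max (- 1) (min 1 (f i x)))"
  have fm: "f i \<in> borel_measurable borel" and fa: "AE x in M i. sgn (d i x) = f i x" and f0: "\<And>x. x \<notin> {0<..<L i} \<Longrightarrow> f i x = 0"
    if "i \<in> {1..N}" for i using f[OF that] unfolding Pr_def by blast+
  have \<phi>m: "\<phi> i \<in> borel_measurable borel" if "i \<in> {1..N}" for i
    unfolding \<phi>_def using fm[OF that] by measurable
  have t: "test 1 \<phi>" unfolding test_def bdd_test_def using \<phi>m f0 by (auto simp: \<phi>_def)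
  moreover have "(LINT x|M i. d i x * \<phi> i x) = (LINT x|M i. \<bar>d i x\<bar>)" if i: "i \<in> {1..N}" for i
  proof (rule integral_cong_AE)
    show "AE x in M i. d i x * \<phi> i x = \<bar>d i x\<bar>" using fa[OF i]
    proof eventually_elim
      case (elim x)
      then have "\<phi> i x = sgn (d i x)" unfolding \<phi>_def by (auto simp: sgn_if split: if_splits)
      then show ?case by (simp add: abs_sgn)
    qed
    show "(\<lambda>x. d i x * \<phi> i x) \<in> borel_measurable (M i)"
      by (rule borel_measurable_times[OF borel_measurable_integrable[OF d[OF i]] borel_measurable_lebesgue_onI[OF \<phi>m[OF i]]])
  qed (use d[OF i] in auto)
  ultimately show ?thesis by blast
qed

lemma v_test_integrable:
  assumes "bdd_test K \<psi>" "i \<in> {1..N}" "t \<ge> 0"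
  shows "integrable (M i) (\<lambda>x. v t i x * \<psi> i x)"
  by (rule integrable_mult_bounded_AE[OF v_M[OF assms(2,3)], where K=K])
    (use assms in \<open>auto simp: bdd_test_def intro: borel_measurable_lebesgue_onI\<close>)

lemma v_pair_lborel:
  assumes "bdd_test K \<psi>" "i \<in> {1..N}"
  shows "(LINT x|M i. v t i x * \<psi> i x) = (LINT x|lborel. indicator {0<..<L i} x * (v t i x * \<psi> i x))"
  by (rule integral_lebesgue_on_borel) (use v_measurable[OF assms(2)] bdd_test_measurable[OF assms] in auto)

lemma err_null_AE:
  assumes e: "err t = 0" and t: "t \<ge> 0" and i: "i \<in> {1..N}"
  shows "AE x in M i. z t i x = v t i x"
proof -
  have "(LINT x|M i. \<bar>z t i x - v t i x\<bar>) = 0"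
    using e i unfolding err_def by (subst (asm) sum_nonneg_eq_0_iff) (auto intro!: integral_nonneg_AE)
  then have "AE x in M i. \<bar>z t i x - v t i x\<bar> = 0"
    using integral_nonneg_eq_0_iff_AE[of "M i" "\<lambda>x. \<bar>z t i x - v t i x\<bar>"] zv_M[OF i t] by auto
  then show ?thesis by eventually_elim simp
qed

lemma err_zero: "err 0 = 0"
proof -
  have d: "integrable (M i) (\<lambda>x. z 0 i x - v 0 i x)" if "i \<in> {1..N}" for i using zv_M[OF that] by simp
  obtain \<phi> where t: "test 1 \<phi>"
    and \<phi>: "\<And>i. i \<in> {1..N} \<Longrightarrow> (LINT x|M i. (z 0 i x - v 0 i x) * \<phi> i x) = (LINT x|M i. \<bar>z 0 i x - v 0 i x\<bar>)"
    using sgn_test[OF d] by blast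
  have bt: "bdd_test 1 \<phi>" using t by (simp add: test_def)
  have "(LINT x|M i. (z 0 i x - v 0 i x) * \<phi> i x) = (LINT x|M i. z 0 i x * \<phi> i x) - (LINT x|M i. z0 i x * \<phi> i x)" if i: "i \<in> {1..N}" for i
  proof -
    have ae: "AE x in M i. v 0 i x = z0 i x"
      using z0_u0[OF i] AE_space[of "M i"]
    proof eventually_elim
      case (elim x)
      then have "x > 0" by simp
      then show ?case using elim v_zero[of x i] by simp
    qed
    have "(LINT x|M i. v 0 i x * \<phi> i x) = (LINT x|M i. z0 i x * \<phi> i x)"
    proof (rule integral_cong_AE)
      show "AE x in M i. v 0 i x * \<phi> i x = z0 i x * \<phi> i x" using ae by eventually_elim simp
    qed (use v_test_integrable[OF bt i, of 0] pair_integrable[OF bt z0 i] in auto)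
    then show ?thesis
      using v_test_integrable[OF bt i, of 0] pair_integrable[OF bt zX[of 0] i] by (simp add: left_diff_distrib)
  qed
  then have "err 0 = pair \<phi> (z 0) - pair \<phi> z0"
    unfolding err_def pair_def sum_subtractf[symmetric] by (intro sum.cong refl) (simp flip: \<phi>)
  then show ?thesis using pair_initial[OF bt] by simp
qed

text \<open>The difference of the two weak equations is tested with the sign of \<open>z - v\<close>
  at time \<open>s + \<rho>\<close>. The states agree at \<open>s\<close>, so only the source terms
  remain, and at time \<open>\<tau>\<close> they are at most \<open>err \<tau>\<close> because
  \<open>shift\<close> preserves the bound \<open>1\<close> of the test function and
  \<open>\<beta> \<le> 1\<close>. A constant bound \<open>B\<close> in place of an integral of
  \<open>err\<close> spares the measurability of \<open>err\<close>.\<close>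

lemma err_step:
  assumes s: "s \<ge> 0" and \<rho>: "0 \<le> \<rho>" "\<rho> \<le> Lmin" and e0: "err s = 0"
    and B: "\<And>\<tau>. s \<le> \<tau> \<Longrightarrow> \<tau> \<le> s + \<rho> \<Longrightarrow> err \<tau> \<le> B"
  shows "err (s + \<rho>) \<le> \<rho> * B"
proof -
  have s\<rho>: "s + \<rho> \<ge> 0" using s \<rho> by simp
  have d: "integrable (M i) (\<lambda>x. z (s + \<rho>) i x - v (s + \<rho>) i x)" if "i \<in> {1..N}" for i using zv_M[OF that s\<rho>] .
  obtain \<phi> where t: "test 1 \<phi>"
    and \<phi>: "\<And>i. i \<in> {1..N} \<Longrightarrow> (LINT x|M i. (z (s + \<rho>) i x - v (s + \<rho>) i x) * \<phi> i x) = (LINT x|M i. \<bar>z (s + \<rho>) i x - v (s + \<rho>) i x\<bar>)"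
    using sgn_test[OF d] by blast
  have bt: "bdd_test 1 \<phi>" using t by (simp add: test_def)
  have bs: "bdd_test 1 (shift x \<phi>)" for x by (rule shift_bdd[OF t])
  have e1: "err (s + \<rho>) = pair \<phi> (z (s + \<rho>)) - (\<Sum>i=1..N. LINT x|M i. v (s + \<rho>) i x * \<phi> i x)"
    unfolding err_def pair_def sum_subtractf[symmetric]
  proof (rule sum.cong[OF refl])
    fix i assume i: "i \<in> {1..N}"
    show "(LINT x|M i. \<bar>z (s + \<rho>) i x - v (s + \<rho>) i x\<bar>) = (LINT x|M i. z (s + \<rho>) i x * \<phi> i x) - (LINT x|M i. v (s + \<rho>) i x * \<phi> i x)"
      using v_test_integrable[OF bt i s\<rho>] pair_integrable[OF bt zX[OF s\<rho>] i] by (simp add: left_diff_distrib flip: \<phi>[OF i])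
  qed
  define w where "w = (\<lambda>j \<tau>. \<beta> j \<tau> * (LINT x|lborel. indicator {0<..<L j} x * (indicator {a j..b j} x * v \<tau> j x * ext \<phi> j (x + (s + \<rho> - \<tau>)))))"
  have vw: "\<And>j. j \<in> {1..N} \<Longrightarrow> integrable lborel (\<lambda>\<tau>. indicator {s<..<s+\<rho>} \<tau> * w j \<tau>)"
    "(\<Sum>j=1..N. LINT x|lborel. indicator {0<..<L j} x * (v s j x * ext \<phi> j (x + \<rho>)))
       - (\<Sum>j=1..N. LINT \<tau>|lborel. indicator {s<..<s+\<rho>} \<tau> * w j \<tau>)
     = (\<Sum>j=1..N. LINT x|lborel. indicator {0<..<L j} x * (v (s + \<rho>) j x * \<phi> j x))"
    unfolding w_def
    by (rule v_weak[OF s \<rho>, of \<phi> "ext \<phi>" 1];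
        use t ext_measurable[OF bt] ext_bound[OF t] bdd_test_measurable[OF bt] in \<open>auto simp: test_def ext_def\<close>)+
  have vs: "(\<Sum>j=1..N. LINT x|lborel. indicator {0<..<L j} x * (v s j x * ext \<phi> j (x + \<rho>))) = pair (shift \<rho> \<phi>) (z s)"
    unfolding pair_def
  proof (rule sum.cong[OF refl])
    fix i assume i: "i \<in> {1..N}"
    have "(LINT x|lborel. indicator {0<..<L i} x * (v s i x * ext \<phi> i (x + \<rho>))) = (LINT x|M i. v s i x * shift \<rho> \<phi> i x)"
      unfolding v_pair_lborel[OF bs i] by (simp add: shift_def)
    also have "\<dots> = (LINT x|M i. z s i x * shift \<rho> \<phi> i x)"
    proof (rule integral_cong_AE)
      show "AE x in M i. v s i x * shift \<rho> \<phi> i x = z s i x * shift \<rho> \<phi> i x"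
        using err_null_AE[OF e0 s i] by eventually_elim simp
    qed (use v_test_integrable[OF bs i s] pair_integrable[OF bs zX[OF s] i] in auto)
    finally show "(LINT x|lborel. indicator {0<..<L i} x * (v s i x * ext \<phi> i (x + \<rho>))) = (LINT x|M i. z s i x * shift \<rho> \<phi> i x)" .
  qed
  have e2: "(\<Sum>i=1..N. LINT x|M i. v (s + \<rho>) i x * \<phi> i x) = pair (shift \<rho> \<phi>) (z s) - (\<Sum>j=1..N. LINT \<tau>|lborel. indicator {s<..<s+\<rho>} \<tau> * w j \<tau>)"
    using vw(2) unfolding vs by (simp add: v_pair_lborel[OF bt])
  define G where "G = (\<lambda>\<tau>. indicator {s<..s+\<rho>} \<tau> * pair (shift (s + \<rho> - \<tau>) \<phi>) (source \<tau>) + (\<Sum>j=1..N. indicator {s<..<s+\<rho>} \<tau> * w j \<tau>))"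
  have wl: "has_bochner_integral lebesgue (\<lambda>\<tau>. indicator {s<..<s+\<rho>} \<tau> * w j \<tau>) (LINT \<tau>|lborel. indicator {s<..<s+\<rho>} \<tau> * w j \<tau>)" if j: "j \<in> {1..N}" for j
    using vw(1)[OF j] by (simp add: has_bochner_integral_iff integrable_completion integral_completion)
  have G: "has_bochner_integral lebesgue G (err (s + \<rho>))"
  proof -
    have "has_bochner_integral lebesgue G ((pair \<phi> (z (s + \<rho>)) - pair (shift \<rho> \<phi>) (z s)) + (\<Sum>j=1..N. LINT \<tau>|lborel. indicator {s<..<s+\<rho>} \<tau> * w j \<tau>))"
      unfolding G_def by (intro has_bochner_integral_add pair_restart[OF t s \<rho>] has_bochner_integral_sum wl)
    moreover have "(pair \<phi> (z (s + \<rho>)) - pair (shift \<rho> \<phi>) (z s)) + (\<Sum>j=1..N. LINT \<tau>|lborel. indicator {s<..<s+\<rho>} \<tau> * w j \<tau>) = err (s + \<rho>)"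
      unfolding e1 e2 by linarith
    ultimately show ?thesis by metis
  qed
  have Gb: "AE \<tau> in lebesgue. G \<tau> \<le> indicator {s<..s+\<rho>} \<tau> * B"
  proof -
    \<comment> \<open>The open and the half-open time interval, and likewise \<open>coef\<close> and
      \<open>\<beta>\<close> at nonnegative times, differ only on null sets.\<close>
    have 1: "AE \<tau> in lebesgue. \<tau> \<noteq> s + \<rho>" by (rule AE_completion[OF AE_lborel_singleton])
    have 2: "AE \<tau> in lebesgue. \<forall>j\<in>{1..N}. 0 \<le> \<tau> \<longrightarrow> coef j \<tau> = \<beta> j \<tau>"
      by (rule AE_finite_allI) (use coef_\<beta> in auto)
    show ?thesis using 1 2
    proof eventually_elim
      case (elim \<tau>)
      show ?case
      proof (cases "\<tau> \<in> {s<..<s+\<rho>}")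
        case False
        then have "\<tau> \<notin> {s<..s+\<rho>}" using elim(1) by auto
        then have i0: "indicator {s<..s+\<rho>} \<tau> = (0::real)" by (rule indicator_simps(2))
        have "(\<Sum>j=1..N. indicator {s<..<s+\<rho>} \<tau> * w j \<tau>) = 0"
          by (rule sum.neutral) (use False in simp)
        then show ?thesis unfolding G_def i0 by (simp only: mult_zero_left add_0 order_refl)
      next
        case True
        then have \<tau>: "\<tau> \<ge> 0" "s \<le> \<tau>" "\<tau> \<le> s + \<rho>" using s by auto
        define \<psi> where "\<psi> = shift (s + \<rho> - \<tau>) \<phi>"
        have b\<psi>: "bdd_test 1 \<psi>" unfolding \<psi>_def by (rule bs)
        have bi: "bdd_test 1 (\<lambda>j x. indicator {a j..b j} x * \<psi> j x)"
          unfolding bdd_test_def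
        proof (intro ballI conjI allI)
          fix i x assume i: "i \<in> {1..N}"
          show "(\<lambda>x. indicator {a i..b i} x * \<psi> i x) \<in> borel_measurable borel" using bdd_test_measurable[OF b\<psi> i] by simp
          show "\<bar>indicator {a i..b i} x * \<psi> i x\<bar> \<le> 1" using b\<psi> i by (auto simp: bdd_test_def indicator_def)
        qed
        have ww: "w j \<tau> = \<beta> j \<tau> * (LINT x|M j. v \<tau> j x * (indicator {a j..b j} x * \<psi> j x))" if j: "j \<in> {1..N}" for j
          unfolding w_def v_pair_lborel[OF bi j] by (simp add: \<psi>_def shift_def mult_ac)
        have "G \<tau> = (\<Sum>j=1..N. \<beta> j \<tau> * ((LINT x|M j. v \<tau> j x * (indicator {a j..b j} x * \<psi> j x)) - (LINT x|M j. z \<tau> j x * (indicator {a j..b j} x * \<psi> j x))))"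
        proof -
          have "pair \<psi> (source \<tau>) = - (\<Sum>j=1..N. \<beta> j \<tau> * (LINT x|M j. z \<tau> j x * (indicator {a j..b j} x * \<psi> j x)))"
            unfolding pair_source[OF b\<psi> \<tau>(1)] using elim(2) \<tau>(1) by (simp add: mult_ac)
          then have "G \<tau> = - (\<Sum>j=1..N. \<beta> j \<tau> * (LINT x|M j. z \<tau> j x * (indicator {a j..b j} x * \<psi> j x))) + (\<Sum>j=1..N. w j \<tau>)"
          proof -
            have "(\<Sum>j=1..N. indicator {s<..<s+\<rho>} \<tau> * w j \<tau>) = (\<Sum>j=1..N. w j \<tau>)"
              by (rule sum.cong[OF refl]) (use True in simp)
            moreover have "indicator {s<..s+\<rho>} \<tau> = (1::real)" using True by simp
            ultimately show ?thesis unfolding G_def \<psi>_def[symmetric] using \<open>pair \<psi> (source \<tau>) = _\<close> by simp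
          qed
          also have "(\<Sum>j=1..N. w j \<tau>) = (\<Sum>j=1..N. \<beta> j \<tau> * (LINT x|M j. v \<tau> j x * (indicator {a j..b j} x * \<psi> j x)))"
            by (rule sum.cong[OF refl ww])
          finally show ?thesis by (simp add: right_diff_distrib sum_subtractf)
        qed
        also have "\<dots> \<le> err \<tau>" unfolding err_def
        proof (rule sum_mono)
          fix j assume j: "j \<in> {1..N}"
          let ?k = "\<lambda>x. indicator {a j..b j} x * \<psi> j x"
          have iv: "integrable (M j) (\<lambda>x. v \<tau> j x * ?k x)" by (rule v_test_integrable[OF bi j \<tau>(1)])
          have iz: "integrable (M j) (\<lambda>x. z \<tau> j x * ?k x)" by (rule pair_integrable[OF bi zX[OF \<tau>(1)] j])
          have "(LINT x|M j. v \<tau> j x * ?k x) - (LINT x|M j. z \<tau> j x * ?k x) = (LINT x|M j. v \<tau> j x * ?k x - z \<tau> j x * ?k x)"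
            using iv iz by simp
          also have "\<dots> \<le> (LINT x|M j. \<bar>z \<tau> j x - v \<tau> j x\<bar>)"
          proof (rule integral_mono)
            fix x
            have "\<bar>?k x\<bar> \<le> 1" using bi j by (simp add: bdd_test_def)
            then have k: "\<bar>v \<tau> j x - z \<tau> j x\<bar> * \<bar>?k x\<bar> \<le> \<bar>v \<tau> j x - z \<tau> j x\<bar> * 1" by (rule mult_left_mono) simp
            have "v \<tau> j x * ?k x - z \<tau> j x * ?k x = (v \<tau> j x - z \<tau> j x) * ?k x" by (simp only: left_diff_distrib)
            also have "\<dots> \<le> \<bar>v \<tau> j x - z \<tau> j x\<bar> * \<bar>?k x\<bar>" unfolding abs_mult[symmetric] by (rule abs_ge_self)
            also note k
            finally show "v \<tau> j x * ?k x - z \<tau> j x * ?k x \<le> \<bar>z \<tau> j x - v \<tau> j x\<bar>"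
              by (simp add: abs_minus_commute)
          qed (use iv iz zv_M[OF j \<tau>(1)] in auto)
          finally have le: "(LINT x|M j. v \<tau> j x * ?k x) - (LINT x|M j. z \<tau> j x * ?k x) \<le> (LINT x|M j. \<bar>z \<tau> j x - v \<tau> j x\<bar>)" .
          have "\<beta> j \<tau> * ((LINT x|M j. v \<tau> j x * ?k x) - (LINT x|M j. z \<tau> j x * ?k x)) \<le> \<beta> j \<tau> * (LINT x|M j. \<bar>z \<tau> j x - v \<tau> j x\<bar>)"
            by (rule mult_left_mono[OF le]) (use \<beta>01 in blast)
          also have "\<dots> \<le> 1 * (LINT x|M j. \<bar>z \<tau> j x - v \<tau> j x\<bar>)"
            by (rule mult_right_mono) (use \<beta>01 in \<open>auto intro: integral_nonneg_AE\<close>)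
          finally show "\<beta> j \<tau> * ((LINT x|M j. v \<tau> j x * ?k x) - (LINT x|M j. z \<tau> j x * ?k x)) \<le> (LINT x|M j. \<bar>z \<tau> j x - v \<tau> j x\<bar>)" by simp
        qed
        also have "\<dots> \<le> B" by (rule B[OF \<tau>(2,3)])
        finally show ?thesis using True by simp
      qed
    qed
  qed
  have iB: "integrable lebesgue (\<lambda>\<tau>. indicator {s<..s+\<rho>} \<tau> * B)"
    by (intro integrable_mult_left integrable_real_indicator) (use \<rho> in auto)
  have "err (s + \<rho>) = (LINT \<tau>|lebesgue. G \<tau>)" using G by (simp add: has_bochner_integral_integral_eq)
  also have "\<dots> \<le> (LINT \<tau>|lebesgue. indicator {s<..s+\<rho>} \<tau> * B)"
    by (rule integral_mono_AE[OF _ iB Gb]) (use G in \<open>simp add: has_bochner_integral_iff\<close>)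
  also have "\<dots> = \<rho> * B" using \<rho> by simp
  finally show ?thesis .
qed

text \<open>The starting bound for the contraction. For \<open>z\<close> it comes from continuity in
  time on a compact interval, and for \<open>v\<close> from the integrability of \<open>g\<close>,
  which dominates all states up to \<open>T\<close>.\<close>

lemma err_bounded: "\<exists>B. \<forall>t\<in>{0..T}. err t \<le> B"
proof -
  have c: "continuous_on {0..T} (\<lambda>t. N1 (z t))" unfolding continuous_on_def
  proof
    fix t assume "t \<in> {0..T}"
    then have t: "t \<ge> 0" by simp
    let ?C = "(\<Sum>i=1..N. L i) + 1"
    have lim: "((\<lambda>s. 4 * 0 + ?C * nrm (z s - z t)) \<longlongrightarrow> 4 * 0 + ?C * 0) (at t within {0..T})"
      by (intro tendsto_intros tendsto_within_subset[OF zc[OF t]]) auto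
    show "((\<lambda>s. N1 (z s)) \<longlongrightarrow> N1 (z t)) (at t within {0..T})"
    proof (rule Lim_transform[OF tendsto_const], rule Lim_null_comparison)
      show "((\<lambda>s. ?C * nrm (z s - z t)) \<longlongrightarrow> 0) (at t within {0..T})" using lim by simp
      have "\<forall>\<^sub>F s in at t within {0..T}. s \<in> {0..T}" by (simp add: eventually_at_filter)
      then show "\<forall>\<^sub>F s in at t within {0..T}. norm (N1 (z s) - N1 (z t)) \<le> ?C * nrm (z s - z t)"
      proof eventually_elim
        case (elim s)
        then have s: "s \<ge> 0" by simp
        have X: "z s - z t \<in> X" "z t - z s \<in> X" using qn.Xdiff zX s t by auto
        have "N1 (z s) \<le> N1 (z t) + N1 (z s - z t)" using N1_add[OF zX[OF t] X(1)] by simp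
        moreover have "N1 (z t) \<le> N1 (z s) + N1 (z t - z s)" using N1_add[OF zX[OF s] X(2)] by simp
        moreover have "N1 (z s - z t) \<le> ?C * nrm (z s - z t)" by (rule N1_le[OF X(1)])
        moreover have "N1 (z t - z s) \<le> ?C * nrm (z s - z t)"
          using N1_le[OF X(2)] qn.nrm_diff_commute[OF zX[OF s] zX[OF t]] by simp
        ultimately show ?case by (simp add: abs_le_iff)
      qed
    qed
  qed
  obtain B1 where B1: "\<And>t. t \<in> {0..T} \<Longrightarrow> norm (N1 (z t)) \<le> B1"
    using compact_imp_bounded[OF compact_continuous_image[OF c compact_Icc]] unfolding bounded_iff by blast
  define B2 where "B2 = (\<Sum>i=1..N. LINT c|lborel. \<bar>indicator {- L i<..<T} c * g i c\<bar>)"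
  have "err t \<le> B1 + B2" if t: "t \<in> {0..T}" for t
  proof -
    have t0: "t \<ge> 0" "t \<le> T" using t by auto
    have "err t \<le> (\<Sum>i=1..N. (LINT x|M i. \<bar>z t i x\<bar>) + (LINT c|lborel. \<bar>indicator {- L i<..<T} c * g i c\<bar>))"
      unfolding err_def
    proof (rule sum_mono)
      fix i assume i: "i \<in> {1..N}"
      have iz: "integrable (M i) (z t i)" by (rule X_integrable[OF zX[OF t0(1)] i])
      have iv: "integrable (M i) (v t i)" by (rule v_M[OF i t0(1)])
      have "(LINT x|M i. \<bar>z t i x - v t i x\<bar>) \<le> (LINT x|M i. \<bar>z t i x\<bar> + \<bar>v t i x\<bar>)"
        by (rule integral_mono) (use iz iv in auto)
      also have "\<dots> = (LINT x|M i. \<bar>z t i x\<bar>) + (LINT x|M i. \<bar>v t i x\<bar>)" using iz iv by simp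
      also have "(LINT x|M i. \<bar>v t i x\<bar>) = (LINT x|lborel. \<bar>indicator {0<..<L i} x * v t i x\<bar>)"
      proof -
        have "(LINT x|M i. \<bar>v t i x\<bar>) = (LINT x|lborel. indicator {0<..<L i} x * \<bar>v t i x\<bar>)"
          by (rule integral_lebesgue_on_borel) (use v_measurable[OF i] in auto)
        then show ?thesis by (simp add: abs_mult)
      qed
      also have "\<dots> \<le> (LINT c|lborel. \<bar>indicator {- L i<..<T} c * g i c\<bar>)" by (rule v_integrable(2)[OF i t0])
      finally show "(LINT x|M i. \<bar>z t i x - v t i x\<bar>) \<le> (LINT x|M i. \<bar>z t i x\<bar>) + (LINT c|lborel. \<bar>indicator {- L i<..<T} c * g i c\<bar>)" by simp
    qed
    also have "\<dots> = N1 (z t) + B2" by (simp add: sum.distrib N1_def B2_def)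
    finally show ?thesis using B1[OF t] by simp
  qed
  then show ?thesis by blast
qed

lemma err_null:
  assumes t: "t \<ge> 0"
  shows "err t = 0"
proof -
  \<comment> \<open>A step of at most \<open>1 / 2\<close> makes each application of
    \<open>err_step\<close> halve the bound; \<open>Lmin\<close> is the range of the explicit
    duality.\<close>
  define h where "h = min Lmin (1 / 2)"
  have h: "h > 0" "h \<le> Lmin" "h \<le> 1 / 2" using Lmin by (auto simp: h_def)
  have step: "err (s + \<rho>) = 0" if s: "s \<ge> 0" and e: "err s = 0" and \<rho>: "0 \<le> \<rho>" "\<rho> \<le> h" for s \<rho>
  proof -
    obtain B where B: "\<And>t. t \<in> {0..s + h} \<Longrightarrow> err t \<le> B" using err_bounded by blast
    have it: "\<forall>\<rho>\<in>{0..h}. err (s + \<rho>) \<le> B / 2 ^ n" for n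
    proof (induction n)
      case 0
      then show ?case using B s by auto
    next
      case (Suc n)
      show ?case
      proof
        fix \<rho> assume \<rho>: "\<rho> \<in> {0..h}"
        have B0: "0 \<le> B / 2 ^ n" using Suc.IH \<rho> err_nonneg[of "s + \<rho>"] order_trans by blast
        have "err (s + \<rho>) \<le> \<rho> * (B / 2 ^ n)"
        proof (rule err_step[OF s _ _ e])
          fix \<tau> assume "s \<le> \<tau>" "\<tau> \<le> s + \<rho>"
          then have "\<tau> - s \<in> {0..h}" using \<rho> by auto
          from Suc.IH[rule_format, OF this] show "err \<tau> \<le> B / 2 ^ n" by simp
        qed (use \<rho> h in auto)
        also have "\<dots> \<le> (1 / 2) * (B / 2 ^ n)" by (rule mult_right_mono[OF _ B0]) (use \<rho> h in auto)
        finally show "err (s + \<rho>) \<le> B / 2 ^ Suc n" by simp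
      qed
    qed
    have "(\<lambda>n. B / 2 ^ n) \<longlonglongrightarrow> 0" by (rule LIMSEQ_divide_realpow_zero) simp
    then have "err (s + \<rho>) \<le> 0" by (rule LIMSEQ_le_const) (use it \<rho> in auto)
    then show ?thesis using err_nonneg[of "s + \<rho>"] by simp
  qed
  have "\<forall>t\<in>{0..n * h}. err t = 0" for n :: nat
  proof (induction n)
    case 0
    then show ?case using err_zero by simp
  next
    case (Suc n)
    show ?case
    proof
      fix t assume t: "t \<in> {0..Suc n * h}"
      show "err t = 0"
      proof (cases "t \<le> n * h")
        case True
        then show ?thesis using Suc t by auto
      next
        case False
        then show ?thesis using step[of "n * h" "t - n * h"] Suc t h by (auto simp: algebra_simps)
      qed
    qed
  qed
  moreover obtain n :: nat where "t / h \<le> n" using real_arch_simple by blast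
  then have "t \<le> n * h" using h by (simp add: field_simps)
  ultimately show ?thesis using t by auto
qed

theorem mild_eq_explicit:
  assumes "t \<ge> 0" "i \<in> {1..N}"
  shows "AE x in M i. z t i x = v t i x"
  by (rule err_null_AE[OF err_null[OF assms(1)] assms])

end

section \<open>Exponential stability\<close>

definition index_box :: "nat \<Rightarrow> nat \<Rightarrow> (nat \<Rightarrow> nat) set" where
  "index_box N n = {1..N} \<rightarrow>\<^sub>E {..n}"

lemma finite_index_box: "finite (index_box N n)" and card_index_box: "card (index_box N n) = (n + 1) ^ N"
  unfolding index_box_def by (auto intro: finite_PiE simp: card_PiE)

locale damped_decay = damped_network N L m Lmin a b \<beta> u0 + transit N L m Lmin Lmax
  for N L m Lmin a b \<beta> u0 Lmax
begin

definition len :: "(nat \<Rightarrow> nat) \<Rightarrow> real" where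
  "len \<nu> = (\<Sum>j=1..N. real (\<nu> j) * L j)"

text \<open>This contains every time at which a path with at most \<open>n\<close> transits that
  ends at time \<open>t\<close> can begin, since only the numbers of crossings of the circles
  matter.\<close>

definition reach :: "nat \<Rightarrow> real \<Rightarrow> real set" where
  "reach n t = (\<lambda>\<nu>. t - len \<nu>) ` index_box N n"

lemma finite_reach: "finite (reach n t)" unfolding reach_def by (intro finite_imageI finite_index_box)

lemma reach_self: "t \<in> reach n t"
  unfolding reach_def
proof (rule image_eqI)
  show "t = t - len (\<lambda>j\<in>{1..N}. 0)" by (simp add: len_def)
  show "(\<lambda>j\<in>{1..N}. 0) \<in> index_box N n" by (simp add: index_box_def)
qed

lemma reach_step:
  assumes k: "k \<in> {1..N}"
  shows "reach n (t - L k) \<subseteq> reach (Suc n) t"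
proof
  fix s assume "s \<in> reach n (t - L k)"
  then obtain \<nu> where \<nu>: "\<nu> \<in> index_box N n" and s: "s = t - L k - len \<nu>" by (auto simp: reach_def)
  define \<nu>' where "\<nu>' = \<nu>(k := \<nu> k + 1)"
  have "len \<nu>' = (\<Sum>j=1..N. real (\<nu> j) * L j + (if j = k then L k else 0))"
    unfolding len_def \<nu>'_def by (rule sum.cong) (auto simp: algebra_simps)
  also have "\<dots> = len \<nu> + L k" using k by (simp add: sum.distrib len_def)
  finally have "s = t - len \<nu>'" using s by simp
  moreover have "\<nu>' \<in> index_box N (Suc n)" using \<nu> k by (auto simp: index_box_def \<nu>'_def PiE_iff extensional_def)
  ultimately show "s \<in> reach (Suc n) t" by (auto simp: reach_def)
qed

text \<open>\<open>path_weight n i t l s\<close> is the total weight of the paths with exactly \<open>n\<close> transits that enter circle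
  \<open>l\<close> at time \<open>s\<close> and circle \<open>i\<close> at time \<open>t\<close>.\<close>

fun path_weight :: "nat \<Rightarrow> nat \<Rightarrow> real \<Rightarrow> nat \<Rightarrow> real \<Rightarrow> real" where
  "path_weight 0 i t l s = (if l = i \<and> s = t then 1 else 0)"
| "path_weight (Suc n) i t l s = damping l s (L l) * (\<Sum>k=1..N. m k l * path_weight n i t k (s + L l))"

text \<open>\<open>path_weight\<close> splits off the first transit, as the maximum principle
  requires, whereas the recursion of \<open>g\<close> splits off the last one. The weight of a path
  is the same product in both readings.\<close>

lemma path_weight_last:
  "i \<in> {1..N} \<Longrightarrow> l \<in> {1..N} \<Longrightarrow>
     path_weight (Suc n) i t l s = (\<Sum>k=1..N. m i k * damping k (t - L k) (L k) * path_weight n k (t - L k) l s)"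
proof (induction n arbitrary: l s)
  case 0
  have "(\<Sum>k=1..N. m k l * path_weight 0 i t k (s + L l)) = (\<Sum>k=1..N. if k = i then (if s + L l = t then m i l else 0) else 0)"
    by (rule sum.cong) auto
  then have 1: "path_weight (Suc 0) i t l s = (if s + L l = t then damping l s (L l) * m i l else 0)" using 0 by simp
  have "(\<Sum>k=1..N. m i k * damping k (t - L k) (L k) * path_weight 0 k (t - L k) l s) =
    (\<Sum>k=1..N. if k = l then (if s + L l = t then m i l * damping l s (L l) else 0) else 0)"
    by (rule sum.cong) auto
  then show ?case using 1 0 by simp
next
  case (Suc n)
  have "path_weight (Suc (Suc n)) i t l s = damping l s (L l) * (\<Sum>k=1..N. m k l * path_weight (Suc n) i t k (s + L l))" by (rule path_weight.simps(2))
  also have "(\<Sum>k=1..N. m k l * path_weight (Suc n) i t k (s + L l)) =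
      (\<Sum>k=1..N. \<Sum>k'=1..N. m k l * (m i k' * damping k' (t - L k') (L k') * path_weight n k' (t - L k') k (s + L l)))"
    by (rule sum.cong[OF refl]) (simp only: Suc.IH[OF Suc.prems(1)] sum_distrib_left)
  also have "\<dots> = (\<Sum>k'=1..N. \<Sum>k=1..N. m k l * (m i k' * damping k' (t - L k') (L k') * path_weight n k' (t - L k') k (s + L l)))"
    by (rule sum.swap)
  also have "damping l s (L l) * \<dots> = (\<Sum>k'=1..N. m i k' * damping k' (t - L k') (L k') * path_weight (Suc n) k' (t - L k') l s)"
    unfolding path_weight.simps sum_distrib_left by (intro sum.cong refl) (simp add: mult_ac)
  finally show ?case .
qed

lemma path_weight_late: "l \<in> {1..N} \<Longrightarrow> s > t \<Longrightarrow> path_weight n i t l s = 0"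
proof (induction n arbitrary: l s)
  case (Suc n)
  have "path_weight n i t k (s + L l) = 0" if "k \<in> {1..N}" for k
    using Suc.IH[OF that] Suc.prems Lpos[OF Suc.prems(1)] by simp
  then show ?case by simp
qed simp

lemma path_weight_Suc_late:
  assumes l: "l \<in> {1..N}" and s: "s + L l > t"
  shows "path_weight (Suc n) i t l s = 0"
  using path_weight_late[OF _ s] by simp

lemma g_expansion:
  "i \<in> {1..N} \<Longrightarrow> - L i \<le> t \<Longrightarrow> t < n * Lmin \<Longrightarrow> finite F \<Longrightarrow> reach n t \<subseteq> F \<Longrightarrow>
    g i t = (\<Sum>j=1..N. \<Sum>s\<in>F. if - L j \<le> s \<and> s < 0 then (\<Sum>k\<le>n. path_weight k i t j s) * u0 j (- s) else 0)"
proof (induction n arbitrary: i t)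
  case 0
  then have t: "t < 0" by simp
  have "(\<Sum>j=1..N. \<Sum>s\<in>F. if - L j \<le> s \<and> s < 0 then (\<Sum>k\<le>0. path_weight k i t j s) * u0 j (- s) else 0) =
    (\<Sum>j=1..N. \<Sum>s\<in>F. if s = t then (if j = i then u0 i (- t) else 0) else 0)"
    by (intro sum.cong refl) (use t 0 in auto)
  also have "\<dots> = u0 i (- t)" using 0 reach_self[of t 0] by (simp add: subset_iff)
  finally show ?case using g_neg[OF t] by simp
next
  case (Suc n)
  show ?case
  proof (cases "t < 0")
    case True
    have "(\<Sum>k\<le>Suc n. path_weight k i t j s) = path_weight 0 i t j s" if j: "j \<in> {1..N}" and s: "- L j \<le> s" for j s
    proof -
      \<comment> \<open>A particle that enters circle \<open>j\<close> at
        \<open>s \<ge> - L j\<close> leaves it at a nonnegative time, hence after \<open>t\<close>;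
        only the path without transits contributes.\<close>
      have "s + L j > t" using s True by simp
      then have "(\<Sum>k\<le>n. path_weight (Suc k) i t j s) = 0" by (intro sum.neutral ballI path_weight_Suc_late[OF j])
      then show ?thesis unfolding sum.atMost_Suc_shift by simp
    qed
    then have "(\<Sum>j=1..N. \<Sum>s\<in>F. if - L j \<le> s \<and> s < 0 then (\<Sum>k\<le>Suc n. path_weight k i t j s) * u0 j (- s) else 0) =
      (\<Sum>j=1..N. \<Sum>s\<in>F. if s = t then (if j = i then u0 i (- t) else 0) else 0)"
      by (intro sum.cong refl) (use True Suc.prems in auto)
    also have "\<dots> = u0 i (- t)" using Suc.prems reach_self[of t "Suc n"] by (simp add: subset_iff)
    finally show ?thesis using g_neg[OF True] by simp
  next
    case False
    then have t0: "t \<ge> 0" by simp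
    have IH: "g k (t - L k) = (\<Sum>j=1..N. \<Sum>s\<in>F. if - L j \<le> s \<and> s < 0 then (\<Sum>n'\<le>n. path_weight n' k (t - L k) j s) * u0 j (- s) else 0)"
      if k: "k \<in> {1..N}" for k
    proof (rule Suc.IH[OF k])
      show "t - L k < n * Lmin" using Suc.prems Lge[OF k] by (simp add: algebra_simps)
      show "reach n (t - L k) \<subseteq> F" using reach_step[OF k] Suc.prems by blast
    qed (use t0 Suc.prems in auto)
    have last: "(\<Sum>k=1..N. m i k * damping k (t - L k) (L k) * (\<Sum>n'\<le>n. path_weight n' k (t - L k) j s)) = (\<Sum>n'\<le>Suc n. path_weight n' i t j s)"
      if j: "j \<in> {1..N}" and s: "s < 0" for j s
    proof -
      have "(\<Sum>n'\<le>Suc n. path_weight n' i t j s) = path_weight 0 i t j s + (\<Sum>n'\<le>n. path_weight (Suc n') i t j s)" by (rule sum.atMost_Suc_shift)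
      also have "path_weight 0 i t j s = 0" using s t0 by simp
      also have "(\<Sum>n'\<le>n. path_weight (Suc n') i t j s) = (\<Sum>n'\<le>n. \<Sum>k=1..N. m i k * damping k (t - L k) (L k) * path_weight n' k (t - L k) j s)"
        by (rule sum.cong[OF refl path_weight_last[OF Suc.prems(1) j]])
      also have "\<dots> = (\<Sum>k=1..N. \<Sum>n'\<le>n. m i k * damping k (t - L k) (L k) * path_weight n' k (t - L k) j s)" by (rule sum.swap)
      finally show ?thesis by (simp add: sum_distrib_left)
    qed
    have "g i t = (\<Sum>k=1..N. \<Sum>j=1..N. \<Sum>s\<in>F. m i k * damping k (t - L k) (L k) *
        (if - L j \<le> s \<and> s < 0 then (\<Sum>n'\<le>n. path_weight n' k (t - L k) j s) * u0 j (- s) else 0))"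
      unfolding g_rec[OF Suc.prems(1) t0] by (rule sum.cong[OF refl]) (simp only: IH sum_distrib_left)
    also have "\<dots> = (\<Sum>j=1..N. \<Sum>k=1..N. \<Sum>s\<in>F. m i k * damping k (t - L k) (L k) *
        (if - L j \<le> s \<and> s < 0 then (\<Sum>n'\<le>n. path_weight n' k (t - L k) j s) * u0 j (- s) else 0))" by (rule sum.swap)
    also have "\<dots> = (\<Sum>j=1..N. \<Sum>s\<in>F. \<Sum>k=1..N. m i k * damping k (t - L k) (L k) *
        (if - L j \<le> s \<and> s < 0 then (\<Sum>n'\<le>n. path_weight n' k (t - L k) j s) * u0 j (- s) else 0))"
      by (rule sum.cong[OF refl sum.swap])
    also have "\<dots> = (\<Sum>j=1..N. \<Sum>s\<in>F. if - L j \<le> s \<and> s < 0 then (\<Sum>k\<le>Suc n. path_weight k i t j s) * u0 j (- s) else 0)"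
    proof (intro sum.cong refl)
      fix j s assume j: "j \<in> {1..N}"
      show "(\<Sum>k=1..N. m i k * damping k (t - L k) (L k) * (if - L j \<le> s \<and> s < 0 then (\<Sum>n'\<le>n. path_weight n' k (t - L k) j s) * u0 j (- s) else 0)) =
        (if - L j \<le> s \<and> s < 0 then (\<Sum>k\<le>Suc n. path_weight k i t j s) * u0 j (- s) else 0)"
      proof (cases "- L j \<le> s \<and> s < 0")
        case True
        then show ?thesis
          by (simp only: if_True simp_thms last[OF j, symmetric] sum_distrib_right mult.assoc)
      next
        case F: False
        show ?thesis unfolding if_not_P[OF F] by simp
      qed
    qed
    finally show ?thesis .
  qed
qed

text \<open>This is the function to which \<open>weight_decay\<close> is applied; the absolute
  values supply the nonnegativity required there.\<close>

definition total_weight :: "nat \<Rightarrow> nat \<Rightarrow> real \<Rightarrow> nat \<Rightarrow> real \<Rightarrow> real" where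
  "total_weight n i t l s = (\<Sum>k\<le>n. \<bar>path_weight k i t l s\<bar>)"

lemma total_weight_nonneg: "total_weight n i t l s \<ge> 0" unfolding total_weight_def by (intro sum_nonneg) auto

lemma total_weight_le_1:
  assumes l: "l \<in> {1..N}" and s: "s \<ge> t"
  shows "total_weight n i t l s \<le> 1"
proof -
  have "path_weight (Suc k) i t l s = 0" for k by (rule path_weight_Suc_late[OF l]) (use s Lpos[OF l] in simp)
  then have "\<bar>path_weight k i t l s\<bar> \<le> (if k = 0 then 1 else 0)" for k by (cases k) auto
  then have "total_weight n i t l s \<le> (\<Sum>k\<le>n. if k = 0 then 1 else 0)" unfolding total_weight_def by (intro sum_mono)
  then show ?thesis by simp
qed

lemma total_weight_rec:
  assumes l: "l \<in> {1..N}" and s: "s < t"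
  shows "total_weight n i t l s \<le> damping l s (L l) * (\<Sum>k=1..N. \<bar>m k l\<bar> * total_weight n i t k (s + L l))"
proof -
  have P: "\<bar>path_weight (Suc k) i t l s\<bar> \<le> damping l s (L l) * (\<Sum>k'=1..N. \<bar>m k' l\<bar> * \<bar>path_weight k i t k' (s + L l)\<bar>)" for k
  proof -
    have "\<bar>\<Sum>k'=1..N. m k' l * path_weight k i t k' (s + L l)\<bar> \<le> (\<Sum>k'=1..N. \<bar>m k' l\<bar> * \<bar>path_weight k i t k' (s + L l)\<bar>)"
      by (rule order_trans[OF sum_abs]) (simp add: abs_mult)
    then show ?thesis using damping01(1)[of l s "L l"] by (simp add: abs_mult)
  qed
  have "total_weight n i t l s \<le> total_weight (Suc n) i t l s" unfolding total_weight_def by simp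
  also have "\<dots> = (\<Sum>k\<le>n. \<bar>path_weight (Suc k) i t l s\<bar>)" unfolding total_weight_def sum.atMost_Suc_shift using s by simp
  also have "\<dots> \<le> (\<Sum>k\<le>n. damping l s (L l) * (\<Sum>k'=1..N. \<bar>m k' l\<bar> * \<bar>path_weight k i t k' (s + L l)\<bar>))" by (rule sum_mono[OF P])
  also have "\<dots> = damping l s (L l) * (\<Sum>k\<le>n. \<Sum>k'=1..N. \<bar>m k' l\<bar> * \<bar>path_weight k i t k' (s + L l)\<bar>)" by (simp only: sum_distrib_left)
  also have "(\<Sum>k\<le>n. \<Sum>k'=1..N. \<bar>m k' l\<bar> * \<bar>path_weight k i t k' (s + L l)\<bar>) = (\<Sum>k'=1..N. \<Sum>k\<le>n. \<bar>m k' l\<bar> * \<bar>path_weight k i t k' (s + L l)\<bar>)" by (rule sum.swap)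
  also have "\<dots> = (\<Sum>k=1..N. \<bar>m k l\<bar> * total_weight n i t k (s + L l))" by (simp only: total_weight_def sum_distrib_left)
  finally show ?thesis .
qed

lemma \<beta>_set_integrable: "set_integrable lborel {c..d} (\<beta> i)"
  unfolding set_integrable_def
proof (rule Bochner_Integration.integrable_bound)
  show "integrable lborel (indicator {c..d} :: real \<Rightarrow> real)" by (cases "c \<le> d") (auto intro!: integrable_real_indicator)
  show "AE x in lborel. norm (indicator {c..d} x *\<^sub>R \<beta> i x) \<le> norm (indicator {c..d} x :: real)"
    using \<beta>01 by (intro AE_I2) (auto simp: indicator_def)
qed (use \<beta>m in auto)

lemma damping_transit:
  assumes ab: "0 \<le> a j" "b j \<le> L j"
  shows "damping j s (L j) = exp (- (LINT \<sigma>:{s + a j..s + b j}|lborel. \<beta> j \<sigma>))"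
proof -
  have "(LINT \<sigma>:{s + a j..s + b j}|lborel. \<beta> j \<sigma>) = (LINT z|lborel. indicator {s + a j..s + b j} (s + 1 * z) * \<beta> j (s + 1 * z))"
    unfolding set_lebesgue_integral_def
    using lborel_integral_real_affine[of 1 "\<lambda>\<sigma>. indicator {s + a j..s + b j} \<sigma> * \<beta> j \<sigma>" s] by simp
  also have "\<dots> = (LINT z|lborel. (if 0 \<le> z \<and> z \<le> L j then q j s z else 0))"
    by (rule Bochner_Integration.integral_cong) (use ab in \<open>auto simp: q_def indicator_def\<close>)
  finally show ?thesis by (simp add: damping_def)
qed

text \<open>The interval contains its right end point because the entry times \<open>s\<close> of
  the initial data satisfy \<open>- L j \<le> s\<close> and \<open>s < 0\<close>.\<close>

definition U :: "nat \<Rightarrow> real \<Rightarrow> real" where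
  "U j y = indicator {0<..L j} y * \<bar>u0 j y\<bar>"

lemma g_bound:
  assumes i: "i \<in> {1..N}" and t: "- L i \<le> t" "t < n * Lmin" and c: "c \<ge> 0"
    and total_weight: "\<And>j s. j \<in> {1..N} \<Longrightarrow> - L j \<le> s \<Longrightarrow> s < 0 \<Longrightarrow> total_weight n i t j s \<le> c"
  shows "\<bar>g i t\<bar> \<le> c * (\<Sum>j=1..N. \<Sum>\<nu>\<in>index_box N n. U j (len \<nu> - t))"
proof -
  have U0: "U j y \<ge> 0" for j y by (simp add: U_def)
  have "\<bar>g i t\<bar> \<le> (\<Sum>j=1..N. \<Sum>s\<in>reach n t. \<bar>if - L j \<le> s \<and> s < 0 then (\<Sum>k\<le>n. path_weight k i t j s) * u0 j (- s) else 0\<bar>)"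
    unfolding g_expansion[OF i t finite_reach order_refl]
    by (rule order_trans[OF sum_abs], rule sum_mono, rule sum_abs)
  also have "\<dots> \<le> (\<Sum>j=1..N. \<Sum>s\<in>reach n t. c * U j (- s))"
  proof (intro sum_mono)
    fix j s assume j: "j \<in> {1..N}"
    show "\<bar>if - L j \<le> s \<and> s < 0 then (\<Sum>k\<le>n. path_weight k i t j s) * u0 j (- s) else 0\<bar> \<le> c * U j (- s)"
    proof (cases "- L j \<le> s \<and> s < 0")
      case True
      have "\<bar>\<Sum>k\<le>n. path_weight k i t j s\<bar> \<le> total_weight n i t j s" unfolding total_weight_def by (rule sum_abs)
      also have "\<dots> \<le> c" using total_weight[OF j] True by blast
      finally have "\<bar>\<Sum>k\<le>n. path_weight k i t j s\<bar> * \<bar>u0 j (- s)\<bar> \<le> c * \<bar>u0 j (- s)\<bar>" by (rule mult_right_mono) simp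
      then show ?thesis using True by (simp add: abs_mult U_def)
    next
      case False
      then show ?thesis using c U0 by (simp only: if_False abs_zero mult_nonneg_nonneg)
    qed
  qed
  also have "\<dots> \<le> (\<Sum>j=1..N. \<Sum>\<nu>\<in>index_box N n. c * U j (len \<nu> - t))"
  proof (rule sum_mono)
    fix j
    \<comment> \<open>Different crossing counts may lead to the same time; as the summands are
      nonnegative, summing over the counts can only enlarge the value.\<close>
    have "(\<Sum>s\<in>reach n t. c * U j (- s)) \<le> (\<Sum>\<nu>\<in>index_box N n. ((\<lambda>s. c * U j (- s)) \<circ> (\<lambda>\<nu>. t - len \<nu>)) \<nu>)"
      unfolding reach_def by (rule sum_image_le[OF finite_index_box]) (use c U0 in simp)
    then show "(\<Sum>s\<in>reach n t. c * U j (- s)) \<le> (\<Sum>\<nu>\<in>index_box N n. c * U j (len \<nu> - t))" by simp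
  qed
  also have "\<dots> = c * (\<Sum>j=1..N. \<Sum>\<nu>\<in>index_box N n. U j (len \<nu> - t))" by (simp only: sum_distrib_left)
  finally show ?thesis .
qed

end

text \<open>\<open>\<beta>\<close> and \<open>u0\<close> are quantified behind \<open>C\<close> and
  \<open>\<gamma>\<close>, since the constants have to be the same for all signals and all initial
  data. For this reason \<open>v\<close> appears with its locale parameters.\<close>

lemma (in transit) damped_decay_bound:
  assumes p: "\<And>i j. i \<in> {1..N} \<Longrightarrow> j \<in> {1..N} \<Longrightarrow> p \<le> \<bar>m i j\<bar>" and p0: "p > 0"
    and i0: "i0 \<in> {1..N}" and j0: "j0 \<in> {1..N}" and irr: "L i0 / L j0 \<notin> \<rat>"
    and ab: "0 \<le> a 1" "a 1 < b 1" "b 1 \<le> L 1" and T: "T > 0" and mu: "\<mu> > 0"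
  shows "\<exists>C \<gamma>. C > 0 \<and> \<gamma> > 0 \<and> (\<forall>\<beta> u0 t i x. damped_network N L Lmin \<beta> u0 \<longrightarrow>
     (\<forall>w\<ge>0. (LINT s:{w..w+T}|lborel. \<beta> 1 s) \<ge> \<mu>) \<longrightarrow> t \<ge> 0 \<longrightarrow> i \<in> {1..N} \<longrightarrow> x \<in> {0<..<L i} \<longrightarrow>
     \<bar>damped_network.v N L m Lmin a b \<beta> u0 t i x\<bar> \<le> C * exp (- \<gamma> * t) *
       (\<Sum>j=1..N. \<Sum>\<nu>\<in>index_box N (nat \<lceil>t / Lmin\<rceil> + 1). indicator {0<..L j} ((\<Sum>j=1..N. real (\<nu> j) * L j) - t + x) *
          \<bar>u0 j ((\<Sum>j=1..N. real (\<nu> j) * L j) - t + x)\<bar>))"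
proof -
  obtain \<kappa> T' :: real where \<kappa>: "0 < \<kappa>" "\<kappa> < 1" and T': "T' > 0" and decay: "\<forall>\<beta> d \<theta> (t::real).
     (\<forall>s. \<beta> s \<ge> 0) \<longrightarrow> (\<forall>c d. set_integrable lborel {c..d} \<beta>) \<longrightarrow>
     (\<forall>w\<ge>0. (LINT s:{w..w+T}|lborel. \<beta> s) \<ge> \<mu>) \<longrightarrow>
     (\<forall>l\<in>{1..N}. \<forall>s. 0 \<le> d l s \<and> d l s \<le> 1) \<longrightarrow>
     (\<forall>s. d 1 s \<le> exp (- (LINT \<sigma>:{s+a 1..s+b 1}|lborel. \<beta> \<sigma>))) \<longrightarrow>
     (\<forall>l\<in>{1..N}. \<forall>s. 0 \<le> \<theta> l s) \<longrightarrow>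
     (\<forall>l\<in>{1..N}. \<forall>s<t. \<theta> l s \<le> d l s * (\<Sum>k=1..N. \<bar>m k l\<bar> * \<theta> k (s + L l))) \<longrightarrow>
     (\<forall>l\<in>{1..N}. \<forall>s\<ge>t. \<theta> l s \<le> 1) \<longrightarrow>
     (\<forall>l\<in>{1..N}. \<forall>s\<ge>-Lmax. \<forall>n::nat. s \<le> t - n * T' \<longrightarrow> \<theta> l s \<le> \<kappa> ^ n)"
    by (rule exE[OF weight_decay[OF _ p0 i0 j0 irr ab T mu]], rule p, assumption, assumption,
        elim exE conjE, rule that)
  \<comment> \<open>With this rate \<open>\<kappa> = exp (- (\<gamma> * T'))\<close>. The factor
    \<open>C\<close> makes up for rounding down to full periods \<open>T'\<close> and for the time
    of at most \<open>Lmax\<close> since the particle has entered its circle.\<close>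
  define \<gamma> where "\<gamma> = - ln \<kappa> / T'"
  have \<gamma>: "\<gamma> > 0" using \<kappa> T' by (simp add: \<gamma>_def ln_less_zero_iff divide_neg_pos)
  define C where "C = exp (\<gamma> * (Lmax + T'))"
  show ?thesis
  proof (rule exI[of _ C], rule exI[of _ \<gamma>], intro conjI allI impI)
    show "C > 0" by (simp add: C_def)
    show "\<gamma> > 0" by (rule \<gamma>)
    fix \<beta> u0 :: "nat \<Rightarrow> real \<Rightarrow> real" and t x :: real and i
    assume dn: "damped_network N L Lmin \<beta> u0" and PE: "\<forall>w\<ge>0. (LINT s:{w..w+T}|lborel. \<beta> 1 s) \<ge> \<mu>"
      and t: "t \<ge> 0" and i: "i \<in> {1..N}" and x: "x \<in> {0<..<L i}"
    interpret damped_decay N L m Lmin a b \<beta> u0 Lmax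
      using dn transit_axioms by (simp add: damped_decay_def)
    define n where "n = nat \<lceil>t / Lmin\<rceil> + 1"
    have "t / Lmin < real n" unfolding n_def by linarith
    then have tn: "t < n * Lmin" using Lmin by (simp add: field_simps)
    define k where "k = nat \<lfloor>(t - Lmax) / T'\<rfloor>"
    define c where "c = t - x"
    have k1: "real k * T' \<le> max 0 (t - Lmax)"
    proof (cases "t \<le> Lmax")
      case True
      then have "(t - Lmax) / T' \<le> 0" using T' by (simp add: divide_nonpos_pos)
      then have "\<lfloor>(t - Lmax) / T'\<rfloor> \<le> 0" by (simp add: floor_le_zero) 
      then show ?thesis by (simp add: k_def)
    next
      case False
      then have "real k \<le> (t - Lmax) / T'" using T' by (simp add: k_def)
      then have "real k * T' \<le> t - Lmax" using T' by (simp add: field_simps)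
      then show ?thesis by simp
    qed
    have k2: "real k \<ge> (t - Lmax) / T' - 1" unfolding k_def by linarith
    have pw: "\<kappa> ^ k \<le> C * exp (- \<gamma> * t)"
    proof -
      have "\<kappa> = exp (- (\<gamma> * T'))" using \<kappa> T' by (simp add: \<gamma>_def)
      then have "\<kappa> ^ k = exp (real k * (- (\<gamma> * T')))" by (simp only: exp_of_nat_mult)
      also have "\<dots> \<le> exp (\<gamma> * (Lmax + T') + - \<gamma> * t)"
      proof -
        have "t - Lmax - T' \<le> real k * T'" using k2 T' by (simp add: field_simps)
        then have "\<gamma> * (t - Lmax - T') \<le> \<gamma> * (real k * T')" using \<gamma> by (intro mult_left_mono) auto
        then show ?thesis by (simp add: algebra_simps)
      qed
      finally show ?thesis by (simp only: C_def exp_add)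
    qed
    have xL: "x < Lmax" using x Lle[OF i] by auto
    have wtc: "total_weight n i c j s \<le> \<kappa> ^ k" if j: "j \<in> {1..N}" and s: "- L j \<le> s" "s < 0" for j s
    proof (cases "s \<le> c - k * T'")
      case True
      show ?thesis
      proof (rule decay[rule_format, where \<beta>="\<beta> 1" and d="\<lambda>l s. damping l s (L l)" and t=c and \<theta>="total_weight n i c"])
        show "damping 1 s (L 1) \<le> exp (- (LINT \<sigma>:{s+a 1..s+b 1}|lborel. \<beta> 1 \<sigma>))" for s
          using damping_transit[OF ab(1,3), of s] by simp
        show "total_weight n i c l s \<le> damping l s (L l) * (\<Sum>k=1..N. \<bar>m k l\<bar> * total_weight n i c k (s + L l))" if "l \<in> {1..N}" "s < c" for l s
          by (rule total_weight_rec[OF that])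
        show "total_weight n i c l s \<le> 1" if "l \<in> {1..N}" "c \<le> s" for l s by (rule total_weight_le_1[OF that])
        show "- Lmax \<le> s" using s Lle[OF j] by simp
        show "0 \<le> \<beta> 1 s" for s using \<beta>01 by blast
        show "set_integrable lborel {c..d} (\<beta> 1)" for c d by (rule \<beta>_set_integrable)
        show "\<mu> \<le> (LINT s:{w..w+T}|lborel. \<beta> 1 s)" if "0 \<le> w" for w using PE that by blast
        show "0 \<le> damping l s (L l) \<and> damping l s (L l) \<le> 1" for l s using damping01[of l s "L l"] by simp
        show "0 \<le> total_weight n i c l s" for l s by (rule total_weight_nonneg)
      qed (use j True in auto)
    next
      case False
      \<comment> \<open>For \<open>k > 0\<close> the time \<open>c - k * T'\<close> is nonnegative,
        because \<open>c \<ge> t - Lmax\<close>, and no negative \<open>s\<close> exceeds it. So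
        only the trivial bound \<open>1\<close> is needed here.\<close>
      have "k = 0"
      proof (rule ccontr)
        assume "k \<noteq> 0"
        then have "real k * T' > 0" using T' by simp
        then have "real k * T' \<le> t - Lmax" using k1 by linarith
        then have "c - k * T' \<ge> 0" using xL by (simp add: c_def)
        then show False using False s by simp
      qed
      then have "s \<ge> c" using False by simp
      then show ?thesis using total_weight_le_1[OF j] \<open>k = 0\<close> by simp
    qed
    have sum0: "0 \<le> (\<Sum>j=1..N. \<Sum>\<nu>\<in>index_box N n. U j (len \<nu> - c))" by (intro sum_nonneg) (simp add: U_def)
    have "\<bar>v t i x\<bar> \<le> \<bar>g i c\<bar>"
      unfolding v_def c_def abs_mult using damping01[of i "t - x" x] by (simp add: mult_left_le_one_le)
    also have "\<dots> \<le> \<kappa> ^ k * (\<Sum>j=1..N. \<Sum>\<nu>\<in>index_box N n. U j (len \<nu> - c))"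
      by (rule g_bound[OF i _ _ _ wtc]) (use t x tn \<kappa> in \<open>auto simp: c_def\<close>)
    also have "\<dots> \<le> (C * exp (- \<gamma> * t)) * (\<Sum>j=1..N. \<Sum>\<nu>\<in>index_box N n. U j (len \<nu> - c))"
      by (rule mult_right_mono[OF pw sum0])
    finally show "\<bar>v t i x\<bar> \<le> C * exp (- \<gamma> * t) *
       (\<Sum>j=1..N. \<Sum>\<nu>\<in>index_box N (nat \<lceil>t / Lmin\<rceil> + 1). indicator {0<..L j} ((\<Sum>j=1..N. real (\<nu> j) * L j) - t + x) *
          \<bar>u0 j ((\<Sum>j=1..N. real (\<nu> j) * L j) - t + x)\<bar>)"
      by (simp add: U_def len_def c_def n_def algebra_simps)
  qed
qed

section \<open>From pointwise bounds by translates to Lebesgue norms\<close>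

lemma sum_powr_le:
  fixes h :: "'k \<Rightarrow> real" and r :: real
  assumes Q: "finite Q" "Q \<noteq> {}" and h: "\<And>k. k \<in> Q \<Longrightarrow> h k \<ge> 0" and r: "r \<ge> 0"
  shows "(\<Sum>k\<in>Q. h k) powr r \<le> real (card Q) powr r * (\<Sum>k\<in>Q. h k powr r)"
proof -
  have "Max (h ` Q) \<in> h ` Q" by (rule Max_in) (use Q in auto)
  then obtain k0 where k0: "k0 \<in> Q" "h k0 = Max (h ` Q)" by force
  have "(\<Sum>k\<in>Q. h k) \<le> of_nat (card Q) * h k0"
    by (rule sum_bounded_above) (use Q k0 in auto)
  then have "(\<Sum>k\<in>Q. h k) powr r \<le> (real (card Q) * h k0) powr r"
    by (intro powr_mono2 r sum_nonneg h) auto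
  also have "\<dots> = real (card Q) powr r * h k0 powr r" by (simp add: powr_mult h k0)
  also have "\<dots> \<le> real (card Q) powr r * (\<Sum>k\<in>Q. h k powr r)"
    by (intro mult_left_mono member_le_sum[OF k0(1)]) (use Q in auto)
  finally show ?thesis .
qed

text \<open>The constant must not depend on \<open>p\<close>. One factor \<open>card Q\<close> comes
  from \<open>sum_powr_le\<close>, the other from adding up \<open>card Q\<close> translates with
  the same norm bound, where \<open>n \<le> n powr r\<close> is used before the root is taken.
  Translations preserve the integrals and the essential bounds.\<close>

lemma Lp_norm_translates:
  fixes f :: "real \<Rightarrow> real" and u ub :: "nat \<Rightarrow> real \<Rightarrow> real" and idx :: "'k \<Rightarrow> nat" and \<sigma> :: "'k \<Rightarrow> real"
  assumes p: "p \<ge> 1" and fm: "f \<in> borel_measurable (lebesgue_on {0<..<l})" and I: "finite I"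
    and u: "\<And>j. j \<in> I \<Longrightarrow> u j \<in> Lp_space p (L j)"
    and ubm: "\<And>j. j \<in> I \<Longrightarrow> ub j \<in> borel_measurable borel"
    and uub: "\<And>j. j \<in> I \<Longrightarrow> AE x in lebesgue_on {0<..<L j}. u j x = ub j x"
    and Q: "finite Q" "Q \<noteq> {}" and idx: "\<And>k. k \<in> Q \<Longrightarrow> idx k \<in> I" and c: "c \<ge> 0"
    and fb: "AE x in lebesgue_on {0<..<l}. \<bar>f x\<bar> \<le> c * (\<Sum>k\<in>Q. indicator {0<..L (idx k)} (x + \<sigma> k) * \<bar>ub (idx k) (x + \<sigma> k)\<bar>)"
  shows "Lp_norm p l f \<le> ennreal (c * real (card Q) ^ 2) * (\<Sum>j\<in>I. Lp_norm p (L j) (u j))"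
proof -
  let ?M = "lebesgue_on {0<..<l}"
  define n where "n = card Q"
  have n1: "real n \<ge> 1" using Q by (simp add: n_def Suc_le_eq card_gt_0_iff)
  define H where "H = (\<lambda>j y. indicator {0<..L j} y * \<bar>ub j y\<bar> :: real)"
  have H0: "H j y \<ge> 0" for j y by (simp add: H_def)
  have Hm: "H j \<in> borel_measurable borel" if "j \<in> I" for j
    unfolding H_def using ubm[OF that] by measurable
  have HL: "AE y in lebesgue. y \<in> {0<..<L j} \<longrightarrow> H j y = \<bar>u j y\<bar>" if j: "j \<in> I" for j
  proof -
    have "AE y in lebesgue. y \<in> {0<..<L j} \<longrightarrow> u j y = ub j y"
      using uub[OF j] by (subst (asm) AE_restrict_space_iff) auto
    then show ?thesis by eventually_elim (auto simp: H_def)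
  qed
  have Hout: "AE y in lebesgue. y \<notin> {0<..<L j} \<longrightarrow> H j y = 0" for j
  proof -
    have "AE y in lebesgue. y \<noteq> L j" by (rule AE_completion[OF AE_lborel_singleton])
    then show ?thesis by eventually_elim (auto simp: H_def indicator_def)
  qed
  have fb': "AE x in ?M. \<bar>f x\<bar> \<le> c * (\<Sum>k\<in>Q. H (idx k) (x + \<sigma> k))" using fb by (simp add: H_def)
  show ?thesis
  proof (cases "p = \<infinity>")
    case True
    define E where "E = (\<lambda>j. Lp_norm p (L j) (u j))"
    have HE: "AE y in lebesgue. ennreal (H j y) \<le> E j" if j: "j \<in> I" for j
    proof -
      have "AE y in lebesgue_on {0<..<L j}. ennreal \<bar>u j y\<bar> \<le> E j"
        unfolding E_def Lp_norm_def if_P[OF True] by (rule esssup_AE)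
      then have "AE y in lebesgue. y \<in> {0<..<L j} \<longrightarrow> ennreal \<bar>u j y\<bar> \<le> E j"
        by (subst (asm) AE_restrict_space_iff) auto
      with HL[OF j] Hout[of j] show ?thesis
      proof eventually_elim
        case (elim y)
        then show ?case by (cases "y \<in> {0<..<L j}") auto
      qed
    qed
    have "AE x in lebesgue. \<forall>k\<in>Q. ennreal (H (idx k) (x + \<sigma> k)) \<le> E (idx k)"
    proof (rule AE_finite_allI[OF Q(1)])
      show "AE x in lebesgue. ennreal (H (idx k) (x + \<sigma> k)) \<le> E (idx k)" if "k \<in> Q" for k
        by (rule AE_lebesgue_translate[OF HE[OF idx[OF that]]])
    qed
    then have "AE x in ?M. \<forall>k\<in>Q. ennreal (H (idx k) (x + \<sigma> k)) \<le> E (idx k)" by (rule AE_lebesgue_onI) simp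
    with fb' have "AE x in ?M. ennreal \<bar>f x\<bar> \<le> ennreal (c * real n ^ 2) * (\<Sum>j\<in>I. E j)"
    proof eventually_elim
      case (elim x)
      have "ennreal \<bar>f x\<bar> \<le> ennreal (c * (\<Sum>k\<in>Q. H (idx k) (x + \<sigma> k)))" by (rule ennreal_leI[OF elim(1)])
      also have "\<dots> = ennreal c * (\<Sum>k\<in>Q. ennreal (H (idx k) (x + \<sigma> k)))"
        using c H0 by (simp add: ennreal_mult sum_nonneg sum_ennreal)
      also have "\<dots> \<le> ennreal c * (\<Sum>k\<in>Q. \<Sum>j\<in>I. E j)"
      proof (intro mult_left_mono sum_mono)
        fix k assume k: "k \<in> Q"
        have "ennreal (H (idx k) (x + \<sigma> k)) \<le> E (idx k)" using elim(2) k by blast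
        also have "\<dots> \<le> (\<Sum>j\<in>I. E j)" by (rule member_le_sum[OF idx[OF k] _ I]) simp
        finally show "ennreal (H (idx k) (x + \<sigma> k)) \<le> (\<Sum>j\<in>I. E j)" .
      qed simp
      also have "\<dots> = ennreal (c * real n) * (\<Sum>j\<in>I. E j)"
        using c by (simp add: n_def ennreal_mult ennreal_of_nat_eq_real_of_nat mult.assoc)
      also have "\<dots> \<le> ennreal (c * real n ^ 2) * (\<Sum>j\<in>I. E j)"
      proof (rule mult_right_mono)
        have "real n * 1 \<le> real n * real n" using n1 by (intro mult_left_mono) auto
        then show "ennreal (c * real n) \<le> ennreal (c * real n ^ 2)"
          using c by (intro ennreal_leI mult_left_mono) (auto simp: power2_eq_square)
      qed simp
      finally show ?case .
    qed
    then show ?thesis unfolding E_def n_def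
      by (subst Lp_norm_def, subst if_P[OF True]) (intro esssup_I, use fm in auto)
  next
    case False
    define r where "r = enn2real p"
    have p': "p < \<infinity>" using False by (simp add: top.not_eq_extremum)
    have r1: "r \<ge> 1" unfolding r_def using p p' by (cases p) (auto simp: ennreal_ge_1)
    define E where "E = (\<lambda>j. (LINT x|lebesgue_on {0<..<L j}. \<bar>u j x\<bar> powr r) powr (1 / r))"
    have E0: "E j \<ge> 0" for j by (simp add: E_def)
    have Lpe: "Lp_norm p (L j) (u j) = ennreal (E j)" if "j \<in> I" for j
      unfolding E_def r_def by (rule Lp_norm_eq[OF p p' u[OF that]])
    define \<Lambda> where "\<Lambda> = (\<Sum>j\<in>I. E j)"
    have \<Lambda>0: "\<Lambda> \<ge> 0" unfolding \<Lambda>_def by (rule sum_nonneg) (rule E0)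
    have int: "(\<integral>\<^sup>+y. ennreal (H j y powr r) \<partial>lborel) = ennreal (E j powr r)" if j: "j \<in> I" for j
    proof -
      have ui: "integrable (lebesgue_on {0<..<L j}) (\<lambda>x. \<bar>u j x\<bar> powr r)"
        using u[OF j] Lp_space_iff[OF p p'] by (simp add: r_def)
      have "(\<integral>\<^sup>+y. ennreal (H j y powr r) \<partial>lborel) = (\<integral>\<^sup>+y. ennreal (H j y powr r) \<partial>lebesgue)"
        by (rule nn_integral_completion[symmetric])
      also have "\<dots> = (\<integral>\<^sup>+y. ennreal (\<bar>u j y\<bar> powr r) * indicator {0<..<L j} y \<partial>lebesgue)"
      proof (rule nn_integral_cong_AE)
        show "AE y in lebesgue. ennreal (H j y powr r) = ennreal (\<bar>u j y\<bar> powr r) * indicator {0<..<L j} y"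
          using HL[OF j] Hout[of j]
        proof eventually_elim
          case (elim y)
          then show ?case by (cases "y \<in> {0<..<L j}") auto
        qed
      qed
      also have "\<dots> = (\<integral>\<^sup>+y. ennreal (\<bar>u j y\<bar> powr r) \<partial>lebesgue_on {0<..<L j})"
        by (subst nn_integral_restrict_space) auto
      also have "\<dots> = ennreal (LINT y|lebesgue_on {0<..<L j}. \<bar>u j y\<bar> powr r)"
        by (rule nn_integral_eq_integral[OF ui]) auto
      also have "(LINT y|lebesgue_on {0<..<L j}. \<bar>u j y\<bar> powr r) = E j powr r"
      proof -
        have "0 \<le> (LINT y|lebesgue_on {0<..<L j}. \<bar>u j y\<bar> powr r)" by (rule integral_nonneg_AE) auto
        then show ?thesis using r1 by (simp add: E_def powr_powr)
      qed
      finally show ?thesis .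
    qed
    have tr: "(\<integral>\<^sup>+x. ennreal (H j (x + s) powr r) \<partial>?M) \<le> ennreal (E j powr r)" if j: "j \<in> I" for j s
    proof -
      note [measurable] = Hm[OF j]
      have "(\<integral>\<^sup>+x. ennreal (H j (x + s) powr r) \<partial>?M) = (\<integral>\<^sup>+x. ennreal (H j (x + s) powr r) * indicator {0<..<l} x \<partial>lebesgue)"
        by (subst nn_integral_restrict_space) auto
      also have "\<dots> \<le> (\<integral>\<^sup>+x. ennreal (H j (x + s) powr r) \<partial>lebesgue)"
        by (rule nn_integral_mono) (auto simp: indicator_def)
      also have "\<dots> = (\<integral>\<^sup>+x. ennreal (H j (x + s) powr r) \<partial>lborel)" by (rule nn_integral_completion)
      also have "\<dots> = (\<integral>\<^sup>+x. ennreal (H j (s + 1 * x) powr r) \<partial>lborel)" by (simp add: add.commute)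
      also have "\<dots> = (\<integral>\<^sup>+y. ennreal (H j y powr r) \<partial>lborel)"
        using nn_integral_real_affine[of "\<lambda>y. ennreal (H j y powr r)" 1 s] by simp
      finally show ?thesis using int[OF j] by simp
    qed
    let ?A = "c * real n ^ 2 * \<Lambda>"
    have A0: "?A \<ge> 0" using c \<Lambda>0 by simp
    have meas: "(\<lambda>x. ennreal (H (idx k) (x + \<sigma> k) powr r)) \<in> borel_measurable ?M" if k: "k \<in> Q" for k
    proof -
      have "(\<lambda>x. H (idx k) (x + \<sigma> k) powr r) \<in> borel_measurable borel"
        using measurable_compose[OF _ Hm[OF idx[OF k]], of "\<lambda>x. x + \<sigma> k" borel] by simp
      from borel_measurable_lebesgue_onI[OF this] show ?thesis by simp
    qed
    have "(\<integral>\<^sup>+x. ennreal (\<bar>f x\<bar> powr r) \<partial>?M) \<le> (\<integral>\<^sup>+x. ennreal ((c * n) powr r) * (\<Sum>k\<in>Q. ennreal (H (idx k) (x + \<sigma> k) powr r)) \<partial>?M)"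
    proof (rule nn_integral_mono_AE)
      show "AE x in ?M. ennreal (\<bar>f x\<bar> powr r) \<le> ennreal ((c * n) powr r) * (\<Sum>k\<in>Q. ennreal (H (idx k) (x + \<sigma> k) powr r))"
        using fb'
      proof eventually_elim
        case (elim x)
        have "\<bar>f x\<bar> powr r \<le> (c * (\<Sum>k\<in>Q. H (idx k) (x + \<sigma> k))) powr r"
          by (rule powr_mono2) (use r1 elim in auto)
        also have "\<dots> = c powr r * (\<Sum>k\<in>Q. H (idx k) (x + \<sigma> k)) powr r" using c H0 by (simp add: powr_mult sum_nonneg)
        also have "\<dots> \<le> c powr r * (real n powr r * (\<Sum>k\<in>Q. H (idx k) (x + \<sigma> k) powr r))"
          unfolding n_def by (rule mult_left_mono[OF sum_powr_le[OF Q]]) (use H0 r1 in auto)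
        also have "\<dots> = (c * n) powr r * (\<Sum>k\<in>Q. H (idx k) (x + \<sigma> k) powr r)" using c by (simp add: powr_mult)
        finally have "ennreal (\<bar>f x\<bar> powr r) \<le> ennreal ((c * n) powr r * (\<Sum>k\<in>Q. H (idx k) (x + \<sigma> k) powr r))" by (rule ennreal_leI)
        also have "\<dots> = ennreal ((c * n) powr r) * (\<Sum>k\<in>Q. ennreal (H (idx k) (x + \<sigma> k) powr r))"
          by (simp add: ennreal_mult sum_nonneg sum_ennreal)
        finally show ?case .
      qed
    qed
    also have "\<dots> = ennreal ((c * n) powr r) * (\<Sum>k\<in>Q. \<integral>\<^sup>+x. ennreal (H (idx k) (x + \<sigma> k) powr r) \<partial>?M)"
      by (subst nn_integral_cmult[OF borel_measurable_sum[OF meas]], assumption, subst nn_integral_sum[OF meas]) auto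
    also have "\<dots> \<le> ennreal ((c * n) powr r) * (\<Sum>k\<in>Q. ennreal (\<Lambda> powr r))"
    proof (intro mult_left_mono sum_mono)
      fix k assume k: "k \<in> Q"
      have "E (idx k) \<le> \<Lambda>" unfolding \<Lambda>_def by (rule member_le_sum[OF idx[OF k] _ I]) (rule E0)
      then have "E (idx k) powr r \<le> \<Lambda> powr r" using E0 r1 by (intro powr_mono2) auto
      then show "(\<integral>\<^sup>+x. ennreal (H (idx k) (x + \<sigma> k) powr r) \<partial>?M) \<le> ennreal (\<Lambda> powr r)"
        using tr[OF idx[OF k], of "\<sigma> k"] by (meson ennreal_leI order_trans)
    qed simp
    also have "\<dots> = ennreal ((c * n) powr r * (real n * \<Lambda> powr r))"
      by (simp add: n_def ennreal_mult ennreal_of_nat_eq_real_of_nat)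
    also have "\<dots> \<le> ennreal (?A powr r)"
    proof (rule ennreal_leI)
      have "real n powr 1 \<le> real n powr r" by (rule powr_mono) (use r1 n1 in auto)
      then have "(c * n) powr r * (real n * \<Lambda> powr r) \<le> (c * n) powr r * (real n powr r * \<Lambda> powr r)"
        using n1 by (intro mult_left_mono mult_right_mono) auto
      also have "\<dots> = ?A powr r" using c \<Lambda>0 by (simp add: powr_mult power2_eq_square)
      finally show "(c * n) powr r * (real n * \<Lambda> powr r) \<le> ?A powr r" .
    qed
    finally have I: "(\<integral>\<^sup>+x. ennreal (\<bar>f x\<bar> powr r) \<partial>?M) \<le> ennreal (?A powr r)" .
    then have fin: "(\<integral>\<^sup>+x. ennreal (\<bar>f x\<bar> powr r) \<partial>?M) \<noteq> \<infinity>" by (metis ennreal_neq_top infinity_ennreal_def top.extremum_unique)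
    have "enn2real (\<integral>\<^sup>+x. ennreal (\<bar>f x\<bar> powr r) \<partial>?M) \<le> ?A powr r"
      using enn2real_mono[OF I] by simp
    then have "enn2real (\<integral>\<^sup>+x. ennreal (\<bar>f x\<bar> powr r) \<partial>?M) powr (1 / r) \<le> (?A powr r) powr (1 / r)"
      using r1 by (intro powr_mono2) auto
    also have "\<dots> = ?A" using r1 A0 by (simp add: powr_powr)
    finally have "Lp_norm p l f \<le> ennreal ?A"
      using False fin unfolding Lp_norm_def Let_def r_def by (simp add: ennreal_leI)
    also have "ennreal ?A = ennreal (c * real n ^ 2) * (\<Sum>j\<in>I. Lp_norm p (L j) (u j))"
      using c \<Lambda>0 E0 by (simp add: ennreal_mult Lpe \<Lambda>_def sum_ennreal)
    finally show ?thesis by (simp add: n_def)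
  qed
qed

lemma Linf_subset_Lq:
  assumes q: "1 \<le> q" "q < \<infinity>" and f: "f \<in> Lp_space \<infinity> l"
  shows "f \<in> Lp_space q l"
proof -
  let ?M = "lebesgue_on {0<..<l}"
  have fm: "f \<in> borel_measurable ?M" and fin: "esssup ?M (\<lambda>x. ennreal \<bar>f x\<bar>) < \<infinity>"
    using f by (auto simp: Lp_space_def Lp_norm_def)
  obtain E where E: "esssup ?M (\<lambda>x. ennreal \<bar>f x\<bar>) = ennreal E" "E \<ge> 0"
    using fin by (cases "esssup ?M (\<lambda>x. ennreal \<bar>f x\<bar>)") auto
  have r1: "enn2real q \<ge> 1" using q by (cases q) (auto simp: ennreal_ge_1)
  have "AE x in ?M. ennreal \<bar>f x\<bar> \<le> ennreal E" using esssup_AE[of "\<lambda>x. ennreal \<bar>f x\<bar>" ?M] E by simp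
  then have b: "AE x in ?M. \<bar>\<bar>f x\<bar> powr enn2real q\<bar> \<le> E powr enn2real q"
    by eventually_elim (use E r1 in \<open>auto intro!: powr_mono2\<close>)
  have "integrable ?M (\<lambda>x. 1 * \<bar>f x\<bar> powr enn2real q)"
    by (rule integrable_mult_bounded_AE[OF integrable_one_Ioo _ b]) (use fm in simp)
  then show ?thesis using Lp_space_iff[OF q] fm by simp
qed

text \<open>By \<open>\<delta> * x \<le> exp (\<delta> * x)\<close> each factor
  \<open>A + B * t\<close> grows at most like \<open>exp (\<delta> * B * t)\<close>, and
  \<open>\<delta>\<close> is so small that \<open>k\<close> factors use up at most half of the rate
  \<open>\<gamma>\<close>. The \<open>k + 1\<close> in \<open>\<delta>\<close> covers the case
  \<open>k = 0\<close>.\<close>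

lemma power_exp_bound:
  fixes A B \<gamma> :: real
  assumes A: "A \<ge> 0" and B: "B > 0" and \<gamma>: "\<gamma> > 0"
  shows "\<exists>C>0. \<forall>t\<ge>0. (A + B * t) ^ k * exp (- \<gamma> * t) \<le> C * exp (- (\<gamma> / 2) * t)"
proof -
  define \<delta> where "\<delta> = \<gamma> / (2 * B * (real k + 1))"
  have \<delta>: "\<delta> > 0" using B \<gamma> by (simp add: \<delta>_def)
  define C where "C = (exp (\<delta> * A) / \<delta>) ^ k"
  have C: "C > 0" using \<delta> by (simp add: C_def)
  have "(A + B * t) ^ k * exp (- \<gamma> * t) \<le> C * exp (- (\<gamma> / 2) * t)" if t: "t \<ge> 0" for t
  proof -
    have AB: "0 \<le> A + B * t" using A B t by simp
    have "\<delta> * (A + B * t) \<le> exp (\<delta> * (A + B * t))" using exp_ge_add_one_self[of "\<delta> * (A + B * t)"] by linarith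
    then have "A + B * t \<le> exp (\<delta> * A) / \<delta> * exp (\<delta> * B * t)" using \<delta> by (simp add: field_simps exp_add)
    then have "(A + B * t) ^ k \<le> (exp (\<delta> * A) / \<delta> * exp (\<delta> * B * t)) ^ k" by (rule power_mono[OF _ AB])
    also have "\<dots> = C * exp (real k * (\<delta> * B * t))" by (simp only: C_def power_mult_distrib exp_of_nat_mult)
    also have "\<dots> \<le> C * exp (\<gamma> / 2 * t)"
    proof -
      have "real k * (\<delta> * B) \<le> (real k + 1) * (\<delta> * B)" using \<delta> B by (intro mult_right_mono) auto
      also have "\<dots> = \<gamma> / 2"
      proof -
        have "K * (\<gamma> / (2 * B * K) * B) = \<gamma> / 2" if "K \<noteq> 0" for K using that B by simp
        from this[of "real k + 1"] show ?thesis by (simp add: \<delta>_def)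
      qed
      finally have "real k * (\<delta> * B) * t \<le> \<gamma> / 2 * t" by (rule mult_right_mono[OF _ t])
      then show ?thesis using C by (simp add: mult.assoc)
    qed
    finally have "(A + B * t) ^ k * exp (- \<gamma> * t) \<le> C * exp (\<gamma> / 2 * t) * exp (- \<gamma> * t)" by (rule mult_right_mono) simp
    also have "\<dots> = C * exp (- (\<gamma> / 2) * t)" by (simp add: mult.assoc exp_add[symmetric])
    finally show ?thesis .
  qed
  then show ?thesis using C by blast
qed

text \<open>Clamping makes the bounds hold everywhere and not just almost everywhere. The signal is
  set to \<open>0\<close> at negative times as \<open>damping_early\<close> requires, so the
  excitation is retained for windows with \<open>w \<ge> 0\<close>.\<close>

lemma PE_signals_borel_version:
  assumes \<alpha>: "\<alpha> \<in> PE_signals T \<mu>"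
  shows "\<exists>\<beta>. \<beta> \<in> borel_measurable borel \<and> (\<forall>t. 0 \<le> \<beta> t \<and> \<beta> t \<le> 1) \<and> (\<forall>t<0. \<beta> t = 0) \<and>
    (AE t in lebesgue. 0 \<le> t \<longrightarrow> \<alpha> t = \<beta> t) \<and> (\<forall>w\<ge>0. (LINT s:{w..w+T}|lborel. \<beta> s) \<ge> \<mu>)"
proof -
  have \<alpha>m: "\<alpha> \<in> borel_measurable lebesgue" and \<alpha>01: "AE t in lebesgue. \<alpha> t \<in> {0..1}"
    and \<alpha>\<mu>: "\<And>t. (LINT s:{t..t+T}|lebesgue. \<alpha> s) \<ge> \<mu>"
    using \<alpha> by (auto simp: PE_signals_def)
  from completion_ex_borel_measurable_real[OF \<alpha>m] obtain g
    where g: "g \<in> borel_measurable borel" and ae: "AE t in lborel. \<alpha> t = g t" by auto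
  define \<beta> where "\<beta> = (\<lambda>t. if t < 0 then 0 else max 0 (min 1 (g t)))"
  have \<beta>m: "\<beta> \<in> borel_measurable borel" unfolding \<beta>_def using g by measurable
  have eq: "AE t in lebesgue. 0 \<le> t \<longrightarrow> \<alpha> t = \<beta> t"
    using AE_completion[OF ae] \<alpha>01 by eventually_elim (auto simp: \<beta>_def)
  have "(LINT s:{w..w+T}|lborel. \<beta> s) \<ge> \<mu>" if "w \<ge> 0" for w
  proof -
    have "(LINT s:{w..w+T}|lborel. \<beta> s) = (LINT s:{w..w+T}|lebesgue. \<beta> s)"
      unfolding set_lebesgue_integral_def using \<beta>m by (intro integral_completion[symmetric]) measurable
    also have "\<dots> = (LINT s:{w..w+T}|lebesgue. \<alpha> s)"
      unfolding set_lebesgue_integral_def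
    proof (rule integral_cong_AE)
      show "(\<lambda>s. indicat_real {w..w+T} s *\<^sub>R \<beta> s) \<in> borel_measurable lebesgue"
        using \<beta>m by (intro measurable_completion) simp
      show "(\<lambda>s. indicat_real {w..w+T} s *\<^sub>R \<alpha> s) \<in> borel_measurable lebesgue"
        using \<alpha>m by (intro borel_measurable_scaleR borel_measurable_indicator) auto
      show "AE s in lebesgue. indicat_real {w..w+T} s *\<^sub>R \<beta> s = indicat_real {w..w+T} s *\<^sub>R \<alpha> s"
        using eq by eventually_elim (use that in \<open>auto simp: indicator_def\<close>)
    qed
    finally show ?thesis using \<alpha>\<mu>[of w] by simp
  qed
  then show ?thesis using \<beta>m eq by (intro exI[of _ \<beta>]) (auto simp: \<beta>_def)
qed

text \<open>The solution is identified with \<open>v\<close> for Borel versions of the signals and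
  of the initial datum, with signal \<open>0\<close> on the undamped circles. \<open>F\<close> and
  \<open>G\<close> stay abstract because only the pointwise form of the bound matters.\<close>

lemma (in transit) mild_solution_AE_bound:
  assumes q: "1 \<le> q" "q < \<infinity>" and Nd1: "1 \<le> Nd" and NdN: "Nd \<le> N"
    and \<alpha>: "\<And>i. i \<in> {1..Nd} \<Longrightarrow> \<alpha> i \<in> PE_signals T \<mu>"
    and u0: "u0 \<in> X_space N L q" and sol: "mild_solution N Nd L m a b \<alpha> q u0 u"
    and bound: "\<forall>\<beta> u0 t i x. damped_network N L Lmin \<beta> u0 \<longrightarrow>
     (\<forall>w\<ge>0. (LINT s:{w..w+T}|lborel. \<beta> 1 s) \<ge> \<mu>) \<longrightarrow> t \<ge> 0 \<longrightarrow> i \<in> {1..N} \<longrightarrow> x \<in> {0<..<L i} \<longrightarrow>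
     \<bar>damped_network.v N L m Lmin a b \<beta> u0 t i x\<bar> \<le> F t * G t u0 x"
  shows "\<exists>ub. (\<forall>j. ub j \<in> borel_measurable borel) \<and>
    (\<forall>j\<in>{1..N}. AE x in lebesgue_on {0<..<L j}. u0 j x = ub j x) \<and>
    (\<forall>t\<ge>0. \<forall>i\<in>{1..N}. u t i \<in> borel_measurable (lebesgue_on {0<..<L i}) \<and>
       (AE x in lebesgue_on {0<..<L i}. \<bar>u t i x\<bar> \<le> F t * G t ub x))"
proof -
  interpret Lp_network N L q by unfold_locales (use q Lpos in auto)
  obtain ub' where ub': "\<And>i. i \<in> {1..N} \<Longrightarrow> ub' i \<in> borel_measurable borel \<and> (AE x in lebesgue_on {0<..<L i}. u0 i x = ub' i x)"
  proof -
    have "\<forall>i\<in>{1..N}. \<exists>f. f \<in> borel_measurable borel \<and> (AE x in lebesgue_on {0<..<L i}. u0 i x = f x)"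
    proof
      fix i assume "i \<in> {1..N}"
      from borel_version_on[OF XD(1)[OF u0 this]]
      show "\<exists>f. f \<in> borel_measurable borel \<and> (AE x in lebesgue_on {0<..<L i}. u0 i x = f x)" by auto
    qed
    from bchoice[OF this] that show ?thesis by blast
  qed
  define ub where "ub = (\<lambda>i. if i \<in> {1..N} then ub' i else (\<lambda>x. 0))"
  have ubm: "ub i \<in> borel_measurable borel" for i using ub' by (simp add: ub_def)
  have ubu: "AE x in lebesgue_on {0<..<L i}. u0 i x = ub i x" if "i \<in> {1..N}" for i using ub'[OF that] that by (simp add: ub_def)
  have ubi: "integrable lborel (\<lambda>x. indicator {0<..<L i} x * ub i x)" if i: "i \<in> {1..N}" for i
  proof -
    have "integrable (lebesgue_on {0<..<L i}) (ub i)"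
      by (rule integrable_cong_AE_imp[OF X_integrable[OF u0 i] borel_measurable_lebesgue_onI[OF ubm] ubu[OF i]])
    then show ?thesis using integrable_lebesgue_on_borel[OF ubm, of "{0<..<L i}"] by simp
  qed
  define Pr where "Pr = (\<lambda>i \<beta>. \<beta> \<in> borel_measurable borel \<and> (\<forall>t. 0 \<le> \<beta> t \<and> \<beta> t \<le> 1) \<and> (\<forall>t<0. \<beta> t = 0) \<and>
    (AE t in lebesgue. 0 \<le> t \<longrightarrow> \<alpha> i t = \<beta> t) \<and> (\<forall>w\<ge>0. (LINT s:{w..w+T}|lborel. \<beta> s) \<ge> \<mu>))"
  have "\<forall>i\<in>{1..Nd}. \<exists>\<beta>. Pr i \<beta>" unfolding Pr_def using PE_signals_borel_version \<alpha> by blast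
  from bchoice[OF this] obtain \<beta>' where \<beta>': "\<And>i. i \<in> {1..Nd} \<Longrightarrow> Pr i (\<beta>' i)" by blast
  define \<beta> where "\<beta> = (\<lambda>i. if i \<in> {1..Nd} then \<beta>' i else (\<lambda>t. 0))"
  have dn: "damped_network N L Lmin \<beta> ub"
  proof
    show "\<beta> i \<in> borel_measurable borel" for i using \<beta>'[of i] by (simp add: \<beta>_def Pr_def)
    show "0 \<le> \<beta> i t \<and> \<beta> i t \<le> 1" for i t using \<beta>'[of i] by (simp add: \<beta>_def Pr_def)
    show "t < 0 \<Longrightarrow> \<beta> i t = 0" for i t using \<beta>'[of i] by (simp add: \<beta>_def Pr_def)
  qed (use Lmin Lge ubm ubi in auto)
  interpret damped_network N L m Lmin a b \<beta> ub by (rule dn)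
  obtain S where S: "generates_semigroup X nrm (A_dom N L m q) (A_op L q) S"
    and duh: "\<And>t. t \<ge> 0 \<Longrightarrow> \<exists>w. has_bochner_integral_in X nrm (lebesgue_on {0..t})
               (\<lambda>\<tau>. S (t - \<tau>) (\<Sum>i=1..Nd. \<alpha> i \<tau> *\<^sub>R B_op a b i (u \<tau>))) w \<and> nrm (u t - (S t u0 + w)) = 0"
    and uX: "\<And>t. t \<ge> 0 \<Longrightarrow> u t \<in> X" and uc: "\<And>t. t \<ge> 0 \<Longrightarrow> ((\<lambda>s. nrm (u s - u t)) \<longlongrightarrow> 0) (at t within {0..})"
    using sol unfolding mild_solution_def by auto
  interpret mild N L q m S Lmin Nd a b \<alpha> u0 u
    by unfold_locales (use S Lmin Lge m1 NdN u0 uX uc duh in auto)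
  interpret mild_damped N L q m S Lmin Nd a b \<alpha> u0 u \<beta> ub
  proof
    show "AE \<tau> in lebesgue. 0 \<le> \<tau> \<longrightarrow> coef j \<tau> = \<beta> j \<tau>" if "j \<in> {1..N}" for j
      using \<beta>'[of j] by (cases "j \<in> {1..Nd}") (simp_all add: coef_def \<beta>_def Pr_def del: atLeastAtMost_iff)
  qed (use ubu in auto)
  have PE: "\<forall>w\<ge>0. (LINT s:{w..w+T}|lborel. \<beta> 1 s) \<ge> \<mu>"
  proof -
    have "1 \<in> {1..Nd}" using Nd1 by simp
    from \<beta>'[OF this] this show ?thesis unfolding \<beta>_def Pr_def by (simp del: atLeastAtMost_iff)
  qed
  show ?thesis
  proof (intro exI[of _ ub] conjI allI ballI impI)
    fix t :: real and i assume t: "t \<ge> 0" and i: "i \<in> {1..N}"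
    show "u t i \<in> borel_measurable (lebesgue_on {0<..<L i})" by (rule XD(1)[OF uX[OF t] i])
    have "AE x in lebesgue_on {0<..<L i}. x \<in> {0<..<L i}"
      using AE_space[of "lebesgue_on {0<..<L i}"] by (auto elim: eventually_mono)
    with mild_eq_explicit[OF t i] show "AE x in lebesgue_on {0<..<L i}. \<bar>u t i x\<bar> \<le> F t * G t ub x"
    proof eventually_elim
      case (elim x)
      then show ?case using bound[rule_format, OF dn PE[rule_format] t i elim(2)] by simp
    qed
  qed (use ubm ubu in auto)
qed

text \<open>The number of translates grows like a power of \<open>t\<close> while the factor in
  front of each decays exponentially; half of the rate is given up to absorb the power.\<close>

lemma (in transit) mild_solution_decay:
  assumes Nd: "1 \<le> Nd" "Nd \<le> N" and irr: "\<exists>i\<in>{1..N}. \<exists>j\<in>{1..N}. L i / L j \<notin> \<rat>"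
    and m0: "\<And>i j. i \<in> {1..N} \<Longrightarrow> j \<in> {1..N} \<Longrightarrow> m i j \<noteq> 0"
    and ab: "0 \<le> a 1" "a 1 < b 1" "b 1 \<le> L 1" and T: "T > 0" and mu: "\<mu> > 0"
  shows "\<exists>C \<gamma>. C > 0 \<and> \<gamma> > 0 \<and> (\<forall>p u0 \<alpha> u t. p \<ge> 1 \<longrightarrow> u0 \<in> X_space N L p \<longrightarrow>
    (\<forall>i\<in>{1..Nd}. \<alpha> i \<in> PE_signals T \<mu>) \<longrightarrow> solution N Nd L m a b \<alpha> p u0 u \<longrightarrow> t \<ge> 0 \<longrightarrow>
    (\<Sum>i=1..N. Lp_norm p (L i) (u t i)) \<le> ennreal (C * exp (- \<gamma> * t)) * (\<Sum>i=1..N. Lp_norm p (L i) (u0 i)))"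
proof -
  define len where "len = (\<lambda>\<nu>::nat \<Rightarrow> nat. \<Sum>j=1..N. real (\<nu> j) * L j)"
  define K where "K = (\<lambda>t::real. nat \<lceil>t / Lmin\<rceil> + 1)"
  define G where "G = (\<lambda>t (u0 :: nat \<Rightarrow> real \<Rightarrow> real) x. \<Sum>j=1..N. \<Sum>\<nu>\<in>index_box N (K t).
     indicator {0<..L j} (len \<nu> - t + x) * \<bar>u0 j (len \<nu> - t + x)\<bar> :: real)"
  define pm where "pm = Min ((\<lambda>(i, j). \<bar>m i j\<bar>) ` ({1..N} \<times> {1..N}))"
  have ne: "{1..N} \<times> {1..N} \<noteq> {}" using N1 by auto
  have pm: "pm \<le> \<bar>m i j\<bar>" if "i \<in> {1..N}" "j \<in> {1..N}" for i j
    unfolding pm_def by (rule Min_le) (use that in \<open>auto intro!: image_eqI[of _ _ "(i, j)"]\<close>)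
  have pm0: "pm > 0" unfolding pm_def using ne m0 by (subst Min_gr_iff) auto
  obtain i0 j0 where ij: "i0 \<in> {1..N}" "j0 \<in> {1..N}" "L i0 / L j0 \<notin> \<rat>" using irr by blast
  have B: "\<exists>C \<gamma>. C > 0 \<and> \<gamma> > 0 \<and> (\<forall>\<beta> u0 t i x. damped_network N L Lmin \<beta> u0 \<longrightarrow>
     (\<forall>w\<ge>0. (LINT s:{w..w+T}|lborel. \<beta> 1 s) \<ge> \<mu>) \<longrightarrow> t \<ge> 0 \<longrightarrow> i \<in> {1..N} \<longrightarrow> x \<in> {0<..<L i} \<longrightarrow>
     \<bar>damped_network.v N L m Lmin a b \<beta> u0 t i x\<bar> \<le> C * exp (- \<gamma> * t) * G t u0 x)"
    unfolding G_def K_def len_def by (rule damped_decay_bound[where a=a and b=b, OF _ pm0 ij ab T mu]) (rule pm)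
  obtain C0 \<gamma>0 :: real where C0: "C0 > 0" and \<gamma>0: "\<gamma>0 > 0" and bound: "\<forall>\<beta> u0 t i x. damped_network N L Lmin \<beta> u0 \<longrightarrow>
     (\<forall>w\<ge>0. (LINT s:{w..w+T}|lborel. \<beta> 1 s) \<ge> \<mu>) \<longrightarrow> t \<ge> 0 \<longrightarrow> i \<in> {1..N} \<longrightarrow> x \<in> {0<..<L i} \<longrightarrow>
     \<bar>damped_network.v N L m Lmin a b \<beta> u0 t i x\<bar> \<le> C0 * exp (- \<gamma>0 * t) * G t u0 x"
    by (rule exE[OF B], elim exE conjE, rule that[rotated 2], assumption+)
  obtain C1 where C1: "C1 > 0" and power: "\<And>t. t \<ge> 0 \<Longrightarrow> (3 + 1 / Lmin * t) ^ (2 * N) * exp (- \<gamma>0 * t) \<le> C1 * exp (- (\<gamma>0 / 2) * t)"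
    using power_exp_bound[of 3 "1 / Lmin" \<gamma>0 "2 * N"] Lmin \<gamma>0 by auto
  \<comment> \<open>The first \<open>N\<close> counts the components on the left-hand side.
    \<open>N ^ 2\<close> is part of the square of \<open>card Q = N * (K t + 1) ^ N\<close>, and
    \<open>C1\<close> accounts for the remaining power of \<open>K t + 1\<close>.\<close>
  define C where "C = real N * (C0 * real N ^ 2 * C1)"
  have C: "C > 0" using C0 C1 N1 by (simp add: C_def)
  have main: "(\<Sum>i=1..N. Lp_norm p (L i) (u t i)) \<le> ennreal (C * exp (- (\<gamma>0 / 2) * t)) * (\<Sum>i=1..N. Lp_norm p (L i) (u0 i))"
    if p: "p \<ge> 1" and u0: "u0 \<in> X_space N L p" and \<alpha>: "\<forall>i\<in>{1..Nd}. \<alpha> i \<in> PE_signals T \<mu>"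
      and sol: "solution N Nd L m a b \<alpha> p u0 u" and t: "t \<ge> 0" for p u0 \<alpha> u and t :: real
  proof -
    \<comment> \<open>For \<open>p = \<infinity>\<close> the solution is a mild one for some finite
      \<open>q\<close>. This \<open>q\<close> only serves to obtain the bound almost everywhere; the
      norms are then compared for \<open>p\<close> itself.\<close>
    have "\<exists>q. 1 \<le> q \<and> q < \<infinity> \<and> u0 \<in> X_space N L q \<and> mild_solution N Nd L m a b \<alpha> q u0 u"
    proof (cases "p = \<infinity>")
      case True
      then obtain q where q: "1 \<le> q" "q < \<infinity>" "mild_solution N Nd L m a b \<alpha> q u0 u"
        using sol by (auto simp: solution_def)
      moreover have "u0 \<in> X_space N L q" using u0 Linf_subset_Lq[OF q(1,2)] True by (auto simp: X_space_def)
      ultimately show ?thesis by blast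
    next
      case False
      then show ?thesis using sol p u0 by (auto simp: solution_def top.not_eq_extremum)
    qed
    then obtain q where q: "1 \<le> q" "q < \<infinity>" and u0q: "u0 \<in> X_space N L q" and mild: "mild_solution N Nd L m a b \<alpha> q u0 u"
      by blast
    obtain ub where ubm: "\<And>j. ub j \<in> borel_measurable borel"
      and ubu: "\<And>j. j \<in> {1..N} \<Longrightarrow> AE x in lebesgue_on {0<..<L j}. u0 j x = ub j x"
      and um: "\<And>i. i \<in> {1..N} \<Longrightarrow> u t i \<in> borel_measurable (lebesgue_on {0<..<L i})"
      and ubd: "\<And>i. i \<in> {1..N} \<Longrightarrow> AE x in lebesgue_on {0<..<L i}. \<bar>u t i x\<bar> \<le> C0 * exp (- \<gamma>0 * t) * G t ub x"
      using mild_solution_AE_bound[OF q Nd bspec[OF \<alpha>] u0q mild bound] t by blast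
    define Q where "Q = {1..N} \<times> index_box N (K t)"
    have Qf: "finite Q" unfolding Q_def by (intro finite_cartesian_product finite_index_box) simp
    have cQ: "card Q = N * (K t + 1) ^ N" unfolding Q_def by (simp add: card_cartesian_product card_index_box)
    then have "card Q > 0" using N1 by simp
    then have Qne: "Q \<noteq> {}" by auto
    have GQ: "G t ub x = (\<Sum>k\<in>Q. indicator {0<..L (fst k)} (x + (len (snd k) - t)) * \<bar>ub (fst k) (x + (len (snd k) - t))\<bar>)" for x
      unfolding G_def Q_def by (simp add: sum.cartesian_product case_prod_unfold add.commute)
    let ?c = "C0 * exp (- \<gamma>0 * t)" and ?E = "\<Sum>i=1..N. Lp_norm p (L i) (u0 i)"
    have one: "Lp_norm p (L i) (u t i) \<le> ennreal (?c * real (card Q) ^ 2) * ?E" if i: "i \<in> {1..N}" for i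
    proof (rule Lp_norm_translates[where \<sigma>="\<lambda>k. len (snd k) - t" and idx=fst and ub=ub, OF p um[OF i] _ _ ubm ubu Qf Qne])
      show "AE x in lebesgue_on {0<..<L i}. \<bar>u t i x\<bar> \<le> ?c * (\<Sum>k\<in>Q. indicator {0<..L (fst k)} (x + (len (snd k) - t)) *
          \<bar>ub (fst k) (x + (len (snd k) - t))\<bar>)"
        using ubd[OF i] by (simp only: GQ)
      show "0 \<le> ?c" using C0 by simp
      show "u0 j \<in> Lp_space p (L j)" if "j \<in> {1..N}" for j using u0 that by (simp add: X_space_def)
      show "fst k \<in> {1..N}" if "k \<in> Q" for k using that by (auto simp: Q_def)
    qed simp_all
    have "real (K t + 1) \<le> 3 + 1 / Lmin * t"
    proof -
      have "0 \<le> t / Lmin" using t Lmin by simp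
      then have "real (nat \<lceil>t / Lmin\<rceil>) \<le> t / Lmin + 1" by linarith
      then show ?thesis by (simp add: K_def)
    qed
    then have "real (K t + 1) ^ (2 * N) \<le> (3 + 1 / Lmin * t) ^ (2 * N)" by (rule power_mono) simp
    then have pw: "real (K t + 1) ^ (2 * N) * exp (- \<gamma>0 * t) \<le> C1 * exp (- (\<gamma>0 / 2) * t)"
      using power[OF t] by (meson exp_ge_zero mult_right_mono order_trans)
    have "?c * real (card Q) ^ 2 = C0 * real N ^ 2 * (real (K t + 1) ^ (2 * N) * exp (- \<gamma>0 * t))"
      unfolding cQ of_nat_mult of_nat_power power_mult_distrib power_mult[symmetric] by (simp only: mult_ac)
    also have "\<dots> \<le> C0 * real N ^ 2 * (C1 * exp (- (\<gamma>0 / 2) * t))" using C0 by (intro mult_left_mono[OF pw]) simp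
    finally have cb: "?c * real (card Q) ^ 2 \<le> C0 * real N ^ 2 * (C1 * exp (- (\<gamma>0 / 2) * t))" .
    have "(\<Sum>i=1..N. Lp_norm p (L i) (u t i)) \<le> (\<Sum>i=1..N. ennreal (C0 * real N ^ 2 * (C1 * exp (- (\<gamma>0 / 2) * t))) * ?E)"
      by (intro sum_mono order_trans[OF one] mult_right_mono ennreal_leI cb) auto
    also have "\<dots> = ennreal (real N) * (ennreal (C0 * real N ^ 2 * (C1 * exp (- (\<gamma>0 / 2) * t))) * ?E)"
      by (simp add: ennreal_of_nat_eq_real_of_nat)
    also have "\<dots> = ennreal (real N * (C0 * real N ^ 2 * (C1 * exp (- (\<gamma>0 / 2) * t)))) * ?E"
      using C0 C1 by (subst ennreal_mult) (auto simp: mult.assoc)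
    also have "real N * (C0 * real N ^ 2 * (C1 * exp (- (\<gamma>0 / 2) * t))) = C * exp (- (\<gamma>0 / 2) * t)"
      by (simp add: C_def)
    finally show ?thesis .
  qed
  show ?thesis
    by (intro exI[of _ C] exI[of _ "\<gamma>0 / 2"] conjI allI impI main C) (use \<gamma>0 in auto)
qed

theorem theorem1p2:
  fixes N Nd :: nat
    and L a b :: "nat \<Rightarrow> real"
    and m :: "nat \<Rightarrow> nat \<Rightarrow> real"
  assumes "N \<ge> 2" and "Nd \<ge> 1" and "Nd \<le> N"
    and "\<forall>i\<in>{1..N}. L i > 0"
    and "\<forall>i\<in>{1..Nd}. 0 \<le> a i \<and> a i < b i \<and> b i \<le> L i"
    and "l1_matrix_norm N m \<le> 1"
    and "\<forall>i\<in>{1..N}. \<forall>j\<in>{1..N}. m i j \<noteq> 0"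
    and "\<exists>i\<in>{1..N}. \<exists>j\<in>{1..N}. L i / L j \<notin> \<rat>"
  shows "\<forall>T \<mu> :: real. T \<ge> \<mu> \<and> \<mu> > 0 \<longrightarrow>
    (\<exists>C \<gamma> :: real. C > 0 \<and> \<gamma> > 0 \<and>
      (\<forall>p :: ennreal. p \<ge> 1 \<longrightarrow>
        (\<forall>u0 \<in> X_space N L p. \<forall>\<alpha>. (\<forall>i\<in>{1..Nd}. \<alpha> i \<in> PE_signals T \<mu>) \<longrightarrow>
          (\<forall>u. solution N Nd L m a b \<alpha> p u0 u \<longrightarrow>
            (\<forall>t\<ge>0. (\<Sum>i=1..N. Lp_norm p (L i) (u t i))
                 \<le> ennreal (C * exp (- \<gamma> * t)) * (\<Sum>i=1..N. Lp_norm p (L i) (u0 i)))))))"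
proof (intro allI impI)
  fix T \<mu> :: real assume "T \<ge> \<mu> \<and> \<mu> > 0"
  then have T: "T > 0" and mu: "\<mu> > 0" by auto
  have ne: "finite (L ` {1..N})" "L ` {1..N} \<noteq> {}" using assms(1) by auto
  interpret transit N L m "Min (L ` {1..N})" "Max (L ` {1..N})"
  proof
    show "Min (L ` {1..N}) > 0" using ne assms(4) by (subst Min_gr_iff) auto
    show "(\<Sum>i=1..N. \<bar>m i j\<bar>) \<le> 1" if "j \<in> {1..N}" for j
      using assms(6) that unfolding l1_matrix_norm_def by (subst (asm) Max_le_iff) auto
  qed (use assms(1) in auto)
  have ab: "0 \<le> a 1" "a 1 < b 1" "b 1 \<le> L 1" using assms(2,5) by auto
  have m0: "\<And>i j. i \<in> {1..N} \<Longrightarrow> j \<in> {1..N} \<Longrightarrow> m i j \<noteq> 0" using assms(7) by blast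
  have B: "\<exists>C \<gamma>. C > 0 \<and> \<gamma> > 0 \<and> (\<forall>p u0 \<alpha> u t. p \<ge> 1 \<longrightarrow> u0 \<in> X_space N L p \<longrightarrow>
    (\<forall>i\<in>{1..Nd}. \<alpha> i \<in> PE_signals T \<mu>) \<longrightarrow> solution N Nd L m a b \<alpha> p u0 u \<longrightarrow> t \<ge> 0 \<longrightarrow>
    (\<Sum>i=1..N. Lp_norm p (L i) (u t i)) \<le> ennreal (C * exp (- \<gamma> * t)) * (\<Sum>i=1..N. Lp_norm p (L i) (u0 i)))"
    by (rule mild_solution_decay[where a=a and b=b, OF assms(2,3,8) _ ab T mu]) (rule m0)
  obtain C \<gamma> :: real where "C > 0" "\<gamma> > 0" and bound: "\<forall>p u0 \<alpha> u t. p \<ge> 1 \<longrightarrow> u0 \<in> X_space N L p \<longrightarrow>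
    (\<forall>i\<in>{1..Nd}. \<alpha> i \<in> PE_signals T \<mu>) \<longrightarrow> solution N Nd L m a b \<alpha> p u0 u \<longrightarrow> t \<ge> 0 \<longrightarrow>
    (\<Sum>i=1..N. Lp_norm p (L i) (u t i)) \<le> ennreal (C * exp (- \<gamma> * t)) * (\<Sum>i=1..N. Lp_norm p (L i) (u0 i))"
    by (rule exE[OF B], elim exE conjE, rule that[rotated 2], assumption+)
  then show "\<exists>C \<gamma> :: real. C > 0 \<and> \<gamma> > 0 \<and>
      (\<forall>p :: ennreal. p \<ge> 1 \<longrightarrow>
        (\<forall>u0 \<in> X_space N L p. \<forall>\<alpha>. (\<forall>i\<in>{1..Nd}. \<alpha> i \<in> PE_signals T \<mu>) \<longrightarrow>
          (\<forall>u. solution N Nd L m a b \<alpha> p u0 u \<longrightarrow>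
            (\<forall>t\<ge>0. (\<Sum>i=1..N. Lp_norm p (L i) (u t i))
                 \<le> ennreal (C * exp (- \<gamma> * t)) * (\<Sum>i=1..N. Lp_norm p (L i) (u0 i))))))"
    by (intro exI[of _ C] exI[of _ \<gamma>] conjI allI impI ballI) auto
qed

end
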